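(* Let $I\subset R=\mathbb{k}[x,y,z]$ be an ideal as in the setting described in the context, with presentation matrix $\varphi$ in Case III. Let $S=\mathbb{k}[x,y,z,w_0,\dots,w_{n-1}]$, $[l_1,\dots,l_{n-1}]=[w_0,\dots,w_{n-1}]\cdot\varphi$, $\mathcal{J}=(l_1,\dots,l_{n-2}):_S(x,y)$ and $B=S/\mathcal{J}$, with bars denoting images in $B$. Then the $B$-ideal $\overline{\mathcal{K}}''$ satisfies $$\overline{\mathcal{K}}''=(\overline{z^2w_0}):_B(\overline{x,y,z^2w_0})=(\overline{z^2w_0}).$$ Also, $\overline{\mathcal{K}}''$ is a Cohen-Macaulay ideal of height one.
   Context: Setting. $\mathbb{k}$ is an algebraically closed field, $R=\mathbb{k}[x,y,z]$, $\mathfrak{m}=(x,y,z)$. $I\subset R$ is an ideal such that: $I$ is a height two perfect ideal; $I=(f_1,\dots,f_n)$ is generated by homogeneous elements of the same degree with $\mu(I)=n>4$; its presentation matrix $\varphi$ is $n\times(n-1)$ and almost linear, i.e. all columns except the last have linear entries and the entries of the last column are homogeneous of degree $2$; $I_1(\varphi)=\mathfrak{m}$; after a change of variables, $\varphi$ has rank at most $1$ modulo the prime ideal generated by two of the variables; $I$ satisfies $(G_2)$ but not $(G_3)$. Here $I$ satisfies $(G_s)$ if $\mu(I_{\mathfrak p})\le \operatorname{ht}\mathfrak p$ for all $\mathfrak p\in V(I)$ with $\operatorname{ht}\mathfrak p\le s-1$; $\mu$ is the minimal number of generators and $I_i(\cdot)$ is the ideal of $i\times i$ minors. Case III. (After a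 change of variables and elementary row and column operations) the first row of $\varphi$ is $( *,\dots,*,z^2)$ with $z^2$ in the last column; the block $\varphi'$ formed by the last $n-1$ rows and first $n-2$ columns and the entries $*$ consist of linear forms in $\mathbb{k}[x,y]$; the remaining entries of the last column are homogeneous of degree $2$ in $\mathbb{k}[x,y,z]$ with no $z^2$ term. $\overline{\mathcal K}''$ denotes the colon ideal $(\overline{z^2w_0}):_B(\overline{x,y,z^2w_0})$; an ideal $\mathfrak q$ of $B$ is Cohen-Macaulay if $B/\mathfrak q$ is a Cohen-Macaulay ring.
   Formalization: The hypothesis I_1(φ)=m is replaced by √I_1(φ)=m: in Case III all entries of φ lie in (x,y,z^2), so I_1(φ)=m is impossible and the hypotheses as written are inconsistent. *)

theory Defs
  imports
    "HOL-Library.Poly_Mapping"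
    "HOL-Library.Extended_Nat"
    "HOL-Computational_Algebra.Polynomial"
    "HOL-Algebra.Algebra"
    "Jordan_Normal_Form.Determinant"
    "Jordan_Normal_Form.DL_Submatrix"
    "Jordan_Normal_Form.Missing_VectorSpace"
begin

section \<open>Commutative algebra over ring records\<close>

definition colon :: "('a, 'm) ring_scheme \<Rightarrow> 'a set \<Rightarrow> 'a set \<Rightarrow> 'a set" where
  "colon A I J = {a \<in> carrier A. \<forall>b\<in>J. a \<otimes>\<^bsub>A\<^esub> b \<in> I}"

definition radical :: "('a, 'm) ring_scheme \<Rightarrow> 'a set \<Rightarrow> 'a set" where
  "radical A I = {a \<in> carrier A. \<exists>k::nat. a [^]\<^bsub>A\<^esub> k \<in> I}"

definition min_gens :: "('a, 'm) ring_scheme \<Rightarrow> 'a set \<Rightarrow> enat" where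
  "min_gens A I = Inf {enat (card F) | F. finite F \<and> F \<subseteq> carrier A \<and> I = Idl\<^bsub>A\<^esub> F}"

subsection \<open>Dimension and height\<close>

definition prime_chain :: "('a, 'm) ring_scheme \<Rightarrow> nat \<Rightarrow> (nat \<Rightarrow> 'a set) \<Rightarrow> bool" where
  "prime_chain A n P \<longleftrightarrow> (\<forall>i\<le>n. primeideal (P i) A) \<and> (\<forall>i<n. P i \<subset> P (Suc i))"

definition krull_dim :: "('a, 'm) ring_scheme \<Rightarrow> enat" where
  "krull_dim A = Sup {enat n | n. \<exists>P. prime_chain A n P}"

definition prime_height :: "('a, 'm) ring_scheme \<Rightarrow> 'a set \<Rightarrow> enat" where
  "prime_height A Q = Sup {enat n | n. \<exists>P. prime_chain A n P \<and> P n = Q}"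

text \<open>The unit ideal has height \<open>\<infinity>\<close>.\<close>

definition ideal_height :: "('a, 'm) ring_scheme \<Rightarrow> 'a set \<Rightarrow> enat" where
  "ideal_height A I = Inf (prime_height A ` {Q. primeideal Q A \<and> I \<subseteq> Q})"

subsection \<open>Localization\<close>

text \<open>For a multiplicative set \<open>U\<close>, the fraction \<open>a/s\<close> is the class of \<open>(a, s)\<close> under
  \<open>(a, s) \<sim> (b, t) \<longleftrightarrow> (\<exists>u\<in>U. u t a = u s b)\<close>; \<open>A\<close> may have zero divisors.\<close>

definition loc_frac :: "('a, 'm) ring_scheme \<Rightarrow> 'a set \<Rightarrow> 'a \<Rightarrow> 'a \<Rightarrow> ('a \<times> 'a) set" where
  "loc_frac A U a s = {(b, t). b \<in> carrier A \<and> t \<in> U \<and>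
     (\<exists>u\<in>U. u \<otimes>\<^bsub>A\<^esub> (t \<otimes>\<^bsub>A\<^esub> a) = u \<otimes>\<^bsub>A\<^esub> (s \<otimes>\<^bsub>A\<^esub> b))}"

text \<open>In \<open>mult\<close> and \<open>add\<close> all pairs of representatives give the same class, so the unions
  are that class.\<close>

definition localization :: "('a, 'm) ring_scheme \<Rightarrow> 'a set \<Rightarrow> ('a \<times> 'a) set ring" where
  "localization A U = \<lparr>
     carrier = {loc_frac A U a s | a s. a \<in> carrier A \<and> s \<in> U},
     monoid.mult = (\<lambda>p q. \<Union>(a, s)\<in>p. \<Union>(b, t)\<in>q. loc_frac A U (a \<otimes>\<^bsub>A\<^esub> b) (s \<otimes>\<^bsub>A\<^esub> t)),
     one = loc_frac A U \<one>\<^bsub>A\<^esub> \<one>\<^bsub>A\<^esub>,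
     ring.zero = loc_frac A U \<zero>\<^bsub>A\<^esub> \<one>\<^bsub>A\<^esub>,
     ring.add = (\<lambda>p q. \<Union>(a, s)\<in>p. \<Union>(b, t)\<in>q.
        loc_frac A U ((a \<otimes>\<^bsub>A\<^esub> t) \<oplus>\<^bsub>A\<^esub> (b \<otimes>\<^bsub>A\<^esub> s)) (s \<otimes>\<^bsub>A\<^esub> t))\<rparr>"

definition local_ring_at :: "('a, 'm) ring_scheme \<Rightarrow> 'a set \<Rightarrow> ('a \<times> 'a) set ring" where
  "local_ring_at A P = localization A (carrier A - P)"

definition local_ideal_at :: "('a, 'm) ring_scheme \<Rightarrow> 'a set \<Rightarrow> 'a set \<Rightarrow> ('a \<times> 'a) set set" where
  "local_ideal_at A P I = {loc_frac A (carrier A - P) a s | a s. a \<in> I \<and> s \<in> carrier A - P}"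

definition G_condition :: "nat \<Rightarrow> ('a, 'm) ring_scheme \<Rightarrow> 'a set \<Rightarrow> bool" where
  "G_condition s A I \<longleftrightarrow>
     (\<forall>P. primeideal P A \<and> I \<subseteq> P \<and> prime_height A P \<le> enat (s - 1) \<longrightarrow>
        min_gens (local_ring_at A P) (local_ideal_at A P I) \<le> prime_height A P)"

subsection \<open>Grade and Cohen--Macaulay rings\<close>

definition regular_sequence :: "('a, 'm) ring_scheme \<Rightarrow> 'a list \<Rightarrow> bool" where
  "regular_sequence A xs \<longleftrightarrow>
     set xs \<subseteq> carrier A \<and> Idl\<^bsub>A\<^esub> (set xs) \<noteq> carrier A \<and>
     (\<forall>i<length xs. \<forall>a\<in>carrier A.
        xs ! i \<otimes>\<^bsub>A\<^esub> a \<in> Idl\<^bsub>A\<^esub> (set (take i xs)) \<longrightarrow> a \<in> Idl\<^bsub>A\<^esub> (set (take i xs)))"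

definition grade :: "('a, 'm) ring_scheme \<Rightarrow> 'a set \<Rightarrow> enat" where
  "grade A I = Sup {enat (length xs) | xs. regular_sequence A xs \<and> set xs \<subseteq> I}"

definition CM_local_ring :: "('a, 'm) ring_scheme \<Rightarrow> bool" where
  "CM_local_ring A \<longleftrightarrow> cring A \<and> noetherian_ring A \<and> (\<exists>!M. maximalideal M A) \<and>
     (\<forall>M. maximalideal M A \<longrightarrow> grade A M = krull_dim A)"

definition CM_ring :: "('a, 'm) ring_scheme \<Rightarrow> bool" where
  "CM_ring A \<longleftrightarrow> cring A \<and> noetherian_ring A \<and>
     (\<forall>M. maximalideal M A \<longrightarrow> CM_local_ring (local_ring_at A M))"

definition CM_ideal :: "('a, 'm) ring_scheme \<Rightarrow> 'a set \<Rightarrow> bool" where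
  "CM_ideal A I \<longleftrightarrow> ideal I A \<and> CM_ring (A Quot I)"

subsection \<open>Projective dimension and perfect ideals\<close>

text \<open>The \<open>mult\<close> and \<open>one\<close> fields of a module record carry no meaning.\<close>

definition free_module :: "('a, 'm) ring_scheme \<Rightarrow> nat \<Rightarrow> ('a, nat \<Rightarrow> 'a) module" where
  "free_module A m = \<lparr>
     carrier = {..<m} \<rightarrow>\<^sub>E carrier A,
     monoid.mult = (\<lambda>v w. \<lambda>i\<in>{..<m}. v i \<otimes>\<^bsub>A\<^esub> w i),
     one = (\<lambda>i\<in>{..<m}. \<one>\<^bsub>A\<^esub>),
     ring.zero = (\<lambda>i\<in>{..<m}. \<zero>\<^bsub>A\<^esub>),
     ring.add = (\<lambda>v w. \<lambda>i\<in>{..<m}. v i \<oplus>\<^bsub>A\<^esub> w i),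
     module.smult = (\<lambda>a v. \<lambda>i\<in>{..<m}. a \<otimes>\<^bsub>A\<^esub> v i)\<rparr>"

definition quotient_module :: "('a, 'm) ring_scheme \<Rightarrow> 'a set \<Rightarrow> ('a, 'a set) module" where
  "quotient_module A I = \<lparr>
     carrier = carrier (A Quot I),
     monoid.mult = monoid.mult (A Quot I),
     one = monoid.one (A Quot I),
     ring.zero = ring.zero (A Quot I),
     ring.add = ring.add (A Quot I),
     module.smult = (\<lambda>a v. (I +>\<^bsub>A\<^esub> a) \<otimes>\<^bsub>A Quot I\<^esub> v)\<rparr>"

text \<open>Finitely generated projective: a direct summand of some \<open>A\<^sup>m\<close>.\<close>

definition fg_projective :: "('a, 'm) ring_scheme \<Rightarrow> ('a, 'b) module \<Rightarrow> bool" where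
  "fg_projective A P \<longleftrightarrow> module A P \<and>
     (\<exists>m. \<exists>i\<in>module_hom A P (free_module A m). \<exists>p\<in>module_hom A (free_module A m) P.
        \<forall>v\<in>carrier P. p (i v) = v)"

text \<open>An exact sequence \<open>\<dots> \<rightarrow> P 2 \<rightarrow> P 1 \<rightarrow> P 0 \<rightarrow> M \<rightarrow> 0\<close>, with \<open>D i\<close> the map
  \<open>P (i + 1) \<rightarrow> P i\<close>. Since each \<open>P i\<close> embeds in some \<open>A\<^sup>m\<close>, its elements may be taken
  in the type of tuples.\<close>

definition projective_resolution ::
  "('a, 'm) ring_scheme \<Rightarrow> ('a, 'b) module \<Rightarrow> (nat \<Rightarrow> ('a, nat \<Rightarrow> 'a) module) \<Rightarrow>
   (nat \<Rightarrow> (nat \<Rightarrow> 'a) \<Rightarrow> (nat \<Rightarrow> 'a)) \<Rightarrow> ((nat \<Rightarrow> 'a) \<Rightarrow> 'b) \<Rightarrow> bool" where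
  "projective_resolution A M P D e \<longleftrightarrow>
     (\<forall>i. fg_projective A (P i)) \<and>
     e \<in> module_hom A (P 0) M \<and>
     (\<forall>i. D i \<in> module_hom A (P (Suc i)) (P i)) \<and>
     e ` carrier (P 0) = carrier M \<and>
     {v \<in> carrier (P 0). e v = \<zero>\<^bsub>M\<^esub>} = D 0 ` carrier (P 1) \<and>
     (\<forall>i. {v \<in> carrier (P (Suc i)). D i v = \<zero>\<^bsub>P i\<^esub>} = D (Suc i) ` carrier (P (Suc (Suc i))))"

text \<open>The projective dimension of a finitely generated module over a Noetherian ring, for
  which resolutions by finitely generated projectives suffice.\<close>

definition proj_dim :: "('a, 'm) ring_scheme \<Rightarrow> ('a, 'b) module \<Rightarrow> enat" where
  "proj_dim A M = Inf {enat d | d. \<exists>P D e. projective_resolution A M P D e \<and>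
     (\<forall>i>d. carrier (P i) = {\<zero>\<^bsub>P i\<^esub>})}"

definition perfect_ideal :: "('a, 'm) ring_scheme \<Rightarrow> 'a set \<Rightarrow> bool" where
  "perfect_ideal A I \<longleftrightarrow> ideal I A \<and> I \<noteq> carrier A \<and>
     proj_dim A (quotient_module A I) = grade A I"

section \<open>Polynomial rings and matrices of polynomials\<close>

datatype indet = Vx | Vy | Vz | Vw nat

text \<open>Polynomials in all the variables; rings in finitely many of them are subrings.\<close>

type_synonym 'k pol = "(indet \<Rightarrow>\<^sub>0 nat) \<Rightarrow>\<^sub>0 'k"

definition Var :: "indet \<Rightarrow> 'k::comm_ring_1 pol" where
  "Var v = Poly_Mapping.single (Poly_Mapping.single v 1) 1"

definition pol_ring :: "indet set \<Rightarrow> 'k::comm_ring_1 pol ring" where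
  "pol_ring vs = \<lparr>
     carrier = {p. \<forall>m\<in>Poly_Mapping.keys p. Poly_Mapping.keys m \<subseteq> vs},
     monoid.mult = (*), one = 1, ring.zero = 0, ring.add = (+)\<rparr>"

definition mon_degree :: "(indet \<Rightarrow>\<^sub>0 nat) \<Rightarrow> nat" where
  "mon_degree m = (\<Sum>v\<in>Poly_Mapping.keys m. Poly_Mapping.lookup m v)"

text \<open>The zero polynomial is homogeneous of every degree.\<close>

definition homogeneous :: "nat \<Rightarrow> 'k::comm_ring_1 pol \<Rightarrow> bool" where
  "homogeneous d p \<longleftrightarrow> (\<forall>m\<in>Poly_Mapping.keys p. mon_degree m = d)"

abbreviation R_ring :: "'k::comm_ring_1 pol ring" where
  "R_ring \<equiv> pol_ring {Vx, Vy, Vz}"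

abbreviation S_ring :: "nat \<Rightarrow> 'k::comm_ring_1 pol ring" where
  "S_ring n \<equiv> pol_ring ({Vx, Vy, Vz} \<union> Vw ` {..<n})"

definition minors_ideal :: "'k::comm_ring_1 pol ring \<Rightarrow> nat \<Rightarrow> 'k pol mat \<Rightarrow> 'k pol set" where
  "minors_ideal A t \<phi> = Idl\<^bsub>A\<^esub> {det (submatrix \<phi> I J) | I J.
     I \<subseteq> {..<dim_row \<phi>} \<and> J \<subseteq> {..<dim_col \<phi>} \<and> card I = t \<and> card J = t}"

text \<open>\<open>A\<^sup>c \<rightarrow> A\<^sup>r \<rightarrow> (f) \<rightarrow> 0\<close> is exact, with first map \<open>\<phi>\<close> and second map \<open>v \<mapsto> f \<bullet> v\<close>.\<close>

definition presentation_matrix ::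
  "'k::comm_ring_1 pol ring \<Rightarrow> 'k pol mat \<Rightarrow> 'k pol vec \<Rightarrow> bool" where
  "presentation_matrix A \<phi> f \<longleftrightarrow>
     dim_vec f = dim_row \<phi> \<and> set\<^sub>v f \<subseteq> carrier A \<and> elements_mat \<phi> \<subseteq> carrier A \<and>
     {v \<in> carrier_vec (dim_row \<phi>). set\<^sub>v v \<subseteq> carrier A \<and> f \<bullet> v = 0} =
     {\<phi> *\<^sub>v u | u. u \<in> carrier_vec (dim_col \<phi>) \<and> set\<^sub>v u \<subseteq> carrier A}"

section \<open>The Rees algebra setup\<close>

text \<open>Rows and columns are indexed from 0, so \<open>lform \<phi> j\<close> is $l_{j+1}$ and the last column of
  an \<open>n \<times> (n - 1)\<close> matrix has index \<open>n - 2\<close>.\<close>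

definition lform :: "'k::comm_ring_1 pol mat \<Rightarrow> nat \<Rightarrow> 'k pol" where
  "lform \<phi> j = (\<Sum>i<dim_row \<phi>. Var (Vw i) * \<phi> $$ (i, j))"

definition J_ideal :: "nat \<Rightarrow> 'k::comm_ring_1 pol mat \<Rightarrow> 'k pol set" where
  "J_ideal n \<phi> = colon (S_ring n) (Idl\<^bsub>S_ring n\<^esub> (lform \<phi> ` {..<n - 2})) (Idl\<^bsub>S_ring n\<^esub> {Var Vx, Var Vy})"

definition B_ring :: "nat \<Rightarrow> 'k::comm_ring_1 pol mat \<Rightarrow> 'k pol set ring" where
  "B_ring n \<phi> = S_ring n Quot J_ideal n \<phi>"

definition bar :: "nat \<Rightarrow> 'k::comm_ring_1 pol mat \<Rightarrow> 'k pol \<Rightarrow> 'k pol set" where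
  "bar n \<phi> p = J_ideal n \<phi> +>\<^bsub>S_ring n\<^esub> p"

definition K'' :: "nat \<Rightarrow> 'k::comm_ring_1 pol mat \<Rightarrow> 'k pol set set" where
  "K'' n \<phi> = colon (B_ring n \<phi>)
     (Idl\<^bsub>B_ring n \<phi>\<^esub> {bar n \<phi> (Var Vz ^ 2 * Var (Vw 0))})
     (Idl\<^bsub>B_ring n \<phi>\<^esub> {bar n \<phi> (Var Vx), bar n \<phi> (Var Vy), bar n \<phi> (Var Vz ^ 2 * Var (Vw 0))})"

definition almost_linear :: "nat \<Rightarrow> 'k::comm_ring_1 pol mat \<Rightarrow> bool" where
  "almost_linear n \<phi> \<longleftrightarrow> \<phi> \<in> carrier_mat n (n - 1) \<and>
     (\<forall>i<n. \<forall>j<n - 2. homogeneous 1 (\<phi> $$ (i, j))) \<and>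
     (\<forall>i<n. homogeneous 2 (\<phi> $$ (i, n - 2)))"

text \<open>Here the entries of \<open>\<phi>\<close> lie in $(x, y, z^2)$: the linear ones are forms in \<open>x\<close>, \<open>y\<close>, and the
  quadratic ones involve \<open>z\<close> only through $z^2$, $xz$ and $yz$. So $I_1(\varphi)$ can equal
  $(x, y, z)$ only up to radical.\<close>

definition case_III :: "nat \<Rightarrow> 'k::comm_ring_1 pol mat \<Rightarrow> bool" where
  "case_III n \<phi> \<longleftrightarrow>
     (\<forall>i<n. \<forall>j<n - 2. \<phi> $$ (i, j) \<in> carrier (pol_ring {Vx, Vy}) \<and> homogeneous 1 (\<phi> $$ (i, j))) \<and>
     \<phi> $$ (0, n - 2) = Var Vz ^ 2 \<and>
     (\<forall>i. 0 < i \<and> i < n \<longrightarrow>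
        \<phi> $$ (i, n - 2) \<in> carrier (pol_ring {Vx, Vy, Vz}) \<and> homogeneous 2 (\<phi> $$ (i, n - 2)) \<and>
        Poly_Mapping.lookup (\<phi> $$ (i, n - 2)) (Poly_Mapping.single Vz 2) = 0)"

end

theory Submission
  imports Defs
begin

text \<open>
  The first \<open>n - 2\<close> columns of \<open>\<phi>\<close> are linear in \<open>x\<close> and \<open>y\<close>, so the forms \<open>l\<^sub>j = x A\<^sub>j + y B\<^sub>j\<close> are a
  pencil, with \<open>A\<^sub>j\<close> and \<open>B\<^sub>j\<close> linear in the \<open>w\<close>s. No member \<open>s A + t B\<close> of this pencil has dependent
  columns: a dependency would make some combination of the columns of \<open>\<phi>\<close> a linear form times a constant
  vector, and this vector would be a syzygy of the generators of \<open>I\<close>; but syzygies are combinations of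
  the columns, which vanish at the origin (\<open>pencil_no_relation\<close>). Hence Kronecker's normal form of
  the pencil consists of two chains: the span of the \<open>w\<close>s has a basis \<open>u\<^sub>0, \<dots>, u\<^sub>a, v\<^sub>0, \<dots>, v\<^sub>b\<close> for which the
  relations read \<open>y u\<^sub>i = x u\<^sub>i\<^sub>+\<^sub>1\<close> and \<open>y v\<^sub>j = x v\<^sub>j\<^sub>+\<^sub>1\<close>, with \<open>a + b + 2 = n\<close> (\<open>chain_basis\<close>).

  The substitution \<open>x \<mapsto> p\<close>, \<open>y \<mapsto> \<lambda> p\<close>, \<open>u\<^sub>i \<mapsto> \<lambda>\<^sup>i q\<close>, \<open>v\<^sub>j \<mapsto> \<lambda>\<^sup>j r\<close>, \<open>z \<mapsto> z\<close> respects these relations.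
  Its image is the algebra with basis the monomials \<open>p\<^sup>i q\<^sup>j r\<^sup>k \<lambda>\<^sup>c z\<^sup>e\<close> such that \<open>c \<le> i + a j + b k\<close>, the
  coordinate ring of a cone over a rational normal scroll, with \<open>z\<close> adjoined. Its kernel is the colon
  ideal \<open>(l\<^sub>1, \<dots>, l\<^sub>n\<^sub>-\<^sub>2) : (x, y)\<close>: in the presence of a factor \<open>x\<close> or \<open>y\<close> the relations alone bring
  every monomial into a standard form (\<open>acts_zero\<close>), while \<open>p\<close> is not a zero divisor. So \<open>B\<close> is this
  toric ring, and \<open>z\<^sup>2 w\<^sub>0\<close> becomes \<open>g = z\<^sup>2 w\<close> for a nonzero combination \<open>w\<close> of the \<open>\<lambda>\<^sup>i q\<close> and \<open>\<lambda>\<^sup>j r\<close>.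

  The colon ideal. If \<open>p f\<close> and \<open>\<lambda> p f\<close> are multiples of \<open>g\<close>, then \<open>f = g f'\<close> for some polynomial \<open>f'\<close>,
  as \<open>g\<close> does not involve \<open>p\<close>; and \<open>f'\<close> lies in the toric ring because \<open>\<lambda> p f'\<close> does
  (\<open>colon_multiples\<close>).

  The height. A prime strictly inside \<open>(z)\<close> consists of elements divisible by every power of \<open>z\<close>, so
  the prime \<open>(z)\<close>, which contains \<open>g\<close>, has height at most one (\<open>prime_below_z\<close>).

  The Cohen-Macaulay property. The toric ring is a free module over the polynomial ring in the five
  parameters \<open>p\<close>, \<open>\<lambda> p - q\<close>, \<open>\<lambda>\<^sup>a q - r\<close>, \<open>\<lambda>\<^sup>b r\<close> and \<open>z\<close>: modulo the two differences the scroll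
  degenerates to a rational normal curve of degree \<open>a + b + 1\<close> (\<open>toric_spanned\<close>, \<open>toric_independent\<close>).
  Some multiple of \<open>g\<close> is a nonzero polynomial \<open>N\<close> in the parameters. By the Nullstellensatz a maximal
  ideal gives a point in the space of parameters; choose a line through it on which \<open>N\<close> does not vanish
  identically. The four affine functions that cut out this line form a regular sequence modulo \<open>g\<close>
  (\<open>regular_mod_principal\<close>). On the other hand a chain of primes of length \<open>m\<close> in the toric ring yields
  \<open>m\<close> algebraically independent elements in a polynomial ring in five indeterminates, so \<open>m \<le> 5\<close>
  (\<open>prime_chain_length\<close>), and chains modulo \<open>g\<close> have length at most four. A Noetherian ring in which
  every maximal ideal contains a regular sequence as long as the longest chains of primes is
  Cohen-Macaulay (\<open>CM_ringI\<close>).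
\<close>

section \<open>Polynomials in the indeterminates\<close>

fun indet_code :: "indet \<Rightarrow> nat" where
  "indet_code Vx = 0"
| "indet_code Vy = 1"
| "indet_code Vz = 2"
| "indet_code (Vw i) = i + 3"

lemma indet_code_inj: "indet_code u = indet_code v \<Longrightarrow> u = v"
  by (cases u; cases v) auto

text \<open>Any linear order on the indeterminates makes the polynomials an integral domain: the product of
  the leading terms in the induced lexicographic order does not cancel.\<close>

instantiation indet :: linorder
begin

definition less_eq_indet :: "indet \<Rightarrow> indet \<Rightarrow> bool" where
  "u \<le> v \<longleftrightarrow> indet_code u \<le> indet_code v"

definition less_indet :: "indet \<Rightarrow> indet \<Rightarrow> bool" where
  "u < v \<longleftrightarrow> indet_code u < indet_code v"

instance
  by standard (auto simp: less_eq_indet_def less_indet_def intro: indet_code_inj)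

end

definition Cst :: "'k::comm_ring_1 \<Rightarrow> 'k pol" where
  "Cst c = Poly_Mapping.single 0 c"

definition Mon :: "(indet \<Rightarrow>\<^sub>0 nat) \<Rightarrow> 'k::comm_ring_1 pol" where
  "Mon m = Poly_Mapping.single m 1"

abbreviation PV :: "indet set \<Rightarrow> 'k::comm_ring_1 pol set" where
  "PV vs \<equiv> carrier (pol_ring vs)"

lemma Cst_hom: "comm_ring_hom (Cst :: 'k::comm_ring_1 \<Rightarrow> 'k pol)"
  by unfold_locales (auto simp: Cst_def single_add mult_single)

interpretation Cst: comm_ring_hom "Cst :: 'k::comm_ring_1 \<Rightarrow> 'k pol"
  by (rule Cst_hom)

lemma Cst_inj [simp]: "Cst c = Cst d \<longleftrightarrow> c = d"
  unfolding Cst_def by (metis lookup_single_eq)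

lemma Cst_eq_0 [simp]: "Cst c = 0 \<longleftrightarrow> c = 0"
  using Cst_inj[of c 0] by (simp del: Cst_inj)

lemma single_eq_Cst_Mon: "Poly_Mapping.single m c = Cst c * Mon m"
  by (simp add: Cst_def Mon_def mult_single)

lemma Mon_add: "Mon (m + m') = Mon m * Mon m'"
  by (simp add: Mon_def mult_single)

lemma Mon_0 [simp]: "Mon 0 = 1"
  by (simp add: Mon_def)

lemma Var_eq_Mon: "Var v = Mon (Poly_Mapping.single v 1)"
  by (simp add: Var_def Mon_def)

lemma Mon_single: "Mon (Poly_Mapping.single v n) = Var v ^ n"
proof (induction n)
  case (Suc n)
  have "Poly_Mapping.single v (Suc n) = Poly_Mapping.single v 1 + Poly_Mapping.single v n"
    by (simp flip: single_add)
  then show ?case using Suc by (simp add: Mon_add Var_eq_Mon)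
qed simp

lemma keys_Mon [simp]: "Poly_Mapping.keys (Mon m :: 'k::comm_ring_1 pol) = {m}"
  by (simp add: Mon_def)

lemma lookup_Mon: "Poly_Mapping.lookup (Mon m :: 'k::comm_ring_1 pol) m' = (if m = m' then 1 else 0)"
  by (simp add: Mon_def lookup_single when_def)

lemma lookup_Cst_mult: "Poly_Mapping.lookup (Cst c * p) m = c * Poly_Mapping.lookup p m"
  unfolding Cst_def mult_map_scale_conv_mult [symmetric] by (simp add: map.rep_eq when_def)

lemma pol_eq_sum: "(p :: 'k::comm_ring_1 pol) = (\<Sum>m\<in>Poly_Mapping.keys p. Cst (Poly_Mapping.lookup p m) * Mon m)"
proof (rule poly_mapping_eqI)
  fix m
  have "(\<Sum>m'\<in>Poly_Mapping.keys p. Poly_Mapping.lookup (Cst (Poly_Mapping.lookup p m') * Mon m') m)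
     = (\<Sum>m'\<in>Poly_Mapping.keys p. if m' = m then Poly_Mapping.lookup p m else 0)"
    by (intro sum.cong) (auto simp: lookup_Cst_mult lookup_Mon)
  then show "Poly_Mapping.lookup p m = Poly_Mapping.lookup (\<Sum>m\<in>Poly_Mapping.keys p. Cst (Poly_Mapping.lookup p m) * Mon m) m"
    by (simp add: lookup_sum in_keys_iff)
qed

lemma Mon_eq_prod: "(Mon m :: 'k::comm_ring_1 pol) = (\<Prod>v\<in>Poly_Mapping.keys m. Var v ^ Poly_Mapping.lookup m v)"
proof -
  have m: "m = (\<Sum>v\<in>Poly_Mapping.keys m. Poly_Mapping.single v (Poly_Mapping.lookup m v))"
  proof (rule poly_mapping_eqI)
    fix u
    have "(\<Sum>v\<in>Poly_Mapping.keys m. Poly_Mapping.lookup (Poly_Mapping.single v (Poly_Mapping.lookup m v)) u)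
      = (\<Sum>v\<in>Poly_Mapping.keys m. if v = u then Poly_Mapping.lookup m u else 0)"
      by (intro sum.cong) (auto simp: lookup_single)
    then show "Poly_Mapping.lookup m u = Poly_Mapping.lookup (\<Sum>v\<in>Poly_Mapping.keys m. Poly_Mapping.single v (Poly_Mapping.lookup m v)) u"
      by (simp add: lookup_sum in_keys_iff)
  qed
  have "Mon (\<Sum>v\<in>A. f v) = (\<Prod>v\<in>A. Mon (f v) :: 'k pol)" for A and f :: "indet \<Rightarrow> indet \<Rightarrow>\<^sub>0 nat"
    by (induction A rule: infinite_finite_induct) (auto simp: Mon_add)
  then show ?thesis by (subst m) (simp add: Mon_single)
qed

lemma mult_Mon_inj: "Mon m = (Mon m' :: 'k::comm_ring_1 pol) \<longleftrightarrow> m = m'"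
  using keys_Mon by (metis singleton_inject)

subsection \<open>The subrings of polynomials in a set of indeterminates\<close>

lemma pol_ring_simps [simp]:
  "x \<otimes>\<^bsub>pol_ring vs\<^esub> y = x * y" "x \<oplus>\<^bsub>pol_ring vs\<^esub> y = x + y"
  "\<one>\<^bsub>pol_ring vs\<^esub> = 1" "\<zero>\<^bsub>pol_ring vs\<^esub> = 0"
  by (simp_all add: pol_ring_def)

lemma PV_iff: "p \<in> PV vs \<longleftrightarrow> (\<forall>m\<in>Poly_Mapping.keys p. Poly_Mapping.keys m \<subseteq> vs)"
  by (simp add: pol_ring_def)

lemma PV_mono: "vs \<subseteq> us \<Longrightarrow> p \<in> PV vs \<Longrightarrow> p \<in> PV us"
  by (auto simp: PV_iff)

lemma PV_0 [simp]: "0 \<in> PV vs"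
  by (simp add: PV_iff)

lemma PV_Cst [simp]: "Cst c \<in> PV vs"
  by (auto simp: PV_iff Cst_def)

lemma PV_1 [simp]: "1 \<in> PV vs"
  using PV_Cst[of 1] by simp

lemma PV_Var: "v \<in> vs \<Longrightarrow> Var v \<in> PV vs"
  by (auto simp: PV_iff Var_def)

lemma PV_add: "p \<in> PV vs \<Longrightarrow> q \<in> PV vs \<Longrightarrow> p + q \<in> PV vs"
  using keys_add[of p q] by (auto simp: PV_iff)

lemma PV_uminus: "p \<in> PV vs \<Longrightarrow> - p \<in> PV vs"
  by (auto simp: PV_iff in_keys_iff)

lemma PV_diff: "p \<in> PV vs \<Longrightarrow> q \<in> PV vs \<Longrightarrow> p - q \<in> PV vs"
  using PV_add[of p vs "- q"] PV_uminus[of q] by simp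

lemma keys_add_nat: "Poly_Mapping.keys (a + b :: indet \<Rightarrow>\<^sub>0 nat) = Poly_Mapping.keys a \<union> Poly_Mapping.keys b"
  by (auto simp: in_keys_iff lookup_add)

lemma PV_mult: "p \<in> PV vs \<Longrightarrow> q \<in> PV vs \<Longrightarrow> p * q \<in> PV vs"
  using keys_mult[of p q] by (fastforce simp: PV_iff keys_add_nat)

lemma PV_power: "p \<in> PV vs \<Longrightarrow> p ^ k \<in> PV vs"
  by (induction k) (auto intro: PV_mult)

lemma PV_sum: "(\<And>i. i \<in> A \<Longrightarrow> f i \<in> PV vs) \<Longrightarrow> sum f A \<in> PV vs"
  by (induction A rule: infinite_finite_induct) (auto intro: PV_add)

lemma PV_prod: "(\<And>i. i \<in> A \<Longrightarrow> f i \<in> PV vs) \<Longrightarrow> prod f A \<in> PV vs"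
  by (induction A rule: infinite_finite_induct) (auto intro: PV_mult)

lemma PV_Mon: "Mon m \<in> PV vs \<longleftrightarrow> Poly_Mapping.keys m \<subseteq> vs"
  by (simp add: PV_iff)

lemmas PV_closed = PV_Cst PV_Var PV_add PV_uminus PV_diff PV_mult PV_power PV_sum PV_prod

text \<open>Two ring homomorphisms that agree on constants and indeterminates agree: facts of this kind are
  proved by the following induction, which multiplies by one indeterminate at a time.\<close>

lemma pol_induct [consumes 1, case_names Cst add Var]:
  assumes p: "p \<in> PV vs"
    and 1: "\<And>c. P (Cst c)"
    and 2: "\<And>p q. p \<in> PV vs \<Longrightarrow> q \<in> PV vs \<Longrightarrow> P p \<Longrightarrow> P q \<Longrightarrow> P (p + q)"
    and 3: "\<And>v p. v \<in> vs \<Longrightarrow> p \<in> PV vs \<Longrightarrow> P p \<Longrightarrow> P (Var v * p)"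
  shows "P p"
proof -
  have pw: "P (Var v ^ k * q) \<and> Var v ^ k * q \<in> PV vs" if "v \<in> vs" "q \<in> PV vs" "P q" for v k q
    using that by (induction k) (auto simp: mult.assoc intro: 3 PV_closed)
  have pr: "P ((\<Prod>v\<in>A. Var v ^ f v) * q) \<and> (\<Prod>v\<in>A. Var v ^ f v) * q \<in> PV vs"
    if "finite A" "A \<subseteq> vs" "q \<in> PV vs" "P q" for A f q
    using that
  proof (induction A)
    case (insert a A)
    then show ?case using pw[of a "(\<Prod>v\<in>A. Var v ^ f v) * q" "f a"] by (auto simp: mult.assoc)
  qed auto
  have t: "P (Cst c * Mon m)" if "Poly_Mapping.keys m \<subseteq> vs" for c m
    using pr[of "Poly_Mapping.keys m" "Cst c"] that 1 by (simp add: Mon_eq_prod mult.commute)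
  have "P (\<Sum>m\<in>A. Cst (Poly_Mapping.lookup p m) * Mon m) \<and>
      (\<Sum>m\<in>A. Cst (Poly_Mapping.lookup p m) * Mon m) \<in> PV vs"
    if "finite A" "A \<subseteq> Poly_Mapping.keys p" for A
    using that
  proof (induction A)
    case empty
    then show ?case using 1[of 0] by simp
  next
    case (insert m A)
    then have "Poly_Mapping.keys m \<subseteq> vs" using p by (auto simp: PV_iff)
    then show ?case using insert by (auto intro!: 2 t PV_closed simp: PV_Mon)
  qed
  from this[OF finite_keys order_refl] show ?thesis
    using pol_eq_sum[of p] by metis
qed

lemma PV_UNIV [simp]: "p \<in> PV UNIV"
  by (simp add: PV_iff)

subsection \<open>Substitution\<close>

definition ev :: "('k \<Rightarrow> 'b) \<Rightarrow> (indet \<Rightarrow> 'b) \<Rightarrow> 'k::comm_ring_1 pol \<Rightarrow> 'b::comm_ring_1" where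
  "ev \<kappa> \<sigma> p = (\<Sum>m\<in>Poly_Mapping.keys p. \<kappa> (Poly_Mapping.lookup p m) *
     (\<Prod>v\<in>Poly_Mapping.keys m. \<sigma> v ^ Poly_Mapping.lookup m v))"

context comm_ring_hom
begin

lemma ev_superset:
  assumes "finite A" "Poly_Mapping.keys p \<subseteq> A"
  shows "ev hom \<sigma> p = (\<Sum>m\<in>A. hom (Poly_Mapping.lookup p m) *
     (\<Prod>v\<in>Poly_Mapping.keys m. \<sigma> v ^ Poly_Mapping.lookup m v))"
  unfolding ev_def using assms by (intro sum.mono_neutral_left) (auto simp: in_keys_iff)

lemma ev_add: "ev hom \<sigma> (p + q) = ev hom \<sigma> p + ev hom \<sigma> q"
proof -
  let ?A = "Poly_Mapping.keys p \<union> Poly_Mapping.keys q"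
  have "finite ?A" by simp
  note e = ev_superset[OF this]
  have "Poly_Mapping.keys (p + q) \<subseteq> ?A" by (rule keys_add)
  then show ?thesis by (simp add: e lookup_add hom_distribs algebra_simps sum.distrib)
qed

lemma ev_single: "ev hom \<sigma> (Poly_Mapping.single m c) =
    hom c * (\<Prod>v\<in>Poly_Mapping.keys m. \<sigma> v ^ Poly_Mapping.lookup m v)"
  by (subst ev_superset[of "{m}"]) auto

lemma monval_add:
  fixes m m' :: "indet \<Rightarrow>\<^sub>0 nat"
  shows "(\<Prod>v\<in>Poly_Mapping.keys (m + m'). \<sigma> v ^ Poly_Mapping.lookup (m + m') v) =
   (\<Prod>v\<in>Poly_Mapping.keys m. \<sigma> v ^ Poly_Mapping.lookup m v) *
   (\<Prod>v\<in>Poly_Mapping.keys m'. (\<sigma> v :: 'b) ^ Poly_Mapping.lookup m' v)"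
proof -
  let ?A = "Poly_Mapping.keys m \<union> Poly_Mapping.keys m'"
  have "(\<Prod>v\<in>Poly_Mapping.keys m. \<sigma> v ^ Poly_Mapping.lookup m v) = (\<Prod>v\<in>?A. \<sigma> v ^ Poly_Mapping.lookup m v)"
   and "(\<Prod>v\<in>Poly_Mapping.keys m'. \<sigma> v ^ Poly_Mapping.lookup m' v) = (\<Prod>v\<in>?A. \<sigma> v ^ Poly_Mapping.lookup m' v)"
    by (intro prod.mono_neutral_left; auto simp: in_keys_iff)+
  then show ?thesis by (simp add: keys_add_nat lookup_add power_add prod.distrib)
qed

lemma ev_sum: "ev hom \<sigma> (sum f A) = (\<Sum>i\<in>A. ev hom \<sigma> (f i))"
proof -
  have "ev hom \<sigma> 0 = 0" by (simp add: ev_def)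
  then show ?thesis by (induction A rule: infinite_finite_induct) (auto simp: ev_add)
qed

lemma ev_mult: "ev hom \<sigma> (p * q) = ev hom \<sigma> p * ev hom \<sigma> q"
proof -
  have s: "ev hom \<sigma> (Poly_Mapping.single m c * Poly_Mapping.single m' c') =
     ev hom \<sigma> (Poly_Mapping.single m c) * ev hom \<sigma> (Poly_Mapping.single m' c')" for m m' c c'
    unfolding mult_single ev_single monval_add by (simp add: hom_distribs ac_simps)
  have "ev hom \<sigma> ((\<Sum>m\<in>Poly_Mapping.keys p. Poly_Mapping.single m (Poly_Mapping.lookup p m)) *
      (\<Sum>m\<in>Poly_Mapping.keys q. Poly_Mapping.single m (Poly_Mapping.lookup q m))) =
    ev hom \<sigma> (\<Sum>m\<in>Poly_Mapping.keys p. Poly_Mapping.single m (Poly_Mapping.lookup p m)) *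
    ev hom \<sigma> (\<Sum>m\<in>Poly_Mapping.keys q. Poly_Mapping.single m (Poly_Mapping.lookup q m))"
    unfolding sum_product ev_sum s ..
  then show ?thesis
    unfolding single_eq_Cst_Mon pol_eq_sum[symmetric] .
qed

lemma ev_Cst [simp]: "ev hom \<sigma> (Cst c) = hom c"
  by (simp add: Cst_def ev_single)

lemma ev_Var [simp]: "ev hom \<sigma> (Var v) = \<sigma> v"
  by (simp add: Var_def ev_single)

lemma ev_hom: "comm_ring_hom (ev hom \<sigma>)"
proof
  show "ev hom \<sigma> 1 = 1" using ev_Cst[of \<sigma> 1] by simp
  show "ev hom \<sigma> 0 = 0" using ev_Cst[of \<sigma> 0] by simp
qed (auto simp: ev_add ev_mult)

end

lemma ev_cong: "p \<in> PV vs \<Longrightarrow> (\<And>v. v \<in> vs \<Longrightarrow> \<sigma> v = \<tau> v) \<Longrightarrow> ev \<kappa> \<sigma> p = ev \<kappa> \<tau> p"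
  unfolding ev_def PV_iff
  by (intro sum.cong prod.cong arg_cong2[of _ _ _ _ "(*)"] arg_cong2[of _ _ _ _ "(^)"]) auto

abbreviation psub :: "(indet \<Rightarrow> 'k pol) \<Rightarrow> 'k::comm_ring_1 pol \<Rightarrow> 'k pol" where
  "psub \<equiv> ev Cst"

interpretation psub: comm_ring_hom "psub \<sigma> :: 'k::comm_ring_1 pol \<Rightarrow> 'k pol"
  by (rule Cst.ev_hom)

lemma psub_Cst [simp]: "psub \<sigma> (Cst c) = Cst c"
  by (rule Cst.ev_Cst)

lemma psub_Var [simp]: "psub \<sigma> (Var v) = \<sigma> v"
  by (rule Cst.ev_Var)

lemma psub_PV: "p \<in> PV vs \<Longrightarrow> (\<And>v. v \<in> vs \<Longrightarrow> \<sigma> v \<in> PV us) \<Longrightarrow> psub \<sigma> p \<in> PV us"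
  by (induction p rule: pol_induct) (auto simp: hom_distribs intro: PV_closed)

lemma psub_psub: "psub \<sigma> (psub \<tau> p) = psub (\<lambda>v. psub \<sigma> (\<tau> v)) p"
  by (induction p rule: pol_induct[OF PV_UNIV]) (auto simp: hom_distribs)

lemma psub_id: "psub Var p = p"
  by (induction p rule: pol_induct[OF PV_UNIV]) (auto simp: hom_distribs)

abbreviation pev :: "(indet \<Rightarrow> 'k) \<Rightarrow> 'k::comm_ring_1 pol \<Rightarrow> 'k" where
  "pev \<equiv> ev (\<lambda>a. a)"

lemma id_hom: "comm_ring_hom (\<lambda>a. a :: 'k::comm_ring_1)"
  by unfold_locales auto

interpretation pev: comm_ring_hom "pev \<sigma> :: 'k::comm_ring_1 pol \<Rightarrow> 'k"
  by (rule comm_ring_hom.ev_hom[OF id_hom])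

lemma pev_Cst [simp]: "pev \<sigma> (Cst c) = c"
  by (rule comm_ring_hom.ev_Cst[OF id_hom])

lemma pev_Var [simp]: "pev \<sigma> (Var v) = \<sigma> v"
  by (rule comm_ring_hom.ev_Var[OF id_hom])

lemma pev_psub: "pev c (psub \<sigma> p) = pev (\<lambda>v. pev c (\<sigma> v)) p"
  by (induction p rule: pol_induct[OF PV_UNIV])
    (auto simp: hom_distribs)

subsection \<open>Polynomials as polynomials in one of the indeterminates\<close>

text \<open>The coefficients keep the type of polynomials in all the indeterminates, so that inserting
  \<open>Var v\<close> again is evaluation of a univariate polynomial over one and the same ring.\<close>

definition UP :: "indet \<Rightarrow> 'k::comm_ring_1 pol \<Rightarrow> 'k pol poly" where
  "UP v = ev (\<lambda>c. [:Cst c:]) (\<lambda>u. if u = v then [:0, 1:] else [:Var u:])"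

lemma UP_coef_hom: "comm_ring_hom (\<lambda>c. [:Cst c:] :: 'k::comm_ring_1 pol poly)"
  by unfold_locales (auto simp: hom_distribs one_pCons)

interpretation UPc: comm_ring_hom "\<lambda>c. [:Cst c:] :: 'k::comm_ring_1 pol poly"
  by (rule UP_coef_hom)

interpretation UP: comm_ring_hom "UP v :: 'k::comm_ring_1 pol \<Rightarrow> 'k pol poly"
  unfolding UP_def by (rule UPc.ev_hom)

lemma UP_Cst [simp]: "UP v (Cst c) = [:Cst c:]"
  unfolding UP_def by (rule UPc.ev_Cst)

lemma UP_Var: "UP v (Var u) = (if u = v then [:0, 1:] else [:Var u:])"
  unfolding UP_def by (rule UPc.ev_Var)

lemma poly_UP: "poly (UP v p) (Var v) = p"
  by (induction p rule: pol_induct[OF PV_UNIV]) (auto simp: hom_distribs UP_Var)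

lemma UP_eq_iff [simp]: "UP v p = UP v q \<longleftrightarrow> p = q"
  by (metis poly_UP)

lemma UP_eq_0 [simp]: "UP v p = 0 \<longleftrightarrow> p = 0"
  using UP_eq_iff[of v p 0] by (simp del: UP_eq_iff)

lemma UP_const: "p \<in> PV vs \<Longrightarrow> v \<notin> vs \<Longrightarrow> UP v p = [:p:]"
  by (induction p rule: pol_induct) (auto simp: hom_distribs UP_Var)

lemma UP_coeff: "p \<in> PV vs \<Longrightarrow> coeff (UP v p) i \<in> PV (vs - {v})"
proof (induction p arbitrary: i rule: pol_induct)
  case (Cst c)
  then show ?case by (cases i) auto
next
  case (add p q)
  then show ?case by (auto simp: hom_distribs intro: PV_closed)
next
  case (Var u p)
  show ?case
  proof (cases "u = v")
    case True
    then show ?thesis using Var by (cases i) (auto simp: hom_distribs UP_Var)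
  next
    case False
    then show ?thesis using Var by (auto simp: hom_distribs UP_Var intro: PV_closed)
  qed
qed

lemma UP_expand: "p = (\<Sum>i\<le>degree (UP v p). coeff (UP v p) i * Var v ^ i)"
  using poly_UP[of v p] by (simp add: poly_altdef)

subsection \<open>Points where a polynomial does not vanish\<close>

text \<open>Over a finite field, the product of all \<open>x - c\<close>, plus \<open>1\<close>, has no root.\<close>

lemma infinite_alg_closed: "infinite (UNIV :: 'k::alg_closed_field set)"
proof
  assume fin: "finite (UNIV :: 'k set)"
  let ?q = "(\<Prod>a\<in>UNIV. [:- a, 1:]) :: 'k poly"
  have "degree ?q = card (UNIV :: 'k set)"
    by (simp add: degree_prod_sum_eq)
  moreover have "card (UNIV :: 'k set) > 0" using fin by (simp add: card_gt_0_iff)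
  ultimately have "degree (?q + 1) > 0"
    by (subst degree_add_eq_left) auto
  then obtain x where "poly (?q + 1) x = 0" using alg_closed_imp_poly_has_root by blast
  moreover have "poly ?q x = 0" using fin by (auto simp: poly_prod intro!: prod_zero bexI[of _ x])
  ultimately show False by simp
qed

text \<open>By induction, some values of the other indeterminates leave a nonzero coefficient, and the resulting
  univariate polynomial has finitely many roots.\<close>

lemma nonvanishing_point:
  fixes p :: "'k::field pol"
  assumes inf: "infinite (UNIV :: 'k set)" and "finite vs" "p \<in> PV vs" "p \<noteq> 0"
  shows "\<exists>c. pev c p \<noteq> 0"
  using assms(2-)
proof (induction vs arbitrary: p rule: finite_induct)
  case empty
  then have "Poly_Mapping.keys p \<subseteq> {0}" by (auto simp: PV_iff)
  then have "p = Cst (Poly_Mapping.lookup p 0)"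
    by (metis (no_types) Cst_def not_in_keys_iff_lookup_eq_zero empty_iff insert_iff lookup_single_eq lookup_single_not_eq poly_mapping_eqI subset_iff)
  then show ?case using empty by (metis Cst_eq_0 pev_Cst)
next
  case (insert v vs)
  from insert.prems have "UP v p \<noteq> 0" by simp
  then obtain i where i: "coeff (UP v p) i \<noteq> 0" by (metis coeff_0 poly_eqI)
  have c: "coeff (UP v p) j \<in> PV vs" for j
    using UP_coeff[OF insert.prems(1), of v j] by (rule PV_mono[rotated]) auto
  from insert.IH[OF c i] obtain c where c0: "pev c (coeff (UP v p) i) \<noteq> 0" ..
  define q where "q = map_poly (pev c) (UP v p)"
  have cq: "coeff q j = pev c (coeff (UP v p) j)" for j by (simp add: q_def coeff_map_poly)
  have "q \<noteq> 0" using c0 cq by (metis coeff_0)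
  then have "finite {t. poly q t = 0}" by (rule poly_roots_finite)
  with inf obtain t where t: "poly q t \<noteq> 0" by (metis (mono_tags) UNIV_eq_I mem_Collect_eq)
  have same: "pev (c(v := t)) (coeff (UP v p) j) = pev c (coeff (UP v p) j)" for j
    by (rule ev_cong[OF c]) (use insert.hyps in auto)
  have "pev (c(v := t)) p = (\<Sum>j\<le>degree (UP v p). pev c (coeff (UP v p) j) * t ^ j)"
    by (subst UP_expand[of p v]) (simp add: hom_distribs same)
  also have "\<dots> = (\<Sum>j\<le>degree (UP v p). coeff q j * t ^ j)" by (simp add: cq)
  also have "\<dots> = poly q t"
  proof -
    have "degree q \<le> degree (UP v p)" by (rule degree_le) (simp add: cq coeff_eq_0)
    then show ?thesis unfolding poly_altdef
      by (intro sum.mono_neutral_right) (auto simp: coeff_eq_0)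
  qed
  finally have "pev (c(v := t)) p \<noteq> 0" using t by metis
  then show ?case by blast
qed

section \<open>Algebraic dependence and lengths of chains of primes\<close>

text \<open>A relation \<open>F = 0\<close> between elements of a domain can be divided by a power of \<open>v\<close>, so that the term
  without \<open>v\<close> is not zero. This is how algebraic relations are used below.\<close>

lemma UP_lowest_term:
  fixes p :: "'k::idom pol"
  assumes p: "p \<in> PV vs" "p \<noteq> 0" and v: "v \<in> vs"
  shows "\<exists>i a q. p = Var v ^ i * (a + Var v * q) \<and> a \<noteq> 0 \<and> a \<in> PV (vs - {v}) \<and> q \<in> PV vs"
proof -
  have "UP v p \<noteq> 0" using p by simp
  from order_decomp[OF this, of 0] obtain Q where
    Q: "UP v p = [:0, 1:] ^ order 0 (UP v p) * Q" "\<not> [:0, 1:] dvd Q" by auto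
  define i where "i = order 0 (UP v p)"
  obtain a Q' where Q': "Q = pCons a Q'" by (cases Q)
  have "coeff Q j = coeff (UP v p) (j + i)" for j
    using Q(1) coeff_monom_mult[of 1 i Q "j + i"] by (simp add: i_def monom_altdef)
  then have cQ: "coeff Q j \<in> PV (vs - {v})" for j using UP_coeff[OF p(1)] by simp
  have "p = poly (UP v p) (Var v)" by (simp add: poly_UP)
  also have "\<dots> = Var v ^ i * (a + Var v * poly Q' (Var v))"
    by (subst Q(1)) (simp add: Q' i_def algebra_simps)
  finally have "p = Var v ^ i * (a + Var v * poly Q' (Var v))" .
  moreover have "a \<noteq> 0" using Q(2) Q' by (auto simp: dvd_iff_poly_eq_0[of 0, simplified] simp flip: poly_eq_0_iff_dvd)
  moreover have "a \<in> PV (vs - {v})" using cQ[of 0] Q' by simp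
  moreover have "poly Q' (Var v) \<in> PV vs"
    unfolding poly_altdef
  proof (intro PV_sum PV_mult PV_power PV_Var v)
    fix j show "coeff Q' j \<in> PV vs" using cQ[of "Suc j"] Q' by (auto intro: PV_mono[rotated])
  qed
  ultimately show ?thesis by blast
qed

subsection \<open>Counting monomials\<close>

interpretation PolV: vector_space "\<lambda>(c::'k::field) (p :: 'k pol). Cst c * p"
  by unfold_locales (auto simp: algebra_simps hom_distribs)

definition mons :: "indet set \<Rightarrow> nat \<Rightarrow> (indet \<Rightarrow>\<^sub>0 nat) set" where
  "mons vs D = {m. Poly_Mapping.keys m \<subseteq> vs \<and> (\<forall>v. Poly_Mapping.lookup m v \<le> D)}"

lemma mons_card:
  assumes "finite vs"
  shows "finite (mons vs D)" "card (mons vs D) = (D + 1) ^ card vs"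
proof -
  have b: "bij_betw (\<lambda>m. restrict (Poly_Mapping.lookup m) vs) (mons vs D) (vs \<rightarrow>\<^sub>E {..D})"
  proof (rule bij_betw_imageI)
    show "inj_on (\<lambda>m. restrict (Poly_Mapping.lookup m) vs) (mons vs D)"
    proof (rule inj_onI, rule poly_mapping_eqI)
      fix m m' v assume *: "m \<in> mons vs D" "m' \<in> mons vs D"
        "restrict (Poly_Mapping.lookup m) vs = restrict (Poly_Mapping.lookup m') vs"
      show "Poly_Mapping.lookup m v = Poly_Mapping.lookup m' v"
      proof (cases "v \<in> vs")
        case True then show ?thesis using fun_cong[OF *(3), of v] by simp
      next
        case False
        then have "v \<notin> Poly_Mapping.keys m" "v \<notin> Poly_Mapping.keys m'" using * by (auto simp: mons_def)
        then show ?thesis by (simp add: not_in_keys_iff_lookup_eq_zero)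
      qed
    qed
    show "(\<lambda>m. restrict (Poly_Mapping.lookup m) vs) ` mons vs D = vs \<rightarrow>\<^sub>E {..D}"
    proof (intro equalityI subsetI)
      fix g assume g: "g \<in> vs \<rightarrow>\<^sub>E {..D}"
      define m where "m = Poly_Mapping.Abs_poly_mapping (\<lambda>v. if v \<in> vs then g v else 0)"
      have l: "Poly_Mapping.lookup m = (\<lambda>v. if v \<in> vs then g v else 0)"
        unfolding m_def using assms by (intro lookup_Abs_poly_mapping) (auto elim: rev_finite_subset)
      have "m \<in> mons vs D" using g by (auto simp: mons_def in_keys_iff l split: if_splits)
      moreover have "restrict (Poly_Mapping.lookup m) vs = g" using g by (auto simp: l fun_eq_iff PiE_def extensional_def)
      ultimately show "g \<in> (\<lambda>m. restrict (Poly_Mapping.lookup m) vs) ` mons vs D" by force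
    qed (auto simp: mons_def)
  qed
  have "card (vs \<rightarrow>\<^sub>E {..D}) = (D + 1) ^ card vs" using assms by (simp add: card_PiE)
  moreover have "finite (vs \<rightarrow>\<^sub>E {..D})" using assms by (simp add: finite_PiE)
  ultimately show "finite (mons vs D)" "card (mons vs D) = (D + 1) ^ card vs"
    using b bij_betw_finite bij_betw_same_card by metis+
qed

definition exp_bounded :: "nat \<Rightarrow> 'k::comm_ring_1 pol \<Rightarrow> bool" where
  "exp_bounded D p \<longleftrightarrow> (\<forall>m\<in>Poly_Mapping.keys p. \<forall>v. Poly_Mapping.lookup m v \<le> D)"

lemma exp_bounded_mult: "exp_bounded D p \<Longrightarrow> exp_bounded E q \<Longrightarrow> exp_bounded (D + E) (p * q)"
  unfolding exp_bounded_def using keys_mult[of p q] by (fastforce simp: lookup_add intro: add_mono)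

lemma exp_bounded_1: "exp_bounded 0 1"
  by (auto simp: exp_bounded_def)

lemma exp_bounded_power: "exp_bounded D p \<Longrightarrow> exp_bounded (k * D) (p ^ k)"
  by (induction k) (auto intro: exp_bounded_mult exp_bounded_1)

lemma exp_bounded_prod:
  "finite A \<Longrightarrow> (\<And>i. i \<in> A \<Longrightarrow> exp_bounded (D i) (f i)) \<Longrightarrow> exp_bounded (sum D A) (prod f A)"
  by (induction A rule: finite_induct) (auto intro: exp_bounded_mult exp_bounded_1)

lemma exp_bounded_mono: "D \<le> E \<Longrightarrow> exp_bounded D p \<Longrightarrow> exp_bounded E p"
  unfolding exp_bounded_def by (meson order_trans)

lemma exists_exp_bound: "\<exists>D. exp_bounded D p"
proof -
  have "finite (\<Union>m\<in>Poly_Mapping.keys p. Poly_Mapping.range m)" by simp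
  then obtain D where D: "\<And>x. x \<in> (\<Union>m\<in>Poly_Mapping.keys p. Poly_Mapping.range m) \<Longrightarrow> x \<le> D"
    by (meson finite_nat_set_iff_bounded_le)
  have "exp_bounded D p" unfolding exp_bounded_def
  proof (intro ballI allI)
    fix m v assume "m \<in> Poly_Mapping.keys p"
    then show "Poly_Mapping.lookup m v \<le> D"
    proof (cases "v \<in> Poly_Mapping.keys m")
      case True
      show ?thesis by (rule D, rule UN_I, fact) (rule in_keys_lookup_in_range[OF True])
    qed (simp add: not_in_keys_iff_lookup_eq_zero)
  qed
  then show ?thesis ..
qed

lemma exp_bounded_span:
  assumes "p \<in> PV vs" "exp_bounded D p"
  shows "(p :: 'k::field pol) \<in> PolV.span (Mon ` mons vs D)"
  by (subst pol_eq_sum, intro PolV.span_sum PolV.span_scale PolV.span_base)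
    (use assms in \<open>auto simp: mons_def PV_iff exp_bounded_def\<close>)

text \<open>The monomials of exponents at most \<open>M\<close> in the elements \<open>f v\<close> are more numerous, for large \<open>M\<close>,
  than the monomials in fewer indeterminates of which they are linear combinations: \<open>M\<^sup>a\<close> outgrows
  \<open>C M\<^sup>b\<close> for \<open>a > b\<close>.\<close>

theorem algebraic_dependence:
  fixes f :: "indet \<Rightarrow> 'k::field pol"
  assumes fin: "finite xs" "finite ys" and card: "card ys < card xs"
    and f: "\<And>v. v \<in> xs \<Longrightarrow> f v \<in> PV ys"
  shows "\<exists>F\<in>PV xs. F \<noteq> 0 \<and> psub f F = 0"
proof -
  have "\<exists>D. \<forall>v\<in>xs. exp_bounded D (f v)"
  proof -
    have "\<forall>v. \<exists>d. exp_bounded d (f v)" using exists_exp_bound by blast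
    then obtain d where d: "\<And>v. exp_bounded (d v) (f v)" by metis
    have "\<forall>v\<in>xs. exp_bounded (\<Sum>v\<in>xs. d v) (f v)"
      using d fin(1) by (auto intro: exp_bounded_mono[OF member_le_sum])
    then show ?thesis ..
  qed
  then obtain D where D: "\<And>v. v \<in> xs \<Longrightarrow> exp_bounded D (f v)" by blast
  define C where "C = card xs * D + 1"
  define M where "M = C ^ card ys"
  define E where "E = card xs * M * D"
  define g where "g m = psub f (Mon m)" for m
  have g_prod: "g m = (\<Prod>v\<in>Poly_Mapping.keys m. f v ^ Poly_Mapping.lookup m v)" for m
    by (simp add: g_def Mon_eq_prod hom_distribs)
  have gspan: "g m \<in> PolV.span (Mon ` mons ys E)" if m: "m \<in> mons xs M" for m
  proof (rule exp_bounded_span)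
    have k: "Poly_Mapping.keys m \<subseteq> xs" using m by (auto simp: mons_def)
    show "g m \<in> PV ys" unfolding g_prod using k f by (intro PV_prod PV_power) auto
    have "exp_bounded (\<Sum>v\<in>Poly_Mapping.keys m. Poly_Mapping.lookup m v * D) (g m)"
      unfolding g_prod using k D by (intro exp_bounded_prod exp_bounded_power) auto
    moreover have "(\<Sum>v\<in>Poly_Mapping.keys m. Poly_Mapping.lookup m v * D) \<le> E"
    proof -
      have "(\<Sum>v\<in>Poly_Mapping.keys m. Poly_Mapping.lookup m v * D) \<le> (\<Sum>v\<in>Poly_Mapping.keys m. M * D)"
        using m by (intro sum_mono mult_right_mono) (auto simp: mons_def)
      also have "\<dots> \<le> card xs * (M * D)" using card_mono[OF fin(1) k] by simp
      finally show ?thesis by (simp add: E_def)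
    qed
    ultimately show "exp_bounded E (g m)" by (rule exp_bounded_mono[rotated])
  qed
  \<comment> \<open>The choice \<open>M = C\<^bsup>card ys\<^esup>\<close> makes \<open>(C (M + 1))\<^bsup>card ys\<^esup> = M (M + 1)\<^bsup>card ys\<^esup>\<close> less than \<open>(M + 1)\<^bsup>card xs\<^esup>\<close>.\<close>
  have lt: "card (mons ys E) < card (mons xs M)"
  proof -
    have "E + 1 \<le> C * (M + 1)" by (simp add: E_def C_def algebra_simps)
    then have "(E + 1) ^ card ys \<le> (C * (M + 1)) ^ card ys" by (rule power_mono) simp
    also have "\<dots> = M * (M + 1) ^ card ys" unfolding power_mult_distrib by (simp only: M_def)
    also have "\<dots> < (M + 1) ^ Suc (card ys)" by simp
    also have "\<dots> \<le> (M + 1) ^ card xs" using card by (intro power_increasing) auto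
    finally show ?thesis using mons_card fin by simp
  qed
  show ?thesis
  proof (cases "inj_on g (mons xs M)")
    case False
    then obtain m m' where m: "m \<in> mons xs M" "m' \<in> mons xs M" "m \<noteq> m'" "g m = g m'"
      by (auto simp: inj_on_def)
    then have "Mon m - Mon m' \<in> PV xs" "Mon m - Mon m' \<noteq> (0 :: 'k pol)" "psub f (Mon m - Mon m') = 0"
      by (auto simp: mons_def PV_Mon mult_Mon_inj g_def hom_distribs intro!: PV_diff)
    then show ?thesis by blast
  next
    case inj: True
    have "PolV.dependent (g ` mons xs M)"
    proof (rule ccontr)
      assume "\<not> ?thesis"
      moreover have "g ` mons xs M \<subseteq> PolV.span (Mon ` mons ys E)" using gspan by auto
      ultimately have "card (g ` mons xs M) \<le> card (Mon ` mons ys E :: 'k pol set)"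
        using PolV.independent_span_bound mons_card(1)[OF fin(2)] by blast
      also have "\<dots> \<le> card (mons ys E)" using mons_card(1)[OF fin(2)] by (rule card_image_le)
      finally show False using lt card_image[OF inj] by simp
    qed
    then obtain t u where t: "finite t" "t \<subseteq> g ` mons xs M" "(\<Sum>p\<in>t. Cst (u p) * p) = 0" "\<exists>p\<in>t. u p \<noteq> 0"
      unfolding PolV.dependent_explicit by blast
    define A where "A = {m \<in> mons xs M. g m \<in> t}"
    have fA: "finite A" using mons_card(1)[OF fin(1)] by (simp add: A_def)
    have gA: "g ` A = t" "inj_on g A" using t(2) inj by (auto simp: A_def inj_on_def)
    define F where "F = (\<Sum>m\<in>A. Cst (u (g m)) * Mon m)"
    have "psub f F = (\<Sum>m\<in>A. Cst (u (g m)) * g m)" by (simp add: F_def g_def hom_distribs)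
    also have "\<dots> = (\<Sum>p\<in>t. Cst (u p) * p)" using gA by (simp add: sum.reindex flip: gA(1))
    finally have "psub f F = 0" using t(3) by simp
    moreover have "F \<in> PV xs" unfolding F_def by (intro PV_sum PV_mult PV_Cst) (auto simp: A_def mons_def PV_Mon)
    moreover have "F \<noteq> 0"
    proof -
      obtain m where m: "m \<in> A" "u (g m) \<noteq> 0" using t(4) gA(1) by blast
      have "Poly_Mapping.lookup F m = (\<Sum>m'\<in>A. if m' = m then u (g m) else 0)"
        unfolding F_def lookup_sum by (intro sum.cong) (auto simp: lookup_Cst_mult lookup_Mon)
      then have "Poly_Mapping.lookup F m = u (g m)" using fA m by simp
      then show ?thesis using m by auto
    qed
    ultimately show ?thesis by blast
  qed
qed

subsection \<open>Subrings of the polynomial ring\<close>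

definition sub_ring :: "'k::comm_ring_1 pol set \<Rightarrow> 'k pol ring" where
  "sub_ring K = \<lparr>carrier = K, monoid.mult = (*), one = 1, ring.zero = 0, ring.add = (+)\<rparr>"

lemma sub_ring_simps [simp]:
  "carrier (sub_ring K) = K" "x \<otimes>\<^bsub>sub_ring K\<^esub> y = x * y" "x \<oplus>\<^bsub>sub_ring K\<^esub> y = x + y"
  "\<one>\<^bsub>sub_ring K\<^esub> = 1" "\<zero>\<^bsub>sub_ring K\<^esub> = 0"
  by (simp_all add: sub_ring_def)

lemma pol_ring_eq_sub_ring: "pol_ring vs = sub_ring (PV vs)"
  by (simp add: pol_ring_def sub_ring_def)

locale subalgebra =
  fixes K :: "'k::field pol set"
  assumes K_Cst [intro, simp]: "Cst c \<in> K"
    and K_add [intro]: "p \<in> K \<Longrightarrow> q \<in> K \<Longrightarrow> p + q \<in> K"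
    and K_mult [intro]: "p \<in> K \<Longrightarrow> q \<in> K \<Longrightarrow> p * q \<in> K"
begin

lemma K_0 [intro, simp]: "0 \<in> K" and K_1 [intro, simp]: "1 \<in> K"
  using K_Cst[of 0] K_Cst[of 1] by simp_all

lemma K_uminus [intro]: "p \<in> K \<Longrightarrow> - p \<in> K"
  using K_mult[OF K_Cst[of "- 1"], of p] by (simp add: hom_distribs)

lemma K_diff [intro]: "p \<in> K \<Longrightarrow> q \<in> K \<Longrightarrow> p - q \<in> K"
  using K_add[of p "- q"] K_uminus[of q] by simp

lemma K_power [intro]: "p \<in> K \<Longrightarrow> p ^ k \<in> K"
  by (induction k) auto

lemma K_sum [intro]: "(\<And>i. i \<in> A \<Longrightarrow> f i \<in> K) \<Longrightarrow> sum f A \<in> K"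
  by (induction A rule: infinite_finite_induct) auto

lemma K_psub: "p \<in> PV vs \<Longrightarrow> (\<And>v. v \<in> vs \<Longrightarrow> \<sigma> v \<in> K) \<Longrightarrow> psub \<sigma> p \<in> K"
  by (induction p rule: pol_induct) (auto simp: hom_distribs)

sublocale cring "sub_ring K"
proof (rule cringI)
  show "abelian_group (sub_ring K)"
  proof (rule abelian_groupI)
    fix x assume "x \<in> carrier (sub_ring K)"
    then show "\<exists>y\<in>carrier (sub_ring K). y \<oplus>\<^bsub>sub_ring K\<^esub> x = \<zero>\<^bsub>sub_ring K\<^esub>"
      by (intro bexI[of _ "- x"]) auto
  qed auto
  show "comm_monoid (sub_ring K)" by (rule comm_monoidI) auto
qed (auto simp: algebra_simps)

text \<open>If \<open>f i\<close> lies in the \<open>(i + 1)\<close>-st prime of a chain but not in the \<open>i\<close>-th, the \<open>f i\<close> are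
  algebraically independent: in a relation modulo the lowest prime divide by a power of the first
  element, then pass to the next prime, where the first element vanishes.\<close>

lemma prime_chain_algebraically_independent:
  assumes P: "prime_chain (sub_ring K) n P"
    and f: "\<And>i. i < n \<Longrightarrow> f (Vw i) \<in> P (Suc i) - P i"
    and k: "k \<le> n" and F: "F \<in> PV (Vw ` {k..<n})" "psub f F \<in> P k"
  shows "F = 0"
  using k F
proof (induction k arbitrary: F rule: inc_induct)
  case base
  interpret P: primeideal "P n" "sub_ring K" using P by (auto simp: prime_chain_def)
  have "Poly_Mapping.keys F \<subseteq> {0}" using base by (auto simp: PV_iff)
  then have Fc: "F = Cst (Poly_Mapping.lookup F 0)" (is "_ = Cst ?c")
    by (metis (no_types) Cst_def not_in_keys_iff_lookup_eq_zero empty_iff insert_iff lookup_single_eq lookup_single_not_eq poly_mapping_eqI subset_iff)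
  then have "Cst ?c \<in> P n" using base by (metis psub_Cst)
  then have *: "Cst (inverse ?c) * Cst ?c \<in> P n" using P.I_l_closed[of "Cst ?c" "Cst (inverse ?c)"] by simp
  have "?c = 0"
  proof (rule ccontr)
    assume "?c \<noteq> 0"
    then have "1 \<in> P n" using * by (simp flip: Cst.hom_mult)
    then show False using P.one_imp_carrier P.I_notcarr by auto
  qed
  then show ?case using Fc by simp
next
  case (step k)
  interpret P: primeideal "P k" "sub_ring K" using P step by (auto simp: prime_chain_def)
  interpret Q: primeideal "P (Suc k)" "sub_ring K" using P step by (auto simp: prime_chain_def)
  have PQ: "P k \<subseteq> P (Suc k)" using P step by (auto simp: prime_chain_def)
  have fK: "f v \<in> K" if v: "v \<in> Vw ` {k..<n}" for v
  proof -
    obtain i where i: "v = Vw i" "i < n" using v by auto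
    then interpret S: primeideal "P (Suc i)" "sub_ring K" using P by (auto simp: prime_chain_def)
    show ?thesis using f[OF i(2)] S.Icarr i by auto
  qed
  let ?v = "Vw k"
  show ?case
  proof (rule ccontr)
    assume "F \<noteq> 0"
    from UP_lowest_term[OF step.prems(1) this, of ?v] step.hyps
    obtain i a q where F: "F = Var ?v ^ i * (a + Var ?v * q)" "a \<noteq> 0"
      "a \<in> PV (Vw ` {k..<n} - {?v})" "q \<in> PV (Vw ` {k..<n})" by auto
    have a: "a \<in> PV (Vw ` {Suc k..<n})" using F(3) by (rule PV_mono[rotated]) auto
    define G where "G = psub f a + f ?v * psub f q"
    have vK: "f ?v \<in> K" using fK step.hyps by auto
    have qK: "psub f q \<in> K" using F(4) fK by (rule K_psub)
    have aK: "psub f a \<in> K" using a fK by (rule K_psub) auto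
    have GK: "G \<in> K" unfolding G_def using vK qK aK by auto
    have e: "f ?v ^ j * G \<in> P k \<Longrightarrow> G \<in> P k" for j
    proof (induction j)
      case (Suc j)
      then have "f ?v * (f ?v ^ j * G) \<in> P k" by (simp add: mult.assoc)
      then show ?case using Suc P.I_prime[of "f ?v" "f ?v ^ j * G"] vK GK f[OF step.hyps(2)] by (auto intro: K_mult K_power)
    qed simp
    have "psub f F = f ?v ^ i * G" by (simp add: F(1) G_def hom_distribs)
    then have "G \<in> P (Suc k)" using e step.prems PQ by auto
    moreover have "f ?v * psub f q \<in> P (Suc k)" using Q.I_r_closed[of "f ?v" "psub f q"] f[OF step.hyps(2)] qK by simp
    ultimately have "psub f a \<in> P (Suc k)"
      using Q.a_closed[of G "- (f ?v * psub f q)"] Q.I_l_closed[of "f ?v * psub f q" "Cst (- 1)"]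
        K_Cst[of "- 1"]
      by (simp add: G_def hom_distribs)
    from step.IH[OF a this] F(2) show False by simp
  qed
qed

text \<open>Elements taken from the successive differences of the chain cannot be more numerous than the
  indeterminates, since they would be algebraically dependent.\<close>

theorem prime_chain_length:
  assumes P: "prime_chain (sub_ring K) n P" and K: "K \<subseteq> PV ys" "finite ys"
  shows "n \<le> card ys"
proof (rule ccontr)
  assume "\<not> ?thesis"
  then have "card ys < card (Vw ` {0..<n})" by (simp add: card_image inj_on_def)
  moreover have "\<exists>a. a \<in> P (Suc i) - P i" if "i < n" for i
    using P that by (auto simp: prime_chain_def)
  then obtain f where f: "\<And>i. i < n \<Longrightarrow> f i \<in> P (Suc i) - P i" by metis
  define f' where "f' v = (case v of Vw i \<Rightarrow> f i | _ \<Rightarrow> 0)" for v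
  have f': "f' (Vw i) \<in> P (Suc i) - P i" if "i < n" for i using f[OF that] by (simp add: f'_def)
  have "f' v \<in> PV ys" if v: "v \<in> Vw ` {0..<n}" for v
  proof -
    obtain i where i: "v = Vw i" "i < n" using v by auto
    then interpret S: primeideal "P (Suc i)" "sub_ring K" using P by (auto simp: prime_chain_def)
    show ?thesis using f'[OF i(2)] S.Icarr i K by auto
  qed
  ultimately obtain F where F: "F \<in> PV (Vw ` {0..<n})" "F \<noteq> 0" "psub f' F = 0"
    using algebraic_dependence[of "Vw ` {0..<n}" ys f'] K(2) by blast
  interpret S: primeideal "P 0" "sub_ring K" using P by (auto simp: prime_chain_def)
  have "psub f' F \<in> P 0" using F(3) S.zero_closed by simp
  then show False using prime_chain_algebraically_independent[OF P f' _ F(1)] F(2) by blast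
qed

end

section \<open>A criterion for Cohen--Macaulay rings\<close>

subsection \<open>Prime ideals avoiding a multiplicative set\<close>

lemma (in cring) mem_ideal_add_principal:
  assumes "ideal I R" "a \<in> carrier R" "w \<in> I <+>\<^bsub>R\<^esub> PIdl a"
  shows "\<exists>i\<in>I. \<exists>r\<in>carrier R. w = i \<oplus> r \<otimes> a"
  using assms unfolding set_add_def' cgenideal_def by auto

lemma (in cring) ideal_add_principal:
  assumes "ideal I R" "a \<in> carrier R"
  shows "ideal (I <+>\<^bsub>R\<^esub> PIdl a) R" "I \<subseteq> I <+>\<^bsub>R\<^esub> PIdl a" "a \<in> I <+>\<^bsub>R\<^esub> PIdl a"
proof -
  interpret I: ideal I R by fact
  show "ideal (I <+>\<^bsub>R\<^esub> PIdl a) R" using assms cgenideal_ideal add_ideals by blast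
  have z: "\<zero> \<in> PIdl a"
    using assms(2) by (auto simp: cgenideal_def intro!: exI[of _ "\<zero>"])
  have a: "a \<in> PIdl a"
    by (rule cgenideal_self[OF assms(2)])
  show "I \<subseteq> I <+>\<^bsub>R\<^esub> PIdl a"
  proof
    fix i assume "i \<in> I"
    then have "i = i \<oplus> \<zero>" by (simp add: I.Icarr)
    with \<open>i \<in> I\<close> z show "i \<in> I <+>\<^bsub>R\<^esub> PIdl a" unfolding set_add_def' by blast
  qed
  have "a = \<zero> \<oplus> a" using assms(2) by simp
  with a show "a \<in> I <+>\<^bsub>R\<^esub> PIdl a" unfolding set_add_def' using I.zero_closed by blast
qed

text \<open>An ideal \<open>M\<close> maximal among those disjoint from \<open>W\<close> is prime: for \<open>a, b \<notin> M\<close> the ideals \<open>M + (a)\<close> and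
  \<open>M + (b)\<close> meet \<open>W\<close>, and so does their product, which is contained in \<open>M + (a b)\<close>.\<close>

lemma (in cring) exists_prime_avoiding:
  assumes I: "ideal I R" and W: "W \<subseteq> carrier R" "\<one> \<in> W" "\<And>v w. v \<in> W \<Longrightarrow> w \<in> W \<Longrightarrow> v \<otimes> w \<in> W"
    and disj: "I \<inter> W = {}"
  shows "\<exists>P. primeideal P R \<and> I \<subseteq> P \<and> P \<inter> W = {}"
proof -
  define Fam where "Fam = {K. ideal K R \<and> I \<subseteq> K \<and> K \<inter> W = {}}"
  have "\<exists>K\<in>Fam. \<forall>Z\<in>Fam. K \<subseteq> Z \<longrightarrow> Z = K"
  proof (rule subset_Zorn_nonempty)
    show "Fam \<noteq> {}" using I disj by (auto simp: Fam_def)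
  next
    fix C assume C: "C \<noteq> {}" "subset.chain Fam C"
    then have "subset.chain {I. ideal I R} C" by (auto simp: Fam_def subset.chain_def)
    from chain_Union_is_ideal[OF this] C(1) have "ideal (\<Union>C) R" by simp
    moreover have "C \<subseteq> Fam" using C by (auto simp: subset.chain_def)
    ultimately show "\<Union>C \<in> Fam" using C(1) by (auto simp: Fam_def)
  qed
  then obtain M where M: "M \<in> Fam" and max: "\<And>Z. Z \<in> Fam \<Longrightarrow> M \<subseteq> Z \<Longrightarrow> Z = M" by blast
  from M have idM: "ideal M R" and IM: "I \<subseteq> M" and MW: "M \<inter> W = {}" by (auto simp: Fam_def)
  interpret M: ideal M R by fact
  have meet: "\<exists>w\<in>W. \<exists>i\<in>M. \<exists>r\<in>carrier R. w = i \<oplus> r \<otimes> a" if "a \<in> carrier R" "a \<notin> M" for a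
  proof -
    note ia = ideal_add_principal[OF idM that(1)]
    have "M <+>\<^bsub>R\<^esub> PIdl a \<notin> Fam" using max[of "M <+>\<^bsub>R\<^esub> PIdl a"] ia that(2) by auto
    then obtain w where "w \<in> W" "w \<in> M <+>\<^bsub>R\<^esub> PIdl a" using ia IM by (auto simp: Fam_def)
    then show ?thesis using mem_ideal_add_principal[OF idM that(1)] by blast
  qed
  have "primeideal M R"
  proof (rule primeidealI[OF idM is_cring])
    show "carrier R \<noteq> M" using W(1,2) MW by auto
    fix a b assume ab: "a \<in> carrier R" "b \<in> carrier R" "a \<otimes> b \<in> M"
    show "a \<in> M \<or> b \<in> M"
    proof (rule ccontr)
      assume "\<not> ?thesis"
      with meet ab obtain v w i j r s where *: "v \<in> W" "w \<in> W" "i \<in> M" "j \<in> M" "r \<in> carrier R" "s \<in> carrier R"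
        "v = i \<oplus> r \<otimes> a" "w = j \<oplus> s \<otimes> b" by metis
      have c: "i \<in> carrier R" "j \<in> carrier R" using * M.Icarr by auto
      have "v \<otimes> w = i \<otimes> w \<oplus> ((r \<otimes> a) \<otimes> j \<oplus> (r \<otimes> s) \<otimes> (a \<otimes> b))"
        using * c ab by (simp add: l_distr r_distr m_ac a_ac)
      also have "\<dots> \<in> M"
      proof (intro M.a_closed)
        show "i \<otimes> w \<in> M" using M.I_r_closed[OF *(3)] *(2) W(1) by blast
        show "(r \<otimes> a) \<otimes> j \<in> M" using M.I_l_closed[OF *(4)] *(5) ab(1) by simp
        show "(r \<otimes> s) \<otimes> (a \<otimes> b) \<in> M" using M.I_l_closed[OF ab(3)] *(5,6) by simp
      qed
      finally show False using W(3)[OF *(1,2)] MW by blast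
    qed
  qed
  with IM MW show ?thesis by blast
qed

text \<open>A regular sequence inside a prime ideal \<open>P\<close> yields a descending chain of primes below \<open>P\<close>: if
  \<open>x\<close> is regular modulo \<open>J\<close> and both lie in \<open>P\<close>, some prime between \<open>J\<close> and \<open>P\<close> misses \<open>x\<close>. So the
  grade of a local ring is at most its dimension.\<close>

lemma (in cring) regular_sequence_prime_chain:
  assumes reg: "regular_sequence R xs" and P: "primeideal P R" "set xs \<subseteq> P"
  shows "\<exists>Q. prime_chain R (length xs) Q"
proof -
  have xc: "set xs \<subseteq> carrier R" and
    rg: "\<And>i a. i < length xs \<Longrightarrow> a \<in> carrier R \<Longrightarrow> xs ! i \<otimes> a \<in> Idl (set (take i xs)) \<Longrightarrow> a \<in> Idl (set (take i xs))"
    using reg by (auto simp: regular_sequence_def)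
  have "k \<le> length xs \<Longrightarrow> \<exists>Q. prime_chain R k Q \<and> set (take (length xs - k) xs) \<subseteq> Q 0" for k
  proof (induction k)
    case 0
    show ?case by (rule exI[of _ "\<lambda>_. P"]) (use P in \<open>auto simp: prime_chain_def\<close>)
  next
    case (Suc k)
    then obtain Q where Q: "prime_chain R k Q" "set (take (length xs - k) xs) \<subseteq> Q 0" by auto
    define i where "i = length xs - Suc k"
    have i: "i < length xs" "length xs - k = Suc i" using Suc.prems by (auto simp: i_def)
    define x where "x = xs ! i"
    define J where "J = Idl (set (take i xs))"
    have xcar: "x \<in> carrier R" using xc i by (auto simp: x_def)
    have tk: "set (take i xs) \<subseteq> carrier R" using xc by (meson order_trans set_take_subset)
    have J: "ideal J R" unfolding J_def by (rule genideal_ideal[OF tk])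
    have JQ: "J \<subseteq> Q 0" and xQ: "x \<in> Q 0"
    proof -
      have pr: "primeideal (Q 0) R" using Q(1) by (auto simp: prime_chain_def)
      have s: "set (take (Suc i) xs) = insert x (set (take i xs))"
        using i by (simp add: take_Suc_conv_app_nth x_def)
      with Q(2) i show "x \<in> Q 0" by simp
      show "J \<subseteq> Q 0" unfolding J_def
        by (rule genideal_minimal) (use pr Q(2) i s in \<open>auto simp: primeideal.axioms\<close>)
    qed
    interpret Q0: primeideal "Q 0" R using Q(1) by (auto simp: prime_chain_def)
    \<comment> \<open>A prime that avoids these products lies in \<open>Q 0\<close> and does not contain \<open>x\<close>.\<close>
    define W where "W = {s \<otimes> x [^] n | s n. s \<in> carrier R - Q 0 \<and> (n::nat) \<in> UNIV}"
    have "\<exists>P'. primeideal P' R \<and> J \<subseteq> P' \<and> P' \<inter> W = {}"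
    proof (rule exists_prime_avoiding[OF J])
      show "W \<subseteq> carrier R" using xcar by (auto simp: W_def)
      have "\<one> \<notin> Q 0" using Q0.I_notcarr Q0.one_imp_carrier by auto
      then show "\<one> \<in> W" unfolding W_def using xcar by (auto intro!: exI[of _ "\<one>"] exI[of _ "0::nat"])
    next
      fix v w assume "v \<in> W" "w \<in> W"
      then obtain s m t n where *: "s \<in> carrier R - Q 0" "t \<in> carrier R - Q 0"
        "v = s \<otimes> x [^] (m::nat)" "w = t \<otimes> x [^] (n::nat)" by (auto simp: W_def)
      then have "v \<otimes> w = (s \<otimes> t) \<otimes> x [^] (m + n)" using xcar
        by (simp add: nat_pow_mult[symmetric] m_ac)
      moreover have "s \<otimes> t \<in> carrier R - Q 0" using * Q0.I_prime by auto
      ultimately show "v \<otimes> w \<in> W" by (auto simp: W_def)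
    next
      have "s \<otimes> x [^] n \<in> J \<Longrightarrow> s \<in> carrier R \<Longrightarrow> s \<in> J" for s and n :: nat
      proof (induction n arbitrary: s)
        case (Suc n)
        have "s \<otimes> x [^] Suc n = x \<otimes> (s \<otimes> x [^] n)" using xcar Suc.prems by (simp add: m_ac)
        then have "s \<otimes> x [^] n \<in> J" using rg[OF i(1), of "s \<otimes> x [^] n"] Suc.prems xcar by (simp add: x_def J_def)
        then show ?case using Suc by blast
      qed auto
      then show "J \<inter> W = {}" using JQ by (auto simp: W_def)
    qed
    then obtain P' where P': "primeideal P' R" "J \<subseteq> P'" "P' \<inter> W = {}" by blast
    interpret P': primeideal P' R by fact
    have sub: "P' \<subseteq> Q 0"
    proof
      fix a assume a: "a \<in> P'"
      show "a \<in> Q 0"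
      proof (rule ccontr)
        assume "a \<notin> Q 0"
        then have "a \<otimes> x [^] (0::nat) \<in> W" using a P'.Icarr unfolding W_def by blast
        then show False using a P' P'.Icarr by auto
      qed
    qed
    have "\<one> \<otimes> x [^] (1::nat) \<in> W" unfolding W_def
      using Q0.I_notcarr Q0.one_imp_carrier by blast
    then have "x \<notin> P'" using P' xcar by auto
    with sub xQ have "P' \<subset> Q 0" by auto
    define Q' where "Q' = case_nat P' Q"
    have "prime_chain R (Suc k) Q'"
      unfolding prime_chain_def
    proof (intro conjI allI impI)
      fix j assume "j \<le> Suc k"
      then show "primeideal (Q' j) R" using Q(1) P' by (cases j) (auto simp: Q'_def prime_chain_def)
    next
      fix j assume "j < Suc k"
      then show "Q' j \<subset> Q' (Suc j)" using Q(1) \<open>P' \<subset> Q 0\<close> by (cases j) (auto simp: Q'_def prime_chain_def)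
    qed
    moreover have "set (take i xs) \<subseteq> Q' 0" using P' genideal_self[OF tk] by (auto simp: Q'_def J_def)
    ultimately show ?case unfolding i_def by blast
  qed
  from this[of "length xs"] show ?thesis by auto
qed

subsection \<open>Localization\<close>

text \<open>The operations of the localization are unions over all pairs of representatives; this reduces them
  to one pair.\<close>

lemma Union_pairs_const:
  assumes "(a, s) \<in> p" "(b, t) \<in> q"
    and "\<And>a s b t. (a, s) \<in> p \<Longrightarrow> (b, t) \<in> q \<Longrightarrow> H a s b t = Z"
  shows "(\<Union>(a, s)\<in>p. \<Union>(b, t)\<in>q. H a s b t) = Z"
proof -
  have inner: "(\<Union>(b, t)\<in>q. H a s b t) = Z" if "(a, s) \<in> p" for a s
  proof -
    have "(\<Union>(b, t)\<in>q. H a s b t) = (\<Union>y\<in>q. Z)"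
      by (rule SUP_cong[OF refl]) (use assms(3)[OF that] in auto)
    then show ?thesis using assms(2) by auto
  qed
  have "(\<Union>(a, s)\<in>p. \<Union>(b, t)\<in>q. H a s b t) = (\<Union>y\<in>p. Z)"
  proof (rule SUP_cong[OF refl])
    fix y assume "y \<in> p"
    then show "(case y of (a, s) \<Rightarrow> \<Union>(b, t)\<in>q. H a s b t) = Z"
      using inner[of "fst y" "snd y"] by (simp add: case_prod_beta')
  qed
  then show ?thesis using assms(1) by auto
qed

locale mult_set = cring +
  fixes U
  assumes U_carr: "U \<subseteq> carrier R" and U_one: "\<one> \<in> U"
    and U_mult: "\<And>u v. u \<in> U \<Longrightarrow> v \<in> U \<Longrightarrow> u \<otimes> v \<in> U"
begin

abbreviation "L \<equiv> localization R U"
abbreviation "fr \<equiv> loc_frac R U"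

lemma UC [simp]: "u \<in> U \<Longrightarrow> u \<in> carrier R"
  using U_carr by blast

declare U_one [simp] U_mult [simp]

lemma fr_self: "a \<in> carrier R \<Longrightarrow> s \<in> U \<Longrightarrow> (a, s) \<in> fr a s"
  by (auto simp: loc_frac_def)

lemma fr_eq:
  assumes "a \<in> carrier R" "b \<in> carrier R" "s \<in> U" "t \<in> U"
  shows "fr a s = fr b t \<longleftrightarrow> (\<exists>u\<in>U. u \<otimes> (t \<otimes> a) = u \<otimes> (s \<otimes> b))"
proof
  assume "fr a s = fr b t"
  then have "(b, t) \<in> fr a s" using fr_self assms by blast
  then show "\<exists>u\<in>U. u \<otimes> (t \<otimes> a) = u \<otimes> (s \<otimes> b)" by (simp add: loc_frac_def)
next
  have tr: "fr b t \<subseteq> fr a s" if u: "u \<in> U" "u \<otimes> (t \<otimes> a) = u \<otimes> (s \<otimes> b)"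
    and c: "a \<in> carrier R" "b \<in> carrier R" "s \<in> U" "t \<in> U" for a b s t u
  proof
    fix p assume "p \<in> fr b t"
    then obtain d r v where p: "p = (d, r)" "d \<in> carrier R" "r \<in> U" "v \<in> U" "v \<otimes> (r \<otimes> b) = v \<otimes> (t \<otimes> d)"
      by (auto simp: loc_frac_def)
    note cc = p(2-4) u(1) c
    have "(u \<otimes> v \<otimes> t) \<otimes> (r \<otimes> a) = (v \<otimes> r) \<otimes> (u \<otimes> (t \<otimes> a))" using cc by (simp add: m_ac)
    also have "\<dots> = (u \<otimes> s) \<otimes> (v \<otimes> (r \<otimes> b))" unfolding u(2) using cc by (simp add: m_ac)
    also have "\<dots> = (u \<otimes> v \<otimes> t) \<otimes> (s \<otimes> d)" unfolding p(5) using cc by (simp add: m_ac)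
    finally show "p \<in> fr a s" using p u c by (auto simp: loc_frac_def intro!: bexI[of _ "u \<otimes> v \<otimes> t"])
  qed
  assume "\<exists>u\<in>U. u \<otimes> (t \<otimes> a) = u \<otimes> (s \<otimes> b)"
  then obtain u where u: "u \<in> U" "u \<otimes> (t \<otimes> a) = u \<otimes> (s \<otimes> b)" by blast
  show "fr a s = fr b t"
    using tr[OF u] tr[OF u(1) u(2)[symmetric]] assms by blast
qed

lemma fr_eqI:
  assumes "a \<in> carrier R" "b \<in> carrier R" "s \<in> U" "t \<in> U" "t \<otimes> a = s \<otimes> b"
  shows "fr a s = fr b t"
  using assms by (auto simp: fr_eq intro!: bexI[of _ \<one>])

lemma carr_L: "carrier L = {fr a s | a s. a \<in> carrier R \<and> s \<in> U}"
  by (simp add: localization_def)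

lemma L_E:
  assumes "p \<in> carrier L"
  obtains a s where "p = fr a s" "a \<in> carrier R" "s \<in> U"
  using assms by (auto simp: carr_L)

lemma fr_carr [simp]: "a \<in> carrier R \<Longrightarrow> s \<in> U \<Longrightarrow> fr a s \<in> carrier L"
  by (auto simp: carr_L)

lemma fr_mem:
  assumes "(b, t) \<in> fr a s"
  shows "b \<in> carrier R" "t \<in> U" "\<exists>u\<in>U. u \<otimes> (t \<otimes> a) = u \<otimes> (s \<otimes> b)"
  using assms by (auto simp: loc_frac_def)

lemma fr_mult:
  assumes c: "a \<in> carrier R" "b \<in> carrier R" "s \<in> U" "t \<in> U"
  shows "fr a s \<otimes>\<^bsub>L\<^esub> fr b t = fr (a \<otimes> b) (s \<otimes> t)"
proof -
  have *: "fr (a' \<otimes> b') (s' \<otimes> t') = fr (a \<otimes> b) (s \<otimes> t)" if "(a', s') \<in> fr a s" "(b', t') \<in> fr b t" for a' b' s' t'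
  proof -
    note m = fr_mem[OF that(1)] fr_mem[OF that(2)]
    then obtain u v where u: "u \<in> U" "v \<in> U" "u \<otimes> (s' \<otimes> a) = u \<otimes> (s \<otimes> a')" "v \<otimes> (t' \<otimes> b) = v \<otimes> (t \<otimes> b')" by blast
    note cc = c u(1,2) m(1,2,4,5)
    have "(u \<otimes> v) \<otimes> ((s \<otimes> t) \<otimes> (a' \<otimes> b')) = (u \<otimes> (s \<otimes> a')) \<otimes> (v \<otimes> (t \<otimes> b'))" using cc by (simp add: m_ac)
    also have "\<dots> = (u \<otimes> v) \<otimes> ((s' \<otimes> t') \<otimes> (a \<otimes> b))" unfolding u(3,4)[symmetric] using cc by (simp add: m_ac)
    finally show ?thesis using c u m by (subst fr_eq) (auto intro!: bexI[of _ "u \<otimes> v"])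
  qed
  show ?thesis
    unfolding localization_def
    using Union_pairs_const[OF fr_self[OF c(1,3)] fr_self[OF c(2,4)] *] by simp
qed

lemma fr_add:
  assumes c: "a \<in> carrier R" "b \<in> carrier R" "s \<in> U" "t \<in> U"
  shows "fr a s \<oplus>\<^bsub>L\<^esub> fr b t = fr (a \<otimes> t \<oplus> b \<otimes> s) (s \<otimes> t)"
proof -
  have *: "fr (a' \<otimes> t' \<oplus> b' \<otimes> s') (s' \<otimes> t') = fr (a \<otimes> t \<oplus> b \<otimes> s) (s \<otimes> t)" if "(a', s') \<in> fr a s" "(b', t') \<in> fr b t" for a' b' s' t'
  proof -
    note m = fr_mem[OF that(1)] fr_mem[OF that(2)]
    then obtain u v where u: "u \<in> U" "v \<in> U" "u \<otimes> (s' \<otimes> a) = u \<otimes> (s \<otimes> a')" "v \<otimes> (t' \<otimes> b) = v \<otimes> (t \<otimes> b')" by blast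
    note cc = c u(1,2) m(1,2,4,5)
    have "(u \<otimes> v) \<otimes> ((s \<otimes> t) \<otimes> (a' \<otimes> t' \<oplus> b' \<otimes> s'))
        = (v \<otimes> t \<otimes> t') \<otimes> (u \<otimes> (s \<otimes> a')) \<oplus> (u \<otimes> s \<otimes> s') \<otimes> (v \<otimes> (t \<otimes> b'))" using cc by (simp add: m_ac r_distr)
    also have "\<dots> = (u \<otimes> v) \<otimes> ((s' \<otimes> t') \<otimes> (a \<otimes> t \<oplus> b \<otimes> s))" unfolding u(3,4)[symmetric] using cc by (simp add: m_ac r_distr)
    finally show ?thesis using c u m by (subst fr_eq) (auto intro!: bexI[of _ "u \<otimes> v"])
  qed
  show ?thesis
    unfolding localization_def
    using Union_pairs_const[OF fr_self[OF c(1,3)] fr_self[OF c(2,4)] *] by simp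
qed

lemma L_one: "\<one>\<^bsub>L\<^esub> = fr \<one> \<one>" and L_zero: "\<zero>\<^bsub>L\<^esub> = fr \<zero> \<one>"
  by (simp_all add: localization_def)

lemma L_cring: "cring L"
proof (rule cringI)
  show "abelian_group L"
  proof (rule abelian_groupI)
    fix x y assume "x \<in> carrier L" "y \<in> carrier L"
    then show "x \<oplus>\<^bsub>L\<^esub> y \<in> carrier L" by (elim L_E) (simp add: fr_add)
  next
    show "\<zero>\<^bsub>L\<^esub> \<in> carrier L" by (simp add: L_zero)
  next
    fix x y z assume "x \<in> carrier L" "y \<in> carrier L" "z \<in> carrier L"
    then show "x \<oplus>\<^bsub>L\<^esub> y \<oplus>\<^bsub>L\<^esub> z = x \<oplus>\<^bsub>L\<^esub> (y \<oplus>\<^bsub>L\<^esub> z)"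
      by (elim L_E) (simp add: fr_add, rule fr_eqI, auto simp: r_distr l_distr m_ac a_ac)
  next
    fix x y assume "x \<in> carrier L" "y \<in> carrier L"
    then show "x \<oplus>\<^bsub>L\<^esub> y = y \<oplus>\<^bsub>L\<^esub> x" by (elim L_E) (simp add: fr_add m_ac a_ac)
  next
    fix x assume "x \<in> carrier L"
    then show "\<zero>\<^bsub>L\<^esub> \<oplus>\<^bsub>L\<^esub> x = x" by (elim L_E) (simp add: fr_add L_zero)
  next
    fix x assume "x \<in> carrier L"
    then obtain a s where x: "x = fr a s" "a \<in> carrier R" "s \<in> U" by (rule L_E)
    have "fr (\<ominus> a) s \<oplus>\<^bsub>L\<^esub> x = \<zero>\<^bsub>L\<^esub>"
      using x by (simp add: fr_add L_zero, intro fr_eqI) (auto simp: l_minus l_neg)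
    then show "\<exists>y\<in>carrier L. y \<oplus>\<^bsub>L\<^esub> x = \<zero>\<^bsub>L\<^esub>" using x by (intro bexI[of _ "fr (\<ominus> a) s"]) auto
  qed
  show "comm_monoid L"
  proof (rule comm_monoidI)
    fix x y assume "x \<in> carrier L" "y \<in> carrier L"
    then show "x \<otimes>\<^bsub>L\<^esub> y \<in> carrier L" by (elim L_E) (simp add: fr_mult)
  next
    show "\<one>\<^bsub>L\<^esub> \<in> carrier L" by (simp add: L_one)
  next
    fix x y z assume "x \<in> carrier L" "y \<in> carrier L" "z \<in> carrier L"
    then show "x \<otimes>\<^bsub>L\<^esub> y \<otimes>\<^bsub>L\<^esub> z = x \<otimes>\<^bsub>L\<^esub> (y \<otimes>\<^bsub>L\<^esub> z)" by (elim L_E) (simp add: fr_mult m_ac)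
  next
    fix x assume "x \<in> carrier L"
    then show "\<one>\<^bsub>L\<^esub> \<otimes>\<^bsub>L\<^esub> x = x" by (elim L_E) (simp add: fr_mult L_one)
  next
    fix x y assume "x \<in> carrier L" "y \<in> carrier L"
    then show "x \<otimes>\<^bsub>L\<^esub> y = y \<otimes>\<^bsub>L\<^esub> x" by (elim L_E) (simp add: fr_mult m_ac)
  qed
  fix x y z assume "x \<in> carrier L" "y \<in> carrier L" "z \<in> carrier L"
  then show "(x \<oplus>\<^bsub>L\<^esub> y) \<otimes>\<^bsub>L\<^esub> z = x \<otimes>\<^bsub>L\<^esub> z \<oplus>\<^bsub>L\<^esub> y \<otimes>\<^bsub>L\<^esub> z"
    by (elim L_E) (simp add: fr_mult fr_add, rule fr_eqI, auto simp: r_distr l_distr m_ac a_ac)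
qed

lemma fr_ring_hom: "ring_hom_ring R L (\<lambda>a. fr a \<one>)"
proof -
  have "(\<lambda>a. fr a \<one>) \<in> Ring.ring_hom R L"
    by (rule ring_hom_memI) (auto simp: fr_mult fr_add L_one)
  then show ?thesis
    using cring.axioms(1)[OF L_cring] ring_axioms unfolding ring_hom_ring_def ring_hom_ring_axioms_def by blast
qed

text \<open>Extension and contraction of ideals along \<open>R \<rightarrow> L\<close>.\<close>

definition ext :: "'a set \<Rightarrow> ('a \<times> 'a) set set" where
  "ext I = {fr a s | a s. a \<in> I \<and> s \<in> U}"

lemma ext_I: "a \<in> I \<Longrightarrow> s \<in> U \<Longrightarrow> fr a s \<in> ext I"
  unfolding ext_def by blast

lemma ext_ideal:
  assumes "ideal I R"
  shows "ideal (ext I) L"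
proof -
  interpret I: ideal I R by fact
  interpret L: cring L by (rule L_cring)
  have neg: "\<ominus>\<^bsub>L\<^esub> fr a s = fr (\<ominus> a) s" if "a \<in> carrier R" "s \<in> U" for a s
  proof -
    have "fr (\<ominus> a) s \<oplus>\<^bsub>L\<^esub> fr a s = \<zero>\<^bsub>L\<^esub>"
      using that by (simp add: fr_add L_zero, intro fr_eqI) (auto simp: l_minus l_neg)
    then show ?thesis using that L.minus_equality by simp
  qed
  show ?thesis
  proof (rule idealI)
    show "ring L" by (rule L.ring_axioms)
    show "subgroup (ext I) (add_monoid L)"
    proof
      show "ext I \<subseteq> carrier (add_monoid L)" by (auto simp: ext_def I.Icarr)
      show "\<one>\<^bsub>add_monoid L\<^esub> \<in> ext I"
        using ext_I[OF I.zero_closed U_one] by (simp add: L_zero)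
    next
      fix x y assume "x \<in> ext I" "y \<in> ext I"
      then obtain a s b t where *: "a \<in> I" "b \<in> I" "s \<in> U" "t \<in> U" "x = fr a s" "y = fr b t" by (auto simp: ext_def)
      then have "x \<oplus>\<^bsub>L\<^esub> y = fr (a \<otimes> t \<oplus> b \<otimes> s) (s \<otimes> t)" by (simp add: fr_add I.Icarr)
      moreover have "a \<otimes> t \<oplus> b \<otimes> s \<in> I" using * by (intro I.a_closed I.I_r_closed) auto
      ultimately show "x \<otimes>\<^bsub>add_monoid L\<^esub> y \<in> ext I" using * by (simp add: ext_I)
    next
      fix x assume "x \<in> ext I"
      then obtain a s where *: "a \<in> I" "s \<in> U" "x = fr a s" by (auto simp: ext_def)
      then have "\<ominus>\<^bsub>L\<^esub> x = fr (\<ominus> a) s" by (simp add: neg I.Icarr)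
      then show "inv\<^bsub>add_monoid L\<^esub> x \<in> ext I" using * ext_I[OF I.a_inv_closed, of a s] by (simp add: a_inv_def)
    qed
    have m: "y \<otimes>\<^bsub>L\<^esub> x \<in> ext I" if xy: "x \<in> ext I" "y \<in> carrier L" for x y
    proof -
      obtain a s b t where *: "a \<in> I" "b \<in> carrier R" "s \<in> U" "t \<in> U" "x = fr a s" "y = fr b t"
        using xy by (auto simp: ext_def carr_L)
      then have "y \<otimes>\<^bsub>L\<^esub> x = fr (b \<otimes> a) (t \<otimes> s)" by (simp add: fr_mult I.Icarr)
      then show ?thesis using * I.I_l_closed U_mult unfolding ext_def by blast
    qed
    fix x y assume xy: "x \<in> ext I" "y \<in> carrier L"
    show "y \<otimes>\<^bsub>L\<^esub> x \<in> ext I" using m xy .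
    have "x \<in> carrier L" using xy by (auto simp: ext_def I.Icarr)
    then show "x \<otimes>\<^bsub>L\<^esub> y \<in> ext I" using m[OF xy] L.m_comm[of x y] xy(2) by simp
  qed
qed

definition ctr :: "('a \<times> 'a) set set \<Rightarrow> 'a set" where
  "ctr I = {a \<in> carrier R. fr a \<one> \<in> I}"

lemma ctr_ideal: "ideal I L \<Longrightarrow> ideal (ctr I) R"
  unfolding ctr_def by (rule ring_hom_ring.ideal_vimage[OF fr_ring_hom])

lemma fr_mem_iff:
  assumes "ideal I L" "a \<in> carrier R" "s \<in> U"
  shows "fr a s \<in> I \<longleftrightarrow> a \<in> ctr I"
proof -
  interpret I: ideal I L by fact
  have "fr s \<one> \<otimes>\<^bsub>L\<^esub> fr a s = fr a \<one>"
    using assms by (simp add: fr_mult, intro fr_eqI) (auto simp: m_ac)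
  moreover have "fr \<one> s \<otimes>\<^bsub>L\<^esub> fr a \<one> = fr a s"
    using assms by (simp add: fr_mult)
  ultimately show ?thesis using assms I.I_l_closed[of "fr a s" "fr s \<one>"] I.I_l_closed[of "fr a \<one>" "fr \<one> s"]
    by (auto simp: ctr_def)
qed

lemma ctr_subset_iff: "ideal I L \<Longrightarrow> ideal J L \<Longrightarrow> ctr I \<subseteq> ctr J \<longleftrightarrow> I \<subseteq> J"
proof
  assume *: "ideal I L" "ideal J L" "ctr I \<subseteq> ctr J"
  show "I \<subseteq> J"
  proof
    fix x assume x: "x \<in> I"
    then have "x \<in> carrier L" using *(1) ideal.Icarr by metis
    then show "x \<in> J" using x * fr_mem_iff by (elim L_E) blast
  qed
qed (auto simp: ctr_def)

lemma Idl_image: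
  assumes "F \<subseteq> carrier R"
  shows "Idl\<^bsub>L\<^esub> ((\<lambda>a. fr a \<one>) ` F) = ext (Idl F)"
proof
  interpret L: cring L by (rule L_cring)
  have sub: "(\<lambda>a. fr a \<one>) ` F \<subseteq> carrier L" using assms by auto
  have "F \<subseteq> Idl F" using genideal_self assms by blast
  then have "(\<lambda>a. fr a \<one>) ` F \<subseteq> ext (Idl F)" by (auto intro: ext_I)
  then show "Idl\<^bsub>L\<^esub> ((\<lambda>a. fr a \<one>) ` F) \<subseteq> ext (Idl F)"
    by (intro L.genideal_minimal ext_ideal genideal_ideal assms)
  let ?I = "Idl\<^bsub>L\<^esub> ((\<lambda>a. fr a \<one>) ` F)"
  have I: "ideal ?I L" using sub by (rule L.genideal_ideal)
  have "F \<subseteq> ctr ?I" using L.genideal_self[OF sub] assms by (auto simp: ctr_def)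
  then have s: "Idl F \<subseteq> ctr ?I" by (intro genideal_minimal ctr_ideal I)
  show "ext (Idl F) \<subseteq> ?I"
  proof
    fix x assume "x \<in> ext (Idl F)"
    then obtain a t where a: "a \<in> Idl F" "t \<in> U" "x = fr a t" by (auto simp: ext_def)
    then have "a \<in> ctr ?I" using s by blast
    then show "x \<in> ?I" using a fr_mem_iff[OF I, of a t] by (auto simp: ctr_def)
  qed
qed

text \<open>An ideal of the localization is the extension of its contraction.\<close>

lemma L_noetherian:
  assumes "noetherian_ring R"
  shows "noetherian_ring L"
proof -
  interpret L: cring L by (rule L_cring)
  show ?thesis
  proof (rule L.noetherian_ringI)
    fix I assume I: "ideal I L"
    from noetherian_ring.finetely_gen[OF assms ctr_ideal[OF I]]
    obtain F where F: "F \<subseteq> carrier R" "finite F" "ctr I = Idl F" by blast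
    have eq: "I = ext (ctr I)"
    proof (rule Set.set_eqI)
      fix x
      have *: "fr a s \<in> I \<longleftrightarrow> a \<in> ctr I" if "a \<in> carrier R" "s \<in> U" for a s
        using fr_mem_iff[OF I that] .
      show "x \<in> I \<longleftrightarrow> x \<in> ext (ctr I)"
      proof
        assume x: "x \<in> I"
        then have "x \<in> carrier L" using ideal.Icarr[OF I] by blast
        then obtain a s where "x = fr a s" "a \<in> carrier R" "s \<in> U" by (rule L_E)
        then show "x \<in> ext (ctr I)" using x * by (auto simp: ext_def)
      next
        assume "x \<in> ext (ctr I)"
        then obtain a s where "x = fr a s" "a \<in> ctr I" "s \<in> U" by (auto simp: ext_def)
        then show "x \<in> I" using * by (auto simp: ctr_def)
      qed
    qed
    have "I = Idl\<^bsub>L\<^esub> ((\<lambda>a. fr a \<one>) ` F)" using eq Idl_image[OF F(1)] F(3) by simp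
    then show "\<exists>A\<subseteq>carrier L. finite A \<and> I = Idl\<^bsub>L\<^esub> A"
      using F by (intro exI[of _ "(\<lambda>a. fr a \<one>) ` F"]) auto
  qed
qed

lemma prime_chain_ctr:
  assumes "prime_chain L n P"
  shows "prime_chain R n (\<lambda>i. ctr (P i))"
  unfolding prime_chain_def
proof (intro conjI allI impI)
  fix i assume "i \<le> n"
  then have "primeideal (P i) L" using assms by (auto simp: prime_chain_def)
  then show "primeideal (ctr (P i)) R"
    unfolding ctr_def by (rule ring_hom_ring.primeideal_vimage[OF fr_ring_hom is_cring])
next
  fix i assume "i < n"
  then have "ideal (P i) L" "ideal (P (Suc i)) L" "P i \<subset> P (Suc i)"
    using assms by (auto simp: prime_chain_def primeideal.axioms)
  then show "ctr (P i) \<subset> ctr (P (Suc i))"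
    using ctr_subset_iff by (simp add: less_le_not_le)
qed

end

lemma (in cring) mult_set_prime_compl:
  assumes "primeideal M R"
  shows "mult_set R (carrier R - M)"
proof -
  interpret M: primeideal M R by fact
  show ?thesis
    by unfold_locales (use M.I_notcarr M.one_imp_carrier M.I_prime in auto)
qed

text \<open>An ideal of the localization that is not contained in the extension of \<open>M\<close> contains a fraction with
  numerator outside \<open>M\<close>, which is a unit.\<close>

lemma (in cring) local_ring_at_maximal:
  assumes M: "maximalideal M R"
  defines "U \<equiv> carrier R - M"
  shows "maximalideal (mult_set.ext R U M) (localization R U)"
    and "\<And>N. maximalideal N (localization R U) \<Longrightarrow> N = mult_set.ext R U M"
proof -
  interpret M: maximalideal M R by fact
  interpret mult_set R U unfolding U_def
    by (rule mult_set_prime_compl) (rule maximalideal_prime[OF M])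
  interpret L: cring L by (rule L_cring)
  have E: "ideal (ext M) L" by (rule ext_ideal) (rule M.is_ideal)
  have small: "I \<subseteq> ext M" if I: "ideal I L" "I \<noteq> carrier L" for I
  proof
    interpret I: ideal I L by fact
    fix x assume x: "x \<in> I"
    then obtain a s where a: "x = fr a s" "a \<in> carrier R" "s \<in> U" using I.Icarr L_E by metis
    show "x \<in> ext M"
    proof (cases "a \<in> M")
      case True then show ?thesis using a by (auto simp: ext_def)
    next
      case False
      then have "a \<in> U" using a by (simp add: U_def)
      then have "fr s a \<otimes>\<^bsub>L\<^esub> x = \<one>\<^bsub>L\<^esub>" using a by (simp add: fr_mult L_one, intro fr_eqI) (auto simp: m_comm)
      moreover have "fr s a \<otimes>\<^bsub>L\<^esub> x \<in> I" using I.I_l_closed[OF x] a \<open>a \<in> U\<close> by simp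
      ultimately show ?thesis using I.one_imp_carrier that by auto
    qed
  qed
  have proper: "ext M \<noteq> carrier L"
  proof
    assume "ext M = carrier L"
    then have "fr \<one> \<one> \<in> ext M" by simp
    then obtain a s where a: "fr \<one> \<one> = fr a s" "a \<in> M" "s \<in> U" by (auto simp: ext_def)
    then obtain u where u: "u \<in> U" "u \<otimes> (s \<otimes> \<one>) = u \<otimes> (\<one> \<otimes> a)" using fr_eq[of \<one> a \<one> s] M.Icarr by auto
    then have "u \<otimes> s = u \<otimes> a" using a M.Icarr by simp
    moreover have "u \<otimes> a \<in> M" using a u by (intro M.I_l_closed) auto
    moreover have "u \<otimes> s \<in> U" using a(3) u(1) by (rule U_mult[rotated])
    ultimately show False by (simp add: U_def)
  qed
  show "maximalideal (ext M) L"
  proof (rule maximalidealI[OF E])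
    show "carrier L \<noteq> ext M" using proper by simp
    fix J assume "ideal J L" "ext M \<subseteq> J" "J \<subseteq> carrier L"
    then show "J = ext M \<or> J = carrier L" using small by blast
  qed
  fix N assume N: "maximalideal N L"
  interpret N: maximalideal N L by fact
  have "N \<subseteq> ext M" using small N.is_ideal N.I_notcarr by auto
  then show "N = ext M" using N.I_maximal[OF E] proper ideal.Icarr[OF E] by blast
qed

text \<open>If \<open>x (a/s)\<close> lies in the extension of an ideal, then \<open>x u a\<close> lies in the ideal for some \<open>u\<close> outside \<open>M\<close>;
  regularity gives \<open>u a\<close>, and \<open>u\<close> becomes invertible.\<close>

lemma (in cring) regular_sequence_local:
  assumes M: "maximalideal M R" and reg: "regular_sequence R xs" and xs: "set xs \<subseteq> M"
  defines "U \<equiv> carrier R - M"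
  shows "regular_sequence (localization R U) (map (\<lambda>a. loc_frac R U a \<one>) xs)"
    and "set (map (\<lambda>a. loc_frac R U a \<one>) xs) \<subseteq> mult_set.ext R U M"
proof -
  interpret M: maximalideal M R by fact
  interpret mult_set R U unfolding U_def
    by (rule mult_set_prime_compl) (rule maximalideal_prime[OF M])
  interpret L: cring L by (rule L_cring)
  have xc: "set xs \<subseteq> carrier R" and
    rg: "\<And>i a. i < length xs \<Longrightarrow> a \<in> carrier R \<Longrightarrow> xs ! i \<otimes> a \<in> Idl (set (take i xs)) \<Longrightarrow> a \<in> Idl (set (take i xs))"
    using reg by (auto simp: regular_sequence_def)
  show s: "set (map (\<lambda>a. fr a \<one>) xs) \<subseteq> ext M" using xs by (auto intro: ext_I)
  show "regular_sequence L (map (\<lambda>a. fr a \<one>) xs)"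
    unfolding regular_sequence_def
  proof (intro conjI allI impI ballI)
    show "set (map (\<lambda>a. fr a \<one>) xs) \<subseteq> carrier L" using xc by auto
    have "Idl\<^bsub>L\<^esub> (set (map (\<lambda>a. fr a \<one>) xs)) \<subseteq> ext M"
      by (rule L.genideal_minimal) (use s ext_ideal M.is_ideal in auto)
    moreover have "ext M \<noteq> carrier L"
      using local_ring_at_maximal(1)[OF M] maximalideal.I_notcarr unfolding U_def by metis
    ultimately show "Idl\<^bsub>L\<^esub> (set (map (\<lambda>a. fr a \<one>) xs)) \<noteq> carrier L"
      using ideal.Icarr[OF ext_ideal[OF M.is_ideal]] by blast
  next
    fix i p assume i: "i < length (map (\<lambda>a. fr a \<one>) xs)" and p: "p \<in> carrier L"
      and mem: "map (\<lambda>a. fr a \<one>) xs ! i \<otimes>\<^bsub>L\<^esub> p \<in> Idl\<^bsub>L\<^esub> (set (take i (map (\<lambda>a. fr a \<one>) xs)))"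
    have tk: "set (take i xs) \<subseteq> carrier R" using xc by (meson order_trans set_take_subset)
    let ?I = "Idl (set (take i xs))"
    interpret I: ideal ?I R by (rule genideal_ideal[OF tk])
    have eq: "Idl\<^bsub>L\<^esub> (set (take i (map (\<lambda>a. fr a \<one>) xs))) = ext ?I"
      using Idl_image[OF tk] by (simp add: take_map)
    obtain a s where a: "p = fr a s" "a \<in> carrier R" "s \<in> U" using p by (rule L_E)
    have xi: "xs ! i \<in> carrier R" using xc i by auto
    have "fr (xs ! i \<otimes> a) s \<in> ext ?I" using mem eq i a xi by (simp add: fr_mult)
    then obtain b t where b: "fr (xs ! i \<otimes> a) s = fr b t" "b \<in> ?I" "t \<in> U" by (auto simp: ext_def)
    then obtain u where u: "u \<in> U" "u \<otimes> (t \<otimes> (xs ! i \<otimes> a)) = u \<otimes> (s \<otimes> b)"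
      using fr_eq[of "xs ! i \<otimes> a" b s t] a xi I.Icarr by auto
    have "xs ! i \<otimes> ((u \<otimes> t) \<otimes> a) = u \<otimes> (t \<otimes> (xs ! i \<otimes> a))" using u b a xi by (simp add: m_ac)
    also have "\<dots> \<in> ?I" unfolding u(2) using b u a by (intro I.I_l_closed) auto
    finally have "(u \<otimes> t) \<otimes> a \<in> ?I" using rg i a u b by simp
    moreover have "p = fr ((u \<otimes> t) \<otimes> a) ((u \<otimes> t) \<otimes> s)"
      unfolding a(1) using a u b by (intro fr_eqI) (auto simp: m_ac)
    ultimately show "p \<in> Idl\<^bsub>L\<^esub> (set (take i (map (\<lambda>a. fr a \<one>) xs)))"
      unfolding eq using ext_I[of "(u \<otimes> t) \<otimes> a" ?I "(u \<otimes> t) \<otimes> s"] u(1) b(3) a(3) by simp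
  qed
qed

text \<open>At a maximal ideal \<open>M\<close>, the regular sequence bounds the grade of the local ring from below by
  \<open>d\<close>, the chain condition bounds its dimension from above by \<open>d\<close>, and the grade never exceeds the
  dimension.\<close>

theorem CM_ringI:
  assumes "cring A" "noetherian_ring A"
    and reg: "\<And>M. maximalideal M A \<Longrightarrow> \<exists>xs. length xs = d \<and> set xs \<subseteq> M \<and> regular_sequence A xs"
    and dim: "\<And>n P. prime_chain A n P \<Longrightarrow> n \<le> d"
  shows "CM_ring A"
  unfolding CM_ring_def
proof (intro conjI allI impI assms(1,2))
  interpret A: cring A by fact
  fix M assume M: "maximalideal M A"
  interpret M: maximalideal M A by fact
  define U where "U = carrier A - M"
  interpret mult_set A U unfolding U_def
    by (rule A.mult_set_prime_compl) (rule A.maximalideal_prime[OF M])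
  note mx = A.local_ring_at_maximal[OF M, folded U_def]
  interpret L: cring L by (rule L_cring)
  have kd: "krull_dim L \<le> enat d" unfolding krull_dim_def
  proof (rule Sup_least, clarify)
    fix n P assume "prime_chain L n P"
    then show "enat n \<le> enat d" using dim[OF prime_chain_ctr] by simp
  qed
  obtain xs where xs: "length xs = d" "set xs \<subseteq> M" "regular_sequence A xs" using reg[OF M] by blast
  have "regular_sequence L (map (\<lambda>a. fr a \<one>\<^bsub>A\<^esub>) xs)" "set (map (\<lambda>a. fr a \<one>\<^bsub>A\<^esub>) xs) \<subseteq> ext M"
    using A.regular_sequence_local[OF M xs(3,2)] by (auto simp: U_def)
  then have ge: "enat d \<le> grade L (ext M)"
    unfolding grade_def using xs(1) by (intro Sup_upper) (auto intro!: exI[of _ "map (\<lambda>a. fr a \<one>\<^bsub>A\<^esub>) xs"])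
  have le: "grade L (ext M) \<le> krull_dim L" unfolding grade_def
  proof (rule Sup_least, clarify)
    fix ys assume "regular_sequence L ys" "set ys \<subseteq> ext M"
    from L.regular_sequence_prime_chain[OF this(1) L.maximalideal_prime[OF mx(1)] this(2)]
    show "enat (length ys) \<le> krull_dim L" unfolding krull_dim_def by (intro Sup_upper) auto
  qed
  have "grade L (ext M) = krull_dim L" using kd ge le by (meson order.trans antisym)
  then show "CM_local_ring (local_ring_at A M)"
    unfolding CM_local_ring_def local_ring_at_def U_def[symmetric]
    using L_cring L_noetherian[OF assms(2)] mx by metis
qed

section \<open>Hilbert's basis theorem\<close>

lemma subalgebra_PV: "subalgebra (PV vs :: 'k::field pol set)"
  by unfold_locales (auto intro: PV_closed)

lemma (in subalgebra) Idl_finite_family: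
  assumes f: "\<And>i. i \<in> A \<Longrightarrow> f i \<in> K"
  shows "Idl\<^bsub>sub_ring K\<^esub> (f ` A) = {\<Sum>i\<in>B. r i * f i | r B. finite B \<and> B \<subseteq> A \<and> (\<forall>i\<in>B. r i \<in> K)}" (is "_ = ?S")
proof
  have fA: "f ` A \<subseteq> carrier (sub_ring K)" using f by auto
  interpret I: ideal "Idl\<^bsub>sub_ring K\<^esub> (f ` A)" "sub_ring K" by (rule genideal_ideal[OF fA])
  show "?S \<subseteq> Idl\<^bsub>sub_ring K\<^esub> (f ` A)"
  proof clarify
    fix r B assume B: "finite B" "B \<subseteq> A" "\<forall>i\<in>B. r i \<in> K"
    then show "(\<Sum>i\<in>B. r i * f i) \<in> Idl\<^bsub>sub_ring K\<^esub> (f ` A)"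
    proof (induction B)
      case (insert i B)
      have "f i \<in> Idl\<^bsub>sub_ring K\<^esub> (f ` A)" using genideal_self[OF fA] insert by auto
      then have "r i * f i \<in> Idl\<^bsub>sub_ring K\<^esub> (f ` A)" using I.I_l_closed[of "f i" "r i"] insert by simp
      then show ?case using I.a_closed insert by auto
    qed (use I.zero_closed in simp)
  qed
  have "ideal ?S (sub_ring K)"
  proof (rule idealI[OF ring_axioms])
    show "subgroup ?S (add_monoid (sub_ring K))"
    proof
      show "?S \<subseteq> carrier (add_monoid (sub_ring K))" using f by (auto intro!: K_sum)
      show "\<one>\<^bsub>add_monoid (sub_ring K)\<^esub> \<in> ?S" by (auto intro!: exI[of _ "{}"])
    next
      fix x y assume "x \<in> ?S" "y \<in> ?S"
      then obtain r B s C where B: "finite B" "B \<subseteq> A" "\<forall>i\<in>B. r i \<in> K" "x = (\<Sum>i\<in>B. r i * f i)"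
        and C: "finite C" "C \<subseteq> A" "\<forall>i\<in>C. s i \<in> K" "y = (\<Sum>i\<in>C. s i * f i)" by auto
      define r' where "r' i = (if i \<in> B then r i else 0) + (if i \<in> C then s i else 0)" for i
      have x: "x = (\<Sum>i\<in>B \<union> C. (if i \<in> B then r i else 0) * f i)"
        unfolding B(4) using B(1) C(1) by (intro sum.mono_neutral_cong_left) auto
      have y: "y = (\<Sum>i\<in>B \<union> C. (if i \<in> C then s i else 0) * f i)"
        unfolding C(4) using B(1) C(1) by (intro sum.mono_neutral_cong_left) auto
      have "x + y = (\<Sum>i\<in>B \<union> C. r' i * f i)"
        unfolding x y by (simp add: r'_def algebra_simps sum.distrib)
      moreover have "\<forall>i\<in>B \<union> C. r' i \<in> K" using B C by (auto simp: r'_def)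
      ultimately show "x \<otimes>\<^bsub>add_monoid (sub_ring K)\<^esub> y \<in> ?S" using B(1,2) C(1,2)
        by (auto intro!: exI[of _ r'] exI[of _ "B \<union> C"])
    next
      fix x assume x: "x \<in> ?S"
      then obtain r B where B: "finite B" "B \<subseteq> A" "\<forall>i\<in>B. r i \<in> K" "x = (\<Sum>i\<in>B. r i * f i)" by auto
      have "x \<in> K" using B f by (auto intro!: K_sum)
      then have "\<ominus>\<^bsub>sub_ring K\<^esub> x = - x" by (intro minus_equality) auto
      moreover have "- x = (\<Sum>i\<in>B. - r i * f i)" using B by (simp add: sum_negf)
      moreover have "\<forall>i\<in>B. - r i \<in> K" using B by auto
      ultimately show "inv\<^bsub>add_monoid (sub_ring K)\<^esub> x \<in> ?S" unfolding a_inv_def[symmetric] using B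
        by (auto intro!: exI[of _ "\<lambda>i. - r i"] exI[of _ B])
    qed
    fix x q assume "x \<in> ?S" and q: "q \<in> carrier (sub_ring K)"
    then obtain r B where B: "finite B" "B \<subseteq> A" "\<forall>i\<in>B. r i \<in> K" "x = (\<Sum>i\<in>B. r i * f i)" by auto
    then have "q * x = (\<Sum>i\<in>B. (q * r i) * f i)" "\<forall>i\<in>B. q * r i \<in> K" using q by (auto simp: sum_distrib_left mult.assoc)
    then have "q * x \<in> ?S" using B(1,2) by (auto intro!: exI[of _ "\<lambda>i. q * r i"] exI[of _ B])
    then show "q \<otimes>\<^bsub>sub_ring K\<^esub> x \<in> ?S" "x \<otimes>\<^bsub>sub_ring K\<^esub> q \<in> ?S" by (simp_all add: mult.commute)
  qed
  moreover have "f ` A \<subseteq> ?S"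
  proof
    fix p assume "p \<in> f ` A"
    then obtain i where "i \<in> A" "p = f i" by auto
    then show "p \<in> ?S" by (auto intro!: exI[of _ "\<lambda>_. 1"] exI[of _ "{i}"])
  qed
  ultimately show "Idl\<^bsub>sub_ring K\<^esub> (f ` A) \<subseteq> ?S" by (rule genideal_minimal)
qed

lemma PV_empty:
  assumes "p \<in> PV {}"
  shows "\<exists>c. p = Cst c"
proof -
  have k: "Poly_Mapping.keys p \<subseteq> {0}" using assms by (auto simp: PV_iff)
  have "p = Cst (Poly_Mapping.lookup p 0)"
  proof (rule poly_mapping_eqI)
    fix m show "Poly_Mapping.lookup p m = Poly_Mapping.lookup (Cst (Poly_Mapping.lookup p 0)) m"
      using k by (cases "m = 0") (auto simp: Cst_def lookup_single not_in_keys_iff_lookup_eq_zero[symmetric])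
  qed
  then show ?thesis ..
qed

lemma noetherian_PV_empty: "noetherian_ring (pol_ring {} :: 'k::field pol ring)"
proof -
  interpret subalgebra "PV {} :: 'k pol set" by (rule subalgebra_PV)
  have "noetherian_ring (sub_ring (PV {} :: 'k pol set))"
  proof (rule noetherian_ringI)
    fix I :: "'k pol set" assume "ideal I (sub_ring (PV {}))"
    then interpret I: ideal I "sub_ring (PV {})" .
    show "\<exists>A\<subseteq>carrier (sub_ring (PV {})). finite A \<and> I = Idl\<^bsub>sub_ring (PV {})\<^esub> A"
    proof (cases "I = {0}")
      case True
      then show ?thesis using genideal_zero by (intro exI[of _ "{0}"]) auto
    next
      case False
      then obtain p where p: "p \<in> I" "p \<noteq> 0" using I.zero_closed unfolding sub_ring_simps by blast
      then obtain c where c: "p = Cst c" "c \<noteq> 0" using PV_empty[of p] I.Icarr[of p] by auto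
      have "Cst (inverse c) * p \<in> I" using I.I_l_closed[OF p(1), of "Cst (inverse c)"] by simp
      moreover have "Cst (inverse c) * p = 1" using c by (simp flip: Cst.hom_mult)
      ultimately have "I = carrier (sub_ring (PV {}))" using I.one_imp_carrier by simp
      then show ?thesis using genideal_one by (intro exI[of _ "{1}"]) auto
    qed
  qed
  then show ?thesis by (subst pol_ring_eq_sub_ring)
qed

text \<open>Choose a sequence in a non-finitely generated ideal, each member of least degree in \<open>v\<close> outside
  the ideal of its predecessors. The leading coefficient of some member is a combination of the
  earlier ones; subtracting the corresponding combination lowers its degree.\<close>

lemma noetherian_PV_insert:
  assumes noeth: "noetherian_ring (pol_ring vs :: 'k::field pol ring)" and v: "v \<notin> vs"
  shows "noetherian_ring (pol_ring (insert v vs) :: 'k pol ring)"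
proof -
  let ?A = "sub_ring (PV (insert v vs)) :: 'k pol ring"
  interpret A: subalgebra "PV (insert v vs) :: 'k pol set" by (rule subalgebra_PV)
  interpret C: subalgebra "PV vs :: 'k pol set" by (rule subalgebra_PV)
  interpret Cn: noetherian_ring "sub_ring (PV vs) :: 'k pol ring" by (subst pol_ring_eq_sub_ring [symmetric]) (rule noeth)
  have "noetherian_ring ?A"
  proof (rule A.noetherian_ringI)
    fix I assume I: "ideal I ?A"
    interpret I: ideal I ?A by fact
    show "\<exists>F\<subseteq>carrier ?A. finite F \<and> I = Idl\<^bsub>?A\<^esub> F"
    proof (rule ccontr)
      assume neg: "\<not> ?thesis"
      define J where "J F = Idl\<^bsub>?A\<^esub> F" for F
      define deg where "deg p = degree (UP v p)" for p :: "'k pol"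
      have "\<exists>p :: nat \<Rightarrow> 'k pol. \<forall>k. p k \<in> I - J (p ` {..<k}) \<and> (\<forall>q\<in>I - J (p ` {..<k}). deg (p k) \<le> deg q)"
      proof (rule dependent_wf_choice[of less_than "\<lambda>p k r. r \<in> I - J (p ` {..<k}) \<and> (\<forall>q\<in>I - J (p ` {..<k}). deg r \<le> deg q)"])
        fix f g :: "nat \<Rightarrow> 'k pol" and k r assume "\<And>z. (z, k) \<in> less_than \<Longrightarrow> f z = g z"
        then have "f ` {..<k} = g ` {..<k}" by auto
        then show "(r \<in> I - J (f ` {..<k}) \<and> (\<forall>q\<in>I - J (f ` {..<k}). deg r \<le> deg q)) =
          (r \<in> I - J (g ` {..<k}) \<and> (\<forall>q\<in>I - J (g ` {..<k}). deg r \<le> deg q))" by simp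
      next
        fix k and p :: "nat \<Rightarrow> 'k pol"
        assume prev: "\<And>j. (j, k) \<in> less_than \<Longrightarrow> p j \<in> I - J (p ` {..<j}) \<and> (\<forall>q\<in>I - J (p ` {..<j}). deg (p j) \<le> deg q)"
        have pI: "p ` {..<k} \<subseteq> I" using prev by auto
        then have "J (p ` {..<k}) \<subseteq> I" unfolding J_def by (intro A.genideal_minimal I)
        moreover have "I \<noteq> J (p ` {..<k})" using neg pI I.Icarr unfolding J_def by (metis finite_imageI finite_lessThan subsetD subsetI)
        ultimately obtain q where "q \<in> I - J (p ` {..<k})" by blast
        then show "\<exists>r. r \<in> I - J (p ` {..<k}) \<and> (\<forall>q\<in>I - J (p ` {..<k}). deg r \<le> deg q)"
          using ex_has_least_nat[of "\<lambda>q. q \<in> I - J (p ` {..<k})" q deg] by blast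
      qed simp
      then obtain p :: "nat \<Rightarrow> 'k pol" where
        pp: "\<forall>k. p k \<in> I - J (p ` {..<k}) \<and> (\<forall>q\<in>I - J (p ` {..<k}). deg (p k) \<le> deg q)" by blast
      have p: "p k \<in> I" "p k \<notin> J (p ` {..<k})"
        "q \<in> I \<Longrightarrow> q \<notin> J (p ` {..<k}) \<Longrightarrow> deg (p k) \<le> deg q" for k q using pp by blast+
      have pA: "p k \<in> PV (insert v vs)" for k using I.Icarr[OF p(1)] by simp
      have Jmono: "J (p ` {..<i}) \<subseteq> J (p ` {..<k})" if "i \<le> k" for i k
        unfolding J_def using that pA by (intro A.genideal_minimal A.genideal_ideal order_trans[OF _ A.genideal_self]) auto
      have dmono: "deg (p i) \<le> deg (p k)" if "i \<le> k" for i k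
        using p(3)[OF p(1), of k i] p(2)[of k] Jmono[OF that] by blast
      define a where "a k = lead_coeff (UP v (p k))" for k
      have aC: "a k \<in> PV vs" for k
      proof -
        have "a k \<in> PV (insert v vs - {v})" unfolding a_def by (rule UP_coeff[OF pA])
        then show ?thesis using v by simp
      qed
      define Ch where "Ch = range (\<lambda>k. Idl\<^bsub>sub_ring (PV vs)\<^esub> (a ` {..<k}))"
      have amono: "Idl\<^bsub>sub_ring (PV vs)\<^esub> (a ` {..<i}) \<subseteq> Idl\<^bsub>sub_ring (PV vs)\<^esub> (a ` {..<k})" if "i \<le> k" for i k
        using that aC by (intro C.genideal_minimal C.genideal_ideal order_trans[OF _ C.genideal_self]) auto
      have "\<Union>Ch \<in> Ch"
      proof (rule Cn.ideal_chain_is_trivial)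
        show "Ch \<noteq> {}" by (auto simp: Ch_def)
        show "subset.chain {I. ideal I (sub_ring (PV vs))} Ch"
          unfolding subset.chain_def
        proof (intro conjI ballI)
          show "Ch \<subseteq> {I. ideal I (sub_ring (PV vs))}"
            using aC by (auto simp: Ch_def intro!: C.genideal_ideal)
          fix x y assume "x \<in> Ch" "y \<in> Ch"
          then obtain i k where "x = Idl\<^bsub>sub_ring (PV vs)\<^esub> (a ` {..<i})" "y = Idl\<^bsub>sub_ring (PV vs)\<^esub> (a ` {..<k})"
            by (auto simp: Ch_def)
          then show "(\<subset>)\<^sup>=\<^sup>= x y \<or> (\<subset>)\<^sup>=\<^sup>= y x"
            using amono[of i k] amono[of k i] by (cases "i \<le> k") auto
        qed
      qed
      then obtain m where m: "\<Union>Ch = Idl\<^bsub>sub_ring (PV vs)\<^esub> (a ` {..<m})" by (auto simp: Ch_def)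
      have "a m \<in> Idl\<^bsub>sub_ring (PV vs)\<^esub> (a ` {..<Suc m})"
        using C.genideal_self[of "a ` {..<Suc m}"] aC by auto
      then have "a m \<in> Idl\<^bsub>sub_ring (PV vs)\<^esub> (a ` {..<m})" using m by (auto simp: Ch_def)
      then obtain r B where B: "finite B" "B \<subseteq> {..<m}" "\<forall>i\<in>B. r i \<in> PV vs" "a m = (\<Sum>i\<in>B. r i * a i)"
        using C.Idl_finite_family[of "{..<m}" a] aC by auto
      define s where "s = (\<Sum>i\<in>B. (r i * Var v ^ (deg (p m) - deg (p i))) * p i)"
      define q where "q = p m - s"
      have rA: "r i * Var v ^ k \<in> PV (insert v vs)" if "i \<in> B" for i k
        using that B(3) by (intro PV_mult PV_power PV_Var) (auto intro: PV_mono[of vs])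
      have sJ: "s \<in> J (p ` {..<m})"
      proof -
        have "J (p ` {..<m}) = {\<Sum>i\<in>B. r i * p i | r B. finite B \<and> B \<subseteq> {..<m} \<and> (\<forall>i\<in>B. r i \<in> PV (insert v vs))}"
          unfolding J_def by (rule A.Idl_finite_family) (rule pA)
        then show ?thesis using B(1,2) rA unfolding s_def
          by (auto intro!: exI[of _ "\<lambda>i. r i * Var v ^ (deg (p m) - deg (p i))"] exI[of _ B])
      qed
      interpret Jm: ideal "J (p ` {..<m})" ?A unfolding J_def using pA by (intro A.genideal_ideal) auto
      have JI: "J (p ` {..<m}) \<subseteq> I" unfolding J_def using p(1) by (intro A.genideal_minimal I) auto
      have neg_s: "- s \<in> J (p ` {..<m})" using Jm.I_l_closed[OF sJ, of "Cst (-1)"] A.K_Cst[of "-1"] by (simp add: hom_distribs)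
      have qI: "q \<in> I" using I.a_closed[OF p(1) subsetD[OF JI neg_s], of m] by (simp add: q_def)
      have qJ: "q \<notin> J (p ` {..<m})" using Jm.a_closed[OF _ sJ, of q] p(2)[of m] by (auto simp: q_def)
      define d where "d = deg (p m)"
      have ge: "d \<le> deg q" using p(3)[OF qI qJ] by (simp add: d_def)
      have Us: "UP v s = (\<Sum>i\<in>B. smult (r i) (monom 1 (d - deg (p i)) * UP v (p i)))"
        unfolding s_def hom_distribs d_def
      proof (intro sum.cong refl)
        fix i assume "i \<in> B"
        then have "UP v (r i) = [:r i:]" using B(3) UP_const v by blast
        then show "UP v (r i) * UP v (Var v) ^ (deg (p m) - deg (p i)) * UP v (p i) =
           smult (r i) (monom 1 (deg (p m) - deg (p i)) * UP v (p i))"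
          by (simp add: UP_Var monom_altdef mult.assoc)
      qed
      have cs: "coeff (UP v s) e = (\<Sum>i\<in>B. r i * (if e < d - deg (p i) then 0 else coeff (UP v (p i)) (e - (d - deg (p i)))))" for e
        unfolding Us by (simp add: coeff_sum coeff_monom_mult cong: if_cong)
      have di: "deg (p i) \<le> d" if "i \<in> B" for i using dmono[of i m] that B(2) by (auto simp: d_def)
      have "coeff (UP v s) d = (\<Sum>i\<in>B. r i * a i)"
        unfolding cs using di by (intro sum.cong) (auto simp: a_def deg_def)
      then have top: "coeff (UP v q) d = 0" using B(4) by (simp add: q_def hom_distribs a_def d_def deg_def)
      have "coeff (UP v q) e = 0" if "e > d" for e
      proof -
        have "coeff (UP v s) e = 0"
          unfolding cs using di that by (intro sum.neutral) (auto simp: deg_def intro!: coeff_eq_0)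
        moreover have "coeff (UP v (p m)) e = 0" using that by (intro coeff_eq_0) (simp add: d_def deg_def)
        ultimately show ?thesis by (simp add: q_def hom_distribs)
      qed
      then have "degree (UP v q) \<le> d" by (intro degree_le) auto
      then have "degree (UP v q) = d" using ge by (simp add: deg_def)
      then have "q = 0" using top by (metis UP_eq_0 leading_coeff_0_iff)
      then show False using qJ Jm.zero_closed by simp
    qed
  qed
  then show ?thesis by (subst pol_ring_eq_sub_ring)
qed

theorem noetherian_pol_ring:
  assumes "finite vs"
  shows "noetherian_ring (pol_ring vs :: 'k::field pol ring)"
  using assms
  by (induction vs rule: finite_induct) (auto intro: noetherian_PV_empty noetherian_PV_insert)

lemma (in ring_hom_ring) noetherian_image:
  assumes "noetherian_ring R" "h ` carrier R = carrier S"
  shows "noetherian_ring S"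
proof (rule S.noetherian_ringI)
  fix J assume J: "ideal J S"
  obtain F where F: "F \<subseteq> carrier R" "finite F" "{x \<in> carrier R. h x \<in> J} = Idl F"
    using noetherian_ring.finetely_gen[OF assms(1) ideal_vimage[OF J]] by blast
  have hF: "h ` F \<subseteq> carrier S" using F by auto
  have "J = Idl\<^bsub>S\<^esub> (h ` F)"
  proof
    show "Idl\<^bsub>S\<^esub> (h ` F) \<subseteq> J" using R.genideal_self[OF F(1)] F(3) by (intro S.genideal_minimal J) auto
    have *: "Idl F \<subseteq> {x \<in> carrier R. h x \<in> Idl\<^bsub>S\<^esub> (h ` F)}"
      using F(1) S.genideal_self[OF hF] by (intro R.genideal_minimal ideal_vimage S.genideal_ideal hF) auto
    show "J \<subseteq> Idl\<^bsub>S\<^esub> (h ` F)"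
    proof
      fix y assume y: "y \<in> J"
      then have "y \<in> h ` carrier R" using assms(2) ideal.Icarr[OF J] by simp
      then obtain x where "x \<in> carrier R" "y = h x" by blast
      then show "y \<in> Idl\<^bsub>S\<^esub> (h ` F)" using y F(3) * by blast
    qed
  qed
  then show "\<exists>A\<subseteq>carrier S. finite A \<and> J = Idl\<^bsub>S\<^esub> A" using F hF by (intro exI[of _ "h ` F"]) auto
qed

section \<open>The Nullstellensatz\<close>

lemma PV_det:
  assumes "A \<in> carrier_mat n n" "\<And>i j. i < n \<Longrightarrow> j < n \<Longrightarrow> A $$ (i, j) \<in> PV vs"
  shows "det A \<in> PV vs"
proof -
  have "signof p \<in> PV vs" for p :: "nat \<Rightarrow> nat"
    by (cases p rule: sign_cases) (auto intro: PV_uminus)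
  moreover have "A $$ (i, p i) \<in> PV vs" if "p permutes {0..<n}" "i < n" for p i
    using assms(2)[of i "p i"] that permutes_in_image[of p "{0..<n}" i] by auto
  ultimately show ?thesis
    unfolding det_def'[OF assms(1)] by (intro PV_sum PV_mult PV_prod) auto
qed

lemma PV_adj_mat:
  assumes A: "A \<in> carrier_mat n n" "\<And>i j. i < n \<Longrightarrow> j < n \<Longrightarrow> A $$ (i, j) \<in> PV vs"
    and ij: "i < n" "j < n"
  shows "adj_mat A $$ (i, j) \<in> PV vs"
proof -
  have "det (mat_delete A j i) \<in> PV vs"
  proof (rule PV_det[of _ "n - 1"])
    show "mat_delete A j i \<in> carrier_mat (n - 1) (n - 1)" using A(1) by (rule mat_delete_carrier)
    fix k l assume "k < n - 1" "l < n - 1"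
    then show "mat_delete A j i $$ (k, l) \<in> PV vs"
      using A by (auto simp: mat_delete_def)
  qed
  then show ?thesis
    using A(1) ij by (auto simp: adj_mat_def cofactor_def intro!: PV_mult PV_power PV_uminus)
qed

lemma cring_pol_ring: "cring (pol_ring vs :: 'k::field pol ring)"
proof -
  interpret subalgebra "PV vs :: 'k pol set" by (rule subalgebra_PV)
  show ?thesis by (subst pol_ring_eq_sub_ring) (rule is_cring)
qed

text \<open>Multiplying by the adjugate matrix shows that \<open>det A\<close> times every entry of \<open>b\<close> is in the ideal.\<close>

lemma det_in_ideal:
  fixes A :: "'k::field pol mat"
  assumes I: "ideal I (pol_ring vs)" and A: "A \<in> carrier_mat n n" "\<And>i j. i < n \<Longrightarrow> j < n \<Longrightarrow> A $$ (i, j) \<in> PV vs"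
    and b: "\<And>i. i < n \<Longrightarrow> (\<Sum>j<n. A $$ (i, j) * b j) \<in> I" and j: "j0 < n" "b j0 = 1"
  shows "det A \<in> I"
proof -
  interpret cring "pol_ring vs :: 'k pol ring" by (rule cring_pol_ring)
  interpret I: ideal I "pol_ring vs" by fact
  have isum: "(\<Sum>i<k. f i) \<in> I" if "\<And>i. i < k \<Longrightarrow> f i \<in> I" for k and f :: "nat \<Rightarrow> 'k pol"
    using that
  proof (induction k)
    case (Suc k)
    then have "sum f {..<k} \<in> I" "f k \<in> I" by auto
    then show ?case using I.a_closed[of "sum f {..<k}" "f k"] by simp
  qed (use I.zero_closed in simp)
  have "(\<Sum>j<n. (\<Sum>i<n. adj_mat A $$ (j0, i) * A $$ (i, j)) * b j) = (\<Sum>j<n. (if j = j0 then det A else 0) * b j)"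
  proof (intro sum.cong refl)
    fix j assume "j \<in> {..<n}"
    then have jn: "j < n" by simp
    have "(adj_mat A * A) $$ (j0, j) = (\<Sum>i<n. adj_mat A $$ (j0, i) * A $$ (i, j))"
      using A(1) adj_mat(1)[OF A(1)] j(1) jn by (simp add: scalar_prod_def atLeast0LessThan)
    moreover have "(adj_mat A * A) $$ (j0, j) = (if j = j0 then det A else 0)"
      using j(1) jn by (simp add: adj_mat(3)[OF A(1)])
    ultimately show "(\<Sum>i<n. adj_mat A $$ (j0, i) * A $$ (i, j)) * b j = (if j = j0 then det A else 0) * b j" by simp
  qed
  also have "\<dots> = (\<Sum>j<n. if j = j0 then det A else 0)" using j(2) by (intro sum.cong) auto
  also have "\<dots> = det A" using j(1) by simp
  finally have "det A = (\<Sum>j<n. (\<Sum>i<n. adj_mat A $$ (j0, i) * A $$ (i, j)) * b j)" ..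
  also have "\<dots> = (\<Sum>i<n. adj_mat A $$ (j0, i) * (\<Sum>j<n. A $$ (i, j) * b j))"
    unfolding sum_distrib_left sum_distrib_right
    by (subst sum.swap) (simp add: mult.assoc)
  also have "\<dots> \<in> I"
  proof (rule isum)
    fix i assume "i < n"
    then show "adj_mat A $$ (j0, i) * (\<Sum>j<n. A $$ (i, j) * b j) \<in> I"
      using I.I_l_closed[OF b, of i "adj_mat A $$ (j0, i)"] PV_adj_mat[OF A j(1)] by simp
  qed
  finally show ?thesis .
qed

text \<open>A univariate polynomial factors, so a prime ideal containing it contains some \<open>v - c\<close>.\<close>

lemma prime_contains_linear_factor:
  fixes q :: "'k::alg_closed_field poly"
  assumes P: "primeideal P (pol_ring vs)" and v: "v \<in> vs"
    and q: "q \<noteq> 0" "poly (map_poly Cst q) (Var v) \<in> P"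
  shows "\<exists>c. Var v - Cst c \<in> P"
  using q
proof (induction "degree q" arbitrary: q)
  case 0
  interpret cring "pol_ring vs :: 'k pol ring" by (rule cring_pol_ring)
  interpret P: primeideal P "pol_ring vs" by fact
  obtain c where c: "q = [:c:]" using 0 degree_eq_zeroE by metis
  then have "Cst c \<in> P" "c \<noteq> 0" using 0 by (auto simp: map_poly_pCons)
  then have "Cst (inverse c) * Cst c \<in> P" using P.I_l_closed[of "Cst c" "Cst (inverse c)"] by simp
  then have "1 \<in> P" using \<open>c \<noteq> 0\<close> by (simp flip: Cst.hom_mult)
  then show ?case using P.one_imp_carrier P.I_notcarr by simp
next
  case (Suc n)
  interpret cring "pol_ring vs :: 'k pol ring" by (rule cring_pol_ring)
  interpret P: primeideal P "pol_ring vs" by fact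
  obtain c where "poly q c = 0" using alg_closed_imp_poly_has_root[of q] Suc by auto
  then obtain q' where q': "q = [:- c, 1:] * q'" by (meson dvdE poly_eq_0_iff_dvd)
  then have q'0: "q' \<noteq> 0" using Suc.prems by auto
  then have "degree q = Suc (degree q')" unfolding q' by (subst degree_mult_eq) auto
  then have q'1: "n = degree q'" using Suc.hyps(2) by simp
  have coefs: "poly (map_poly Cst r) (Var v) \<in> PV vs" for r :: "'k poly"
    unfolding poly_altdef using v by (intro PV_sum PV_mult PV_power) (auto simp: coeff_map_poly PV_Var)
  have "map_poly Cst q = pCons 0 (map_poly Cst q') - smult (Cst c) (map_poly Cst q')"
    by (rule poly_eqI) (simp add: q' coeff_map_poly hom_distribs coeff_pCons split: nat.split)
  then have "poly (map_poly Cst q) (Var v) = (Var v - Cst c) * poly (map_poly Cst q') (Var v)"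
    by (simp add: left_diff_distrib)
  then have "(Var v - Cst c) \<otimes>\<^bsub>pol_ring vs\<^esub> poly (map_poly Cst q') (Var v) \<in> P" using Suc by simp
  then have "Var v - Cst c \<in> P \<or> poly (map_poly Cst q') (Var v) \<in> P"
    using P.I_prime[of "Var v - Cst c" "poly (map_poly Cst q') (Var v)"] coefs v
    by (simp add: PV_diff PV_Var)
  then show ?case using Suc.hyps(1)[OF q'1 q'0] by auto
qed

lemma univariate_form:
  fixes F :: "'k::field pol"
  assumes "F \<in> PV {v}"
  shows "\<exists>q. F = poly (map_poly Cst q) (Var v)"
  using assms
proof (induction F rule: pol_induct)
  case (Cst c)
  show ?case by (rule exI[of _ "[:c:]"]) (simp add: map_poly_pCons)
next
  case (add p q)
  then obtain p' q' where "p = poly (map_poly Cst p') (Var v)" "q = poly (map_poly Cst q') (Var v)" by blast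
  moreover have "map_poly Cst (p' + q') = map_poly Cst p' + map_poly Cst q'"
    by (rule poly_eqI) (simp add: coeff_map_poly hom_distribs)
  ultimately show ?case by (intro exI[of _ "p' + q'"]) simp
next
  case (Var u p)
  then obtain p' where "p = poly (map_poly Cst p') (Var v)" "u = v" by blast
  then show ?case by (intro exI[of _ "pCons 0 p'"]) (simp add: map_poly_pCons)
qed

text \<open>Let \<open>ys\<close> be a maximal set of indeterminates algebraically independent modulo \<open>M\<close>. If it is empty, \<open>v\<close>
  is a root of a polynomial modulo \<open>M\<close>. Otherwise the remaining indeterminates are algebraic over it. Then an
  inverse of \<open>y - c\<close> modulo \<open>M\<close>, for \<open>y \<in> ys\<close>, is integral once the leading coefficients are inverted;
  clearing denominators in the integral equation and evaluating at a point with \<open>y = c\<close> where the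
  leading coefficients do not vanish gives a contradiction.\<close>

theorem nullstellensatz:
  fixes M :: "'k::alg_closed_field pol set"
  assumes fin: "finite vs" and M: "maximalideal M (pol_ring vs)" and v: "v \<in> vs"
  shows "\<exists>c. Var v - Cst c \<in> M"
proof -
  interpret A: cring "pol_ring vs :: 'k pol ring" by (rule cring_pol_ring)
  interpret M: maximalideal M "pol_ring vs" by fact
  interpret P: primeideal M "pol_ring vs" by (rule A.maximalideal_prime[OF M])
  have Madd: "p + q \<in> M" if "p \<in> M" "q \<in> M" for p q using M.a_closed that by simp
  have Mmult: "p * q \<in> M" if "p \<in> PV vs" "q \<in> M" for p q using M.I_l_closed[of q p] that by simp
  have Muminus: "- p \<in> M" if "p \<in> M" for p using Mmult[of "Cst (-1)" p] that PV_Cst[of "-1 :: 'k"] by (simp add: hom_distribs)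
  have Mdiff: "p - q \<in> M" if "p \<in> M" "q \<in> M" for p q using Madd[of p "- q"] Muminus that by simp
  have Msum: "sum f B \<in> M" if "\<And>i. i \<in> B \<Longrightarrow> f i \<in> M" for f and B :: "'z set"
    using that by (induction B rule: infinite_finite_induct) (use M.zero_closed Madd in auto)
  have M0: "0 \<in> M" using M.zero_closed by simp
  define free where "free ys \<longleftrightarrow> ys \<subseteq> vs \<and> M \<inter> PV ys \<subseteq> {0}" for ys
  have "free {}"
  proof -
    have "c = 0" if "Cst c \<in> M" for c
    proof (rule ccontr)
      assume "c \<noteq> 0"
      then have "1 \<in> M" using Mmult[of "Cst (inverse c)" "Cst c"] that by (simp flip: Cst.hom_mult)
      then show False using M.one_imp_carrier M.I_notcarr by simp
    qed
    then have "p = 0" if "p \<in> M" "p \<in> PV {}" for p using PV_empty[OF that(2)] that(1) by auto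
    then show ?thesis by (auto simp: free_def)
  qed
  moreover have "finite {ys. free ys}" using fin by (auto simp: free_def intro: finite_subset[of _ "Pow vs"])
  ultimately obtain ys where ys: "free ys" and mx: "\<And>zs. free zs \<Longrightarrow> ys \<subseteq> zs \<Longrightarrow> zs = ys"
    using finite_has_maximal2[of "{ys. free ys}" "{}"] by auto
  have ysv: "ys \<subseteq> vs" and ysM: "\<And>p. p \<in> M \<Longrightarrow> p \<in> PV ys \<Longrightarrow> p = 0" using ys by (auto simp: free_def)
  have dep: "\<exists>F. F \<in> M \<and> F \<noteq> 0 \<and> F \<in> PV (insert w ys)" if "w \<in> vs - ys" for w
    using mx[of "insert w ys"] that ysv by (auto simp: free_def)
  show ?thesis
  proof (cases "ys = {}")
    case True
    then obtain F where F: "F \<in> M" "F \<noteq> 0" "F \<in> PV {v}" using dep[of v] v by auto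
    from univariate_form[OF F(3)] obtain q where q: "F = poly (map_poly Cst q) (Var v)" ..
    then have "q \<noteq> 0" using F(2) by auto
    with q show ?thesis using prime_contains_linear_factor[OF P.primeideal_axioms v, of q] F by auto
  next
    case False
    then obtain y where y: "y \<in> ys" by auto
    define Z where "Z = vs - ys"
    have finZ: "finite Z" using fin by (simp add: Z_def)
    obtain F where F: "\<And>w. w \<in> Z \<Longrightarrow> F w \<in> M" "\<And>w. w \<in> Z \<Longrightarrow> F w \<noteq> 0" "\<And>w. w \<in> Z \<Longrightarrow> F w \<in> PV (insert w ys)"
      using dep unfolding Z_def by metis
    define e where "e w = degree (UP w (F w))" for w
    define cf where "cf w i = coeff (UP w (F w)) i" for w i
    have cf: "cf w i \<in> PV ys" if "w \<in> Z" for w i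
      using UP_coeff[OF F(3)[OF that], of w i] by (auto simp: cf_def intro: PV_mono[rotated])
    have Fexp: "F w = (\<Sum>i<e w. cf w i * Var w ^ i) + cf w (e w) * Var w ^ e w" for w
      using UP_expand[of "F w" w] by (simp add: e_def cf_def lessThan_Suc_atMost[symmetric])
    define G where "G = (\<Prod>w\<in>Z. cf w (e w))"
    have G: "G \<in> PV ys" unfolding G_def by (intro PV_prod cf)
    have "G \<noteq> 0" unfolding G_def using F(2) finZ by (auto simp: cf_def e_def)
    then obtain c where c: "pev c G \<noteq> 0"
      using nonvanishing_point[OF infinite_alg_closed _ G] finite_subset[OF ysv fin] by blast
    \<comment> \<open>After inverting the product \<open>G\<close> of the leading coefficients, the monomials in \<open>B\<close> generate the ring
      modulo \<open>M\<close> over the polynomials in \<open>ys\<close>; \<open>T\<close> is the set of elements generated in this sense.\<close>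
    define B where "B = {m. Poly_Mapping.keys m \<subseteq> Z \<and> (\<forall>w\<in>Z. Poly_Mapping.lookup m w < e w)}"
    have finB: "finite B"
    proof (rule finite_subset[of _ "mons Z (\<Sum>w\<in>Z. e w)"])
      show "B \<subseteq> mons Z (\<Sum>w\<in>Z. e w)"
      proof
        fix m assume m: "m \<in> B"
        have "Poly_Mapping.lookup m w \<le> (\<Sum>w\<in>Z. e w)" for w
        proof (cases "w \<in> Z")
          case True
          then have "Poly_Mapping.lookup m w \<le> e w" using m by (auto simp: B_def)
          also have "\<dots> \<le> (\<Sum>w\<in>Z. e w)" using True finZ by (intro member_le_sum) auto
          finally show ?thesis .
        next
          case False
          then have "w \<notin> Poly_Mapping.keys m" using m by (auto simp: B_def)
          then show ?thesis by (simp add: not_in_keys_iff_lookup_eq_zero)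
        qed
        then show "m \<in> mons Z (\<Sum>w\<in>Z. e w)" using m by (auto simp: mons_def B_def)
      qed
    qed (use mons_card(1)[OF finZ] in simp)
    have MonB: "Mon m \<in> PV vs" if "m \<in> B" for m using that by (auto simp: B_def PV_Mon Z_def)
    define T where "T = {h. \<exists>k a. (\<forall>m\<in>B. a m \<in> PV ys) \<and> G ^ k * h - (\<Sum>m\<in>B. a m * Mon m) \<in> M}"
    have GV: "G ^ k \<in> PV vs" for k using PV_mono[OF ysv G] by (rule PV_power)
    have T_M: "h \<in> T" if "h \<in> M" for h
      unfolding T_def using that by (auto intro!: exI[of _ 0] exI[of _ "\<lambda>_. 0"])
    have T_up: "\<exists>a. (\<forall>m\<in>B. a m \<in> PV ys) \<and> G ^ (k + j) * h - (\<Sum>m\<in>B. a m * Mon m) \<in> M"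
      if a: "\<forall>m\<in>B. a m \<in> PV ys" "G ^ k * h - (\<Sum>m\<in>B. a m * Mon m) \<in> M" for k j a h
    proof (intro exI conjI ballI)
      fix m assume "m \<in> B" then show "G ^ j * a m \<in> PV ys" using a G by (intro PV_mult PV_power) auto
    next
      have "G ^ (k + j) * h - (\<Sum>m\<in>B. G ^ j * a m * Mon m) = G ^ j * (G ^ k * h - (\<Sum>m\<in>B. a m * Mon m))"
        by (simp add: algebra_simps power_add sum_distrib_left)
      then show "G ^ (k + j) * h - (\<Sum>m\<in>B. G ^ j * a m * Mon m) \<in> M" using Mmult[OF GV a(2)] by simp
    qed
    have T_add: "h + h' \<in> T" if "h \<in> T" "h' \<in> T" for h h'
    proof -
      obtain k a k' a' where *: "\<forall>m\<in>B. a m \<in> PV ys" "G ^ k * h - (\<Sum>m\<in>B. a m * Mon m) \<in> M"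
        "\<forall>m\<in>B. a' m \<in> PV ys" "G ^ k' * h' - (\<Sum>m\<in>B. a' m * Mon m) \<in> M"
        using \<open>h \<in> T\<close> \<open>h' \<in> T\<close> by (auto simp: T_def)
      obtain b b' where b: "\<forall>m\<in>B. b m \<in> PV ys" "G ^ (k + k') * h - (\<Sum>m\<in>B. b m * Mon m) \<in> M"
        "\<forall>m\<in>B. b' m \<in> PV ys" "G ^ (k' + k) * h' - (\<Sum>m\<in>B. b' m * Mon m) \<in> M"
        using T_up[OF *(1,2), of k'] T_up[OF *(3,4), of k] by blast
      have "G ^ (k + k') * (h + h') - (\<Sum>m\<in>B. (b m + b' m) * Mon m) =
        (G ^ (k + k') * h - (\<Sum>m\<in>B. b m * Mon m)) + (G ^ (k' + k) * h' - (\<Sum>m\<in>B. b' m * Mon m))"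
        by (simp add: algebra_simps sum.distrib)
      then have "G ^ (k + k') * (h + h') - (\<Sum>m\<in>B. (b m + b' m) * Mon m) \<in> M" using Madd[OF b(2,4)] by simp
      then show ?thesis unfolding T_def using b(1,3)
        by (intro CollectI exI[of _ "k + k'"] exI[of _ "\<lambda>m. b m + b' m"]) (auto intro: PV_add)
    qed
    have T_mult: "p * h \<in> T" if "p \<in> PV ys" "h \<in> T" for p h
    proof -
      obtain k a where *: "\<forall>m\<in>B. a m \<in> PV ys" "G ^ k * h - (\<Sum>m\<in>B. a m * Mon m) \<in> M"
        using \<open>h \<in> T\<close> by (auto simp: T_def)
      have "G ^ k * (p * h) - (\<Sum>m\<in>B. (p * a m) * Mon m) = p * (G ^ k * h - (\<Sum>m\<in>B. a m * Mon m))"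
        by (simp add: algebra_simps sum_distrib_left)
      then show ?thesis unfolding T_def using * Mmult[OF PV_mono[OF ysv that(1)] *(2)] that(1)
        by (intro CollectI exI[of _ k] exI[of _ "\<lambda>m. p * a m"]) (auto intro: PV_mult)
    qed
    have T_sum: "sum f C \<in> T" if "\<And>i. i \<in> C \<Longrightarrow> f i \<in> T" for f and C :: "(indet \<Rightarrow>\<^sub>0 nat) set"
      using that by (induction C rule: infinite_finite_induct) (auto intro: T_add T_M M0)
    have T_sum': "sum f C \<in> T" if "\<And>i. i \<in> C \<Longrightarrow> f i \<in> T" for f and C :: "nat set"
      using that by (induction C rule: infinite_finite_induct) (auto intro: T_add T_M M0)
    have T_div: "h \<in> T" if GT: "G ^ k * h \<in> T" for k h
    proof -
      obtain j a where *: "\<forall>m\<in>B. a m \<in> PV ys" "G ^ j * (G ^ k * h) - (\<Sum>m\<in>B. a m * Mon m) \<in> M"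
        using GT by (auto simp: T_def)
      then show ?thesis unfolding T_def
        by (intro CollectI exI[of _ "j + k"] exI[of _ a]) (simp add: power_add mult.assoc)
    qed
    have T_Mon: "Mon m \<in> T" if "m \<in> B" for m
    proof -
      have "(\<Sum>m'\<in>B. (if m' = m then 1 else 0) * Mon m') = (\<Sum>m'\<in>B. if m' = m then Mon m' else 0 :: 'k pol)"
        by (intro sum.cong) auto
      then have "G ^ 0 * Mon m - (\<Sum>m'\<in>B. (if m' = m then 1 else 0) * Mon m') = 0" using finB that by simp
      then show ?thesis unfolding T_def using M0
        by (intro CollectI exI[of _ 0] exI[of _ "\<lambda>m'. if m' = m then 1 else 0"]) auto
    qed
    have T_VarMon: "Var w * Mon m \<in> T" if w: "w \<in> Z" and m: "m \<in> B" for w m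
    proof (cases "Suc (Poly_Mapping.lookup m w) < e w")
      case True
      then have "m + Poly_Mapping.single w 1 \<in> B" using m w
        by (auto simp: B_def keys_add_nat lookup_add lookup_single when_def)
      from T_Mon[OF this] show ?thesis by (simp add: Mon_add Var_eq_Mon mult.commute)
    next
      case False
      then have ew: "e w = Suc (Poly_Mapping.lookup m w)" using m w by (auto simp: B_def Suc_lessI)
      define m' where "m' = m - Poly_Mapping.single w (Poly_Mapping.lookup m w)"
      have mm: "m = m' + Poly_Mapping.single w (Poly_Mapping.lookup m w)"
        by (rule poly_mapping_eqI) (auto simp: m'_def lookup_add lookup_minus lookup_single when_def)
      have m'w: "Poly_Mapping.lookup m' w = 0" by (simp add: m'_def lookup_minus)
      have B': "m' + Poly_Mapping.single w i \<in> B" if "i < e w" for i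
      proof -
        have "Poly_Mapping.keys m' \<subseteq> Poly_Mapping.keys m" by (auto simp: in_keys_iff m'_def lookup_minus)
        moreover have "Poly_Mapping.lookup m' u < e u" if "u \<in> Z" for u
        proof -
          have "Poly_Mapping.lookup m' u \<le> Poly_Mapping.lookup m u" by (simp add: m'_def lookup_minus)
          also have "\<dots> < e u" using m that by (simp add: B_def)
          finally show ?thesis .
        qed
        ultimately show ?thesis using m w that m'w
          by (auto simp: B_def keys_add_nat lookup_add lookup_single when_def)
      qed
      define G' where "G' = (\<Prod>u\<in>Z - {w}. cf u (e u))"
      have G': "G' \<in> PV ys" unfolding G'_def by (intro PV_prod cf) auto
      have GG: "G = cf w (e w) * G'" unfolding G_def G'_def using w finZ by (simp add: prod.remove)
      have "G ^ 1 * (Var w * Mon m) = G' * (cf w (e w) * Var w ^ e w * Mon m')"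
        by (subst mm) (simp add: Mon_add Mon_single GG ew algebra_simps)
      also have "cf w (e w) * Var w ^ e w = F w - (\<Sum>i<e w. cf w i * Var w ^ i)" using Fexp[of w] by (simp add: algebra_simps)
      also have "G' * ((F w - (\<Sum>i<e w. cf w i * Var w ^ i)) * Mon m') =
        G' * Mon m' * F w + (\<Sum>i<e w. (- G' * cf w i) * Mon (m' + Poly_Mapping.single w i))"
        by (simp add: Mon_add Mon_single algebra_simps sum_distrib_left sum_negf)
      also have "\<dots> \<in> T"
      proof (rule T_add)
        have "Poly_Mapping.keys m' \<subseteq> Poly_Mapping.keys m" by (auto simp: in_keys_iff m'_def lookup_minus)
        then have "Mon m' \<in> PV vs" using m by (auto simp: PV_Mon B_def Z_def)
        then have "G' * Mon m' \<in> PV vs" using PV_mono[OF ysv G'] by (rule PV_mult[rotated])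
        then show "G' * Mon m' * F w \<in> T" using F(1)[OF w] by (intro T_M Mmult)
        show "(\<Sum>i<e w. (- G' * cf w i) * Mon (m' + Poly_Mapping.single w i)) \<in> T"
        proof (rule T_sum')
          fix i assume "i \<in> {..<e w}"
          then have "Mon (m' + Poly_Mapping.single w i) \<in> T" using B' by (intro T_Mon) simp
          then show "(- G' * cf w i) * Mon (m' + Poly_Mapping.single w i) \<in> T"
            by (rule T_mult[OF PV_mult[OF PV_uminus[OF G'] cf[OF w]]])
        qed
      qed
      finally show ?thesis by (rule T_div)
    qed
    have T_all: "h \<in> T" if "h \<in> PV vs" for h
      using that
    proof (induction h rule: pol_induct)
      case (Cst a)
      have e0: "0 < e w" if w: "w \<in> Z" for w
      proof (rule ccontr)
        assume "\<not> 0 < e w"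
        then have "F w = cf w 0" using Fexp[of w] by simp
        then show False using ysM[OF F(1)[OF w]] cf[OF w] F(2)[OF w] by simp
      qed
      have "0 \<in> B" using e0 by (simp add: B_def)
      from T_mult[OF PV_Cst T_Mon[OF this]] show ?case by simp
    next
      case (Var w p)
      then obtain k a where *: "\<forall>m\<in>B. a m \<in> PV ys" "G ^ k * p - (\<Sum>m\<in>B. a m * Mon m) \<in> M"
        by (auto simp: T_def)
      have "Var w * Mon m \<in> T" if "m \<in> B" for m
        using Var(1) that T_VarMon T_Mon T_mult[OF PV_Var] by (cases "w \<in> ys") (auto simp: Z_def)
      then have "(\<Sum>m\<in>B. a m * (Var w * Mon m)) \<in> T" using *(1) by (blast intro: T_sum T_mult[of "a _"])
      moreover have "Var w * (G ^ k * p - (\<Sum>m\<in>B. a m * Mon m)) \<in> T" using *(2) Var(1) by (intro T_M Mmult PV_Var)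
      ultimately have "Var w * (G ^ k * p - (\<Sum>m\<in>B. a m * Mon m)) + (\<Sum>m\<in>B. a m * (Var w * Mon m)) \<in> T"
        by (rule T_add[rotated])
      moreover have "Var w * (G ^ k * p - (\<Sum>m\<in>B. a m * Mon m)) + (\<Sum>m\<in>B. a m * (Var w * Mon m)) = G ^ k * (Var w * p)"
        by (simp add: algebra_simps sum_distrib_left)
      ultimately show ?case using T_div by metis
    qed (rule T_add)
    \<comment> \<open>\<open>D\<close> vanishes at a point \<open>c\<close> with \<open>G(c) \<noteq> 0\<close>, but it has an inverse \<open>u\<close> modulo \<open>M\<close>.\<close>
    define D where "D = Var y - Cst (c y)"
    have Dy: "D \<in> PV ys" using y by (auto simp: D_def intro!: PV_diff PV_Var)
    have DV: "D \<in> PV vs" using PV_mono[OF ysv Dy] .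
    have D0: "D \<noteq> 0"
    proof
      assume "D = 0"
      then have "pev (\<lambda>v. c y + 1) D = 0" by simp
      then show False by (simp add: D_def hom_distribs)
    qed
    have DM: "D \<notin> M" using ysM Dy D0 by blast
    have "\<exists>u\<in>PV vs. D * u - 1 \<in> M"
    proof -
      note ia = A.ideal_add_principal[OF M.is_ideal, of D]
      have "M <+>\<^bsub>pol_ring vs\<^esub> PIdl\<^bsub>pol_ring vs\<^esub> D = PV vs"
        using M.I_maximal[OF ia(1)] ia DV DM ideal.Icarr[OF ia(1)] by blast
      then have "1 \<in> M <+>\<^bsub>pol_ring vs\<^esub> PIdl\<^bsub>pol_ring vs\<^esub> D" by simp
      from A.mem_ideal_add_principal[OF M.is_ideal DV this]
      have "\<exists>i\<in>M. \<exists>r\<in>PV vs. 1 = i + r * D" unfolding pol_ring_simps .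
      then obtain i r where "i \<in> M" "r \<in> PV vs" "1 = i + r * D" by blast
      then have "D * r - 1 = - i" by (simp add: algebra_simps)
      then show ?thesis using Muminus[OF \<open>i \<in> M\<close>] \<open>r \<in> PV vs\<close> by metis
    qed
    then obtain u where u: "u \<in> PV vs" "D * u - 1 \<in> M" by blast
    have "\<forall>m\<in>B. \<exists>k. \<exists>a. (\<forall>m'\<in>B. a m' \<in> PV ys) \<and> G ^ k * (u * Mon m) - (\<Sum>m'\<in>B. a m' * Mon m') \<in> M"
      using T_all[OF PV_mult[OF u(1) MonB]] by (auto simp: T_def)
    from bchoice[OF this] obtain k where k: "\<forall>m\<in>B. \<exists>a. (\<forall>m'\<in>B. a m' \<in> PV ys) \<and> G ^ k m * (u * Mon m) - (\<Sum>m'\<in>B. a m' * Mon m') \<in> M" ..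
    define kk where "kk = (\<Sum>m\<in>B. k m)"
    have "\<forall>m\<in>B. \<exists>a. (\<forall>m'\<in>B. a m' \<in> PV ys) \<and> G ^ kk * (u * Mon m) - (\<Sum>m'\<in>B. a m' * Mon m') \<in> M"
    proof
      fix m assume m: "m \<in> B"
      have "k m \<le> kk" unfolding kk_def using m finB by (intro member_le_sum) auto
      then have kk: "kk = k m + (kk - k m)" by simp
      show "\<exists>a. (\<forall>m'\<in>B. a m' \<in> PV ys) \<and> G ^ kk * (u * Mon m) - (\<Sum>m'\<in>B. a m' * Mon m') \<in> M"
      proof -
        from k m obtain a where "\<forall>m'\<in>B. a m' \<in> PV ys"
          "G ^ k m * (u * Mon m) - (\<Sum>m'\<in>B. a m' * Mon m') \<in> M" by blast
        from T_up[OF this, of "kk - k m"] show ?thesis using kk by simp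
      qed
    qed
    from bchoice[OF this] obtain a where
      aa: "\<forall>m\<in>B. (\<forall>m'\<in>B. a m m' \<in> PV ys) \<and> G ^ kk * (u * Mon m) - (\<Sum>m'\<in>B. a m m' * Mon m') \<in> M" ..
    have a: "m \<in> B \<Longrightarrow> m' \<in> B \<Longrightarrow> a m m' \<in> PV ys"
      "m \<in> B \<Longrightarrow> G ^ kk * (u * Mon m) - (\<Sum>m'\<in>B. a m m' * Mon m') \<in> M" for m m' using aa by blast+
    obtain bs where bs: "set bs = B" "distinct bs" using finite_distinct_list[OF finB] by blast
    define N where "N = length bs"
    \<comment> \<open>The matrix of multiplication by \<open>u\<close>, cleared of denominators, has entries in the \<open>ys\<close>. Multiplied by
      \<open>D\<close> it acts as \<open>G\<^bsup>kk\<^esup>\<close>, so the determinant below is in \<open>M\<close>, hence \<open>0\<close>; at \<open>c\<close> it is a power of \<open>G(c)\<close>.\<close>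
    define A' where "A' = mat N N (\<lambda>(i, j). (if i = j then G ^ kk else 0) - D * a (bs ! i) (bs ! j))"
    have bsB: "bs ! i \<in> B" if "i < N" for i using that bs N_def by auto
    have A'c: "A' \<in> carrier_mat N N" by (simp add: A'_def)
    have A'ys: "A' $$ (i, j) \<in> PV ys" if "i < N" "j < N" for i j
      using that a(1) bsB Dy G by (auto simp: A'_def intro!: PV_diff PV_mult PV_power PV_uminus)
    have "det A' \<in> M"
    proof -
      have "0 \<in> B"
      proof -
        have e0: "0 < e w" if w: "w \<in> Z" for w
        proof (rule ccontr)
          assume "\<not> 0 < e w"
          then have "F w = cf w 0" using Fexp[of w] by simp
          then show False using ysM[OF F(1)[OF w]] cf[OF w] F(2)[OF w] by simp
        qed
        then show ?thesis by (simp add: B_def)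
      qed
      then obtain j0 where j0: "j0 < N" "bs ! j0 = 0" using bs N_def by (metis in_set_conv_nth)
      show ?thesis
      proof (rule det_in_ideal[OF M.is_ideal A'c _ _ j0(1), of "\<lambda>j. Mon (bs ! j)"])
        show "A' $$ (i, j) \<in> PV vs" if "i < N" "j < N" for i j using A'ys[OF that] PV_mono[OF ysv] by blast
        show "Mon (bs ! j0) = (1 :: 'k pol)" using j0 by simp
        fix i assume i: "i < N"
        let ?m = "bs ! i"
        have re: "(\<Sum>m'\<in>B. a ?m m' * Mon m') = (\<Sum>j<N. a ?m (bs ! j) * Mon (bs ! j))"
          using bs by (intro sum.reindex_bij_betw[symmetric] bij_betw_nth) (auto simp: N_def)
        have "(\<Sum>j<N. A' $$ (i, j) * Mon (bs ! j)) =
          (\<Sum>j<N. (if i = j then G ^ kk else 0) * Mon (bs ! j)) - (\<Sum>j<N. D * a ?m (bs ! j) * Mon (bs ! j))"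
          using i by (simp add: A'_def algebra_simps sum_subtractf)
        also have "(\<Sum>j<N. (if i = j then G ^ kk else 0) * Mon (bs ! j)) = (\<Sum>j<N. if i = j then G ^ kk * Mon (bs ! j) else 0)"
          by (intro sum.cong) auto
        also have "\<dots> = G ^ kk * Mon ?m" using i by simp
        also have "(\<Sum>j<N. D * a ?m (bs ! j) * Mon (bs ! j)) = D * (\<Sum>m'\<in>B. a ?m m' * Mon m')"
          unfolding re by (simp add: sum_distrib_left mult.assoc)
        also have "G ^ kk * Mon ?m - D * (\<Sum>m'\<in>B. a ?m m' * Mon m') =
          D * (G ^ kk * (u * Mon ?m) - (\<Sum>m'\<in>B. a ?m m' * Mon m')) - (G ^ kk * Mon ?m) * (D * u - 1)"
          by (simp add: algebra_simps)
        also have "\<dots> \<in> M"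
          by (rule Mdiff[OF Mmult[OF DV a(2)[OF bsB[OF i]]] Mmult[OF PV_mult[OF GV MonB[OF bsB[OF i]]] u(2)]])
        finally show "(\<Sum>j<N. A' $$ (i, j) * Mon (bs ! j)) \<in> M" .
      qed
    qed
    moreover have "det A' \<in> PV ys" by (rule PV_det[OF A'c A'ys])
    ultimately have "det A' = 0" by (rule ysM)
    then have "det (map_mat (pev c) A') = 0" by (simp add: pev.hom_det)
    moreover have "map_mat (pev c) A' = pev c G ^ kk \<cdot>\<^sub>m 1\<^sub>m N"
      by (rule eq_matI) (auto simp: A'_def D_def hom_distribs)
    ultimately have "(pev c G ^ kk) ^ N = 0" by (simp add: det_smult)
    then show ?thesis using c by simp
  qed
qed

text \<open>The residue field is generated by the values of the indeterminates, which are constants.\<close>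

corollary nullstellensatz_residue_field:
  fixes M :: "'k::alg_closed_field pol set"
  assumes fin: "finite vs" and M: "maximalideal M (pol_ring vs)" and p: "p \<in> PV vs"
  shows "\<exists>c. p - Cst c \<in> M"
proof -
  interpret A: cring "pol_ring vs :: 'k pol ring" by (rule cring_pol_ring)
  interpret M: maximalideal M "pol_ring vs" by fact
  show ?thesis using p
  proof (induction p rule: pol_induct)
    case (Cst c)
    then show ?case using M.zero_closed by (auto intro!: exI[of _ c])
  next
    case (add p q)
    then obtain c d where "p - Cst c \<in> M" "q - Cst d \<in> M" by blast
    then have "(p - Cst c) + (q - Cst d) \<in> M" using M.a_closed[of "p - Cst c" "q - Cst d"] by simp
    then have "(p + q) - Cst (c + d) \<in> M" by (simp add: hom_distribs algebra_simps)
    then show ?case ..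
  next
    case (Var v p)
    then obtain d where d: "p - Cst d \<in> M" by blast
    obtain c where c: "Var v - Cst c \<in> M" using nullstellensatz[OF fin M Var(1)] by blast
    have "Var v * (p - Cst d) \<in> M" using M.I_l_closed[OF d, of "Var v"] Var by (simp add: PV_Var)
    moreover have "Cst d * (Var v - Cst c) \<in> M" using M.I_l_closed[OF c, of "Cst d"] by simp
    ultimately have "Var v * (p - Cst d) + Cst d * (Var v - Cst c) \<in> M" using M.a_closed by fastforce
    then have "Var v * p - Cst (d * c) \<in> M" by (simp add: hom_distribs algebra_simps)
    then show ?case ..
  qed
qed

section \<open>Partial shifts without eigenvectors\<close>

text \<open>A pencil \<open>x A + y B\<close> with independent \<open>B\<^sub>j\<close> is the same as a linear map \<open>T\<close> from the span \<open>H\<close> of the \<open>B\<^sub>j\<close>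
  to \<open>V\<close>, sending \<open>B\<^sub>j\<close> to \<open>- A\<^sub>j\<close>. That no member of the pencil degenerates means that \<open>T\<close> has no
  eigenvectors.\<close>

locale partial_shift =
  fixes T :: "'k::alg_closed_field pol \<Rightarrow> 'k pol" and Bv Bh V H
  defines "V \<equiv> PolV.span Bv" and "H \<equiv> PolV.span Bh"
  assumes Bv: "finite Bv" "PolV.independent Bv" and Bh: "finite Bh" "PolV.independent Bh"
    and codim: "card Bh + 2 = card Bv" and HV: "H \<subseteq> V"
    and T_add: "\<And>x y. x \<in> H \<Longrightarrow> y \<in> H \<Longrightarrow> T (x + y) = T x + T y"
    and T_scale: "\<And>c x. x \<in> H \<Longrightarrow> T (Cst c * x) = Cst c * T x"
    and T_V: "\<And>x. x \<in> H \<Longrightarrow> T x \<in> V"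
    and no_eigen: "\<And>c x. x \<in> H \<Longrightarrow> T x = Cst c * x \<Longrightarrow> x = 0"
begin

lemma sub_V: "PolV.subspace V" and sub_H: "PolV.subspace H"
  by (simp_all add: V_def H_def)

text \<open>\<open>Hs i\<close> is the domain of the \<open>i\<close>-th iterate of \<open>T\<close>.\<close>

fun Hs :: "nat \<Rightarrow> 'k pol set" where
  "Hs 0 = V"
| "Hs (Suc i) = {h \<in> H. h \<in> Hs i \<and> T h \<in> Hs i}"

lemma T_0: "T 0 = 0"
  using T_scale[of 0 0] PolV.subspace_0[OF sub_H] by simp

lemma sub_Hs: "PolV.subspace (Hs i)"
proof (induction i)
  case (Suc i)
  show ?case
    using Suc sub_H by (auto simp: PolV.subspace_def T_0 T_add T_scale)
qed (simp add: sub_V)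

lemmas Hs_0 = PolV.subspace_0[OF sub_Hs]
  and Hs_add = PolV.subspace_add[OF sub_Hs]
  and Hs_scale = PolV.subspace_scale[OF sub_Hs]
  and Hs_diff = PolV.subspace_diff[OF sub_Hs]
  and H_scale = PolV.subspace_scale[OF sub_H]
  and H_add = PolV.subspace_add[OF sub_H]
  and H_diff = PolV.subspace_diff[OF sub_H]

lemma Hs_antimono: "i \<le> j \<Longrightarrow> Hs j \<subseteq> Hs i"
  by (induction j rule: dec_induct) auto

lemma Hs_1: "Hs (Suc 0) = H"
  using HV T_V by auto

lemma Hs_H: "0 < i \<Longrightarrow> Hs i \<subseteq> H"
  by (cases i) auto

lemma T_Hs: "x \<in> Hs (Suc i) \<Longrightarrow> T x \<in> Hs i"
  by auto

lemma T_diff: "x \<in> H \<Longrightarrow> y \<in> H \<Longrightarrow> T (x - y) = T x - T y"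
  using T_add[of x "Cst (- 1) * y"] T_scale[of y "-1"] H_scale[of y "-1"] by (simp add: hom_distribs)

text \<open>A vector whose \<open>n = dim V\<close> iterates are all defined satisfies \<open>q(T) x = 0\<close> for some polynomial
  \<open>q\<close>; splitting off linear factors of \<open>q\<close> one by one finds an eigenvector.\<close>

definition act :: "'k poly \<Rightarrow> 'k pol \<Rightarrow> 'k pol" where
  "act q x = (\<Sum>i\<le>degree q. Cst (coeff q i) * (T ^^ i) x)"

lemma act_bound: "degree q \<le> n \<Longrightarrow> act q x = (\<Sum>i\<le>n. Cst (coeff q i) * (T ^^ i) x)"
  unfolding act_def by (intro sum.mono_neutral_left) (auto simp: coeff_eq_0)

lemma iterate_Hs: "x \<in> Hs n \<Longrightarrow> i \<le> n \<Longrightarrow> (T ^^ i) x \<in> Hs (n - i)"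
proof (induction i)
  case (Suc i)
  then have "(T ^^ i) x \<in> Hs (n - i)" by simp
  moreover have "n - i = Suc (n - Suc i)" using Suc by simp
  ultimately show ?case by simp
qed simp

lemma T_sum:
  assumes "\<And>i. i \<in> A \<Longrightarrow> f i \<in> H"
  shows "T (sum f A) = (\<Sum>i\<in>A. T (f i)) \<and> sum f A \<in> H"
  using assms
  by (induction A rule: infinite_finite_induct)
    (auto simp: T_0 T_add intro: PolV.subspace_0[OF sub_H] H_add)

lemma act_eq_0:
  assumes x: "x \<in> Hs n" and q: "q \<noteq> 0" "degree q \<le> n" "act q x = 0"
  shows "x = 0"
  using q
proof (induction "degree q" arbitrary: q)
  case 0
  then obtain c where "q = [:c:]" "c \<noteq> 0" by (metis degree_eq_zeroE pCons_0_0)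
  then have "Cst c * x = 0" using 0 by (simp add: act_def)
  then show ?case using \<open>c \<noteq> 0\<close> by simp
next
  case (Suc m)
  obtain c where "poly q c = 0" using alg_closed_imp_poly_has_root[of q] Suc by auto
  then obtain q' where q': "q = [:- c, 1:] * q'" by (meson dvdE poly_eq_0_iff_dvd)
  then have q'0: "q' \<noteq> 0" using Suc.prems by auto
  then have "degree q = Suc (degree q')" unfolding q' by (subst degree_mult_eq) auto
  then have q'1: "m = degree q'" using Suc.hyps(2) by simp
  have mn: "Suc m \<le> n" using Suc by simp
  have xi: "(T ^^ i) x \<in> H" if "i \<le> m" for i
    using iterate_Hs[OF x, of i] Hs_H[of "n - i"] that mn by auto
  have eq: "q = pCons 0 q' - smult c q'" unfolding q' by simp
  have "act q x = (\<Sum>i\<le>Suc m. Cst (coeff q i) * (T ^^ i) x)"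
    using Suc.hyps(2) by (simp add: act_def)
  also have "\<dots> = (\<Sum>i\<le>Suc m. Cst (coeff (pCons 0 q') i) * (T ^^ i) x) - Cst c * (\<Sum>i\<le>Suc m. Cst (coeff q' i) * (T ^^ i) x)"
    unfolding sum_distrib_left sum_subtractf[symmetric]
  proof (intro sum.cong refl)
    fix i
    have "coeff q i = coeff (pCons 0 q') i - c * coeff q' i" unfolding eq by simp
    then show "Cst (coeff q i) * (T ^^ i) x = Cst (coeff (pCons 0 q') i) * (T ^^ i) x - Cst c * (Cst (coeff q' i) * (T ^^ i) x)"
      by (simp only: Cst.hom_minus Cst.hom_mult left_diff_distrib mult.assoc)
  qed
  also have "(\<Sum>i\<le>Suc m. Cst (coeff q' i) * (T ^^ i) x) = act q' x"
    using act_bound[of q' "Suc m"] q'1 by simp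
  also have "(\<Sum>i\<le>Suc m. Cst (coeff (pCons 0 q') i) * (T ^^ i) x) = (\<Sum>i\<le>m. Cst (coeff q' i) * (T ^^ Suc i) x)"
    by (subst sum.atMost_Suc_shift) simp
  also have "\<dots> = (\<Sum>i\<le>m. T (Cst (coeff q' i) * (T ^^ i) x))"
    using xi by (intro sum.cong) (auto simp: T_scale)
  also have "\<dots> = T (act q' x)"
    using T_sum[of "{..m}" "\<lambda>i. Cst (coeff q' i) * (T ^^ i) x"] xi H_scale q'1 by (simp add: act_def)
  finally have "T (act q' x) = Cst c * act q' x" using Suc.prems by simp
  moreover have "act q' x \<in> H"
    using T_sum[of "{..m}" "\<lambda>i. Cst (coeff q' i) * (T ^^ i) x"] xi H_scale q'1 by (simp add: act_def)
  ultimately have "act q' x = 0" using no_eigen by blast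
  then show ?case using Suc.hyps(1)[OF q'1 q'0] Suc.prems q'1 mn by simp
qed

text \<open>The \<open>card Bv + 1\<close> iterates of a vector in \<open>Hs (card Bv)\<close> are linearly dependent.\<close>

lemma Hs_trivial: "Hs (card Bv) = {0}"
proof -
  have "x = 0" if x: "x \<in> Hs (card Bv)" for x
  proof (rule ccontr)
    assume "x \<noteq> 0"
    let ?n = "card Bv"
    let ?f = "\<lambda>i. (T ^^ i) x"
    have fV: "?f ` {..?n} \<subseteq> PolV.span Bv"
      using iterate_Hs[OF x] Hs_antimono[of 0] by (auto simp: V_def)
    have "\<exists>c. (\<exists>i\<le>?n. c i \<noteq> 0) \<and> (\<Sum>i\<le>?n. Cst (c i) * ?f i) = 0"
    proof (cases "inj_on ?f {..?n}")
      case True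
      have "PolV.dependent (?f ` {..?n})"
      proof (rule ccontr)
        assume "\<not> ?thesis"
        then have "card (?f ` {..?n}) \<le> card Bv"
          using PolV.independent_span_bound[OF Bv(1) _ fV] by blast
        then show False using card_image[OF True] by simp
      qed
      then obtain u where u: "(\<Sum>p\<in>?f ` {..?n}. Cst (u p) * p) = 0" "\<exists>p\<in>?f ` {..?n}. u p \<noteq> 0"
        using PolV.dependent_finite[of "?f ` {..?n}"] by auto
      then have "(\<Sum>i\<le>?n. Cst (u (?f i)) * ?f i) = 0" using True by (simp add: sum.reindex)
      then show ?thesis using u(2) by (intro exI[of _ "\<lambda>i. u (?f i)"]) auto
    next
      case False
      then obtain i j where ij: "i \<le> ?n" "j \<le> ?n" "i \<noteq> j" "?f i = ?f j" by (auto simp: inj_on_def)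
      let ?c = "\<lambda>k. if k = i then 1 else if k = j then - 1 else (0 :: 'k)"
      have "(\<Sum>k\<le>?n. Cst (?c k) * ?f k) = (\<Sum>k\<in>{i, j}. Cst (?c k) * ?f k)"
        using ij by (intro sum.mono_neutral_right) auto
      also have "\<dots> = 0" using ij by (simp add: hom_distribs)
      finally show ?thesis using ij(1) by (intro exI[of _ ?c]) auto
    qed
    then obtain c i where c: "i \<le> ?n" "c i \<noteq> 0" "(\<Sum>i\<le>?n. Cst (c i) * ?f i) = 0" by blast
    define q where "q = (\<Sum>i\<le>?n. monom (c i) i)"
    have cq: "coeff q i = (if i \<le> ?n then c i else 0)" for i
      by (simp add: q_def coeff_sum)
    have "q \<noteq> 0" using c cq by (metis coeff_0)
    moreover have dq: "degree q \<le> ?n" by (rule degree_le) (simp add: cq)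
    moreover have "act q x = 0" unfolding act_bound[OF dq] using c(3) by (simp add: cq)
    ultimately show False using act_eq_0[OF x] \<open>x \<noteq> 0\<close> by blast
  qed
  then show ?thesis using Hs_0 by blast
qed

lemma lift_level:
  assumes x: "x \<in> Hs (Suc i)" "T x \<in> Hs (Suc i)"
  shows "x \<in> Hs (Suc (Suc i))"
  using x by simp

declare Hs.simps(2) [simp del]

text \<open>Let \<open>b\<close> be the last level with \<open>Hs b \<noteq> 0\<close> and \<open>v\<close> a vector there, and let \<open>a\<close> be the last level at
  which the orbit of \<open>v\<close> does not span \<open>Hs a\<close> modulo \<open>Hs (a + 1)\<close>, with \<open>u\<close> a further vector there.
  \<open>T\<close> induces injections of the successive quotients \<open>Hs (i + 1) / Hs (i + 2) \<rightarrow> Hs i / Hs (i + 1)\<close>, so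
  the two orbits stay independent modulo the next level, and they span each quotient because they
  span \<open>V / H\<close>.\<close>

theorem chain_basis:
  "\<exists>u v a b. a \<le> b \<and> a + b + 2 = card Bv \<and>
    (\<forall>i<a. (T ^^ i) u \<in> H) \<and> (\<forall>j<b. (T ^^ j) v \<in> H) \<and>
    (\<forall>c d. (\<Sum>i\<le>a. Cst (c i) * (T ^^ i) u) + (\<Sum>j\<le>b. Cst (d j) * (T ^^ j) v) = 0 \<longrightarrow>
       (\<forall>i\<le>a. c i = 0) \<and> (\<forall>j\<le>b. d j = 0)) \<and>
    (\<forall>x\<in>V. \<exists>c d. x = (\<Sum>i\<le>a. Cst (c i) * (T ^^ i) u) + (\<Sum>j\<le>b. Cst (d j) * (T ^^ j) v)) \<and>
    (\<forall>x\<in>H. \<exists>c d. x = (\<Sum>i<a. Cst (c i) * (T ^^ i) u) + (\<Sum>j<b. Cst (d j) * (T ^^ j) v)) \<and>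
    (T ^^ a) u \<in> V \<and> (T ^^ b) v \<in> V"
proof -
  have VBv: "Bv \<subseteq> V" by (simp add: V_def PolV.span_superset)
  have BhV: "Bh \<subseteq> V" using HV PolV.span_superset[of Bh] by (auto simp: H_def)
  have "Hs 0 \<noteq> {0}"
  proof
    assume "Hs 0 = {0}"
    then have "Bv \<subseteq> {0}" using VBv by simp
    moreover have "0 \<notin> Bv" using PolV.dependent_zero Bv by blast
    ultimately have "Bv = {}" by blast
    then show False using codim by simp
  qed
  define b' where "b' = (LEAST i. Hs i = {0})"
  have b': "Hs b' = {0}" unfolding b'_def by (rule LeastI[of _ "card Bv"]) (rule Hs_trivial)
  then have "b' \<noteq> 0" using \<open>Hs 0 \<noteq> {0}\<close> by metis
  then obtain b where b: "b' = Suc b" by (cases b') auto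
  have Hb1: "Hs (Suc b) = {0}" using b' b by simp
  have "Hs b \<noteq> {0}" using not_less_Least[of b "\<lambda>i. Hs i = {0}"] b by (simp add: b'_def)
  then obtain v where v: "v \<in> Hs b" "v \<noteq> 0" using Hs_0[of b] by auto
  define vv where "vv l = (T ^^ (b - l)) v" for l
  have vv: "vv l \<in> Hs l" if "l \<le> b" for l
    using iterate_Hs[OF v(1), of "b - l"] that by (simp add: vv_def)
  have Tvv: "T (vv (Suc l)) = vv l" if "Suc l \<le> b" for l
    using that by (simp add: vv_def Suc_diff_Suc[symmetric])
  define bad where "bad l \<longleftrightarrow> \<not> (\<forall>x\<in>Hs l. \<exists>c. x - Cst c * vv l \<in> Hs (Suc l))" for l
  have bad_le: "l \<le> b" if "bad l" for l
  proof (rule ccontr)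
    assume "\<not> l \<le> b"
    then have "Hs l = {0}" using Hs_antimono[of "Suc b" l] Hb1 Hs_0[of l] by auto
    then have "\<forall>x\<in>Hs l. x - Cst 0 * vv l \<in> Hs (Suc l)" using Hs_0[of "Suc l"] by auto
    then show False using that unfolding bad_def by blast
  qed
  have bad0: "bad 0"
  proof (rule ccontr)
    assume "\<not> bad 0"
    then have *: "\<forall>x\<in>V. \<exists>c. x - Cst c * vv 0 \<in> H" by (simp add: bad_def Hs_1)
    have "V \<subseteq> PolV.span (insert (vv 0) Bh)"
    proof
      fix x assume "x \<in> V"
      then obtain c where "x - Cst c * vv 0 \<in> PolV.span Bh" using * by (auto simp: H_def)
      then show "x \<in> PolV.span (insert (vv 0) Bh)" using PolV.span_breakdown_eq by blast
    qed
    then have "card Bv \<le> card (insert (vv 0) Bh)"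
      using PolV.independent_span_bound[of "insert (vv 0) Bh" Bv] Bv Bh VBv by auto
    also have "\<dots> \<le> card Bh + 1" using card_insert_le_m1 Bh(1) by (simp add: card_insert_if)
    finally show False using codim by simp
  qed
  define a where "a = Max {l. bad l}"
  have fb: "finite {l. bad l}" using bad_le by (auto intro: finite_subset[of _ "{..b}"])
  have abad: "bad a" using Max_in[OF fb] bad0 by (auto simp: a_def)
  have notbad: "\<not> bad l" if "l > a" for l using Max_ge[OF fb, of l] that by (auto simp: a_def)
  have ab: "a \<le> b" using bad_le[OF abad] .
  obtain u where u: "u \<in> Hs a" "\<And>c. u - Cst c * vv a \<notin> Hs (Suc a)" using abad by (auto simp: bad_def)
  define uu where "uu l = (T ^^ (a - l)) u" for l
  have uu: "uu l \<in> Hs l" if "l \<le> a" for l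
    using iterate_Hs[OF u(1), of "a - l"] that by (simp add: uu_def)
  have Tuu: "T (uu (Suc l)) = uu l" if "Suc l \<le> a" for l
    using that by (simp add: uu_def Suc_diff_Suc[symmetric])
  have v_indep: "d = 0" if "l \<le> b" "Cst d * vv l \<in> Hs (Suc l)" for l d
    using that
  proof (induction l rule: inc_induct)
    case base
    then have "Cst d * vv b \<in> {0}" unfolding Hb1 .
    then show ?case using v by (simp add: vv_def)
  next
    case (step l)
    have "Cst d * vv (Suc l) \<in> Hs (Suc l)" using vv step by (intro Hs_scale) auto
    moreover have "T (Cst d * vv (Suc l)) = Cst d * vv l"
      using T_scale[of "vv (Suc l)" d] Tvv[of l] vv[of "Suc l"] Hs_H[of "Suc l"] step by auto
    ultimately have "Cst d * vv (Suc l) \<in> Hs (Suc (Suc l))" using step lift_level by metis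
    then show ?case using step by blast
  qed
  have indep: "c = 0 \<and> d = 0" if "l \<le> a" "Cst c * uu l + Cst d * vv l \<in> Hs (Suc l)" for l c d
    using that
  proof (induction l rule: inc_induct)
    case base
    have "c = 0"
    proof (rule ccontr)
      assume c: "c \<noteq> 0"
      have "Cst (inverse c) * (Cst c * uu a + Cst d * vv a) \<in> Hs (Suc a)" using base by (rule Hs_scale)
      moreover have "Cst (inverse c) * (Cst c * uu a + Cst d * vv a) = (Cst (inverse c) * Cst c) * u + Cst (inverse c) * Cst d * vv a"
        by (simp add: uu_def algebra_simps)
      also have "\<dots> = u - Cst (- (inverse c * d)) * vv a" using c by (simp add: hom_distribs flip: Cst.hom_mult)
      ultimately show False using u(2) by metis
    qed
    then show ?case using v_indep[OF ab, of d] base by simp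
  next
    case (step l)
    let ?x = "Cst c * uu (Suc l) + Cst d * vv (Suc l)"
    have h: "uu (Suc l) \<in> Hs (Suc l)" "vv (Suc l) \<in> Hs (Suc l)" using uu vv step ab by auto
    then have hh: "uu (Suc l) \<in> H" "vv (Suc l) \<in> H" using Hs_H[of "Suc l"] by auto
    have "?x \<in> Hs (Suc l)" using h by (intro Hs_add Hs_scale)
    moreover have "T ?x = Cst c * uu l + Cst d * vv l"
      using T_add[OF H_scale[OF hh(1)] H_scale[OF hh(2)]] T_scale hh Tuu[of l] Tvv[of l] step ab by simp
    ultimately have "?x \<in> Hs (Suc (Suc l))" using step lift_level by metis
    then show ?case using step by blast
  qed
  \<comment> \<open>Spanning at level \<open>0\<close>: a basis of \<open>H\<close> together with the ends of the two chains is an independent set of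
    \<open>dim V\<close> vectors.\<close>
  have span0: "\<exists>c d. x - (Cst c * uu 0 + Cst d * vv 0) \<in> H" if "x \<in> V" for x
  proof -
    have uv: "uu 0 \<in> V" "vv 0 \<in> V" using uu[of 0] vv[of 0] by auto
    have h1: "vv 0 \<notin> PolV.span Bh" using indep[of 0 0 1] Hs_1 by (auto simp: H_def)
    have i1: "PolV.independent (insert (vv 0) Bh)" by (rule PolV.independent_insertI[OF h1 Bh(2)])
    have h2: "uu 0 \<notin> PolV.span (insert (vv 0) Bh)"
    proof
      assume "uu 0 \<in> PolV.span (insert (vv 0) Bh)"
      then obtain k where "uu 0 - Cst k * vv 0 \<in> H" using PolV.span_breakdown_eq unfolding H_def by blast
      then show False using indep[of 0 1 "- k"] Hs_1 by (simp add: hom_distribs)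
    qed
    have i2: "PolV.independent (insert (uu 0) (insert (vv 0) Bh))" by (rule PolV.independent_insertI[OF h2 i1])
    let ?S = "insert (uu 0) (insert (vv 0) Bh)"
    have cS: "card ?S = card Bv"
    proof -
      have "vv 0 \<notin> Bh" "uu 0 \<notin> insert (vv 0) Bh" using h1 h2 PolV.span_base[of "vv 0" Bh] PolV.span_base[of "uu 0" "insert (vv 0) Bh"] by argo+
      then show ?thesis using Bh(1) codim by (simp add: card_insert_if)
    qed
    have "?S \<subseteq> V" using uv BhV by auto
    have "V \<subseteq> PolV.span ?S"
    proof (rule ccontr)
      assume "\<not> ?thesis"
      then obtain y where y: "y \<in> V" "y \<notin> PolV.span ?S" by blast
      have "PolV.independent (insert y ?S)" by (rule PolV.independent_insertI[OF y(2) i2])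
      then have "card (insert y ?S) \<le> card Bv"
      proof (intro conjunct2[OF PolV.independent_span_bound[OF Bv(1)]])
        show "insert y ?S \<subseteq> PolV.span Bv" using \<open>?S \<subseteq> V\<close> y(1) unfolding V_def by blast
      qed
      moreover have "y \<notin> ?S" using y(2) PolV.span_base[of y ?S] by argo
      then have "card (insert y ?S) = Suc (card ?S)" using Bh(1) by (intro card_insert_disjoint) auto
      ultimately show False using cS by simp
    qed
    then have "x \<in> PolV.span ?S" using that by blast
    then obtain c where "x - Cst c * uu 0 \<in> PolV.span (insert (vv 0) Bh)" using PolV.span_breakdown_eq by blast
    then obtain d where "x - Cst c * uu 0 - Cst d * vv 0 \<in> PolV.span Bh" using PolV.span_breakdown_eq by blast
    then show ?thesis by (intro exI[of _ c] exI[of _ d]) (simp add: H_def algebra_simps)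
  qed
  \<comment> \<open>Subtracting a combination of the two chains from \<open>x\<close> moves \<open>T x\<close>, and with it \<open>x\<close>, one level up.\<close>
  have span_le: "\<forall>x\<in>Hs l. \<exists>c d. x - (Cst c * uu l + Cst d * vv l) \<in> Hs (Suc l)" if "l \<le> a" for l
    using that
  proof (induction l)
    case 0
    then show ?case using span0 Hs_1 by simp
  next
    case (Suc l)
    show ?case
    proof
      fix x assume x: "x \<in> Hs (Suc l)"
      have "\<forall>x\<in>Hs l. \<exists>c d. x - (Cst c * uu l + Cst d * vv l) \<in> Hs (Suc l)" using Suc by simp
      then obtain c d where cd: "T x - (Cst c * uu l + Cst d * vv l) \<in> Hs (Suc l)" using T_Hs[OF x] by blast
      have h: "uu (Suc l) \<in> Hs (Suc l)" "vv (Suc l) \<in> Hs (Suc l)" using uu vv Suc ab by auto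
      then have hh: "uu (Suc l) \<in> H" "vv (Suc l) \<in> H" "x \<in> H" using x Hs_H[of "Suc l"] by auto
      let ?y = "Cst c * uu (Suc l) + Cst d * vv (Suc l)"
      have y: "?y \<in> H" using hh by (intro H_add H_scale)
      have "T ?y = Cst c * uu l + Cst d * vv l"
        using T_add[OF H_scale[OF hh(1)] H_scale[OF hh(2)]] T_scale hh Tuu[of l] Tvv[of l] Suc ab by simp
      then have "T (x - ?y) \<in> Hs (Suc l)" using T_diff[OF hh(3) y] cd by simp
      moreover have "x - ?y \<in> Hs (Suc l)" using x h by (intro Hs_diff Hs_add Hs_scale)
      ultimately have "x - ?y \<in> Hs (Suc (Suc l))" using lift_level by blast
      then show "\<exists>c d. x - (Cst c * uu (Suc l) + Cst d * vv (Suc l)) \<in> Hs (Suc (Suc l))" by blast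
    qed
  qed
  have span_all: "\<exists>c d. x = (\<Sum>k\<in>{l..a}. Cst (c k) * uu k) + (\<Sum>k\<in>{l..b}. Cst (d k) * vv k)"
    if "l \<le> Suc b" "x \<in> Hs l" for l x
    using that
  proof (induction l arbitrary: x rule: inc_induct)
    case base
    then have "x = 0" using Hb1 by simp
    then show ?case by (intro exI[of _ "\<lambda>_. 0"]) simp
  next
    case (step l)
    then have lb: "l \<le> b" by simp
    have "\<exists>c d. (l > a \<longrightarrow> c = 0) \<and> x - (Cst c * uu l + Cst d * vv l) \<in> Hs (Suc l)"
    proof (cases "l \<le> a")
      case True
      then show ?thesis using span_le[OF True] step.prems by auto
    next
      case False
      then have "\<not> bad l" using notbad by simp
      then obtain d where "x - Cst d * vv l \<in> Hs (Suc l)" using step.prems by (auto simp: bad_def)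
      then show ?thesis by (intro exI[of _ 0] exI[of _ d]) simp
    qed
    then obtain c d where cd: "l > a \<longrightarrow> c = 0" "x - (Cst c * uu l + Cst d * vv l) \<in> Hs (Suc l)" by blast
    from step.IH[OF cd(2)] obtain c' d' where
      eq: "x - (Cst c * uu l + Cst d * vv l) = (\<Sum>k\<in>{Suc l..a}. Cst (c' k) * uu k) + (\<Sum>k\<in>{Suc l..b}. Cst (d' k) * vv k)" by blast
    have 1: "(\<Sum>k\<in>{l..a}. Cst ((c'(l := c)) k) * uu k) = Cst c * uu l + (\<Sum>k\<in>{Suc l..a}. Cst (c' k) * uu k)"
      using cd(1) by (cases "l \<le> a") (auto simp: sum.atLeast_Suc_atMost)
    have 2: "(\<Sum>k\<in>{l..b}. Cst ((d'(l := d)) k) * vv k) = Cst d * vv l + (\<Sum>k\<in>{Suc l..b}. Cst (d' k) * vv k)"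
      using lb by (auto simp: sum.atLeast_Suc_atMost)
    have "x = Cst c * uu l + Cst d * vv l + ((\<Sum>k\<in>{Suc l..a}. Cst (c' k) * uu k) + (\<Sum>k\<in>{Suc l..b}. Cst (d' k) * vv k))"
      using eq by (simp add: algebra_simps)
    then have "x = (\<Sum>k\<in>{l..a}. Cst ((c'(l := c)) k) * uu k) + (\<Sum>k\<in>{l..b}. Cst ((d'(l := d)) k) * vv k)"
      unfolding 1 2 by (simp add: algebra_simps)
    then show ?case by blast
  qed
  have re_u: "(\<Sum>i\<le>a. Cst (c i) * (T ^^ i) u) = (\<Sum>k\<in>{0..a}. Cst (c (a - k)) * uu k)" for c
    unfolding uu_def by (rule sum.reindex_bij_witness[of _ "\<lambda>k. a - k" "\<lambda>k. a - k"]) auto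
  have re_v: "(\<Sum>i\<le>b. Cst (c i) * (T ^^ i) v) = (\<Sum>k\<in>{0..b}. Cst (c (b - k)) * vv k)" for c
    unfolding vv_def by (rule sum.reindex_bij_witness[of _ "\<lambda>k. b - k" "\<lambda>k. b - k"]) auto
  have re_u': "(\<Sum>k\<in>{Suc 0..a}. Cst (c k) * uu k) = (\<Sum>i<a. Cst (c (a - i)) * (T ^^ i) u)" for c
    unfolding uu_def by (rule sum.reindex_bij_witness[of _ "\<lambda>k. a - k" "\<lambda>k. a - k"]) auto
  have re_v': "(\<Sum>k\<in>{Suc 0..b}. Cst (c k) * vv k) = (\<Sum>i<b. Cst (c (b - i)) * (T ^^ i) v)" for c
    unfolding vv_def by (rule sum.reindex_bij_witness[of _ "\<lambda>k. b - k" "\<lambda>k. b - k"]) auto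
  have re_u2: "(\<Sum>k\<in>{0..a}. Cst (c k) * uu k) = (\<Sum>i\<le>a. Cst (c (a - i)) * (T ^^ i) u)" for c
    unfolding uu_def by (rule sum.reindex_bij_witness[of _ "\<lambda>k. a - k" "\<lambda>k. a - k"]) auto
  have re_v2: "(\<Sum>k\<in>{0..b}. Cst (c k) * vv k) = (\<Sum>i\<le>b. Cst (c (b - i)) * (T ^^ i) v)" for c
    unfolding vv_def by (rule sum.reindex_bij_witness[of _ "\<lambda>k. b - k" "\<lambda>k. b - k"]) auto
  \<comment> \<open>Consider the lowest level at which a nonzero coefficient occurs.\<close>
  have lvl: "(\<forall>k\<in>{l..a}. c k = 0) \<and> (\<forall>k\<in>{l..b}. d k = 0)"
    if "l \<le> Suc b" "(\<Sum>k\<in>{l..a}. Cst (c k) * uu k) + (\<Sum>k\<in>{l..b}. Cst (d k) * vv k) = 0" for l c d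
  proof (rule ccontr)
    assume neg: "\<not> ?thesis"
    define z where "z = (LEAST k. k \<ge> l \<and> (k \<le> a \<and> c k \<noteq> 0 \<or> k \<le> b \<and> d k \<noteq> 0))"
    have ex: "\<exists>k. k \<ge> l \<and> (k \<le> a \<and> c k \<noteq> 0 \<or> k \<le> b \<and> d k \<noteq> 0)" using neg by auto
    have z: "z \<ge> l" "z \<le> a \<and> c z \<noteq> 0 \<or> z \<le> b \<and> d z \<noteq> 0" using LeastI_ex[OF ex] by (auto simp: z_def)
    have zmin: "k \<le> a \<Longrightarrow> c k = 0" "k \<le> b \<Longrightarrow> d k = 0" if "l \<le> k" "k < z" for k
      using not_less_Least[of k "\<lambda>k. k \<ge> l \<and> (k \<le> a \<and> c k \<noteq> 0 \<or> k \<le> b \<and> d k \<noteq> 0)"] that by (auto simp: z_def)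
    have zb: "z \<le> b" using z ab by auto
    have s1: "(\<Sum>k\<in>{l..a}. Cst (c k) * uu k) = (\<Sum>k\<in>{z..a}. Cst (c k) * uu k)"
      using z zmin by (intro sum.mono_neutral_right) (auto simp: not_le)
    have s2: "(\<Sum>k\<in>{l..b}. Cst (d k) * vv k) = (\<Sum>k\<in>{z..b}. Cst (d k) * vv k)"
      using z zmin by (intro sum.mono_neutral_right) (auto simp: not_le)
    have t1: "(\<Sum>k\<in>{Suc z..a}. Cst (c k) * uu k) \<in> Hs (Suc z)"
      using uu Hs_antimono[of "Suc z"] by (intro PolV.subspace_sum[OF sub_Hs] Hs_scale) auto
    have t2: "(\<Sum>k\<in>{Suc z..b}. Cst (d k) * vv k) \<in> Hs (Suc z)"
      using vv Hs_antimono[of "Suc z"] by (intro PolV.subspace_sum[OF sub_Hs] Hs_scale) auto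
    have s2': "(\<Sum>k\<in>{z..b}. Cst (d k) * vv k) = Cst (d z) * vv z + (\<Sum>k\<in>{Suc z..b}. Cst (d k) * vv k)"
      using zb by (simp add: sum.atLeast_Suc_atMost)
    show False
    proof (cases "z \<le> a")
      case True
      have s1': "(\<Sum>k\<in>{z..a}. Cst (c k) * uu k) = Cst (c z) * uu z + (\<Sum>k\<in>{Suc z..a}. Cst (c k) * uu k)"
        using True by (simp add: sum.atLeast_Suc_atMost)
      have "Cst (c z) * uu z + Cst (d z) * vv z = 0 - ((\<Sum>k\<in>{Suc z..a}. Cst (c k) * uu k) + (\<Sum>k\<in>{Suc z..b}. Cst (d k) * vv k))"
        using that(2) eq_neg_iff_add_eq_0[of "Cst (c z) * uu z + Cst (d z) * vv z"
          "(\<Sum>k\<in>{Suc z..a}. Cst (c k) * uu k) + (\<Sum>k\<in>{Suc z..b}. Cst (d k) * vv k)"]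
        unfolding s1 s2 s1' s2' by (simp add: add_ac)
      also have "\<dots> \<in> Hs (Suc z)" by (rule Hs_diff[OF Hs_0 Hs_add[OF t1 t2]])
      finally show False using indep[OF True] z by blast
    next
      case False
      have "Cst (d z) * vv z = 0 - (\<Sum>k\<in>{Suc z..b}. Cst (d k) * vv k)"
        using that(2) False eq_neg_iff_add_eq_0[of "Cst (d z) * vv z" "\<Sum>k\<in>{Suc z..b}. Cst (d k) * vv k"]
        unfolding s1 s2 s2' by simp
      also have "\<dots> \<in> Hs (Suc z)" by (rule Hs_diff[OF Hs_0 t2])
      finally show False using v_indep[OF zb] z False by blast
    qed
  qed
  have R1: "\<forall>i<a. (T ^^ i) u \<in> H"
  proof (intro allI impI)
    fix i assume "i < a" then show "(T ^^ i) u \<in> H" using iterate_Hs[OF u(1), of i] Hs_H[of "a - i"] by auto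
  qed
  have R2: "\<forall>j<b. (T ^^ j) v \<in> H"
  proof (intro allI impI)
    fix i assume "i < b" then show "(T ^^ i) v \<in> H" using iterate_Hs[OF v(1), of i] Hs_H[of "b - i"] by auto
  qed
  have R7: "(T ^^ a) u \<in> V" using iterate_Hs[OF u(1), of a] by simp
  have R8: "(T ^^ b) v \<in> V" using iterate_Hs[OF v(1), of b] by simp
  have ind: "(\<forall>i\<le>a. c i = 0) \<and> (\<forall>j\<le>b. d j = 0)"
    if "(\<Sum>i\<le>a. Cst (c i) * (T ^^ i) u) + (\<Sum>j\<le>b. Cst (d j) * (T ^^ j) v) = 0" for c d
  proof -
    have *: "(\<forall>k\<in>{0..a}. c (a - k) = 0) \<and> (\<forall>k\<in>{0..b}. d (b - k) = 0)"
      using lvl[of 0 "\<lambda>k. c (a - k)" "\<lambda>k. d (b - k)"] that unfolding re_u re_v by simp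
    show ?thesis
    proof (intro conjI allI impI)
      fix i assume i: "i \<le> a"
      show "c i = 0" using bspec[OF conjunct1[OF *], of "a - i"] i by simp
    next
      fix i assume i: "i \<le> b"
      show "d i = 0" using bspec[OF conjunct2[OF *], of "b - i"] i by simp
    qed
  qed
  have spV: "\<forall>x\<in>V. \<exists>c d. x = (\<Sum>i\<le>a. Cst (c i) * (T ^^ i) u) + (\<Sum>j\<le>b. Cst (d j) * (T ^^ j) v)"
  proof
    fix x assume "x \<in> V"
    then obtain c d where "x = (\<Sum>k\<in>{0..a}. Cst (c k) * uu k) + (\<Sum>k\<in>{0..b}. Cst (d k) * vv k)"
      using span_all[of 0 x] by auto
    then show "\<exists>c d. x = (\<Sum>i\<le>a. Cst (c i) * (T ^^ i) u) + (\<Sum>j\<le>b. Cst (d j) * (T ^^ j) v)"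
      unfolding re_u2 re_v2 
      by - (rule exI[of _ "\<lambda>i. c (a - i)"], rule exI[of _ "\<lambda>i. d (b - i)"], assumption)
  qed
  have spH: "\<forall>x\<in>H. \<exists>c d. x = (\<Sum>i<a. Cst (c i) * (T ^^ i) u) + (\<Sum>j<b. Cst (d j) * (T ^^ j) v)"
  proof
    fix x assume "x \<in> H"
    then obtain c d where "x = (\<Sum>k\<in>{Suc 0..a}. Cst (c k) * uu k) + (\<Sum>k\<in>{Suc 0..b}. Cst (d k) * vv k)"
      using span_all[of "Suc 0" x] Hs_1 by auto
    then show "\<exists>c d. x = (\<Sum>i<a. Cst (c i) * (T ^^ i) u) + (\<Sum>j<b. Cst (d j) * (T ^^ j) v)"
      unfolding re_u' re_v' 
      by - (rule exI[of _ "\<lambda>i. c (a - i)"], rule exI[of _ "\<lambda>i. d (b - i)"], assumption)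
  qed
  have R0: "a + b + 2 = card Bv"
  proof -
    \<comment> \<open>The chains together form a basis of \<open>V\<close>.\<close>
    define f where "f w = (case w of Inl i \<Rightarrow> (T ^^ i) u | Inr j \<Rightarrow> (T ^^ j) v)" for w :: "nat + nat"
    define A where "A = {..a} <+> {..b}"
    have cA: "card A = a + b + 2" by (simp add: A_def card_Plus)
    have fA: "finite A" by (simp add: A_def)
    have sumA: "(\<Sum>w\<in>A. g w) = (\<Sum>i\<le>a. g (Inl i)) + (\<Sum>j\<le>b. g (Inr j))" for g :: "nat + nat \<Rightarrow> 'k pol"
      unfolding A_def by (simp add: sum.Plus)
    have indA: "\<forall>w\<in>A. e w = 0" if "(\<Sum>w\<in>A. Cst (e w) * f w) = 0" for e
    proof
      have "(\<Sum>i\<le>a. Cst (e (Inl i)) * (T ^^ i) u) + (\<Sum>j\<le>b. Cst (e (Inr j)) * (T ^^ j) v) = 0"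
        using that unfolding sumA by (simp add: f_def)
      from ind[OF this] have "\<And>i. i \<le> a \<Longrightarrow> e (Inl i) = 0" "\<And>j. j \<le> b \<Longrightarrow> e (Inr j) = 0" by blast+
      then show "e w = 0" if "w \<in> A" for w using that by (cases w) (auto simp: A_def)
    qed
    have inj: "inj_on f A"
    proof (rule inj_onI, rule ccontr)
      fix w w' assume w: "w \<in> A" "w' \<in> A" "f w = f w'" "w \<noteq> w'"
      let ?e = "\<lambda>x. if x = w then 1 else if x = w' then - 1 else (0 :: 'k)"
      have "(\<Sum>x\<in>A. Cst (?e x) * f x) = (\<Sum>x\<in>{w, w'}. Cst (?e x) * f x)"
        using w fA by (intro sum.mono_neutral_right) auto
      also have "\<dots> = 0" using w by (simp add: hom_distribs)
      finally show False using indA[of ?e] w(1) by auto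
    qed
    have "PolV.independent (f ` A)"
    proof
      assume "PolV.dependent (f ` A)"
      then obtain e where e: "(\<Sum>p\<in>f ` A. Cst (e p) * p) = 0" "\<exists>p\<in>f ` A. e p \<noteq> 0"
        using PolV.dependent_finite[of "f ` A"] fA by auto
      then have "(\<Sum>w\<in>A. Cst (e (f w)) * f w) = 0" using inj by (simp add: sum.reindex)
      then show False using indA[of "\<lambda>w. e (f w)"] e(2) by auto
    qed
    moreover have "f ` A \<subseteq> V"
    proof
      fix x assume "x \<in> f ` A"
      then consider i where "i \<le> a" "x = (T ^^ i) u" | j where "j \<le> b" "x = (T ^^ j) v"
        by (auto simp: A_def f_def)
      then show "x \<in> V"
      proof cases
        case 1 then show ?thesis using iterate_Hs[OF u(1), of i] Hs_antimono[of 0 "a - i"] by auto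
      next
        case 2 then show ?thesis using iterate_Hs[OF v(1), of j] Hs_antimono[of 0 "b - j"] by auto
      qed
    qed
    ultimately have le: "card (f ` A) \<le> card Bv"
      using PolV.independent_span_bound[OF Bv(1)] by (simp add: V_def)
    have "Bv \<subseteq> PolV.span (f ` A)"
    proof
      fix x assume "x \<in> Bv"
      then obtain c d where "x = (\<Sum>i\<le>a. Cst (c i) * (T ^^ i) u) + (\<Sum>j\<le>b. Cst (d j) * (T ^^ j) v)" using spV VBv by blast
      moreover have "(T ^^ i) u \<in> f ` A" if "i \<le> a" for i using that by (intro image_eqI[of _ _ "Inl i"]) (auto simp: f_def A_def)
      moreover have "(T ^^ j) v \<in> f ` A" if "j \<le> b" for j using that by (intro image_eqI[of _ _ "Inr j"]) (auto simp: f_def A_def)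
      ultimately show "x \<in> PolV.span (f ` A)"
        by (auto intro!: PolV.span_add PolV.span_sum PolV.span_scale[OF PolV.span_base])
    qed
    then have "card Bv \<le> card (f ` A)" using PolV.independent_span_bound[of "f ` A" Bv] fA Bv by auto
    with le show ?thesis using card_image[OF inj] cA by simp
  qed
  show ?thesis
    by (rule exI[of _ u], rule exI[of _ v], rule exI[of _ a], rule exI[of _ b])
      (intro conjI ab R0 R1 R2 R7 R8 spV spH allI impI ind)
qed

end

section \<open>The coordinate ring of the scroll\<close>

text \<open>In the target of the substitution the indeterminates \<open>Vx\<close>, \<open>Vy\<close>, \<open>Vw 0\<close>, \<open>Vw 1\<close> serve as \<open>p\<close>, \<open>\<lambda>\<close>, \<open>q\<close>,
  \<open>r\<close>.\<close>

locale scroll =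
  fixes a b :: nat and ty :: "'k::alg_closed_field itself"
  assumes ab: "a \<le> b" and b_pos: "0 < b"
begin

abbreviation "tvars \<equiv> {Vx, Vy, Vz, Vw 0, Vw (Suc 0)}"

abbreviation pp :: "'k pol" where "pp \<equiv> Var Vx"
abbreviation lam :: "'k pol" where "lam \<equiv> Var Vy"
abbreviation zz :: "'k pol" where "zz \<equiv> Var Vz"
abbreviation qq :: "'k pol" where "qq \<equiv> Var (Vw 0)"
abbreviation rr :: "'k pol" where "rr \<equiv> Var (Vw (Suc 0))"

definition cone :: "(indet \<Rightarrow>\<^sub>0 nat) set" where
  "cone = {m. Poly_Mapping.keys m \<subseteq> tvars \<and>
     Poly_Mapping.lookup m Vy \<le> Poly_Mapping.lookup m Vx + a * Poly_Mapping.lookup m (Vw 0) + b * Poly_Mapping.lookup m (Vw (Suc 0))}"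

definition toric :: "'k pol set" where
  "toric = {f. Poly_Mapping.keys f \<subseteq> cone}"

lemma cone_add: "m \<in> cone \<Longrightarrow> m' \<in> cone \<Longrightarrow> m + m' \<in> cone"
  by (auto simp: cone_def keys_add_nat lookup_add algebra_simps)

lemma cone_0 [simp]: "0 \<in> cone"
  by (simp add: cone_def)

lemma toric_Mon: "Mon m \<in> toric \<longleftrightarrow> m \<in> cone"
  by (simp add: toric_def)

lemma toric_PV: "f \<in> toric \<Longrightarrow> f \<in> PV tvars"
  by (auto simp: toric_def cone_def PV_iff)

sublocale toric: subalgebra toric
proof
  fix c show "Cst c \<in> toric" by (auto simp: toric_def Cst_def)
next
  fix p q assume "p \<in> toric" "q \<in> toric"
  then show "p + q \<in> toric" using keys_add[of p q] by (auto simp: toric_def)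
next
  fix p q assume "p \<in> toric" "q \<in> toric"
  then show "p * q \<in> toric" using keys_mult[of p q] by (fastforce simp: toric_def intro: cone_add)
qed

text \<open>The monomial \<open>p\<^sup>i q\<^sup>j r\<^sup>k \<lambda>\<^sup>c z\<^sup>e\<close>.\<close>

definition tmon :: "nat \<Rightarrow> nat \<Rightarrow> nat \<Rightarrow> nat \<Rightarrow> nat \<Rightarrow> indet \<Rightarrow>\<^sub>0 nat" where
  "tmon i j k c e = Poly_Mapping.single Vx i + (Poly_Mapping.single (Vw 0) j +
     (Poly_Mapping.single (Vw (Suc 0)) k + (Poly_Mapping.single Vy c + Poly_Mapping.single Vz e)))"

lemma Mon_tmon: "Mon (tmon i j k c e) = pp ^ i * (qq ^ j * (rr ^ k * (lam ^ c * zz ^ e)))"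
  by (simp add: tmon_def Mon_add Mon_single)

lemma lookup_tmon [simp]:
  "Poly_Mapping.lookup (tmon i j k c e) Vx = i"
  "Poly_Mapping.lookup (tmon i j k c e) (Vw 0) = j"
  "Poly_Mapping.lookup (tmon i j k c e) (Vw (Suc 0)) = k"
  "Poly_Mapping.lookup (tmon i j k c e) Vy = c"
  "Poly_Mapping.lookup (tmon i j k c e) Vz = e"
  by (simp_all add: tmon_def lookup_add lookup_single)

lemma keys_tmon: "Poly_Mapping.keys (tmon i j k c e) \<subseteq> tvars"
  by (auto simp: tmon_def keys_add_nat)

lemma tmon_cone [simp]: "tmon i j k c e \<in> cone \<longleftrightarrow> c \<le> i + a * j + b * k"
  using keys_tmon[of i j k c e] by (simp add: cone_def)

lemma lookup_tmon_other: "v \<notin> tvars \<Longrightarrow> Poly_Mapping.lookup (tmon i j k c e) v = 0"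
  using keys_tmon[of i j k c e] not_in_keys_iff_lookup_eq_zero[of v "tmon i j k c e"] by blast

lemma eq_tmon:
  assumes "Poly_Mapping.keys m \<subseteq> tvars"
  shows "m = tmon (Poly_Mapping.lookup m Vx) (Poly_Mapping.lookup m (Vw 0)) (Poly_Mapping.lookup m (Vw (Suc 0)))
     (Poly_Mapping.lookup m Vy) (Poly_Mapping.lookup m Vz)" (is "m = ?t")
proof (rule poly_mapping_eqI)
  fix v
  show "Poly_Mapping.lookup m v = Poly_Mapping.lookup ?t v"
  proof (cases "v \<in> tvars")
    case False
    then have "Poly_Mapping.lookup m v = 0" using assms not_in_keys_iff_lookup_eq_zero[of v m] by blast
    then show ?thesis using lookup_tmon_other[OF False] by simp
  qed auto
qed

lemma cone_E:
  assumes "m \<in> cone"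
  obtains i j k c e where "m = tmon i j k c e" "c \<le> i + a * j + b * k"
proof -
  have "m = tmon (Poly_Mapping.lookup m Vx) (Poly_Mapping.lookup m (Vw 0)) (Poly_Mapping.lookup m (Vw (Suc 0)))
     (Poly_Mapping.lookup m Vy) (Poly_Mapping.lookup m Vz)"
    by (rule eq_tmon) (use assms in \<open>simp add: cone_def\<close>)
  then show ?thesis using assms tmon_cone that by metis
qed

lemma toric_gens: "pp \<in> toric" "lam * pp \<in> toric" "zz \<in> toric" "l \<le> a \<Longrightarrow> lam ^ l * qq \<in> toric" "l \<le> b \<Longrightarrow> lam ^ l * rr \<in> toric"
proof -
  have "Mon (tmon 1 0 0 0 0) \<in> toric" "Mon (tmon 1 0 0 1 0) \<in> toric" "Mon (tmon 0 0 0 0 1) \<in> toric"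
    "l \<le> a \<Longrightarrow> Mon (tmon 0 1 0 l 0) \<in> toric" "l \<le> b \<Longrightarrow> Mon (tmon 0 0 1 l 0) \<in> toric"
    unfolding toric_Mon by auto
  then show "pp \<in> toric" "lam * pp \<in> toric" "zz \<in> toric" "l \<le> a \<Longrightarrow> lam ^ l * qq \<in> toric" "l \<le> b \<Longrightarrow> lam ^ l * rr \<in> toric"
    unfolding Mon_tmon by (simp_all add: mult.commute)
qed

end

subsection \<open>Straightening\<close>

text \<open>Modulo the relations \<open>y u\<^sub>i = x u\<^sub>i\<^sub>+\<^sub>1\<close> and \<open>y v\<^sub>j = x v\<^sub>j\<^sub>+\<^sub>1\<close> alone, a factor \<open>x\<close> or \<open>y\<close> in a monomial
  carries a unit of height from any factor to any other. So every monomial containing \<open>x\<close> or \<open>y\<close> is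
  congruent to the one where the height is collected greedily in the \<open>v\<close>s, then in the \<open>u\<close>s.\<close>

locale straightening =
  fixes S :: "'k::alg_closed_field pol set" and L :: "'k pol set" and x y :: "'k pol"
  assumes S: "subalgebra S" and L: "ideal L (sub_ring S)" and xy: "x \<in> S" "y \<in> S"
begin

interpretation S: subalgebra S by (rule S)
interpretation L: ideal L "sub_ring S" by (rule L)

definition cg :: "'k pol \<Rightarrow> 'k pol \<Rightarrow> bool" where
  "cg f g \<longleftrightarrow> f - g \<in> L"

lemma L_mult: "f \<in> S \<Longrightarrow> g \<in> L \<Longrightarrow> f * g \<in> L"
  using L.I_l_closed[of g f] by simp

lemma L_add: "f \<in> L \<Longrightarrow> g \<in> L \<Longrightarrow> f + g \<in> L"
  using L.a_closed[of f g] by simp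

lemma L_0: "0 \<in> L"
  using L.zero_closed by simp

lemma cg_refl [simp]: "cg f f"
  by (simp add: cg_def L_0)

lemma cg_trans [trans]: "cg f g \<Longrightarrow> cg g h \<Longrightarrow> cg f h"
  unfolding cg_def using L_add[of "f - g" "g - h"] by simp

lemma cg_sym: "cg f g \<Longrightarrow> cg g f"
  unfolding cg_def using L_mult[of "Cst (- 1)" "f - g"] S.K_Cst[of "- 1"] by (simp add: hom_distribs)

lemma cg_mult: "h \<in> S \<Longrightarrow> cg f g \<Longrightarrow> cg (h * f) (h * g)"
  unfolding cg_def using L_mult[of h "f - g"] by (simp add: right_diff_distrib)

lemma cg_add: "cg f g \<Longrightarrow> cg f' g' \<Longrightarrow> cg (f + f') (g + g')"
  unfolding cg_def using L_add[of "f - g" "f' - g'"] by (simp add: algebra_simps)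

lemma cg_sum: "(\<And>i. i \<in> A \<Longrightarrow> cg (f i) (g i)) \<Longrightarrow> cg (sum f A) (sum g A)"
  by (induction A rule: infinite_finite_induct) (auto intro: cg_add)

text \<open>\<open>s i c\<close> stands for a standard monomial with \<open>i\<close> factors among \<open>x\<close>, \<open>y\<close> and total height \<open>c\<close>, the height
  of \<open>y\<close>, \<open>u\<^sub>f\<close>, \<open>v\<^sub>f\<close> being \<open>1\<close>, \<open>f\<close>, \<open>f\<close>. The other factors contribute a height of at most \<open>M\<close>.\<close>

definition good :: "nat \<Rightarrow> (nat \<Rightarrow> nat \<Rightarrow> 'k pol) \<Rightarrow> bool" where
  "good M s \<longleftrightarrow> (\<forall>i c. c \<le> i + M \<longrightarrow> s i c \<in> S \<and> cg (x * s i c) (s (Suc i) c) \<and> cg (y * s i c) (s (Suc i) (Suc c)))"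

definition chain :: "nat \<Rightarrow> (nat \<Rightarrow> 'k pol) \<Rightarrow> bool" where
  "chain e t \<longleftrightarrow> (\<forall>f\<le>e. t f \<in> S) \<and> (\<forall>f<e. cg (y * t f) (x * t (Suc f)))"

text \<open>A new factor from a chain of length \<open>e\<close> takes over as much of the height as it can.\<close>

definition extend :: "nat \<Rightarrow> (nat \<Rightarrow> 'k pol) \<Rightarrow> (nat \<Rightarrow> nat \<Rightarrow> 'k pol) \<Rightarrow> nat \<Rightarrow> nat \<Rightarrow> 'k pol" where
  "extend e t s i c = t (min c e) * s i (c - min c e)"

lemma good_extend:
  assumes s: "good M s" and t: "chain e t"
  shows "good (M + e) (extend e t s)"
  unfolding good_def
proof (intro allI impI conjI)
  fix i c assume c: "c \<le> i + (M + e)"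
  define m where "m = min c e"
  have m: "m \<le> e" "c - m \<le> i + M" using c by (auto simp: m_def)
  have tm: "t m \<in> S" using t m by (auto simp: chain_def)
  have sc: "s i (c - m) \<in> S" "cg (x * s i (c - m)) (s (Suc i) (c - m))" "cg (y * s i (c - m)) (s (Suc i) (Suc (c - m)))"
    using s m by (auto simp: good_def)
  show "extend e t s i c \<in> S" using tm sc by (auto simp: extend_def m_def[symmetric])
  have "cg (t m * (x * s i (c - m))) (t m * s (Suc i) (c - m))" using tm sc by (intro cg_mult)
  then show "cg (x * extend e t s i c) (extend e t s (Suc i) c)"
    by (simp add: extend_def m_def[symmetric] mult.left_commute)
  show "cg (y * extend e t s i c) (extend e t s (Suc i) (Suc c))"
  proof (cases "c < e")
    case True
    then have m': "m = c" by (simp add: m_def)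
    have "cg (s i 0 * (y * t c)) (s i 0 * (x * t (Suc c)))" using t True sc m' by (intro cg_mult) (auto simp: chain_def)
    also have "s i 0 * (x * t (Suc c)) = t (Suc c) * (x * s i 0)" by simp
    also have "cg \<dots> (t (Suc c) * s (Suc i) 0)" using t True sc m' by (intro cg_mult) (auto simp: chain_def)
    finally show ?thesis using True by (simp add: extend_def mult_ac)
  next
    case False
    then have m': "m = e" by (simp add: m_def)
    have "cg (t e * (y * s i (c - e))) (t e * s (Suc i) (Suc (c - e)))" using tm sc m' by (intro cg_mult) auto
    then show ?thesis using False by (simp add: extend_def mult_ac Suc_diff_le)
  qed
qed

text \<open>The relations pass one unit of height from a factor of \<open>s\<close> through \<open>y\<close> to \<open>t\<close>; this needs a factor \<open>x\<close>
  or \<open>y\<close>, whence the index \<open>Suc i\<close>.\<close>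

lemma shift_height:
  assumes s: "good M s" and t: "chain e t"
  shows "f + d \<le> e \<Longrightarrow> c + d \<le> Suc i + M \<Longrightarrow> cg (t f * s (Suc i) (c + d)) (t (f + d) * s (Suc i) c)"
proof (induction d arbitrary: f)
  case (Suc d)
  have le: "c + d \<le> i + M" using Suc.prems by simp
  then have sc: "s i (c + d) \<in> S" "cg (x * s i (c + d)) (s (Suc i) (c + d))" "cg (y * s i (c + d)) (s (Suc i) (Suc (c + d)))"
    using s by (auto simp: good_def)
  have tf: "t f \<in> S" "t (Suc f) \<in> S" "cg (y * t f) (x * t (Suc f))" using t Suc.prems by (auto simp: chain_def)
  have "cg (t f * s (Suc i) (Suc (c + d))) (t f * (y * s i (c + d)))" using cg_sym[OF sc(3)] tf(1) by (rule cg_mult[rotated])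
  also have "t f * (y * s i (c + d)) = s i (c + d) * (y * t f)" by simp
  also have "cg \<dots> (s i (c + d) * (x * t (Suc f)))" using sc(1) tf(3) by (rule cg_mult)
  also have "s i (c + d) * (x * t (Suc f)) = t (Suc f) * (x * s i (c + d))" by simp
  also have "cg \<dots> (t (Suc f) * s (Suc i) (c + d))" using tf(2) sc(2) by (rule cg_mult)
  also have "cg \<dots> (t (Suc f + d) * s (Suc i) c)" using Suc.prems by (intro Suc.IH) auto
  finally show ?case by simp
qed simp

lemma mult_chain:
  assumes s: "good M s" and t: "chain e t" and f: "f \<le> e" and c: "c \<le> Suc i + M"
  shows "cg (t f * s (Suc i) c) (extend e t s (Suc i) (c + f))"
proof -
  define m where "m = min (c + f) e"
  define d where "d = m - f"
  have d: "f + d = m" "d \<le> c" using f by (auto simp: d_def m_def)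
  have "cg (t f * s (Suc i) ((c - d) + d)) (t (f + d) * s (Suc i) (c - d))"
    using d c by (intro shift_height[OF s t]) (auto simp: m_def)
  moreover have "c + f - m = c - d" using d by auto
  ultimately show ?thesis using d by (simp add: extend_def m_def[symmetric])
qed

definition base :: "nat \<Rightarrow> nat \<Rightarrow> 'k pol" where
  "base i c = x ^ (i - c) * y ^ c"

lemma good_base: "good 0 base"
proof -
  have "x * base i c = base (Suc i) c" if "c \<le> i" for i c
    using that by (simp add: base_def Suc_diff_le mult_ac)
  moreover have "y * base i c = base (Suc i) (Suc c)" for i c
    by (simp add: base_def mult_ac)
  moreover have "base i c \<in> S" for i c using xy unfolding base_def by auto
  ultimately show ?thesis by (simp add: good_def)
qed

end

locale straightening_scroll = straightening S L x y + scroll a b "TYPE('k)"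
  for S :: "'k::alg_closed_field pol set" and L x y a b +
  fixes u v :: "nat \<Rightarrow> 'k pol" and z :: "'k pol"
  assumes chains: "chain a u" "chain b v" and z: "z \<in> S"
begin

interpretation S: subalgebra S by (rule S)

definition std :: "nat \<Rightarrow> nat \<Rightarrow> nat \<Rightarrow> nat \<Rightarrow> 'k pol" where
  "std j k = (extend b v ^^ k) ((extend a u ^^ j) base)"

lemma good_std: "good (a * j + b * k) (std j k)"
proof (induction k)
  case 0
  show ?case
  proof (induction j)
    case 0
    then show ?case using good_base by (simp add: std_def)
  next
    case (Suc j)
    then show ?case using good_extend[OF Suc chains(1)] by (simp add: std_def add.commute)
  qed
next
  case (Suc k)
  then show ?case using good_extend[OF Suc chains(2)] by (simp add: std_def ac_simps)
qed

lemma std_S: "c \<le> i + a * j + b * k \<Longrightarrow> std j k i c \<in> S"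
  using good_std[of j k] by (auto simp: good_def add.assoc)

lemma std_x: "c \<le> i + a * j + b * k \<Longrightarrow> cg (x * std j k i c) (std j k (Suc i) c)"
  and std_y: "c \<le> i + a * j + b * k \<Longrightarrow> cg (y * std j k i c) (std j k (Suc i) (Suc c))"
  using good_std[of j k] by (auto simp: good_def add.assoc)

lemma std_v:
  assumes "f \<le> b" "c \<le> Suc i + a * j + b * k"
  shows "cg (v f * std j k (Suc i) c) (std j (Suc k) (Suc i) (c + f))"
  using mult_chain[OF good_std[of j k] chains(2) assms(1), of c i] assms(2) by (simp add: std_def add.assoc)

lemma std_u:
  assumes f: "f \<le> a"
  shows "c \<le> Suc i + a * j + b * k \<Longrightarrow> cg (u f * std j k (Suc i) c) (std (Suc j) k (Suc i) (c + f))"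
proof (induction k arbitrary: c)
  case 0
  then show ?case using mult_chain[OF good_std[of j 0] chains(1) f, of c i] by (simp add: std_def)
next
  case (Suc k)
  define m where "m = min c b"
  have m: "m \<le> b" "c - m \<le> Suc i + a * j + b * k" using Suc.prems by (auto simp: m_def)
  have vm: "v m \<in> S" using chains(2) m by (simp add: chain_def)
  have "u f * std j (Suc k) (Suc i) c = v m * (u f * std j k (Suc i) (c - m))"
    by (simp add: std_def extend_def m_def mult_ac)
  also have "cg \<dots> (v m * std (Suc j) k (Suc i) (c - m + f))" using vm Suc.IH[OF m(2)] by (rule cg_mult)
  also have "cg \<dots> (std (Suc j) (Suc k) (Suc i) (c - m + f + m))"
    using m f by (intro std_v) auto
  finally show ?case using m by (simp add: m_def)
qed

definition stdm :: "(indet \<Rightarrow>\<^sub>0 nat) \<Rightarrow> 'k pol" where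
  "stdm m = z ^ Poly_Mapping.lookup m Vz * std (Poly_Mapping.lookup m (Vw 0)) (Poly_Mapping.lookup m (Vw (Suc 0)))
     (Poly_Mapping.lookup m Vx) (Poly_Mapping.lookup m Vy)"

lemma stdm_tmon [simp]: "stdm (tmon i j k c e) = z ^ e * std j k i c"
  by (simp add: stdm_def)

lemma stdm_S: "m \<in> cone \<Longrightarrow> stdm m \<in> S"
  using z by (elim cone_E) (auto intro!: std_S)

text \<open>A linear section of the substitution: each monomial goes to the standard monomial over it.\<close>

definition Sec :: "'k pol \<Rightarrow> 'k pol" where
  "Sec f = (\<Sum>m\<in>Poly_Mapping.keys f. Cst (Poly_Mapping.lookup f m) * stdm m)"

lemma Sec_superset: "finite A \<Longrightarrow> Poly_Mapping.keys f \<subseteq> A \<Longrightarrow> Sec f = (\<Sum>m\<in>A. Cst (Poly_Mapping.lookup f m) * stdm m)"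
  unfolding Sec_def by (rule sum.mono_neutral_left) (auto simp: in_keys_iff)

lemma Sec_add: "Sec (f + g) = Sec f + Sec g"
proof -
  let ?A = "Poly_Mapping.keys f \<union> Poly_Mapping.keys g"
  have "finite ?A" by simp
  note s = Sec_superset[OF this]
  show ?thesis using keys_add[of f g] by (simp add: s lookup_add hom_distribs algebra_simps sum.distrib)
qed

lemma Sec_0: "Sec 0 = 0"
  by (simp add: Sec_def)

lemma Sec_sum: "Sec (sum f A) = (\<Sum>i\<in>A. Sec (f i))"
  by (induction A rule: infinite_finite_induct) (auto simp: Sec_add Sec_0)

lemma Sec_Cst_mult: "Sec (Cst c * f) = Cst c * Sec f"
proof -
  have "Poly_Mapping.keys (Cst c * f) \<subseteq> Poly_Mapping.keys f" by (auto simp: in_keys_iff lookup_Cst_mult)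
  from Sec_superset[OF finite_keys this] show ?thesis
    by (simp only: Sec_def lookup_Cst_mult Cst.hom_mult sum_distrib_left mult.assoc)
qed

lemma Sec_Mon: "Sec (Mon m) = stdm m"
  by (simp add: Sec_def lookup_Mon)

text \<open>A factor \<open>p\<close> stems from a factor \<open>x\<close> or \<open>y\<close>; only over these monomials do the relations straighten.\<close>

definition cone_p :: "(indet \<Rightarrow>\<^sub>0 nat) set" where
  "cone_p = {m \<in> cone. 0 < Poly_Mapping.lookup m Vx}"

lemma cone_p_E:
  assumes "m \<in> cone_p"
  obtains i j k c e where "m = tmon (Suc i) j k c e" "c \<le> Suc i + a * j + b * k"
proof -
  from assms have "m \<in> cone" "0 < Poly_Mapping.lookup m Vx" by (auto simp: cone_p_def)
  then obtain i j k c e where m: "m = tmon i j k c e" "c \<le> i + a * j + b * k" by (elim cone_E)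
  with \<open>0 < Poly_Mapping.lookup m Vx\<close> obtain i' where "i = Suc i'" by (cases i) auto
  with m that show ?thesis by blast
qed

text \<open>Multiplication by \<open>h\<close> upstairs is compared with multiplication by \<open>g\<close> in the toric ring, along the
  section. As the generators of the ring upstairs act like their images, so does every element.\<close>

definition acts :: "'k pol \<Rightarrow> 'k pol \<Rightarrow> bool" where
  "acts h g \<longleftrightarrow> h \<in> S \<and> g \<in> toric \<and> (\<forall>m\<in>cone_p. cg (h * stdm m) (Sec (g * Mon m)))"

lemma acts_gens: "acts x pp" "acts y (lam * pp)" "acts z zz"
  "f \<le> a \<Longrightarrow> acts (u f) (lam ^ f * qq)" "f \<le> b \<Longrightarrow> acts (v f) (lam ^ f * rr)"
proof -
  have zS: "z ^ e \<in> S" for e using z by auto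
  have 1: "pp * Mon (tmon i j k c e) = Mon (tmon (Suc i) j k c e)"
    "lam * pp * Mon (tmon i j k c e) = Mon (tmon (Suc i) j k (Suc c) e)"
    "zz * Mon (tmon i j k c e) = Mon (tmon i j k c (Suc e))"
    "lam ^ f * qq * Mon (tmon i j k c e) = Mon (tmon i (Suc j) k (c + f) e)"
    "lam ^ f * rr * Mon (tmon i j k c e) = Mon (tmon i j (Suc k) (c + f) e)" for i j k c e f
    by (simp_all add: Mon_tmon power_add mult_ac)
  have lift: "cg (h * (z ^ e * s)) (z ^ e * s')" if "cg (h * s) s'" for h s s' e
    using cg_mult[OF zS[of e] that] by (simp add: mult_ac)
  show "acts x pp" "acts y (lam * pp)"
    unfolding acts_def using xy toric_gens
    by (auto simp: 1 Sec_Mon elim!: cone_p_E intro!: lift std_x std_y)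
  show "acts z zz"
    unfolding acts_def using z toric_gens
    by (auto simp: 1 Sec_Mon mult.assoc elim!: cone_p_E)
  show "acts (u f) (lam ^ f * qq)" if "f \<le> a"
    unfolding acts_def using that toric_gens chains(1)
    by (auto simp: 1 Sec_Mon chain_def elim!: cone_p_E intro!: lift std_u)
  show "acts (v f) (lam ^ f * rr)" if "f \<le> b"
    unfolding acts_def using that toric_gens chains(2)
    by (auto simp: 1 Sec_Mon chain_def elim!: cone_p_E intro!: lift std_v)
qed

lemma acts_add: "acts h g \<Longrightarrow> acts h' g' \<Longrightarrow> acts (h + h') (g + g')"
  unfolding acts_def by (auto simp: distrib_right Sec_add intro: cg_add)

lemma acts_Cst: "acts (Cst c) (Cst c)"
  unfolding acts_def by (auto simp: Sec_Cst_mult Sec_Mon)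

lemma acts_mult:
  assumes h: "acts h g" and h': "acts h' g'"
  shows "acts (h * h') (g * g')"
  unfolding acts_def
proof (intro conjI ballI)
  show "h * h' \<in> S" "g * g' \<in> toric" using assms by (auto simp: acts_def)
  fix m assume m: "m \<in> cone_p"
  have hS: "h \<in> S" "g' \<in> toric" using assms by (auto simp: acts_def)
  have "h * h' * stdm m = h * (h' * stdm m)" by (simp add: mult.assoc)
  also have "cg \<dots> (h * Sec (g' * Mon m))" using h' m hS by (intro cg_mult) (auto simp: acts_def)
  also have "h * Sec (g' * Mon m) = (\<Sum>m'\<in>Poly_Mapping.keys (g' * Mon m). Cst (Poly_Mapping.lookup (g' * Mon m) m') * (h * stdm m'))"
    by (simp add: Sec_def sum_distrib_left mult_ac)
  also have "cg \<dots> (\<Sum>m'\<in>Poly_Mapping.keys (g' * Mon m). Cst (Poly_Mapping.lookup (g' * Mon m) m') * Sec (g * Mon m'))"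
  proof (rule cg_sum, rule cg_mult)
    fix m' assume m': "m' \<in> Poly_Mapping.keys (g' * Mon m)"
    then obtain m0 where "m0 \<in> Poly_Mapping.keys g'" "m' = m0 + m"
      using keys_mult[of g' "Mon m"] by auto
    then have "m' \<in> cone_p" using m hS(2) by (auto simp: cone_p_def toric_def lookup_add intro!: cone_add)
    then show "cg (h * stdm m') (Sec (g * Mon m'))" using h by (simp add: acts_def)
  qed simp
  also have "(\<Sum>m'\<in>Poly_Mapping.keys (g' * Mon m). Cst (Poly_Mapping.lookup (g' * Mon m) m') * Sec (g * Mon m'))
     = Sec (g * (\<Sum>m'\<in>Poly_Mapping.keys (g' * Mon m). Cst (Poly_Mapping.lookup (g' * Mon m) m') * Mon m'))"
    by (simp add: sum_distrib_left Sec_sum mult.left_commute[of g] Sec_Cst_mult)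
  also have "\<dots> = Sec (g * g' * Mon m)" by (simp flip: pol_eq_sum add: mult.assoc)
  finally show "cg (h * h' * stdm m) (Sec (g * g' * Mon m))" .
qed

lemma acts_sum: "(\<And>i. i \<in> A \<Longrightarrow> acts (f i) (g i)) \<Longrightarrow> acts (sum f A) (sum g A)"
  by (induction A rule: infinite_finite_induct) (use acts_Cst[of 0] in \<open>auto intro: acts_add\<close>)

text \<open>For \<open>g = 0\<close> the comparison on the monomials \<open>p\<close> and \<open>\<lambda> p\<close> says that \<open>x h\<close> and \<open>y h\<close> are in \<open>L\<close>.\<close>

lemma acts_zero:
  assumes "acts h 0"
  shows "x * h \<in> L" "y * h \<in> L"
proof -
  have "std 0 0 = base" by (simp add: std_def)
  then have "stdm (tmon 1 0 0 0 0) = x" "stdm (tmon 1 0 0 1 0) = y" by (simp_all add: base_def)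
  moreover have "cg (h * stdm (tmon 1 0 0 c 0)) 0" if "c \<le> 1" for c
  proof -
    have "tmon 1 0 0 c 0 \<in> cone_p" using that by (simp add: cone_p_def)
    then have "cg (h * stdm (tmon 1 0 0 c 0)) (Sec (0 * Mon (tmon 1 0 0 c 0)))"
      using assms unfolding acts_def by blast
    then show ?thesis by (simp add: Sec_0)
  qed
  ultimately have "cg (h * x) 0" "cg (h * y) 0" by (metis le_numeral_extra(4) zero_le_one)+
  then show "x * h \<in> L" "y * h \<in> L" by (simp_all add: cg_def mult.commute)
qed

lemma psub_std:
  assumes "psub \<pi> x = pp" "psub \<pi> y = lam * pp"
    and u: "\<And>f. f \<le> a \<Longrightarrow> psub \<pi> (u f) = lam ^ f * qq" and v: "\<And>f. f \<le> b \<Longrightarrow> psub \<pi> (v f) = lam ^ f * rr"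
  shows "c \<le> i + a * j + b * k \<Longrightarrow> psub \<pi> (std j k i c) = pp ^ i * qq ^ j * rr ^ k * lam ^ c"
proof (induction k arbitrary: c)
  case 0
  then show ?case
  proof (induction j arbitrary: c)
    case 0
    then have "i = (i - c) + c" by simp
    then have "pp ^ i = pp ^ (i - c) * pp ^ c" by (metis power_add)
    then show ?case using assms(1,2) by (simp add: std_def base_def hom_distribs power_mult_distrib mult_ac)
  next
    case (Suc j)
    define m where "m = min c a"
    have m: "m \<le> a" "c - m \<le> i + a * j + b * 0" "m \<le> c" using Suc.prems by (auto simp: m_def)
    have "std (Suc j) 0 i c = u m * std j 0 i (c - m)" by (simp add: std_def extend_def m_def)
    then have "psub \<pi> (std (Suc j) 0 i c) = lam ^ m * lam ^ (c - m) * (pp ^ i * qq ^ Suc j)"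
      using Suc.IH[OF m(2)] u[OF m(1)] by (simp add: hom_distribs mult_ac)
    also have "lam ^ m * lam ^ (c - m) = lam ^ c" using m(3) by (simp flip: power_add)
    finally show ?case by (simp add: mult_ac)
  qed
next
  case (Suc k)
  define m where "m = min c b"
  have m: "m \<le> b" "c - m \<le> i + a * j + b * k" "m \<le> c" using Suc.prems by (auto simp: m_def)
  have "std j (Suc k) i c = v m * std j k i (c - m)" by (simp add: std_def extend_def m_def)
  then have "psub \<pi> (std j (Suc k) i c) = lam ^ m * lam ^ (c - m) * (pp ^ i * qq ^ j * rr ^ Suc k)"
    using Suc.IH[OF m(2)] v[OF m(1)] by (simp add: hom_distribs mult_ac)
  also have "lam ^ m * lam ^ (c - m) = lam ^ c" using m(3) by (simp flip: power_add)
  finally show ?case by (simp add: mult_ac)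
qed

end

subsection \<open>The toric ring is free over a polynomial ring\<close>

context scroll
begin

abbreviation "rk \<equiv> a + b + 1"

text \<open>Together with \<open>p\<close> and \<open>z\<close> these are the parameters. The rational normal curves of degrees \<open>1\<close>, \<open>a\<close>, \<open>b\<close>
  that generate the scroll are \<open>(p, \<lambda> p)\<close>, \<open>(q, \<dots>, \<lambda>\<^sup>a q)\<close> and \<open>(r, \<dots>, \<lambda>\<^sup>b r)\<close>; the vanishing of \<open>th2\<close> and
  \<open>th3\<close> identifies the end of each with the beginning of the next.\<close>

definition th2 :: "'k pol" where "th2 = lam * pp - qq"
definition th3 :: "'k pol" where "th3 = lam ^ a * qq - rr"
definition th4 :: "'k pol" where "th4 = lam ^ b * rr"

abbreviation "pvars \<equiv> {Vw 0, Vw (Suc 0), Vw 2, Vw 3, Vz}"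

text \<open>The indeterminates \<open>Vw 0\<close>, \<dots>, \<open>Vw 3\<close>, \<open>Vz\<close> name the parameters; the values elsewhere are arbitrary.\<close>

fun param :: "indet \<Rightarrow> 'k pol" where
  "param (Vw i) = (if i = 0 then pp else if i = 1 then th2 else if i = 2 then th3 else th4)"
| "param Vz = zz"
| "param Vx = 0"
| "param Vy = 0"

text \<open>The coordinates of the rational normal curve of degree \<open>a + b + 1\<close> obtained by gluing the three
  curves of the scroll end to end, that is, modulo \<open>th2\<close> and \<open>th3\<close>.\<close>

definition curve :: "nat \<Rightarrow> 'k pol" where
  "curve e = (if e = 0 then pp else if e \<le> a then lam ^ (e - 1) * qq else lam ^ (e - 1 - a) * rr)"

definition bas :: "nat \<Rightarrow> 'k pol" where
  "bas c = (if c = 0 then 1 else curve c)"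

lemma th_toric: "th2 \<in> toric" "th3 \<in> toric" "th4 \<in> toric"
  using toric_gens(4)[of 0] toric_gens(4)[of a] toric_gens(5)[of 0] toric_gens(5)[of b] toric_gens(2)
  by (auto simp: th2_def th3_def th4_def)

lemma param_toric: "param v \<in> toric"
  using th_toric toric_gens by (cases v) auto

lemma curve_Mon:
  assumes "e \<le> rk"
  shows "\<exists>i j k c. curve e = Mon (tmon i j k c 0) \<and> i + j + k = 1 \<and> c \<le> i + a * j + b * k"
proof -
  consider "e = 0" | "0 < e" "e \<le> a" | "a < e" by linarith
  then show ?thesis
  proof cases
    case 1 then show ?thesis by (intro exI[of _ 1] exI[of _ 0]) (simp add: curve_def Mon_tmon)
  next
    case 2 then show ?thesis
      by (intro exI[of _ 0] exI[of _ 1] exI[of _ 0] exI[of _ "e - 1"]) (auto simp: curve_def Mon_tmon mult.commute)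
  next
    case 3 then show ?thesis using assms
      by (intro exI[of _ 0] exI[of _ 0] exI[of _ 1] exI[of _ "e - 1 - a"]) (auto simp: curve_def Mon_tmon mult.commute)
  qed
qed

lemma curve_rk: "curve rk = th4"
  using b_pos by (simp add: curve_def th4_def)

text \<open>The parameters other than \<open>z\<close> are homogeneous for the degree in \<open>p\<close>, \<open>q\<close>, \<open>r\<close>, which allows an induction.\<close>

definition pd :: "(indet \<Rightarrow>\<^sub>0 nat) \<Rightarrow> nat" where
  "pd m = Poly_Mapping.lookup m Vx + Poly_Mapping.lookup m (Vw 0) + Poly_Mapping.lookup m (Vw (Suc 0))"

lemma pd_tmon [simp]: "pd (tmon i j k c e) = i + j + k"
  by (simp add: pd_def)

lemma pd_add: "pd (m + m') = pd m + pd m'"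
  by (simp add: pd_def lookup_add)

definition forms :: "nat \<Rightarrow> 'k pol set" where
  "forms n = {f \<in> toric. \<forall>m\<in>Poly_Mapping.keys f. pd m = n}"

lemma forms_mult: "f \<in> forms m \<Longrightarrow> g \<in> forms n \<Longrightarrow> f * g \<in> forms (m + n)"
  using keys_mult[of f g] by (fastforce simp: forms_def pd_add)

lemma forms_add: "f \<in> forms n \<Longrightarrow> g \<in> forms n \<Longrightarrow> f + g \<in> forms n"
  using keys_add[of f g] by (fastforce simp: forms_def)

lemma forms_Cst: "Cst c \<in> forms 0"
  unfolding forms_def using toric.K_Cst[of c] by (auto simp: forms_def Cst_def pd_def)

lemma forms_Mon: "m \<in> cone \<Longrightarrow> Mon m \<in> forms (pd m)"
  by (simp add: forms_def toric_Mon)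

lemma forms_curve: "e \<le> rk \<Longrightarrow> curve e \<in> forms 1"
  using curve_Mon[of e] forms_Mon tmon_cone pd_tmon by metis

definition th_ideal :: "nat \<Rightarrow> 'k pol set" where
  "th_ideal n = {th2 * f + th3 * g | f g. f \<in> forms n \<and> g \<in> forms n}"

lemma th_ideal_mult: "h \<in> forms d \<Longrightarrow> e \<in> th_ideal n \<Longrightarrow> h * e \<in> th_ideal (n + d)"
proof -
  assume h: "h \<in> forms d" and "e \<in> th_ideal n"
  then obtain f g where "f \<in> forms n" "g \<in> forms n" "e = th2 * f + th3 * g" by (auto simp: th_ideal_def)
  moreover have "h * (th2 * f + th3 * g) = th2 * (f * h) + th3 * (g * h)" by (simp add: algebra_simps)
  ultimately show ?thesis using forms_mult[OF _ h] unfolding th_ideal_def by blast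
qed

lemma th_ideal_add: "e \<in> th_ideal n \<Longrightarrow> e' \<in> th_ideal n \<Longrightarrow> e + e' \<in> th_ideal n"
proof -
  assume "e \<in> th_ideal n" "e' \<in> th_ideal n"
  then obtain f g f' g' where *: "f \<in> forms n" "g \<in> forms n" "f' \<in> forms n" "g' \<in> forms n"
    "e = th2 * f + th3 * g" "e' = th2 * f' + th3 * g'" by (auto simp: th_ideal_def)
  then have "e + e' = th2 * (f + f') + th3 * (g + g')" by (simp add: algebra_simps)
  then show ?thesis using * forms_add unfolding th_ideal_def by blast
qed

lemma th_ideal_uminus: "e \<in> th_ideal n \<Longrightarrow> - e \<in> th_ideal n"
  using th_ideal_mult[OF forms_Cst[of "- 1"], of e n] by (simp add: hom_distribs)

text \<open>Congruence modulo \<open>th2\<close> and \<open>th3\<close> between forms of degree \<open>n\<close>, the cofactors being of degree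
  \<open>n - 1\<close>.\<close>

definition cgE :: "nat \<Rightarrow> 'k pol \<Rightarrow> 'k pol \<Rightarrow> bool" where
  "cgE n f g \<longleftrightarrow> f = g \<or> (\<exists>d. n = Suc d \<and> f - g \<in> th_ideal d)"

lemma cgE_refl [simp]: "cgE n f f"
  by (simp add: cgE_def)

lemma cgE_trans [trans]: "cgE n f g \<Longrightarrow> cgE n g h \<Longrightarrow> cgE n f h"
  unfolding cgE_def using th_ideal_add[of "f - g" _ "g - h"] by (auto simp del: diff_eq_eq)

lemma cgE_mult: "h \<in> forms d \<Longrightarrow> cgE n f g \<Longrightarrow> cgE (d + n) (h * f) (h * g)"
  unfolding cgE_def using th_ideal_mult[of h d "f - g"] by (auto simp: right_diff_distrib add.commute)

text \<open>Up to \<open>th2\<close> and \<open>th3\<close>, multiplication by \<open>\<lambda>\<close> moves to the next point also at the two joints.\<close>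

lemma lam_curve:
  assumes "e < rk"
  shows "\<exists>\<alpha> \<beta>. lam * curve e - curve (Suc e) = Cst \<alpha> * th2 + Cst \<beta> * th3"
proof -
  consider "e = 0" "a > 0" | "e = 0" "a = 0" | "0 < e" "e < a" | "0 < e" "e = a" | "a < e" by linarith
  then show ?thesis
  proof cases
    case 1 then show ?thesis by (intro exI[of _ 1] exI[of _ 0]) (simp add: curve_def th2_def)
  next
    case 2
    have "curve e = pp" "curve (Suc e) = rr" "th3 = qq - rr" unfolding curve_def th3_def using 2 by simp_all
    then have "lam * curve e - curve (Suc e) = Cst 1 * th2 + Cst 1 * th3" by (simp add: th2_def)
    then show ?thesis by blast
  next
    case 3
    then have "lam * curve e = curve (Suc e)" using power_Suc[of lam "e - 1"] by (simp add: curve_def flip: mult.assoc)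
    then show ?thesis by (intro exI[of _ 0]) simp
  next
    case 4
    then have "lam * curve e - curve (Suc e) = th3" using power_Suc[of lam "a - 1"] by (simp add: curve_def th3_def flip: mult.assoc)
    then show ?thesis by (intro exI[of _ 0] exI[of _ 1]) simp
  next
    case 5
    then have "lam * lam ^ (e - 1 - a) = lam ^ (e - a)" using power_Suc[of lam "e - 1 - a"] by (simp add: Suc_diff_le Suc_diff_Suc)
    then have "lam * curve e = curve (Suc e)" using 5 by (simp add: curve_def flip: mult.assoc)
    then show ?thesis by (intro exI[of _ 0]) simp
  qed
qed

lemma curve_exchange_Suc:
  assumes e: "e < rk" "f < rk"
  shows "cgE 2 (curve f * curve (Suc e)) (curve (Suc f) * curve e)"
proof -
  obtain \<alpha> \<beta> \<gamma> \<delta> where *: "lam * curve e - curve (Suc e) = Cst \<alpha> * th2 + Cst \<beta> * th3"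
    "lam * curve f - curve (Suc f) = Cst \<gamma> * th2 + Cst \<delta> * th3" using lam_curve[OF e(1)] lam_curve[OF e(2)] by blast
  have "curve f * curve (Suc e) - curve (Suc f) * curve e = curve e * (lam * curve f - curve (Suc f)) - curve f * (lam * curve e - curve (Suc e))"
    by (simp add: algebra_simps)
  also have "\<dots> = th2 * (Cst \<gamma> * curve e + Cst (- \<alpha>) * curve f) + th3 * (Cst \<delta> * curve e + Cst (- \<beta>) * curve f)"
    unfolding * by (simp add: algebra_simps hom_distribs)
  also have "\<dots> \<in> th_ideal 1"
  proof -
    have "Cst x * curve e + Cst y * curve f \<in> forms 1" for x y
      using forms_mult[OF forms_Cst forms_curve] e by (intro forms_add) fastforce+
    then show ?thesis unfolding th_ideal_def by blast
  qed
  finally show ?thesis by (auto simp: cgE_def numeral_2_eq_2)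
qed

lemma curve_exchange: "f + d \<le> rk \<Longrightarrow> e + d \<le> rk \<Longrightarrow> cgE 2 (curve f * curve (e + d)) (curve (f + d) * curve e)"
proof (induction d arbitrary: f)
  case (Suc d)
  have "cgE 2 (curve f * curve (Suc (e + d))) (curve (Suc f) * curve (e + d))"
    using Suc.prems by (intro curve_exchange_Suc) auto
  also have "cgE 2 \<dots> (curve (Suc f + d) * curve e)" using Suc.prems by (intro Suc.IH) auto
  finally show ?case by simp
qed simp

text \<open>The standard monomial of degree \<open>m\<close> and height \<open>E\<close> on the curve: a power of the last coordinate, at most
  one other coordinate, and a power of the first.\<close>

fun curve_mon :: "nat \<Rightarrow> nat \<Rightarrow> 'k pol" where
  "curve_mon 0 E = 1"
| "curve_mon (Suc m) E = curve (min E rk) * curve_mon m (E - min E rk)"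

lemma forms_curve_mon: "curve_mon m E \<in> forms m"
proof (induction m arbitrary: E)
  case 0
  show ?case using forms_Cst[of 1] by simp
next
  case (Suc m)
  show ?case using forms_mult[OF forms_curve Suc, of "min E rk" "E - min E rk"] by simp
qed

lemma curve_mon_0: "curve_mon m 0 = pp ^ m"
  by (induction m) (auto simp: curve_def)

text \<open>Coordinates of the curve may exchange height as in the straightening of the scroll.\<close>

lemma curve_curve_mon: "f \<le> rk \<Longrightarrow> E \<le> rk * m \<Longrightarrow> cgE (Suc m) (curve f * curve_mon m E) (curve_mon (Suc m) (E + f))"
proof (induction m arbitrary: f E)
  case (Suc m)
  have hN: "curve rk \<in> forms 1" by (rule forms_curve) simp
  consider "rk \<le> E" | "E < rk" "E + f \<le> rk" | "E < rk" "rk < E + f" by linarith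
  then show ?case
  proof cases
    case 1
    have "curve f * curve_mon (Suc m) E = curve rk * (curve f * curve_mon m (E - rk))" using 1 by (simp add: min_def mult_ac)
    also have "cgE (1 + Suc m) \<dots> (curve rk * curve_mon (Suc m) (E - rk + f))"
      using Suc.prems 1 by (intro cgE_mult[OF hN] Suc.IH) auto
    also have "curve rk * curve_mon (Suc m) (E - rk + f) = curve_mon (Suc (Suc m)) (E + f)"
    proof -
      have mn: "min (E + f) rk = rk" "E - rk + f = E + f - rk" using 1 by auto
      show ?thesis unfolding mn(2) curve_mon.simps(2)[of "Suc m"] mn(1) ..
    qed
    finally show ?thesis by simp
  next
    case 2
    have "cgE 2 (curve f * curve (0 + E)) (curve (f + E) * curve 0)" using 2 by (intro curve_exchange) auto
    from cgE_mult[OF forms_curve_mon[of m 0] this]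
    have "cgE (Suc (Suc m)) (curve_mon m 0 * (curve f * curve E)) (curve_mon m 0 * (curve (f + E) * curve 0))" by simp
    moreover have "curve_mon (Suc m) E = curve E * curve_mon m 0" using 2 by (simp add: min_def)
    moreover have "curve_mon (Suc (Suc m)) (E + f) = curve (E + f) * (curve 0 * curve_mon m 0)" using 2 by (simp add: min_def)
    ultimately show ?thesis by (simp add: mult_ac add.commute del: curve_mon.simps)
  next
    case 3
    define d where "d = rk - f"
    have d: "f + d = rk" "E - d + d = E" "E - d = E + f - rk" using 3 Suc.prems by (auto simp: d_def)
    have "cgE 2 (curve f * curve ((E - d) + d)) (curve (f + d) * curve (E - d))" using 3 d by (intro curve_exchange) auto
    then have ex: "cgE 2 (curve f * curve E) (curve rk * curve (E + f - rk))" unfolding d(1,2) unfolding d(3) .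
    have s1: "curve_mon (Suc m) E = curve E * curve_mon m 0" using 3 by (simp add: min_def)
    have s2: "curve_mon (Suc (Suc m)) (E + f) = curve rk * curve_mon (Suc m) (E + f - rk)"
    proof -
      have mn: "min (E + f) rk = rk" using 3 by simp
      show ?thesis unfolding curve_mon.simps(2)[of "Suc m"] mn ..
    qed
    from cgE_mult[OF forms_curve_mon[of m 0] ex]
    have "cgE (Suc (Suc m)) (curve f * curve_mon (Suc m) E) (curve rk * (curve (E + f - rk) * curve_mon m 0))"
      unfolding s1 by (simp add: mult_ac)
    also have "cgE (Suc (Suc m)) (curve rk * (curve (E + f - rk) * curve_mon m 0)) (curve rk * curve_mon (Suc m) (0 + (E + f - rk)))"
      using cgE_mult[OF hN Suc.IH[of "E + f - rk" 0]] 3 Suc.prems by simp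
    finally show ?thesis unfolding s2 by simp
  qed
qed (simp add: min_def)

lemma Mon_step:
  assumes w: "cgE 1 w (curve f)" and f: "f \<le> rk" and M: "M \<in> forms n" "cgE n M (curve_mon n E)" and E: "E \<le> rk * n"
  shows "cgE (Suc n) (M * w) (curve_mon (Suc n) (E + f))"
proof -
  have "cgE (Suc n) (M * w) (curve f * M)" using cgE_mult[OF M(1) w] by (simp add: mult.commute)
  also have "cgE (Suc n) \<dots> (curve f * curve_mon n E)" using cgE_mult[OF forms_curve[OF f] M(2)] by simp
  also have "cgE (Suc n) \<dots> (curve_mon (Suc n) (E + f))" by (rule curve_curve_mon[OF f E])
  finally show ?thesis .
qed

lemma cgE_1I:
  assumes "w - t = Cst \<alpha> * th2 + Cst \<beta> * th3"
  shows "cgE 1 w t"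
proof -
  have "w - t = th2 * Cst \<alpha> + th3 * Cst \<beta>" using assms by (simp add: mult.commute)
  then have "w - t \<in> th_ideal 0" using forms_Cst unfolding th_ideal_def by blast
  then show ?thesis by (auto simp: cgE_def)
qed

text \<open>Write the monomial as a product of coordinates of the three curves. The height on the glued curve counts
  one more for each \<open>q\<close> and \<open>a + 1\<close> more for each \<open>r\<close>, the positions where these curves begin.\<close>

lemma Mon_curve_mon:
  "c \<le> i + a * j + b * k \<Longrightarrow> cgE (i + j + k) (Mon (tmon i j k c 0)) (curve_mon (i + j + k) (c + j + (a + 1) * k))"
proof (induction k arbitrary: c)
  case 0
  then show ?case
  proof (induction j arbitrary: c)
    case 0
    then show ?case
    proof (induction i arbitrary: c)
      case 0
      then show ?case by (simp add: Mon_tmon)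
    next
      case (Suc i)
      define m where "m = min c 1"
      have m: "m \<le> 1" "c - m \<le> i" "m \<le> c" using Suc.prems by (auto simp: m_def)
      have w: "cgE 1 (lam ^ m * pp) (curve m)"
      proof (cases "m = 0")
        case True then show ?thesis by (simp add: curve_def)
      next
        case False
        then have "m = 1" using m by simp
        obtain \<alpha> \<beta> where "lam * curve 0 - curve (Suc 0) = Cst \<alpha> * th2 + Cst \<beta> * th3"
          using lam_curve[of 0] by auto
        then have "lam ^ m * pp - curve m = Cst \<alpha> * th2 + Cst \<beta> * th3" by (simp add: \<open>m = 1\<close> curve_def[of 0])
        then show ?thesis by (rule cgE_1I)
      qed
      have "cgE (Suc i) (Mon (tmon i 0 0 (c - m) 0) * (lam ^ m * pp)) (curve_mon (Suc i) (c - m + m))"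
      proof (rule Mon_step[OF w])
        show "m \<le> rk" using m by simp
        show "Mon (tmon i 0 0 (c - m) 0) \<in> forms i" using forms_Mon[of "tmon i 0 0 (c - m) 0"] m by simp
        show "cgE i (Mon (tmon i 0 0 (c - m) 0)) (curve_mon i (c - m))" using Suc.IH[of "c - m"] m by simp
        show "c - m \<le> rk * i" using m by (simp add: algebra_simps)
      qed
      moreover have "Mon (tmon i 0 0 (c - m) 0) * (lam ^ m * pp) = Mon (tmon (Suc i) 0 0 c 0)"
      proof -
        have "lam ^ c = lam ^ (c - m) * lam ^ m" using m by (simp flip: power_add)
        then show ?thesis by (simp add: Mon_tmon mult_ac)
      qed
      ultimately show ?case using m by (simp del: curve_mon.simps)
    qed
  next
    case (Suc j)
    define m where "m = min c a"
    have m: "m \<le> a" "c - m \<le> i + a * j + b * 0" "m \<le> c" using Suc.prems by (auto simp: m_def)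
    have w: "cgE 1 (lam ^ m * qq) (curve (1 + m))"
    proof (cases "m = a")
      case True
      have "lam ^ m * qq - curve (1 + m) = Cst 0 * th2 + Cst 1 * th3" using True by (simp add: curve_def th3_def)
      then show ?thesis by (rule cgE_1I)
    qed (use m in \<open>simp add: curve_def\<close>)
    have "cgE (Suc (i + j)) (Mon (tmon i j 0 (c - m) 0) * (lam ^ m * qq)) (curve_mon (Suc (i + j)) (c - m + j + (1 + m)))"
    proof (rule Mon_step[OF w])
      show "1 + m \<le> rk" using m by simp
      show "Mon (tmon i j 0 (c - m) 0) \<in> forms (i + j)" using forms_Mon[of "tmon i j 0 (c - m) 0"] m by simp
      show "cgE (i + j) (Mon (tmon i j 0 (c - m) 0)) (curve_mon (i + j) (c - m + j))" using Suc.IH[OF m(2)] by simp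
      show "c - m + j \<le> rk * (i + j)" using m(2) by (simp add: algebra_simps)
    qed
    moreover have "Mon (tmon i j 0 (c - m) 0) * (lam ^ m * qq) = Mon (tmon i (Suc j) 0 c 0)"
    proof -
      have "lam ^ c = lam ^ (c - m) * lam ^ m" using m by (simp flip: power_add)
      then show ?thesis by (simp add: Mon_tmon mult_ac)
    qed
    moreover have "c - m + j + (1 + m) = c + Suc j" using m by simp
    ultimately show ?case by (simp del: curve_mon.simps)
  qed
next
  case (Suc k)
  define m where "m = min c b"
  have m: "m \<le> b" "c - m \<le> i + a * j + b * k" "m \<le> c" using Suc.prems by (auto simp: m_def)
  let ?E = "c - m + j + (a + 1) * k" and ?f = "a + 1 + m"
  have w: "cgE 1 (lam ^ m * rr) (curve ?f)" by (simp add: curve_def)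
  have A: "cgE (Suc (i + j + k)) (Mon (tmon i j k (c - m) 0) * (lam ^ m * rr)) (curve_mon (Suc (i + j + k)) (?E + ?f))"
  proof (rule Mon_step[OF w])
    show "?f \<le> rk" using m by simp
    show "Mon (tmon i j k (c - m) 0) \<in> forms (i + j + k)" using forms_Mon[of "tmon i j k (c - m) 0"] m by simp
    show "cgE (i + j + k) (Mon (tmon i j k (c - m) 0)) (curve_mon (i + j + k) ?E)" using Suc.IH[OF m(2)] .
    show "?E \<le> rk * (i + j + k)" using m(2) by (simp add: algebra_simps)
  qed
  have B: "Mon (tmon i j k (c - m) 0) * (lam ^ m * rr) = Mon (tmon i j (Suc k) c 0)"
  proof -
    have "lam ^ c = lam ^ (c - m) * lam ^ m" using m by (simp flip: power_add)
    then show ?thesis by (simp add: Mon_tmon mult_ac)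
  qed
  have C: "?E + ?f = c + j + (a + 1) * Suc k" using m by simp
  show ?case using A unfolding B C by (simp only: add_Suc_right)
qed

definition pspan :: "'k pol set" where
  "pspan = {f. \<exists>F. (\<forall>c<rk. F c \<in> PV pvars) \<and> f = (\<Sum>c<rk. psub param (F c) * bas c)}"

lemma pspan_add: "f \<in> pspan \<Longrightarrow> g \<in> pspan \<Longrightarrow> f + g \<in> pspan"
proof -
  assume "f \<in> pspan" "g \<in> pspan"
  then obtain F G where *: "\<forall>c<rk. F c \<in> PV pvars" "f = (\<Sum>c<rk. psub param (F c) * bas c)"
    "\<forall>c<rk. G c \<in> PV pvars" "g = (\<Sum>c<rk. psub param (G c) * bas c)" by (auto simp: pspan_def)
  have "f + g = (\<Sum>c<rk. psub param (F c + G c) * bas c)"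
    unfolding * by (simp only: psub.hom_add distrib_right sum.distrib)
  moreover have "\<forall>c<rk. F c + G c \<in> PV pvars" using * by (auto intro: PV_add)
  ultimately show ?thesis unfolding pspan_def by (intro CollectI exI[of _ "\<lambda>c. F c + G c"]) blast
qed

lemma pspan_mult: "P \<in> PV pvars \<Longrightarrow> f \<in> pspan \<Longrightarrow> psub param P * f \<in> pspan"
proof -
  assume P: "P \<in> PV pvars" and "f \<in> pspan"
  then obtain F where *: "\<forall>c<rk. F c \<in> PV pvars" "f = (\<Sum>c<rk. psub param (F c) * bas c)" by (auto simp: pspan_def)
  have "psub param P * f = (\<Sum>c<rk. psub param (P * F c) * bas c)"
    unfolding * by (simp only: psub.hom_mult sum_distrib_left mult.assoc)
  moreover have "\<forall>c<rk. P * F c \<in> PV pvars" using * P by (auto intro: PV_mult)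
  ultimately show ?thesis unfolding pspan_def by (intro CollectI exI[of _ "\<lambda>c. P * F c"]) blast
qed

lemma pspan_bas: "c < rk \<Longrightarrow> bas c \<in> pspan"
proof -
  assume c: "c < rk"
  have "(\<Sum>c'<rk. psub param (Cst (if c' = c then 1 else 0)) * bas c') = (\<Sum>c'<rk. if c' = c then bas c' else 0)"
    by (intro sum.cong) auto
  also have "\<dots> = bas c" using c by simp
  finally have "bas c = (\<Sum>c'<rk. psub param (Cst (if c' = c then 1 else 0)) * bas c')" ..
  then show ?thesis unfolding pspan_def
    by (intro CollectI exI[of _ "\<lambda>c'. Cst (if c' = c then 1 else 0)"]) (auto simp del: psub_Cst)
qed

lemma pspan_0: "0 \<in> pspan"
  using pspan_mult[of 0, OF _ pspan_bas[of 0]] by simp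

lemma pspan_sum: "(\<And>i. i \<in> A \<Longrightarrow> f i \<in> pspan) \<Longrightarrow> sum f A \<in> pspan"
  by (induction A rule: infinite_finite_induct) (auto intro: pspan_add pspan_0)

lemma pspan_param: "v \<in> pvars \<Longrightarrow> f \<in> pspan \<Longrightarrow> param v ^ k * f \<in> pspan"
  using pspan_mult[of "Var v ^ k" f] by (auto simp: hom_distribs intro: PV_power PV_Var)

lemma pspan_Cst: "f \<in> pspan \<Longrightarrow> Cst c * f \<in> pspan"
  using pspan_mult[of "Cst c" f] by simp

lemma pspan_curve_mon: "curve_mon n E \<in> pspan"
proof (induction n arbitrary: E)
  case 0
  show ?case using pspan_bas[of 0] by (simp add: bas_def)
next
  case (Suc n)
  show ?case
  proof (cases "rk \<le> E")
    case True
    then have "curve_mon (Suc n) E = param (Vw 3) ^ 1 * curve_mon n (E - rk)" using curve_rk by (simp add: min_def)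
    then show ?thesis using pspan_param[of "Vw 3" "curve_mon n (E - rk)" 1] Suc by simp
  next
    case False
    then have "curve_mon (Suc n) E = param (Vw 0) ^ n * curve E" by (simp add: min_def curve_mon_0 mult.commute)
    moreover have "curve E \<in> pspan"
    proof (cases "E = 0")
      case True
      have "param (Vw 0) ^ 1 * bas 0 \<in> pspan" by (intro pspan_param pspan_bas) auto
      then show ?thesis using True by (simp add: bas_def curve_def)
    next
      case neq: False
      then show ?thesis using pspan_bas[of E] False by (simp add: bas_def)
    qed
    ultimately show ?thesis using pspan_param[of "Vw 0"] by simp
  qed
qed

text \<open>Modulo \<open>th2\<close> and \<open>th3\<close>, whose cofactors have smaller degree, a monomial is a standard monomial of the
  curve, and these are \<open>th4\<^sup>i p\<^sup>j\<close> times a basis element.\<close>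

lemma forms_pspan: "forms n \<subseteq> pspan"
proof (induction n rule: less_induct)
  case (less n)
  have mon: "Mon m \<in> pspan" if m: "m \<in> cone" "pd m = n" for m
  proof -
    obtain i j k c e where t: "m = tmon i j k c e" "c \<le> i + a * j + b * k" using m(1) by (rule cone_E)
    have n: "n = i + j + k" using m t by simp
    from Mon_curve_mon[OF t(2)] have cg: "cgE n (Mon (tmon i j k c 0)) (curve_mon n (c + j + (a + 1) * k))" by (simp add: n)
    have "Mon (tmon i j k c 0) \<in> pspan"
    proof (cases "Mon (tmon i j k c 0) = curve_mon n (c + j + (a + 1) * k)")
      case True then show ?thesis using pspan_curve_mon by simp
    next
      case False
      then obtain d where d: "n = Suc d" "Mon (tmon i j k c 0) - curve_mon n (c + j + (a + 1) * k) \<in> th_ideal d"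
        using cg by (auto simp: cgE_def)
      then obtain f g where fg: "f \<in> forms d" "g \<in> forms d" "Mon (tmon i j k c 0) - curve_mon n (c + j + (a + 1) * k) = th2 * f + th3 * g"
        by (auto simp: th_ideal_def)
      then have "f \<in> pspan" "g \<in> pspan" using less[of d] d by auto
      then have "param (Vw 1) ^ 1 * f + param (Vw 2) ^ 1 * g + curve_mon n (c + j + (a + 1) * k) \<in> pspan"
        by (intro pspan_add pspan_param pspan_curve_mon) auto
      moreover have "Mon (tmon i j k c 0) = th2 * f + th3 * g + curve_mon n (c + j + (a + 1) * k)"
        using fg(3) by (simp add: diff_eq_eq)
      ultimately show ?thesis by simp
    qed
    moreover have "Mon m = param Vz ^ e * Mon (tmon i j k c 0)" by (simp add: t Mon_tmon mult_ac)
    ultimately show ?thesis using pspan_param[of Vz] by simp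
  qed
  show ?case
  proof
    fix f assume f: "f \<in> forms n"
    have "(\<Sum>m\<in>Poly_Mapping.keys f. Cst (Poly_Mapping.lookup f m) * Mon m) \<in> pspan"
      using f mon by (intro pspan_sum pspan_Cst) (auto simp: forms_def toric_def)
    then show "f \<in> pspan" by (simp flip: pol_eq_sum)
  qed
qed

theorem toric_spanned: "f \<in> toric \<Longrightarrow> \<exists>F. (\<forall>c<rk. F c \<in> PV pvars) \<and> f = (\<Sum>c<rk. psub param (F c) * bas c)"
proof -
  assume f: "f \<in> toric"
  have "(\<Sum>m\<in>Poly_Mapping.keys f. Cst (Poly_Mapping.lookup f m) * Mon m) \<in> pspan"
    using f forms_Mon forms_pspan by (intro pspan_sum pspan_Cst) (auto simp: toric_def)
  then have "f \<in> pspan" by (simp flip: pol_eq_sum)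
  then show ?thesis by (simp add: pspan_def)
qed

text \<open>For independence apply the automorphism of the polynomial ring that sends \<open>th2\<close> to \<open>q\<close> and \<open>th3\<close>
  to \<open>r\<close>. In lowest degree in \<open>q\<close> and \<open>r\<close> the products of powers of the parameters with the basis elements
  become distinct monomials.\<close>

fun rho :: "indet \<Rightarrow> 'k pol" where
  "rho (Vw i) = (if i = 0 then lam * pp - qq else lam ^ a * (lam * pp - qq) - rr)"
| "rho Vx = pp"
| "rho Vy = lam"
| "rho Vz = zz"

definition qr :: "(indet \<Rightarrow>\<^sub>0 nat) \<Rightarrow> nat" where
  "qr m = Poly_Mapping.lookup m (Vw 0) + Poly_Mapping.lookup m (Vw (Suc 0))"

definition qr_ord :: "nat \<Rightarrow> 'k pol set" where
  "qr_ord n = {f. \<forall>m\<in>Poly_Mapping.keys f. n \<le> qr m}"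

lemma qr_ord_add: "f \<in> qr_ord n \<Longrightarrow> g \<in> qr_ord n \<Longrightarrow> f + g \<in> qr_ord n"
  using keys_add[of f g] by (fastforce simp: qr_ord_def)

lemma qr_ord_mult: "f \<in> qr_ord n \<Longrightarrow> g \<in> qr_ord m \<Longrightarrow> f * g \<in> qr_ord (n + m)"
  using keys_mult[of f g] by (fastforce simp: qr_ord_def qr_def lookup_add)

lemma qr_ord_mult0: "g \<in> qr_ord n \<Longrightarrow> f * g \<in> qr_ord n"
  using qr_ord_mult[of f 0 g n] by (simp add: qr_ord_def)

lemma qr_ord_0: "0 \<in> qr_ord n"
  by (simp add: qr_ord_def)

lemma qr_ord_uminus: "f \<in> qr_ord n \<Longrightarrow> - f \<in> qr_ord n"
  by (auto simp: qr_ord_def in_keys_iff)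

lemma qr_ord_qr: "qq \<in> qr_ord 1" "rr \<in> qr_ord 1"
  by (auto simp: qr_ord_def Var_def qr_def)

lemma qr_ord_Mon: "Mon m \<in> qr_ord (qr m)"
  by (simp add: qr_ord_def)

lemma power_cong_qr_ord: "f - g \<in> qr_ord 1 \<Longrightarrow> f ^ n - g ^ n \<in> qr_ord 1"
proof (induction n)
  case (Suc n)
  have "f ^ Suc n - g ^ Suc n = f * (f ^ n - g ^ n) + g ^ n * (f - g)" by (simp add: algebra_simps)
  then show ?case using Suc by (auto intro!: qr_ord_add qr_ord_mult0)
qed (simp add: qr_ord_0)

lemma rho_th: "psub rho th2 = qq" "psub rho th3 = rr" "psub rho th4 - lam ^ rk * pp \<in> qr_ord 1"
proof -
  show "psub rho th2 = qq" "psub rho th3 = rr" by (simp_all add: th2_def th3_def hom_distribs)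
  have "psub rho th4 - lam ^ rk * pp = - (lam ^ b * lam ^ a * qq + lam ^ b * rr)"
    by (simp add: th4_def hom_distribs power_add algebra_simps)
  moreover have "\<dots> \<in> qr_ord 1" by (intro qr_ord_uminus qr_ord_add qr_ord_mult0 qr_ord_qr)
  ultimately show "psub rho th4 - lam ^ rk * pp \<in> qr_ord 1" by argo
qed

lemma rho_bas: "psub rho (bas c) - lam ^ c * pp ^ (if c = 0 then 0 else 1) \<in> qr_ord 1" if "c < rk"
proof -
  consider "c = 0" | "0 < c" "c \<le> a" | "a < c" by linarith
  then show ?thesis
  proof cases
    case 1 then show ?thesis by (simp add: bas_def qr_ord_0)
  next
    case 2
    then have "lam ^ c = lam ^ (c - 1) * lam" using power_Suc2[of lam "c - 1"] by simp
    then have "psub rho (bas c) - lam ^ c * pp ^ (if c = 0 then 0 else 1) = - (lam ^ (c - 1) * qq)"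
      using 2 by (simp add: bas_def curve_def hom_distribs algebra_simps)
    moreover have "\<dots> \<in> qr_ord 1" by (intro qr_ord_uminus qr_ord_add qr_ord_mult0 qr_ord_qr)
    ultimately show ?thesis by argo
  next
    case 3
    then have "c = (c - 1 - a) + a + 1" by simp
    then have "lam ^ c = lam ^ (c - 1 - a) * lam ^ a * lam" by (metis power_add power_one_right)
    then have "psub rho (bas c) - lam ^ c * pp ^ (if c = 0 then 0 else 1) = - (lam ^ (c - 1 - a) * lam ^ a * qq + lam ^ (c - 1 - a) * rr)"
      using 3 by (simp add: bas_def curve_def hom_distribs algebra_simps)
    moreover have "\<dots> \<in> qr_ord 1" by (intro qr_ord_uminus qr_ord_add qr_ord_mult0 qr_ord_qr)
    ultimately show ?thesis by argo
  qed
qed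

text \<open>The term of lowest degree in \<open>q\<close>, \<open>r\<close> of the product of the parameter monomial \<open>m\<close> with the basis element
  \<open>c\<close>, after the automorphism: \<open>th2\<close>, \<open>th3\<close>, \<open>th4\<close> contribute \<open>q\<close>, \<open>r\<close> and \<open>\<lambda>\<^bsup>rk\<^esup> p\<close>, the basis element
  \<open>\<lambda>\<^sup>c p\<close>, or \<open>1\<close> if \<open>c = 0\<close>.\<close>

definition lead :: "(indet \<Rightarrow>\<^sub>0 nat) \<Rightarrow> nat \<Rightarrow> indet \<Rightarrow>\<^sub>0 nat" where
  "lead m c = tmon (Poly_Mapping.lookup m (Vw 0) + Poly_Mapping.lookup m (Vw 3) + (if c = 0 then 0 else 1))
     (Poly_Mapping.lookup m (Vw (Suc 0))) (Poly_Mapping.lookup m (Vw 2)) (rk * Poly_Mapping.lookup m (Vw 3) + c)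
     (Poly_Mapping.lookup m Vz)"

text \<open>The exponent of \<open>\<lambda>\<close> determines \<open>c\<close> as its remainder modulo the rank.\<close>

lemma lead_inj:
  assumes "lead m c = lead m' c'" "c < rk" "c' < rk" "Poly_Mapping.keys m \<subseteq> pvars" "Poly_Mapping.keys m' \<subseteq> pvars"
  shows "c = c' \<and> m = m'"
proof -
  have 1: "rk * Poly_Mapping.lookup m (Vw 3) + c = rk * Poly_Mapping.lookup m' (Vw 3) + c'"
    using arg_cong[OF assms(1), of "\<lambda>m. Poly_Mapping.lookup m Vy"] by (simp only: lead_def lookup_tmon)
  have c: "c = c'"
    using arg_cong[OF 1, of "\<lambda>x. x mod rk"] assms(2,3) by (simp only: mod_mult_self4 mod_less)
  have "rk * Poly_Mapping.lookup m (Vw 3) = rk * Poly_Mapping.lookup m' (Vw 3)"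
    using 1 unfolding c by (rule add_right_imp_eq)
  then have e4: "Poly_Mapping.lookup m (Vw 3) = Poly_Mapping.lookup m' (Vw 3)"
    by (subst (asm) mult_left_cancel) simp_all
  have "Poly_Mapping.lookup m (Vw 0) = Poly_Mapping.lookup m' (Vw 0)"
    using arg_cong[OF assms(1), of "\<lambda>m. Poly_Mapping.lookup m Vx"] c e4 by (simp add: lead_def)
  moreover have "Poly_Mapping.lookup m (Vw (Suc 0)) = Poly_Mapping.lookup m' (Vw (Suc 0))"
    using arg_cong[OF assms(1), of "\<lambda>m. Poly_Mapping.lookup m (Vw 0)"] by (simp add: lead_def)
  moreover have "Poly_Mapping.lookup m (Vw 2) = Poly_Mapping.lookup m' (Vw 2)"
    using arg_cong[OF assms(1), of "\<lambda>m. Poly_Mapping.lookup m (Vw (Suc 0))"] by (simp add: lead_def)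
  moreover have "Poly_Mapping.lookup m Vz = Poly_Mapping.lookup m' Vz"
    using arg_cong[OF assms(1), of "\<lambda>m. Poly_Mapping.lookup m Vz"] by (simp add: lead_def)
  ultimately have "Poly_Mapping.lookup m v = Poly_Mapping.lookup m' v" if "v \<in> pvars" for v using e4 that by auto
  moreover have "Poly_Mapping.lookup m v = Poly_Mapping.lookup m' v" if "v \<notin> pvars" for v
  proof -
    have "v \<notin> Poly_Mapping.keys m" "v \<notin> Poly_Mapping.keys m'" using assms(4,5) that by blast+
    then show ?thesis by (simp add: not_in_keys_iff_lookup_eq_zero)
  qed
  ultimately have "m = m'" by (intro poly_mapping_eqI) blast
  with c show ?thesis by simp
qed

lemma eq_prod_pvars:
  assumes "Poly_Mapping.keys m \<subseteq> pvars"
  shows "psub param (Mon m) = pp ^ Poly_Mapping.lookup m (Vw 0) * (th2 ^ Poly_Mapping.lookup m (Vw (Suc 0)) *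
     (th3 ^ Poly_Mapping.lookup m (Vw 2) * (th4 ^ Poly_Mapping.lookup m (Vw 3) * zz ^ Poly_Mapping.lookup m Vz)))"
proof -
  have "psub param (Mon m) = (\<Prod>v\<in>Poly_Mapping.keys m. param v ^ Poly_Mapping.lookup m v)"
    by (simp add: Mon_eq_prod hom_distribs)
  also have "\<dots> = (\<Prod>v\<in>pvars. param v ^ Poly_Mapping.lookup m v)"
    using assms by (intro prod.mono_neutral_left) (auto simp: in_keys_iff)
  also have "\<dots> = pp ^ Poly_Mapping.lookup m (Vw 0) * (th2 ^ Poly_Mapping.lookup m (Vw (Suc 0)) *
     (th3 ^ Poly_Mapping.lookup m (Vw 2) * (th4 ^ Poly_Mapping.lookup m (Vw 3) * zz ^ Poly_Mapping.lookup m Vz)))"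
    by simp
  finally show ?thesis .
qed

lemma rho_lead:
  assumes m: "Poly_Mapping.keys m \<subseteq> pvars" and c: "c < rk"
  shows "psub rho (psub param (Mon m) * bas c) - Mon (lead m c) \<in> qr_ord (Suc (qr (lead m c)))"
proof -
  define e1 e2 e3 e4 e5 where e: "e1 = Poly_Mapping.lookup m (Vw 0)" "e2 = Poly_Mapping.lookup m (Vw (Suc 0))"
    "e3 = Poly_Mapping.lookup m (Vw 2)" "e4 = Poly_Mapping.lookup m (Vw 3)" "e5 = Poly_Mapping.lookup m Vz"
  define \<epsilon> where "\<epsilon> = (if c = 0 then 0 else 1 :: nat)"
  have lead: "lead m c = tmon (e1 + e4 + \<epsilon>) e2 e3 (rk * e4 + c) e5" by (simp add: lead_def e \<epsilon>_def)
  let ?u = "qq ^ e2 * rr ^ e3"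
  have uLL: "?u \<in> qr_ord (e2 + e3)"
    using qr_ord_Mon[of "tmon 0 e2 e3 0 0"] by (simp add: Mon_tmon qr_def)
  let ?w = "psub rho th4 ^ e4 * psub rho (bas c) - (lam ^ rk * pp) ^ e4 * (lam ^ c * pp ^ \<epsilon>)"
  have "?w = psub rho th4 ^ e4 * (psub rho (bas c) - lam ^ c * pp ^ \<epsilon>) + (lam ^ c * pp ^ \<epsilon>) * (psub rho th4 ^ e4 - (lam ^ rk * pp) ^ e4)"
    by (simp add: algebra_simps)
  also have "\<dots> \<in> qr_ord 1"
    using rho_bas[OF c] power_cong_qr_ord[OF rho_th(3), of e4] unfolding \<epsilon>_def by (intro qr_ord_add qr_ord_mult0)
  finally have w: "?w \<in> qr_ord 1" .
  have "psub rho (psub param (Mon m) * bas c) = pp ^ e1 * (qq ^ e2 * (rr ^ e3 * (psub rho th4 ^ e4 * zz ^ e5))) * psub rho (bas c)"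
    unfolding eq_prod_pvars[OF m] e[symmetric] by (simp add: hom_distribs rho_th)
  moreover have "Mon (lead m c) = pp ^ e1 * (qq ^ e2 * (rr ^ e3 * zz ^ e5)) * ((lam ^ rk * pp) ^ e4 * (lam ^ c * pp ^ \<epsilon>))"
    unfolding lead Mon_tmon power_mult_distrib power_add power_mult by (simp only: mult_ac)
  ultimately have "psub rho (psub param (Mon m) * bas c) - Mon (lead m c) = (pp ^ e1 * zz ^ e5) * (?u * ?w)"
    by (simp add: algebra_simps)
  also have "\<dots> \<in> qr_ord (e2 + e3 + 1)" by (rule qr_ord_mult0[OF qr_ord_mult[OF uLL w]])
  also have "e2 + e3 + 1 = Suc (qr (lead m c))" by (simp add: lead qr_def)
  finally show ?thesis .
qed

theorem toric_independent:
  assumes F: "\<And>c. c < rk \<Longrightarrow> F c \<in> PV pvars" and zero: "(\<Sum>c<rk. psub param (F c) * bas c) = 0" and c: "c < rk"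
  shows "F c = 0"
proof (rule ccontr)
  assume "F c \<noteq> 0"
  define A where "A = (SIGMA c:{..<rk}. Poly_Mapping.keys (F c))"
  have finA: "finite A" by (simp add: A_def)
  define \<delta> where "\<delta> w = qr (lead (snd w) (fst w))" for w
  obtain m where "m \<in> Poly_Mapping.keys (F c)" using \<open>F c \<noteq> 0\<close> keys_eq_empty by blast
  then have "(c, m) \<in> A" using c by (auto simp: A_def)
  then have "A \<noteq> {}" by blast
  \<comment> \<open>A product \<open>w0\<close> with lead term of least degree: its lead term occurs in no other product.\<close>
  then obtain w0 where w0: "w0 \<in> A" "\<And>w. w \<in> A \<Longrightarrow> \<delta> w0 \<le> \<delta> w"
    using ex_has_least_nat[of "\<lambda>w. w \<in> A" _ \<delta>] by blast
  have keysA: "Poly_Mapping.keys (snd w) \<subseteq> pvars" "fst w < rk" if "w \<in> A" for w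
  proof -
    have w: "fst w < rk" "snd w \<in> Poly_Mapping.keys (F (fst w))" using that by (auto simp: A_def)
    then show "fst w < rk" by blast
    show "Poly_Mapping.keys (snd w) \<subseteq> pvars" using F[OF w(1)] w(2) unfolding PV_iff by blast
  qed
  define m0 where "m0 = lead (snd w0) (fst w0)"
  define g where "g w = psub rho (psub param (Mon (snd w)) * bas (fst w))" for w
  have lk: "Poly_Mapping.lookup (g w) m0 = (if w = w0 then 1 else 0)" if w: "w \<in> A" for w
  proof -
    have LLw: "g w - Mon (lead (snd w) (fst w)) \<in> qr_ord (Suc (\<delta> w))"
      unfolding g_def \<delta>_def using rho_lead keysA[OF w] by blast
    have "m0 \<notin> Poly_Mapping.keys (g w - Mon (lead (snd w) (fst w)))"
      using LLw w0(2)[OF w] by (auto simp: qr_ord_def m0_def \<delta>_def)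
    then have "Poly_Mapping.lookup (g w) m0 = Poly_Mapping.lookup (Mon (lead (snd w) (fst w)) :: 'k pol) m0"
      by (simp add: not_in_keys_iff_lookup_eq_zero lookup_minus)
    moreover have "lead (snd w) (fst w) = m0 \<longleftrightarrow> w = w0"
      using lead_inj[of "snd w" "fst w" "snd w0" "fst w0"] keysA[OF w] keysA[OF w0(1)] by (auto simp: m0_def prod_eq_iff)
    ultimately show ?thesis by (simp add: lookup_Mon)
  qed
  have "psub param (F c) * bas c = (\<Sum>m\<in>Poly_Mapping.keys (F c). Cst (Poly_Mapping.lookup (F c) m) * (psub param (Mon m) * bas c))" for c
    by (subst pol_eq_sum[of "F c"]) (simp add: hom_distribs sum_distrib_right mult.assoc)
  then have "(\<Sum>c<rk. psub param (F c) * bas c) = (\<Sum>w\<in>A. Cst (Poly_Mapping.lookup (F (fst w)) (snd w)) * (psub param (Mon (snd w)) * bas (fst w)))"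
    unfolding A_def by (simp add: sum.Sigma split_def del: sum.lessThan_Suc)
  then have "0 = psub rho (\<Sum>w\<in>A. Cst (Poly_Mapping.lookup (F (fst w)) (snd w)) * (psub param (Mon (snd w)) * bas (fst w)))"
    using zero by simp
  also have "\<dots> = (\<Sum>w\<in>A. Cst (Poly_Mapping.lookup (F (fst w)) (snd w)) * g w)"
    by (simp add: g_def hom_distribs)
  finally have "0 = Poly_Mapping.lookup (\<Sum>w\<in>A. Cst (Poly_Mapping.lookup (F (fst w)) (snd w)) * g w) m0"
    by (metis lookup_zero)
  also have "\<dots> = (\<Sum>w\<in>A. if w = w0 then Poly_Mapping.lookup (F (fst w)) (snd w) else 0)"
    unfolding lookup_sum by (intro sum.cong) (auto simp: lookup_Cst_mult lk)
  also have "\<dots> = Poly_Mapping.lookup (F (fst w0)) (snd w0)" using finA w0(1) by simp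
  finally show False using w0(1) by (auto simp: A_def in_keys_iff)
qed

end

subsection \<open>Principal ideals of the toric ring\<close>

lemma Var_neq_0 [simp]: "Var v \<noteq> (0 :: 'k::comm_ring_1 pol)"
  by (metis Var_eq_Mon keys_Mon keys_zero insert_not_empty)

lemma split_off_Var:
  assumes "p \<in> PV vs"
  shows "\<exists>a q. p = a + Var v * q \<and> a \<in> PV (vs - {v}) \<and> q \<in> PV (vs :: indet set)"
  using assms
proof (induction p rule: pol_induct)
  case (Cst c)
  show ?case by (rule exI[of _ "Cst c"], rule exI[of _ 0]) simp
next
  case (add p q)
  then obtain a p' b q' where "p = a + Var v * p'" "a \<in> PV (vs - {v})" "p' \<in> PV vs"
    "q = b + Var v * q'" "b \<in> PV (vs - {v})" "q' \<in> PV vs" by blast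
  then show ?case by (intro exI[of _ "a + b"] exI[of _ "p' + q'"]) (auto simp: algebra_simps intro: PV_add)
next
  case (Var u p)
  show ?case
  proof (cases "u = v")
    case True
    then show ?thesis using Var by (intro exI[of _ 0] exI[of _ p]) auto
  next
    case False
    from Var obtain a q where "p = a + Var v * q" "a \<in> PV (vs - {v})" "q \<in> PV vs" by blast
    then show ?thesis using Var False
      by (intro exI[of _ "Var u * a"] exI[of _ "Var u * q"]) (auto simp: algebra_simps intro: PV_mult PV_Var)
  qed
qed

lemma not_multiple_of_Var:
  assumes "p \<in> PV vs" "v \<notin> vs" "p = Var v * q"
  shows "p = 0"
proof -
  have "[:p:] = [:0, 1:] * UP v q"
    using UP_const[OF assms(1,2)] by (subst (asm) assms(3)) (simp add: hom_distribs UP_Var assms(3))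
  then have "coeff [:p:] 0 = coeff ([:0, 1:] * UP v q) 0" by simp
  then show ?thesis by simp
qed

lemma lookup_Mon_mult: "Poly_Mapping.lookup (Mon m * (f :: 'k::comm_ring_1 pol)) (m + m') = Poly_Mapping.lookup f m'"
proof -
  have "Mon m * f = (\<Sum>m1\<in>Poly_Mapping.keys f. Cst (Poly_Mapping.lookup f m1) * Mon (m + m1))"
    by (subst pol_eq_sum[of f]) (simp add: sum_distrib_left Mon_add mult.left_commute)
  then have "Poly_Mapping.lookup (Mon m * f) (m + m') =
    (\<Sum>m1\<in>Poly_Mapping.keys f. Poly_Mapping.lookup (Cst (Poly_Mapping.lookup f m1) * Mon (m + m1)) (m + m'))"
    by (simp only: lookup_sum)
  also have "\<dots> = (\<Sum>m1\<in>Poly_Mapping.keys f. if m1 = m' then Poly_Mapping.lookup f m' else 0)"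
    by (intro sum.cong) (auto simp: lookup_Cst_mult lookup_Mon)
  also have "\<dots> = Poly_Mapping.lookup f m'" by (simp add: in_keys_iff)
  finally show ?thesis .
qed

lemma keys_Mon_mult: "m' \<in> Poly_Mapping.keys f \<Longrightarrow> m + m' \<in> Poly_Mapping.keys (Mon m * (f :: 'k::comm_ring_1 pol))"
  by (simp add: in_keys_iff lookup_Mon_mult)

context scroll
begin

definition multiples :: "'k pol \<Rightarrow> 'k pol set" where
  "multiples g = {g * f | f. f \<in> toric}"

lemma multiplesI: "f \<in> toric \<Longrightarrow> g * f \<in> multiples g"
  by (auto simp: multiples_def)

text \<open>From \<open>p f = g b\<^sub>1\<close> it follows that \<open>p\<close> divides \<open>b\<^sub>1\<close> in the polynomial ring, so \<open>f = g b\<^sub>0\<close> with \<open>p b\<^sub>0 = b\<^sub>1\<close>. The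
  second hypothesis puts \<open>\<lambda> p b\<^sub>0\<close> into the toric ring. There the inequality on the exponents is the one for
  \<open>b\<^sub>0\<close>, as the exponents of \<open>\<lambda>\<close> and \<open>p\<close> both grow by one.\<close>

lemma colon_multiples:
  assumes g: "g \<in> PV us" "Vx \<notin> us" "g \<noteq> 0" and f: "pp * f \<in> multiples g" "lam * pp * f \<in> multiples g"
  shows "f \<in> multiples g"
proof -
  obtain b1 b2 where b: "b1 \<in> toric" "pp * f = g * b1" "b2 \<in> toric" "lam * pp * f = g * b2"
    using f by (auto simp: multiples_def)
  have "g * b2 = lam * (g * b1)" using b(2,4) by (metis mult.assoc)
  then have "g * b2 = g * (lam * b1)" by (simp only: mult.left_commute)
  then have b2: "b2 = lam * b1" using g by simp
  obtain c b0 where c: "b1 = c + pp * b0" "c \<in> PV (tvars - {Vx})"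
    using split_off_Var[OF toric_PV[OF b(1)], of Vx] by blast
  have "g * c = pp * (f - g * b0)" using b(2) c(1) by (simp add: algebra_simps)
  moreover have "g * c \<in> PV (us \<union> (tvars - {Vx}))" using g(1) c(2) by (intro PV_mult) (auto elim: PV_mono[rotated])
  moreover have "Vx \<notin> us \<union> (tvars - {Vx})" using g(2) by simp
  ultimately have "g * c = 0" using not_multiple_of_Var by metis
  then have "c = 0" using g by simp
  then have b1: "b1 = pp * b0" using c by simp
  then have "pp * f = pp * (g * b0)" using b(2) by (simp add: algebra_simps)
  then have f_eq: "f = g * b0" by simp
  have "b0 \<in> toric"
    unfolding toric_def
  proof (intro CollectI subsetI)
    fix m assume m: "m \<in> Poly_Mapping.keys b0"
    have "b2 = Mon (tmon 1 0 0 1 0) * b0" unfolding b2 b1 by (simp add: Mon_tmon mult_ac)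
    then have "tmon 1 0 0 1 0 + m \<in> cone" using keys_Mon_mult[OF m, of "tmon 1 0 0 1 0"] b(3) by (auto simp: toric_def)
    then show "m \<in> cone" by (simp add: cone_def keys_add_nat lookup_add)
  qed
  then show ?thesis using f_eq by (auto simp: multiples_def)
qed

lemma z_cancel_toric: "zz * f \<in> toric \<Longrightarrow> f \<in> toric"
  unfolding toric_def
proof (intro CollectI subsetI)
  fix m assume *: "zz * f \<in> {f. Poly_Mapping.keys f \<subseteq> cone}" "m \<in> Poly_Mapping.keys f"
  have "tmon 0 0 0 0 1 + m \<in> cone"
    using keys_Mon_mult[OF *(2), of "tmon 0 0 0 0 1"] *(1) by (auto simp: Mon_tmon)
  then show "m \<in> cone" by (simp add: cone_def keys_add_nat lookup_add)
qed

text \<open>The exponent of \<open>z\<close> is not restricted in the toric ring, so \<open>z\<close> is prime there as in the polynomial ring.\<close>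

lemma z_prime: "primeideal (multiples zz) (sub_ring toric)"
proof (rule primeidealI)
  have m: "multiples zz = PIdl\<^bsub>sub_ring toric\<^esub> zz" by (auto simp: multiples_def cgenideal_def mult.commute)
  then show "ideal (multiples zz) (sub_ring toric)" using toric.cgenideal_ideal toric_gens by simp
  show "cring (sub_ring toric)" by (rule toric.is_cring)
  have nd: "f = 0" if "f \<in> PV (tvars - {Vz})" "f = zz * q" for f q
    using not_multiple_of_Var[OF that(1) _ that(2)] by simp
  have "1 \<notin> multiples zz" using nd[of 1] by (auto simp: multiples_def)
  then show "carrier (sub_ring toric) \<noteq> multiples zz" by auto
  fix f h assume fh: "f \<in> carrier (sub_ring toric)" "h \<in> carrier (sub_ring toric)" "f \<otimes>\<^bsub>sub_ring toric\<^esub> h \<in> multiples zz"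
  then have K: "f \<in> toric" "h \<in> toric" by auto
  obtain s where s: "f * h = zz * s" using fh by (auto simp: multiples_def)
  obtain c f' d h' where cd: "f = c + zz * f'" "c \<in> PV (tvars - {Vz})" "h = d + zz * h'" "d \<in> PV (tvars - {Vz})"
    using split_off_Var[OF toric_PV[OF K(1)], of Vz] split_off_Var[OF toric_PV[OF K(2)], of Vz] by blast
  have "c * d = zz * (s - f' * d - c * h' - zz * f' * h')" using s unfolding cd by (simp add: algebra_simps)
  then have "c * d = 0" using nd PV_mult[OF cd(2,4)] by blast
  then have "c = 0 \<or> d = 0" by simp
  then show "f \<in> multiples zz \<or> h \<in> multiples zz"
  proof
    assume "c = 0"
    then have "f = zz * f'" using cd by simp
    then show ?thesis using K z_cancel_toric by (auto simp: multiples_def)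
  next
    assume "d = 0"
    then have "h = zz * h'" using cd by simp
    then show ?thesis using K z_cancel_toric by (auto simp: multiples_def)
  qed
qed

text \<open>A prime strictly inside \<open>(z)\<close> does not contain \<open>z\<close>, so its elements can be divided by \<open>z\<close> again
  and again without leaving it.\<close>

lemma prime_below_z:
  assumes P: "primeideal P (sub_ring toric)" "P \<subset> multiples zz"
  shows "P = {0}"
proof -
  interpret P: primeideal P "sub_ring toric" by fact
  have "zz \<notin> P"
  proof
    assume "zz \<in> P"
    then have "multiples zz \<subseteq> P" using P.I_r_closed[of zz] by (auto simp: multiples_def)
    then show False using P(2) by blast
  qed
  have step: "\<exists>q'\<in>P. q = zz * q'" if q: "q \<in> P" for q
  proof -
    from q P(2) obtain q' where q': "q' \<in> toric" "q = zz * q'" by (auto simp: multiples_def)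
    then have "q' \<in> P" using P.I_prime[of zz q'] q \<open>zz \<notin> P\<close> toric_gens(3) by simp
    then show ?thesis using q' by blast
  qed
  have pow: "\<exists>q'\<in>P. q = zz ^ k * q'" if "q \<in> P" for q k
  proof (induction k)
    case (Suc k)
    then obtain q' where q': "q' \<in> P" "q = zz ^ k * q'" by blast
    from step[OF q'(1)] obtain q'' where "q'' \<in> P" "q' = zz * q''" by blast
    then show ?case using q' by (intro bexI[of _ q'']) (simp_all add: mult_ac)
  qed (use that in auto)
  have "q = 0" if q: "q \<in> P" for q
  proof (rule ccontr)
    assume "q \<noteq> 0"
    then obtain m where m: "m \<in> Poly_Mapping.keys q" using keys_eq_empty by blast
    define k where "k = Suc (Poly_Mapping.lookup m Vz)"
    obtain q' where "q = zz ^ k * q'" using pow[OF q] by blast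
    then have "q = Mon (Poly_Mapping.single Vz k) * q'" by (simp add: Mon_single)
    then obtain m' where "m = Poly_Mapping.single Vz k + m'"
      using keys_mult[of "Mon (Poly_Mapping.single Vz k)" q'] m by auto
    then have "Poly_Mapping.lookup m Vz = k + Poly_Mapping.lookup m' Vz" by (simp add: lookup_add)
    then show False by (simp add: k_def)
  qed
  then show ?thesis using P.zero_closed by auto
qed

lemma zero_prime: "primeideal {0} (sub_ring toric)"
proof (rule primeidealI)
  have "(1 :: 'k pol) \<notin> {0}" by simp
  then show "carrier (sub_ring toric) \<noteq> {0}" unfolding sub_ring_simps using toric.K_1 by metis
  show "ideal {0} (sub_ring toric)" using toric.zeroideal by simp
  show "cring (sub_ring toric)" by (rule toric.is_cring)
qed simp

subsection \<open>A regular sequence modulo a principal ideal, at every point\<close>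

text \<open>The element \<open>g\<close> is algebraic over the field of fractions of the parameters; the constant term of an
  algebraic equation is a multiple of \<open>g\<close>.\<close>

lemma exists_norm:
  assumes g: "g \<in> toric" "g \<noteq> 0"
  shows "\<exists>N\<in>PV pvars. N \<noteq> 0 \<and> (\<exists>g'\<in>toric. g * g' = psub param N)"
proof -
  define xs where "xs = insert (Vw 4) pvars"
  define f where "f v = (if v = Vw 4 then g else param v)" for v
  have fK: "f v \<in> toric" for v using g param_toric by (simp add: f_def)
  have "\<exists>F\<in>PV xs. F \<noteq> 0 \<and> psub f F = 0"
    by (rule algebraic_dependence[of xs tvars]) (auto simp: xs_def intro: toric_PV fK)
  then obtain F where F: "F \<in> PV xs" "F \<noteq> 0" "psub f F = 0" by blast
  obtain i N q where N: "F = Var (Vw 4) ^ i * (N + Var (Vw 4) * q)" "N \<noteq> 0" "N \<in> PV (xs - {Vw 4})" "q \<in> PV xs"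
    using UP_lowest_term[OF F(1,2), of "Vw 4"] by (auto simp: xs_def)
  have Np: "N \<in> PV pvars" using N(3) by (rule PV_mono[rotated]) (auto simp: xs_def)
  have "psub f N = psub param N" by (rule ev_cong[OF Np]) (auto simp: f_def)
  then have "g ^ i * (psub param N + g * psub f q) = 0" using F(3) unfolding N(1) by (simp add: hom_distribs f_def)
  then have "psub param N + g * psub f q = 0" using g(2) by simp
  then have "g * (- psub f q) = psub param N" by (simp add: add_eq_0_iff2)
  moreover have "- psub f q \<in> toric" by (intro toric.K_uminus toric.K_psub[OF N(4)] fK)
  ultimately show ?thesis using Np N(2) by blast
qed

text \<open>Reduction modulo the first \<open>i\<close> parameters.\<close>

definition kill :: "nat \<Rightarrow> indet \<Rightarrow> 'k pol" where
  "kill i v = (if v \<in> Vw ` {..<i} then 0 else Var v)"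

lemma kill_in [simp]: "j < i \<Longrightarrow> kill i (Vw j) = 0"
  and kill_out [simp]: "i \<le> j \<Longrightarrow> kill i (Vw j) = Var (Vw j)" and kill_z [simp]: "kill i Vz = Var Vz"
  by (auto simp: kill_def)

lemma kill_eq_0:
  "F \<in> PV vs \<Longrightarrow> Vw ` {..<i} \<subseteq> vs \<Longrightarrow> psub (kill i) F = 0 \<Longrightarrow> \<exists>G. (\<forall>j<i. G j \<in> PV vs) \<and> F = (\<Sum>j<i. Var (Vw j) * G j)"
proof (induction i arbitrary: F)
  case 0
  have "kill 0 = Var" by (auto simp: kill_def)
  then show ?case using 0 by (simp add: psub_id)
next
  case (Suc i)
  obtain A G where A: "F = A + Var (Vw i) * G" "A \<in> PV (vs - {Vw i})" "G \<in> PV vs"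
    using split_off_Var[OF Suc.prems(1), of "Vw i"] by blast
  have "psub (kill (Suc i)) A = psub (kill i) A"
    by (rule ev_cong[OF A(2)]) (auto simp: kill_def less_Suc_eq)
  then have "psub (kill i) A = 0" using Suc.prems(3) unfolding A(1) by (simp add: hom_distribs)
  moreover have "A \<in> PV vs" using A(2) by (rule PV_mono[rotated]) auto
  moreover have "Vw ` {..<i} \<subseteq> vs" using Suc.prems(2) by (auto simp: image_subset_iff)
  ultimately obtain G' where G': "\<forall>j<i. G' j \<in> PV vs" "A = (\<Sum>j<i. Var (Vw j) * G' j)"
    using Suc.IH[of A] by blast
  show ?case
    by (rule exI[of _ "G'(i := G)"]) (use G' A in \<open>auto simp: less_Suc_eq\<close>)
qed

text \<open>After an affine change of the parameters that moves a given point to the origin and makes \<open>N\<close>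
  nonzero on the last coordinate axis, the first four parameters form a regular sequence modulo \<open>g\<close>:
  on the quotient by any number of them, a free module over a polynomial ring, \<open>g\<close> is injective because
  its multiple \<open>N\<close> is.\<close>

theorem regular_mod_principal:
  assumes g: "g \<in> toric" "g \<noteq> 0"
  shows "\<exists>\<nu>. \<forall>i<4. \<forall>f\<in>toric.
     (let h = (\<lambda>j. param (Vw j) - Cst (\<gamma> j) - Cst (\<nu> j) * (zz - Cst \<gamma>z)) in
      (\<exists>f'\<in>toric. \<exists>s. (\<forall>j<i. s j \<in> toric) \<and> h i * f = g * f' + (\<Sum>j<i. h j * s j)) \<longrightarrow>
      (\<exists>f'\<in>toric. \<exists>s. (\<forall>j<i. s j \<in> toric) \<and> f = g * f' + (\<Sum>j<i. h j * s j)))"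
proof -
  obtain N g' where N: "N \<in> PV pvars" "N \<noteq> 0" "g' \<in> toric" "g * g' = psub param N"
    using exists_norm[OF g] by blast
  have VzN: "Var Vz - Cst \<gamma>z \<noteq> (0 :: 'k pol)"
  proof
    assume "Var Vz - Cst \<gamma>z = (0 :: 'k pol)"
    then have "pev (\<lambda>_. \<gamma>z + 1) (Var Vz - Cst \<gamma>z) = 0" by simp
    then show False by (simp add: hom_distribs)
  qed
  have "N * (Var Vz - Cst \<gamma>z) \<in> PV pvars" using N(1) by (intro PV_mult PV_diff PV_Var PV_Cst) auto
  then obtain d where "pev d (N * (Var Vz - Cst \<gamma>z)) \<noteq> 0"
    using nonvanishing_point[OF infinite_alg_closed, of pvars "N * (Var Vz - Cst \<gamma>z)"] N(2) VzN by auto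
  then have d: "pev d N \<noteq> 0" "d Vz - \<gamma>z \<noteq> 0" by (auto simp: hom_distribs)
  \<comment> \<open>The line through the given point and a point \<open>d\<close> where \<open>N\<close> does not vanish, parametrized by \<open>z\<close>.\<close>
  define \<nu> where "\<nu> i = (d (Vw i) - \<gamma> i) / (d Vz - \<gamma>z)" for i
  define to_new :: "indet \<Rightarrow> 'k pol" where
    "to_new v = (case v of Vw i \<Rightarrow> Var v + Cst (\<gamma> i) + Cst (\<nu> i) * Var Vz | Vz \<Rightarrow> Var v + Cst \<gamma>z | _ \<Rightarrow> Var v)" for v
  define to_old :: "indet \<Rightarrow> 'k pol" where
    "to_old v = (case v of Vw i \<Rightarrow> Var v - Cst (\<gamma> i) - Cst (\<nu> i) * (Var Vz - Cst \<gamma>z) | Vz \<Rightarrow> Var v - Cst \<gamma>z | _ \<Rightarrow> Var v)" for v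
  have new_old: "psub to_new (psub to_old F) = F" for F
  proof -
    have "(\<lambda>v. psub to_new (to_old v)) = Var"
      by (rule ext) (simp add: to_new_def to_old_def hom_distribs split: indet.split)
    then show ?thesis by (simp add: psub_psub psub_id)
  qed
  have old_new: "psub to_old (psub to_new F) = F" for F
  proof -
    have "(\<lambda>v. psub to_old (to_new v)) = Var"
      by (rule ext) (simp add: to_new_def to_old_def hom_distribs split: indet.split)
    then show ?thesis by (simp add: psub_psub psub_id)
  qed
  have new_PV: "psub to_new F \<in> PV pvars" if "F \<in> PV pvars" for F
    using that by (rule psub_PV) (auto simp: to_new_def intro!: PV_add PV_mult PV_Var PV_Cst)
  have old_PV: "psub to_old F \<in> PV pvars" if "F \<in> PV pvars" for F
    using that by (rule psub_PV) (auto simp: to_old_def intro!: PV_diff PV_mult PV_Var PV_Cst)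
  define \<sigma> where "\<sigma> v = psub param (to_old v)" for v
  have sig: "psub \<sigma> F = psub param (psub to_old F)" for F
    unfolding psub_psub by (rule ev_cong[OF PV_UNIV]) (simp add: \<sigma>_def)
  have sigK: "psub \<sigma> F \<in> toric" for F
    unfolding sig by (rule toric.K_psub[OF PV_UNIV]) (rule param_toric)
  define h where "h j = param (Vw j) - Cst (\<gamma> j) - Cst (\<nu> j) * (zz - Cst \<gamma>z)" for j
  have hs: "h j = psub \<sigma> (Var (Vw j))" for j unfolding sig by (simp add: h_def to_old_def hom_distribs)
  have hK: "h j \<in> toric" for j unfolding hs by (rule sigK)
  define N' where "N' = psub to_new N"
  have N': "N' \<in> PV pvars" "psub \<sigma> N' = g * g'" unfolding N'_def sig old_new N(4) using new_PV[OF N(1)] by auto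
  \<comment> \<open>Coordinates with respect to the basis, in the new parameters.\<close>
  have "\<forall>f\<in>toric. \<exists>F. (\<forall>c<rk. F c \<in> PV pvars) \<and> f = (\<Sum>c<rk. psub \<sigma> (F c) * bas c)"
  proof
    fix f assume "f \<in> toric"
    then obtain F where F: "\<forall>c<rk. F c \<in> PV pvars" "f = (\<Sum>c<rk. psub param (F c) * bas c)" using toric_spanned by blast
    then have "f = (\<Sum>c<rk. psub \<sigma> (psub to_new (F c)) * bas c)" by (simp only: sig old_new)
    moreover have "\<forall>c<rk. psub to_new (F c) \<in> PV pvars" using F new_PV by blast
    ultimately show "\<exists>F. (\<forall>c<rk. F c \<in> PV pvars) \<and> f = (\<Sum>c<rk. psub \<sigma> (F c) * bas c)"
      by (intro exI[of _ "\<lambda>c. psub to_new (F c)"]) blast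
  qed
  from bchoice[OF this] obtain co where
    co: "\<forall>f\<in>toric. (\<forall>c<rk. co f c \<in> PV pvars) \<and> f = (\<Sum>c<rk. psub \<sigma> (co f c) * bas c)" ..
  have coP: "c < rk \<Longrightarrow> f \<in> toric \<Longrightarrow> co f c \<in> PV pvars" for f c using co by blast
  have coE: "f \<in> toric \<Longrightarrow> f = (\<Sum>c<rk. psub \<sigma> (co f c) * bas c)" for f using co by blast
  have uniq: "co f c = F c" if f: "f \<in> toric" and F: "\<And>c. c < rk \<Longrightarrow> F c \<in> PV pvars" "f = (\<Sum>c<rk. psub \<sigma> (F c) * bas c)" and c: "c < rk" for f F c
  proof -
    have "(\<Sum>c<rk. psub param (psub to_old (co f c - F c)) * bas c) = (\<Sum>c<rk. psub \<sigma> (co f c) * bas c) - (\<Sum>c<rk. psub \<sigma> (F c) * bas c)"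
      unfolding sig by (simp only: psub.hom_minus left_diff_distrib sum_subtractf)
    also have "\<dots> = 0" using coE[OF f] F(2) by simp
    finally have "psub to_old (co f c - F c) = 0"
      by (rule toric_independent[rotated]) (use c coP[OF _ f] F(1) in \<open>auto intro!: old_PV PV_diff\<close>)
    then have "psub to_new (psub to_old (co f c - F c)) = 0" by simp
    then show ?thesis unfolding new_old by simp
  qed
  have co_mult: "co (psub \<sigma> P * f) c = P * co f c" if P: "P \<in> PV pvars" and f: "f \<in> toric" and c: "c < rk" for P f c
  proof (rule uniq[OF _ _ _ c])
    show "psub \<sigma> P * f \<in> toric" using sigK f by (rule toric.K_mult)
    show "P * co f c \<in> PV pvars" if "c < rk" for c using P coP[OF that f] by (rule PV_mult)
    have "psub \<sigma> P * f = psub \<sigma> P * (\<Sum>c<rk. psub \<sigma> (co f c) * bas c)" by (rule arg_cong[OF coE[OF f]])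
    also have "\<dots> = (\<Sum>c<rk. psub \<sigma> (P * co f c) * bas c)"
      by (simp only: psub.hom_mult sum_distrib_left mult.assoc)
    finally show "psub \<sigma> P * f = (\<Sum>c<rk. psub \<sigma> (P * co f c) * bas c)" .
  qed
  define ai where "ai i = {f. \<exists>s. (\<forall>j<i. s j \<in> toric) \<and> f = (\<Sum>j<i. h j * s j)}" for i :: nat
  have bbK: "bas c \<in> toric" if "c < rk" for c
  proof -
    have "bas c = 1 \<or> bas c \<in> forms 1" using that forms_curve[of c] by (auto simp: bas_def)
    then show ?thesis by (auto simp: forms_def)
  qed
  have aiK: "f \<in> toric" if "f \<in> ai i" for f i using that hK by (auto simp: ai_def)
  \<comment> \<open>The ideal of the first \<open>i\<close> new parameters, read off from the coordinates.\<close>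
  have ai_kill: "f \<in> ai i \<longleftrightarrow> (\<forall>c<rk. psub (kill i) (co f c) = 0)" if f: "f \<in> toric" and i: "i \<le> 4" for f i
  proof
    assume "f \<in> ai i"
    then obtain s where s: "\<forall>j<i. s j \<in> toric" "f = (\<Sum>j<i. h j * s j)" by (auto simp: ai_def)
    show "\<forall>c<rk. psub (kill i) (co f c) = 0"
    proof (intro allI impI)
      fix c assume c: "c < rk"
      have vp: "Vw j \<in> pvars" if "j < i" for j
      proof -
        have "j = 0 \<or> j = 1 \<or> j = 2 \<or> j = 3" using that i by linarith
        then show ?thesis by auto
      qed
      have "co f c = (\<Sum>j<i. Var (Vw j) * co (s j) c)"
      proof (rule uniq[OF f _ _ c])
        show "(\<Sum>j<i. Var (Vw j) * co (s j) c) \<in> PV pvars" if "c < rk" for c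
          using s vp coP[OF that] by (intro PV_sum PV_mult PV_Var) auto
        have "f = (\<Sum>j<i. h j * (\<Sum>c<rk. psub \<sigma> (co (s j) c) * bas c))"
          unfolding s(2) using s(1) by (intro sum.cong refl arg_cong2[of _ _ _ _ "(*)"] coE) auto
        also have "\<dots> = (\<Sum>c<rk. \<Sum>j<i. h j * (psub \<sigma> (co (s j) c) * bas c))"
          unfolding sum_distrib_left by (rule sum.swap)
        also have "\<dots> = (\<Sum>c<rk. psub \<sigma> (\<Sum>j<i. Var (Vw j) * co (s j) c) * bas c)"
          unfolding hs psub.hom_sum psub.hom_mult sum_distrib_right mult.assoc ..
        finally show "f = (\<Sum>c<rk. psub \<sigma> (\<Sum>j<i. Var (Vw j) * co (s j) c) * bas c)" .
      qed
      then show "psub (kill i) (co f c) = 0" by (simp add: hom_distribs)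
    qed
  next
    assume k: "\<forall>c<rk. psub (kill i) (co f c) = 0"
    have sub: "Vw ` {..<i} \<subseteq> pvars"
    proof
      fix v assume "v \<in> Vw ` {..<i}"
      then obtain j where "v = Vw j" "j < i" by auto
      then have "j = 0 \<or> j = 1 \<or> j = 2 \<or> j = 3" using i by linarith
      then show "v \<in> pvars" using \<open>v = Vw j\<close> by auto
    qed
    have "\<forall>c\<in>{..<rk}. \<exists>G. (\<forall>j<i. G j \<in> PV pvars) \<and> co f c = (\<Sum>j<i. Var (Vw j) * G j)"
      using kill_eq_0[OF coP[OF _ f] sub] k by blast
    from bchoice[OF this] obtain G where G: "\<forall>c\<in>{..<rk}. (\<forall>j<i. G c j \<in> PV pvars) \<and> co f c = (\<Sum>j<i. Var (Vw j) * G c j)" ..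
    have "f = (\<Sum>c<rk. psub \<sigma> (co f c) * bas c)" by (rule coE[OF f])
    also have "\<dots> = (\<Sum>c<rk. psub \<sigma> (\<Sum>j<i. Var (Vw j) * G c j) * bas c)"
      using G by (intro sum.cong refl arg_cong2[of _ _ _ _ "(*)"] arg_cong[of _ _ "psub \<sigma>"]) blast
    also have "\<dots> = (\<Sum>c<rk. \<Sum>j<i. h j * (psub \<sigma> (G c j) * bas c))"
      unfolding hs psub.hom_sum psub.hom_mult sum_distrib_right mult.assoc ..
    also have "\<dots> = (\<Sum>j<i. h j * (\<Sum>c<rk. psub \<sigma> (G c j) * bas c))"
      unfolding sum_distrib_left by (rule sum.swap)
    finally have fe: "f = (\<Sum>j<i. h j * (\<Sum>c<rk. psub \<sigma> (G c j) * bas c))" .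
    have sK: "(\<Sum>c<rk. psub \<sigma> (G c j) * bas c) \<in> toric" for j
      using sigK bbK by (intro toric.K_sum toric.K_mult) auto
    show "f \<in> ai i" unfolding ai_def
      by (rule CollectI, rule exI[of _ "\<lambda>j. \<Sum>c<rk. psub \<sigma> (G c j) * bas c"], intro conjI allI impI sK fe)
  qed
  have ai_add: "f + f' \<in> ai i" if "f \<in> ai i" "f' \<in> ai i" for f f' i
  proof -
    obtain s s' where "\<forall>j<i. s j \<in> toric" "f = (\<Sum>j<i. h j * s j)" "\<forall>j<i. s' j \<in> toric" "f' = (\<Sum>j<i. h j * s' j)"
      using \<open>f \<in> ai i\<close> \<open>f' \<in> ai i\<close> by (auto simp: ai_def)
    then show ?thesis unfolding ai_def
      by (intro CollectI exI[of _ "\<lambda>j. s j + s' j"]) (auto simp: distrib_left sum.distrib)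
  qed
  have ai_mult: "k * f \<in> ai i" if "k \<in> toric" "f \<in> ai i" for k f i
  proof -
    obtain s where "\<forall>j<i. s j \<in> toric" "f = (\<Sum>j<i. h j * s j)" using \<open>f \<in> ai i\<close> by (auto simp: ai_def)
    then show ?thesis unfolding ai_def using \<open>k \<in> toric\<close>
      by (intro CollectI exI[of _ "\<lambda>j. k * s j"]) (auto simp: sum_distrib_left mult.left_commute)
  qed
  have ai_diff: "f - f' \<in> ai i" if "f \<in> ai i" "f' \<in> ai i" for f f' i
    using ai_add[OF that(1) ai_mult[OF toric.K_Cst[of "- 1"] that(2)]] by (simp add: hom_distribs)
  \<comment> \<open>The new parameters are a regular sequence, and \<open>g\<close> is regular modulo the first \<open>i\<close> of them.\<close>
  have reg: "f \<in> ai i" if f: "f \<in> toric" and i: "i < 4" and m: "h i * f \<in> ai i" for f i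
  proof -
    have ip: "Vw i \<in> pvars"
    proof -
      have "i = 0 \<or> i = 1 \<or> i = 2 \<or> i = 3" using i by linarith
      then show ?thesis by auto
    qed
    have "psub (kill i) (co f c) = 0" if c: "c < rk" for c
    proof -
      have "psub (kill i) (co (h i * f) c) = 0" using m ai_kill[of "h i * f" i] hK f i c by auto
      moreover have "co (h i * f) c = Var (Vw i) * co f c" unfolding hs by (rule co_mult[OF PV_Var[OF ip] f c])
      ultimately have "Var (Vw i) * psub (kill i) (co f c) = 0" by (simp add: hom_distribs)
      then show ?thesis by simp
    qed
    then show ?thesis using ai_kill[OF f] i by simp
  qed
  have inj: "f \<in> ai i" if f: "f \<in> toric" and i: "i \<le> 4" and m: "g * f \<in> ai i" for f i
  proof -
    have "g' * (g * f) \<in> ai i" by (rule ai_mult[OF N(3) m])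
    then have m': "psub \<sigma> N' * f \<in> ai i" unfolding N'(2) by (simp add: mult_ac)
    have N0: "psub (kill i) N' \<noteq> 0"
    proof
      assume "psub (kill i) N' = 0"
      moreover define e where "e v = (if v = Vz then d Vz - \<gamma>z else 0)" for v
      ultimately have "pev e (psub (kill i) N') = 0" by simp
      moreover have "pev e (psub (kill i) N') = pev (\<lambda>v. pev e (psub (kill i) (to_new v))) N"
        unfolding N'_def psub_psub pev_psub ..
      moreover have "\<dots> = pev d N"
      proof (rule ev_cong[OF N(1)])
        fix v assume "v \<in> pvars"
        moreover have "\<nu> j * (d Vz - \<gamma>z) = d (Vw j) - \<gamma> j" for j using d(2) by (simp add: \<nu>_def)
        ultimately show "pev e (psub (kill i) (to_new v)) = d v"
          by (auto simp: to_new_def hom_distribs e_def kill_def)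
      qed
      ultimately show False using d(1) by simp
    qed
    have "psub (kill i) (co f c) = 0" if c: "c < rk" for c
    proof -
      have "psub \<sigma> N' * f \<in> toric" using sigK f by (rule toric.K_mult)
      then have "psub (kill i) (co (psub \<sigma> N' * f) c) = 0" using m' ai_kill i c by blast
      then have "psub (kill i) N' * psub (kill i) (co f c) = 0" unfolding co_mult[OF N'(1) f c] by (simp add: hom_distribs)
      then show ?thesis using N0 by simp
    qed
    then show ?thesis using ai_kill[OF f i] by simp
  qed
  show ?thesis
  proof (intro exI[of _ \<nu>] allI impI ballI, unfold Let_def, fold h_def, intro impI)
    fix i f assume i: "i < (4::nat)" and f: "f \<in> toric"
      and "\<exists>f'\<in>toric. \<exists>s. (\<forall>j<i. s j \<in> toric) \<and> h i * f = g * f' + (\<Sum>j<i. h j * s j)"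
    then obtain f' s where f': "f' \<in> toric" and s: "s \<in> ai i" and eq: "h i * f = g * f' + s"
      unfolding ai_def by blast
    \<comment> \<open>The two kinds of regularity allow \<open>g\<close> to be moved to the front of the sequence.\<close>
    have Suc_mem: "h i * k + t \<in> ai (Suc i)" if "k \<in> toric" "t \<in> ai i" for k t
    proof -
      obtain r where "\<forall>j<i. r j \<in> toric" "t = (\<Sum>j<i. h j * r j)" using \<open>t \<in> ai i\<close> by (auto simp: ai_def)
      then show ?thesis unfolding ai_def using \<open>k \<in> toric\<close>
        by (intro CollectI exI[of _ "r(i := k)"]) (auto simp: less_Suc_eq add.commute)
    qed
    have z: "0 \<in> ai i" unfolding ai_def by (intro CollectI exI[of _ "\<lambda>_. 0"]) auto
    have "g * f' = h i * f + (0 - s)" using eq by (simp add: algebra_simps)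
    then have "g * f' \<in> ai (Suc i)" using Suc_mem[OF f ai_diff[OF z s]] by simp
    then have "f' \<in> ai (Suc i)" using inj[OF f', of "Suc i"] i by simp
    then obtain r where r: "\<forall>j<Suc i. r j \<in> toric" "f' = (\<Sum>j<Suc i. h j * r j)" by (auto simp: ai_def simp del: sum.lessThan_Suc)
    define t where "t = (\<Sum>j<i. h j * r j)"
    have t: "t \<in> ai i" unfolding ai_def t_def using r(1) by (intro CollectI exI[of _ r]) auto
    have f'e: "f' = t + h i * r i" unfolding r(2) t_def by simp
    have "h i * (f - g * r i) = g * t + s" using eq unfolding f'e by (simp add: algebra_simps)
    then have "h i * (f - g * r i) \<in> ai i" using ai_add[OF ai_mult[OF g(1) t] s] by simp
    then have "f - g * r i \<in> ai i" using reg[of "f - g * r i" i] f g r(1) i by auto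
    then obtain s' where "\<forall>j<i. s' j \<in> toric" "f - g * r i = (\<Sum>j<i. h j * s' j)" by (auto simp: ai_def)
    moreover from this have "f = g * r i + (\<Sum>j<i. h j * s' j)" by (simp add: algebra_simps)
    ultimately show "\<exists>f'\<in>toric. \<exists>s. (\<forall>j<i. s j \<in> toric) \<and> f = g * f' + (\<Sum>j<i. h j * s j)"
      using r(1) by blast
  qed
qed

end

section \<open>Passage to the quotient rings\<close>

locale surj_cring_hom = ring_hom_ring R S h for R (structure) and S (structure) and h +
  assumes R_cring: "cring R" and S_cring: "cring S" and surj: "h ` carrier R = carrier S"
begin

lemma preimage:
  assumes "y \<in> carrier S"
  obtains x where "x \<in> carrier R" "y = h x"
  using assms surj by blast

lemma Idl_image_eq:
  assumes F: "F \<subseteq> carrier R"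
  shows "Idl\<^bsub>S\<^esub> (h ` F) = h ` (Idl\<^bsub>R\<^esub> F)"
proof
  have hF: "h ` F \<subseteq> carrier S" using F by auto
  interpret I: ideal "Idl\<^bsub>R\<^esub> F" R by (rule R.genideal_ideal[OF F])
  have "Idl\<^bsub>R\<^esub> F \<subseteq> {x \<in> carrier R. h x \<in> Idl\<^bsub>S\<^esub> (h ` F)}"
    using F S.genideal_self[OF hF] by (intro R.genideal_minimal ideal_vimage S.genideal_ideal hF) auto
  then show "h ` (Idl\<^bsub>R\<^esub> F) \<subseteq> Idl\<^bsub>S\<^esub> (h ` F)" by blast
  have "ideal (h ` (Idl\<^bsub>R\<^esub> F)) S"
  proof (rule idealI[OF S.ring_axioms])
    show "subgroup (h ` (Idl\<^bsub>R\<^esub> F)) (add_monoid S)"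
    proof
      show "h ` (Idl\<^bsub>R\<^esub> F) \<subseteq> carrier (add_monoid S)" using I.Icarr by auto
      show "\<one>\<^bsub>add_monoid S\<^esub> \<in> h ` (Idl\<^bsub>R\<^esub> F)" using I.zero_closed hom_zero by (metis add.one_closed image_eqI monoid.select_convs(2) partial_object.select_convs(1))
    next
      fix x y assume "x \<in> h ` (Idl\<^bsub>R\<^esub> F)" "y \<in> h ` (Idl\<^bsub>R\<^esub> F)"
      then obtain i j where "i \<in> Idl\<^bsub>R\<^esub> F" "j \<in> Idl\<^bsub>R\<^esub> F" "x = h i" "y = h j" by auto
      then show "x \<otimes>\<^bsub>add_monoid S\<^esub> y \<in> h ` (Idl\<^bsub>R\<^esub> F)"
        using I.a_closed[of i j] I.Icarr by (auto intro!: image_eqI[of _ _ "i \<oplus>\<^bsub>R\<^esub> j"])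
    next
      fix x assume "x \<in> h ` (Idl\<^bsub>R\<^esub> F)"
      then obtain i where i: "i \<in> Idl\<^bsub>R\<^esub> F" "x = h i" by auto
      then have "\<ominus>\<^bsub>S\<^esub> x = h (\<ominus>\<^bsub>R\<^esub> i)" using I.Icarr by simp
      then show "inv\<^bsub>add_monoid S\<^esub> x \<in> h ` (Idl\<^bsub>R\<^esub> F)"
        using I.a_inv_closed[OF i(1)] unfolding a_inv_def by auto
    qed
    fix x y assume "x \<in> h ` (Idl\<^bsub>R\<^esub> F)" "y \<in> carrier S"
    then obtain i where i: "i \<in> Idl\<^bsub>R\<^esub> F" "x = h i" by blast
    obtain r where "r \<in> carrier R" "y = h r" using \<open>y \<in> carrier S\<close> by (rule preimage)
    note ir = i this
    have ic: "i \<in> carrier R" using ir(1) by (rule I.Icarr)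
    show "y \<otimes>\<^bsub>S\<^esub> x \<in> h ` (Idl\<^bsub>R\<^esub> F)"
      by (rule image_eqI[OF _ I.I_l_closed[OF ir(1,3)]]) (use ir ic in simp)
    show "x \<otimes>\<^bsub>S\<^esub> y \<in> h ` (Idl\<^bsub>R\<^esub> F)"
      by (rule image_eqI[OF _ I.I_r_closed[OF ir(1,3)]]) (use ir ic in simp)
  qed
  moreover have "h ` F \<subseteq> h ` (Idl\<^bsub>R\<^esub> F)" using R.genideal_self[OF F] by blast
  ultimately show "Idl\<^bsub>S\<^esub> (h ` F) \<subseteq> h ` (Idl\<^bsub>R\<^esub> F)" by (rule S.genideal_minimal)
qed

text \<open>Let \<open>J\<close> properly contain the preimage \<open>V\<close>. An element of \<open>J\<close> outside \<open>V\<close> is invertible modulo \<open>M\<close>, so \<open>J\<close>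
  contains an element congruent to \<open>1\<close> modulo \<open>V\<close>.\<close>

lemma maximal_vimage:
  assumes M: "maximalideal M S"
  shows "maximalideal {x \<in> carrier R. h x \<in> M} R"
proof -
  interpret M: maximalideal M S by fact
  interpret RC: cring R by (rule R_cring)
  interpret SC: cring S by (rule S_cring)
  let ?V = "{x \<in> carrier R. h x \<in> M}"
  show ?thesis
  proof (rule maximalidealI)
    show "ideal ?V R" by (rule ideal_vimage) (rule M.is_ideal)
    have "\<one>\<^bsub>S\<^esub> \<notin> M" using M.I_notcarr M.one_imp_carrier by metis
    then have "\<one>\<^bsub>R\<^esub> \<notin> ?V" using hom_one by simp
    then show "carrier R \<noteq> ?V" using R.one_closed by metis
    fix J assume J: "ideal J R" "?V \<subseteq> J" "J \<subseteq> carrier R"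
    interpret J: ideal J R by fact
    show "J = ?V \<or> J = carrier R"
    proof (cases "J = ?V")
      case False
      then obtain x where x: "x \<in> J" "x \<notin> ?V" using J by blast
      then have xc: "x \<in> carrier R" "h x \<notin> M" using J by auto
      note ia = SC.ideal_add_principal[OF M.is_ideal, of "h x"]
      have "M <+>\<^bsub>S\<^esub> PIdl\<^bsub>S\<^esub> (h x) = carrier S"
      proof -
        interpret N: ideal "M <+>\<^bsub>S\<^esub> PIdl\<^bsub>S\<^esub> (h x)" S using ia(1) xc by simp
        have "M <+>\<^bsub>S\<^esub> PIdl\<^bsub>S\<^esub> (h x) \<subseteq> carrier S" by (rule subsetI) (rule N.Icarr)
        from M.I_maximal[OF N.is_ideal _ this] show ?thesis using ia xc by auto
      qed
      then obtain m s where m: "m \<in> M" "s \<in> carrier S" "\<one>\<^bsub>S\<^esub> = m \<oplus>\<^bsub>S\<^esub> s \<otimes>\<^bsub>S\<^esub> h x"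
        using SC.mem_ideal_add_principal[OF M.is_ideal, of "h x" "\<one>\<^bsub>S\<^esub>"] xc by auto
      obtain m' where m': "m' \<in> carrier R" "m = h m'" using M.Icarr[OF m(1)] by (rule preimage)
      obtain s' where s': "s' \<in> carrier R" "s = h s'" using m(2) by (rule preimage)
      note ms = m' s'
      define y where "y = m' \<oplus>\<^bsub>R\<^esub> s' \<otimes>\<^bsub>R\<^esub> x"
      have yc: "y \<in> carrier R" using ms xc by (simp add: y_def)
      have yJ: "y \<in> J" unfolding y_def
        using J(2) m ms x(1) J.I_l_closed[OF x(1) ms(3)] by (intro J.a_closed) auto
      have "h (\<one>\<^bsub>R\<^esub> \<ominus>\<^bsub>R\<^esub> y) = \<zero>\<^bsub>S\<^esub>"
        using m(3) ms xc yc by (simp add: y_def R.minus_eq S.r_neg)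
      then have "\<one>\<^bsub>R\<^esub> \<ominus>\<^bsub>R\<^esub> y \<in> ?V" using yc M.zero_closed by simp
      then have "(\<one>\<^bsub>R\<^esub> \<ominus>\<^bsub>R\<^esub> y) \<oplus>\<^bsub>R\<^esub> y \<in> J" using J(2) yJ by (intro J.a_closed) auto
      moreover have "(\<one>\<^bsub>R\<^esub> \<ominus>\<^bsub>R\<^esub> y) \<oplus>\<^bsub>R\<^esub> y = \<one>\<^bsub>R\<^esub>" using yc by (simp add: R.minus_eq R.a_assoc R.l_neg)
      ultimately show ?thesis using J.one_imp_carrier by metis
    next
      case True
      then show ?thesis ..
    qed
  qed
qed

lemma prime_chain_vimage:
  assumes "prime_chain S n P"
  shows "prime_chain R n (\<lambda>i. {x \<in> carrier R. h x \<in> P i})"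
  unfolding prime_chain_def
proof (intro conjI allI impI)
  fix i assume "i \<le> n"
  then have "primeideal (P i) S" using assms by (auto simp: prime_chain_def)
  then show "primeideal {x \<in> carrier R. h x \<in> P i} R" by (rule primeideal_vimage[OF R_cring])
next
  fix i assume i: "i < n"
  then have P: "P i \<subset> P (Suc i)" "primeideal (P (Suc i)) S" using assms by (auto simp: prime_chain_def)
  then obtain y where y: "y \<in> P (Suc i)" "y \<notin> P i" by blast
  then have "y \<in> carrier S" using P(2) ideal.Icarr primeideal.axioms(1) by metis
  then obtain x where "x \<in> carrier R" "y = h x" by (rule preimage)
  then show "{x \<in> carrier R. h x \<in> P i} \<subset> {x \<in> carrier R. h x \<in> P (Suc i)}" using P y by auto
qed

end

context scroll
begin

text \<open>Given a presentation \<open>\<pi>\<close> of the toric ring with kernel \<open>J\<close>, the properties of the principal ideal of \<open>g\<close>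
  are carried over to the quotient ring \<open>B\<close>, whose elements are cosets, and to its quotient \<open>C\<close>.\<close>

context
  fixes vs :: "indet set" and \<pi> :: "indet \<Rightarrow> 'k pol" and x y g0 g w :: "'k pol" and us :: "indet set"
    and A :: "'k pol ring" and J :: "'k pol set"
  assumes vs: "finite vs" and img: "psub \<pi> ` PV vs = toric"
    and xyg: "x \<in> PV vs" "y \<in> PV vs" "g0 \<in> PV vs"
    and px: "psub \<pi> x = pp" and py: "psub \<pi> y = lam * pp" and pg: "psub \<pi> g0 = g"
    and g: "g = zz ^ 2 * w" and w: "w \<in> toric" "w \<noteq> 0" "w \<in> PV us" "Vx \<notin> us"
    and A_def: "A = pol_ring vs" and J_def: "J = {p \<in> PV vs. psub \<pi> p = 0}"
begin

interpretation A: cring A unfolding A_def by (rule cring_pol_ring)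

lemma A_simps [simp]: "carrier A = PV vs" "p \<otimes>\<^bsub>A\<^esub> q = p * q" "p \<oplus>\<^bsub>A\<^esub> q = p + q" "\<one>\<^bsub>A\<^esub> = 1" "\<zero>\<^bsub>A\<^esub> = 0"
  by (simp_all add: A_def)

lemma A_minus: "p \<in> PV vs \<Longrightarrow> q \<in> PV vs \<Longrightarrow> p \<ominus>\<^bsub>A\<^esub> q = p - q"
proof -
  assume pq: "p \<in> PV vs" "q \<in> PV vs"
  have "\<ominus>\<^bsub>A\<^esub> q = - q" by (rule A.minus_equality) (use pq PV_uminus in auto)
  then show ?thesis by (simp add: A.minus_eq)
qed

lemma psub_toric: "p \<in> PV vs \<Longrightarrow> psub \<pi> p \<in> toric"
  using img by blast

interpretation pi: surj_cring_hom A "sub_ring toric" "psub \<pi>"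
proof -
  have "psub \<pi> \<in> Ring.ring_hom A (sub_ring toric)"
    by (rule ring_hom_memI) (auto simp: hom_distribs psub_toric)
  then have "ring_hom_ring A (sub_ring toric) (psub \<pi>)"
    using A.ring_axioms toric.ring_axioms unfolding ring_hom_ring_def ring_hom_ring_axioms_def by blast
  then show "surj_cring_hom A (sub_ring toric) (psub \<pi>)"
    using A.is_cring toric.is_cring img unfolding surj_cring_hom_def surj_cring_hom_axioms_def by simp
qed

lemma J_kernel: "J = a_kernel A (sub_ring toric) (psub \<pi>)"
  unfolding a_kernel_def' by (simp add: J_def)

lemma J_ideal_A: "ideal J A"
  unfolding J_kernel by (rule pi.kernel_is_ideal)

abbreviation "B \<equiv> A Quot J"
abbreviation "br p \<equiv> J +>\<^bsub>A\<^esub> p"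

lemma B_cring: "cring B"
  by (rule ideal.quotient_is_cring[OF J_ideal_A A.is_cring])

interpretation B: cring B by (rule B_cring)

interpretation br: surj_cring_hom A B "(+>\<^bsub>A\<^esub>) J"
proof -
  have "(+>\<^bsub>A\<^esub>) J ` carrier A = carrier B" by (auto simp: FactRing_def A_RCOSETS_def')
  then show "surj_cring_hom A B ((+>\<^bsub>A\<^esub>) J)"
    using ideal.rcos_ring_hom_ring[OF J_ideal_A] A.is_cring B_cring
    unfolding surj_cring_hom_def surj_cring_hom_axioms_def by simp
qed

lemma br_eq: "p \<in> PV vs \<Longrightarrow> q \<in> PV vs \<Longrightarrow> br p = br q \<longleftrightarrow> psub \<pi> p = psub \<pi> q"
  using A.quotient_eq_iff_same_a_r_cos[OF J_ideal_A, of p q] A_minus[of p q]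
  by (auto simp: J_def PV_diff hom_distribs)

text \<open>The isomorphism of the toric ring with \<open>B\<close>, inverse to the one induced by \<open>\<pi>\<close>.\<close>

definition chi :: "'k pol \<Rightarrow> 'k pol set" where
  "chi f = br (SOME p. p \<in> PV vs \<and> psub \<pi> p = f)"

lemma chi_psub: "p \<in> PV vs \<Longrightarrow> chi (psub \<pi> p) = br p"
proof -
  assume p: "p \<in> PV vs"
  have "(SOME q. q \<in> PV vs \<and> psub \<pi> q = psub \<pi> p) \<in> PV vs \<and> psub \<pi> (SOME q. q \<in> PV vs \<and> psub \<pi> q = psub \<pi> p) = psub \<pi> p"
    by (rule someI[of _ p]) (use p in simp)
  then show ?thesis unfolding chi_def using br_eq p by blast
qed

lemma toric_psub:
  assumes "f \<in> toric"
  obtains p where "p \<in> PV vs" "f = psub \<pi> p"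
  using assms img by blast

interpretation chi: surj_cring_hom "sub_ring toric" B chi
proof -
  have "chi \<in> Ring.ring_hom (sub_ring toric) B"
  proof (rule ring_hom_memI)
    fix f assume "f \<in> carrier (sub_ring toric)"
    then obtain p where p: "p \<in> PV vs" "f = psub \<pi> p" using toric_psub by auto
    then show "chi f \<in> carrier B" using chi_psub br.hom_closed by simp
    fix h assume "h \<in> carrier (sub_ring toric)"
    then obtain q where q: "q \<in> PV vs" "h = psub \<pi> q" using toric_psub by auto
    have "chi (psub \<pi> (p * q)) = br (p * q)" "chi (psub \<pi> (p + q)) = br (p + q)"
      using p q by (auto intro!: chi_psub PV_mult PV_add)
    then show "chi (f \<otimes>\<^bsub>sub_ring toric\<^esub> h) = chi f \<otimes>\<^bsub>B\<^esub> chi h" "chi (f \<oplus>\<^bsub>sub_ring toric\<^esub> h) = chi f \<oplus>\<^bsub>B\<^esub> chi h"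
      using p q br.hom_mult[of p q] br.hom_add[of p q] chi_psub by (auto simp: hom_distribs)
  next
    have "chi (psub \<pi> 1) = br 1" by (rule chi_psub) simp
    then show "chi \<one>\<^bsub>sub_ring toric\<^esub> = \<one>\<^bsub>B\<^esub>" using br.hom_one by simp
  qed
  then have "ring_hom_ring (sub_ring toric) B chi"
    using B.ring_axioms toric.ring_axioms unfolding ring_hom_ring_def ring_hom_ring_axioms_def by blast
  moreover have "chi ` toric = carrier B"
  proof
    show "chi ` toric \<subseteq> carrier B"
    proof
      fix b assume "b \<in> chi ` toric"
      then obtain f where f: "f \<in> toric" "b = chi f" by blast
      obtain p where p: "p \<in> PV vs" "f = psub \<pi> p" using f(1) by (rule toric_psub)
      then show "b \<in> carrier B" using f chi_psub br.hom_closed[of p] by simp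
    qed
    show "carrier B \<subseteq> chi ` toric"
    proof
      fix b assume "b \<in> carrier B"
      then obtain p where "p \<in> carrier A" and b: "b = br p" by (rule br.preimage)
      then have p: "p \<in> PV vs" by simp
      show "b \<in> chi ` toric" by (rule image_eqI[OF _ psub_toric[OF p]]) (simp add: chi_psub p b)
    qed
  qed
  ultimately show "surj_cring_hom (sub_ring toric) B chi"
    using B_cring toric.is_cring unfolding surj_cring_hom_def surj_cring_hom_axioms_def by simp
qed

lemma chi_inj: "f \<in> toric \<Longrightarrow> h \<in> toric \<Longrightarrow> chi f = chi h \<longleftrightarrow> f = h"
proof -
  assume f: "f \<in> toric" and h: "h \<in> toric"
  obtain p where p: "p \<in> PV vs" "f = psub \<pi> p" using f by (rule toric_psub)
  obtain q where q: "q \<in> PV vs" "h = psub \<pi> q" using h by (rule toric_psub)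
  show ?thesis unfolding p(2) q(2) chi_psub[OF p(1)] chi_psub[OF q(1)] by (rule br_eq[OF p(1) q(1)])
qed

lemma g_toric: "g \<in> toric" "g \<noteq> 0"
  using w toric_gens(3) unfolding g by auto

lemma multiples_PIdl: "h \<in> toric \<Longrightarrow> multiples h = Idl\<^bsub>sub_ring toric\<^esub> {h}"
  using toric.cgenideal_eq_genideal[of h] by (auto simp: multiples_def cgenideal_def mult.commute)

definition I :: "'k pol set set" where "I = Idl\<^bsub>B\<^esub> {br g0}"

lemma I_eq: "I = chi ` multiples g"
proof -
  have "br g0 = chi g" using chi_psub[OF xyg(3)] pg by simp
  then show ?thesis
    using chi.Idl_image_eq[of "{g}"] g_toric multiples_PIdl by (simp add: I_def)
qed

lemma I_iff: "f \<in> toric \<Longrightarrow> chi f \<in> I \<longleftrightarrow> f \<in> multiples g"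
proof -
  assume f: "f \<in> toric"
  have "multiples g \<subseteq> toric" using g_toric by (auto simp: multiples_def)
  then show ?thesis unfolding I_eq using f chi_inj by (auto simp: image_iff subset_iff)
qed

lemma br_g0: "br g0 \<in> carrier B"
  using br.hom_closed[of g0] xyg by simp

lemma I_ideal: "ideal I B"
  unfolding I_def by (rule B.genideal_ideal) (use br_g0 in simp)

interpretation I: ideal I B by (rule I_ideal)

lemma colon_eq: "colon B I (Idl\<^bsub>B\<^esub> {br x, br y, br g0}) = I"
proof
  have gen: "{br x, br y, br g0} \<subseteq> carrier B"
    using br.hom_closed xyg by auto
  interpret G: ideal "Idl\<^bsub>B\<^esub> {br x, br y, br g0}" B by (rule B.genideal_ideal[OF gen])
  show "I \<subseteq> colon B I (Idl\<^bsub>B\<^esub> {br x, br y, br g0})"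
    using I.Icarr G.Icarr I.I_r_closed by (auto simp: colon_def)
  show "colon B I (Idl\<^bsub>B\<^esub> {br x, br y, br g0}) \<subseteq> I"
  proof
    fix c assume c: "c \<in> colon B I (Idl\<^bsub>B\<^esub> {br x, br y, br g0})"
    then have "c \<in> carrier B" by (simp add: colon_def)
    then obtain f where f: "f \<in> toric" "c = chi f" using chi.preimage by auto
    have "br x \<in> Idl\<^bsub>B\<^esub> {br x, br y, br g0}" "br y \<in> Idl\<^bsub>B\<^esub> {br x, br y, br g0}"
      using B.genideal_self[OF gen] by auto
    then have "c \<otimes>\<^bsub>B\<^esub> br x \<in> I" "c \<otimes>\<^bsub>B\<^esub> br y \<in> I" using c by (auto simp: colon_def)
    moreover have "br x = chi pp" "br y = chi (lam * pp)"
      using chi_psub[OF xyg(1)] chi_psub[OF xyg(2)] px py by simp_all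
    ultimately have "chi (f * pp) \<in> I" "chi (f * (lam * pp)) \<in> I"
      using f chi.hom_mult[of f pp] chi.hom_mult[of f "lam * pp"] toric_gens by simp_all
    then have "f * pp \<in> multiples g" "f * (lam * pp) \<in> multiples g"
      using I_iff f toric_gens by auto
    moreover have "g \<in> PV (insert Vz us)" unfolding g
      using w(3) by (intro PV_mult PV_power PV_Var) (auto elim: PV_mono[rotated])
    ultimately have "f \<in> multiples g"
      using colon_multiples[of g "insert Vz us" f] w(4) g_toric by (simp add: mult.commute)
    then show "c \<in> I" using I_iff f by simp
  qed
qed

abbreviation "C \<equiv> B Quot I"
abbreviation "chiC f \<equiv> I +>\<^bsub>B\<^esub> chi f"

lemma C_cring: "cring C"
  by (rule ideal.quotient_is_cring[OF I_ideal B_cring])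

interpretation C: cring C by (rule C_cring)

interpretation chiC: surj_cring_hom "sub_ring toric" C "\<lambda>f. chiC f"
proof -
  have "(+>\<^bsub>B\<^esub>) I \<circ> chi \<in> Ring.ring_hom (sub_ring toric) C"
    by (rule ring_hom_trans[OF chi.homh ideal.rcos_ring_hom[OF I_ideal]])
  then have "ring_hom_ring (sub_ring toric) C (\<lambda>f. chiC f)"
    using C.ring_axioms toric.ring_axioms unfolding ring_hom_ring_def ring_hom_ring_axioms_def comp_def by blast
  moreover have "(\<lambda>f. chiC f) ` toric = carrier C"
  proof -
    have "carrier C = (+>\<^bsub>B\<^esub>) I ` carrier B" by (auto simp: FactRing_def A_RCOSETS_def')
    also have "\<dots> = (+>\<^bsub>B\<^esub>) I ` (chi ` toric)" using chi.surj by simp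
    also have "\<dots> = (\<lambda>f. chiC f) ` toric" by (rule image_image)
    finally show ?thesis by simp
  qed
  ultimately show "surj_cring_hom (sub_ring toric) C (\<lambda>f. chiC f)"
    using C_cring toric.is_cring unfolding surj_cring_hom_def surj_cring_hom_axioms_def by simp
qed

lemma chiC_eq: "f \<in> toric \<Longrightarrow> h \<in> toric \<Longrightarrow> chiC f = chiC h \<longleftrightarrow> f - h \<in> multiples g"
proof -
  assume f: "f \<in> toric" and h: "h \<in> toric"
  have cf: "chi f \<in> carrier B" "chi h \<in> carrier B" using f h chi.hom_closed by auto
  have "chi (f - h) \<oplus>\<^bsub>B\<^esub> chi h = chi f" using chi.hom_add[of "f - h" h] f h by auto
  moreover have "chi (f - h) \<in> carrier B" using toric.K_diff[OF f h] chi.hom_closed[of "f - h"] by simp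
  ultimately have "chi f \<ominus>\<^bsub>B\<^esub> chi h = chi (f - h)"
    using cf by (simp add: B.minus_eq B.a_assoc B.r_neg flip: \<open>chi (f - h) \<oplus>\<^bsub>B\<^esub> chi h = chi f\<close>)
  then show ?thesis
    using B.quotient_eq_iff_same_a_r_cos[OF I_ideal cf] I_iff[of "f - h"] f h by auto
qed

text \<open>By the Nullstellensatz, the maximal ideal of the polynomial ring above \<open>M\<close> determines the values \<open>\<gamma>\<close> and \<open>\<gamma>z\<close>
  of the parameters at a point, and the regular sequence at that point lies in \<open>M\<close>.\<close>

lemma C_regular_sequence:
  assumes M: "maximalideal M C"
  shows "\<exists>xs. length xs = 4 \<and> set xs \<subseteq> M \<and> regular_sequence C xs"
proof -
  interpret M: maximalideal M C by fact
  define V where "V = {f \<in> toric. chiC f \<in> M}"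
  have V: "maximalideal V (sub_ring toric)" using chiC.maximal_vimage[OF M] by (simp add: V_def)
  have W: "maximalideal {p \<in> PV vs. psub \<pi> p \<in> V} (pol_ring vs)" using pi.maximal_vimage[OF V] by (simp add: A_def)
  interpret V: maximalideal V "sub_ring toric" by (rule V)
  have val: "\<exists>c. f - Cst c \<in> V" if f: "f \<in> toric" for f
  proof -
    obtain p where p: "p \<in> PV vs" "f = psub \<pi> p" using f by (rule toric_psub)
    then obtain c where "p - Cst c \<in> {p \<in> PV vs. psub \<pi> p \<in> V}"
      using nullstellensatz_residue_field[OF vs W, of p] by blast
    then show ?thesis using p by (auto simp: hom_distribs)
  qed
  have "\<forall>j. \<exists>c. param (Vw j) - Cst c \<in> V" using val param_toric by blast
  then obtain \<gamma> where \<gamma>: "\<And>j. param (Vw j) - Cst (\<gamma> j) \<in> V" by metis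
  obtain \<gamma>z where \<gamma>z: "zz - Cst \<gamma>z \<in> V" using val toric_gens(3) by blast
  obtain \<nu> where \<nu>: "\<forall>i<4. \<forall>f\<in>toric.
     (let h = (\<lambda>j. param (Vw j) - Cst (\<gamma> j) - Cst (\<nu> j) * (zz - Cst \<gamma>z)) in
      (\<exists>f'\<in>toric. \<exists>s. (\<forall>j<i. s j \<in> toric) \<and> h i * f = g * f' + (\<Sum>j<i. h j * s j)) \<longrightarrow>
      (\<exists>f'\<in>toric. \<exists>s. (\<forall>j<i. s j \<in> toric) \<and> f = g * f' + (\<Sum>j<i. h j * s j)))"
    using regular_mod_principal[OF g_toric, of \<gamma> \<gamma>z] by blast
  define h where "h j = param (Vw j) - Cst (\<gamma> j) - Cst (\<nu> j) * (zz - Cst \<gamma>z)" for j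
  have reg: "\<exists>f'\<in>toric. \<exists>s. (\<forall>j<i. s j \<in> toric) \<and> f = g * f' + (\<Sum>j<i. h j * s j)"
    if "i < 4" "f \<in> toric" "f' \<in> toric" "\<forall>j<i. s j \<in> toric" "h i * f = g * f' + (\<Sum>j<i. h j * s j)" for i f f' s
    using \<nu> that unfolding Let_def h_def[symmetric] by blast
  have hV: "h j \<in> V" for j
  proof -
    have "Cst (- \<nu> j) * (zz - Cst \<gamma>z) \<in> V" using V.I_l_closed[OF \<gamma>z, of "Cst (- \<nu> j)"] by simp
    then have "(param (Vw j) - Cst (\<gamma> j)) + Cst (- \<nu> j) * (zz - Cst \<gamma>z) \<in> V"
      using V.a_closed[OF \<gamma>[of j]] unfolding sub_ring_simps by blast
    moreover have "h j = (param (Vw j) - Cst (\<gamma> j)) + Cst (- \<nu> j) * (zz - Cst \<gamma>z)"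
      by (simp add: h_def hom_distribs)
    ultimately show ?thesis by (simp only:)
  qed
  have hK: "h j \<in> toric" for j using hV by (simp add: V_def)
  define xs where "xs = map (\<lambda>j. chiC (h j)) [0..<4]"
  have len: "length xs = 4" by (simp add: xs_def)
  have xsM: "set xs \<subseteq> M" using hV by (auto simp: xs_def V_def)
  have xsC: "set xs \<subseteq> carrier C" using xsM M.Icarr by blast
  have set_take: "set (take i xs) = (\<lambda>f. chiC f) ` (h ` {..<i})" if "i \<le> 4" for i
    using that by (auto simp: xs_def take_map image_image)
  have "regular_sequence C xs"
    unfolding regular_sequence_def
  proof (intro conjI allI impI ballI)
    show "set xs \<subseteq> carrier C" by (rule xsC)
    have "Idl\<^bsub>C\<^esub> (set xs) \<subseteq> M" by (rule C.genideal_minimal) (use xsM M.is_ideal in auto)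
    then show "Idl\<^bsub>C\<^esub> (set xs) \<noteq> carrier C" using M.I_notcarr M.Icarr by blast
  next
    fix i c assume i: "i < length xs" and c: "c \<in> carrier C"
      and mem: "xs ! i \<otimes>\<^bsub>C\<^esub> c \<in> Idl\<^bsub>C\<^esub> (set (take i xs))"
    have i4: "i < 4" using i len by simp
    obtain f where f: "f \<in> toric" "c = chiC f" using c chiC.preimage by auto
    have hF: "h ` {..<i} \<subseteq> carrier (sub_ring toric)" using hK by auto
    have Idl: "Idl\<^bsub>C\<^esub> (set (take i xs)) = (\<lambda>f. chiC f) ` (Idl\<^bsub>sub_ring toric\<^esub> (h ` {..<i}))"
      using set_take[of i] i4 chiC.Idl_image_eq[OF hF] by simp
    have "xs ! i = chiC (h i)" using i4 by (simp add: xs_def)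
    then have "xs ! i \<otimes>\<^bsub>C\<^esub> c = chiC (h i * f)" using chiC.hom_mult[of "h i" f] hK f by simp
    then obtain t where t: "t \<in> Idl\<^bsub>sub_ring toric\<^esub> (h ` {..<i})" "chiC (h i * f) = chiC t"
      using mem unfolding Idl by auto
    obtain r Bs where Bs: "finite Bs" "Bs \<subseteq> {..<i}" "\<forall>j\<in>Bs. r j \<in> toric" "t = (\<Sum>j\<in>Bs. r j * h j)"
      using t(1) toric.Idl_finite_family[of "{..<i}" h] hK by auto
    define s where "s j = (if j \<in> Bs then r j else 0)" for j
    have ts: "t = (\<Sum>j<i. h j * s j)"
      unfolding Bs(4) using Bs(2) by (intro sum.mono_neutral_cong_left) (auto simp: s_def)
    have sK: "\<forall>j<i. s j \<in> toric" using Bs(3) by (auto simp: s_def)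
    have "t \<in> toric" unfolding ts using sK hK by (intro toric.K_sum toric.K_mult) auto
    then have "h i * f - t \<in> multiples g" using t(2) chiC_eq[of "h i * f" t] hK f by auto
    then obtain f' where f': "f' \<in> toric" "h i * f - t = g * f'" by (auto simp: multiples_def)
    have "h i * f = g * f' + (\<Sum>j<i. h j * s j)" using f'(2) ts by (simp add: diff_eq_eq)
    from reg[OF i4 f(1) f'(1) sK this] obtain f1 s1 where
      f1: "f1 \<in> toric" "\<forall>j<i. s1 j \<in> toric" "f = g * f1 + (\<Sum>j<i. h j * s1 j)" by blast
    have t1: "(\<Sum>j<i. h j * s1 j) \<in> Idl\<^bsub>sub_ring toric\<^esub> (h ` {..<i})"
      using toric.Idl_finite_family[of "{..<i}" h] hK f1(2)
      by (auto intro!: exI[of _ s1] exI[of _ "{..<i}"] simp: mult.commute)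
    have t1K: "(\<Sum>j<i. h j * s1 j) \<in> toric" using hK f1(2) by (intro toric.K_sum toric.K_mult) auto
    have "f - (\<Sum>j<i. h j * s1 j) \<in> multiples g" using f1 by (auto simp: multiples_def)
    then have "c = chiC (\<Sum>j<i. h j * s1 j)" using chiC_eq[OF f(1) t1K] f(2) by simp
    then show "c \<in> Idl\<^bsub>C\<^esub> (set (take i xs))" unfolding Idl using t1 by blast
  qed
  with len xsM show ?thesis by blast
qed

text \<open>A chain of primes containing \<open>g \<noteq> 0\<close> can be prolonged by the zero ideal, and the toric ring has dimension
  at most five.\<close>

lemma C_dim:
  assumes "prime_chain C n P"
  shows "n \<le> 4"
proof -
  define Q where "Q i = {f \<in> toric. chiC f \<in> P i}" for i
  have Q: "prime_chain (sub_ring toric) n Q" using chiC.prime_chain_vimage[OF assms] by (simp add: Q_def[abs_def])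
  interpret P0: primeideal "P 0" C using assms by (auto simp: prime_chain_def)
  have "chiC g = chiC 0" using chiC_eq[of g 0] g_toric multiplesI[of 1 g] by auto
  then have "chiC g \<in> P 0" using chiC.hom_zero P0.zero_closed by simp
  then have gQ: "g \<in> Q 0" using g_toric by (simp add: Q_def)
  interpret Q0: primeideal "Q 0" "sub_ring toric" using Q by (auto simp: prime_chain_def)
  have sub: "{0} \<subset> Q 0" using gQ g_toric(2) Q0.zero_closed by auto
  have "prime_chain (sub_ring toric) (Suc n) (case_nat {0} Q)"
    unfolding prime_chain_def
  proof (intro conjI allI impI)
    fix i assume "i \<le> Suc n"
    then show "primeideal (case i of 0 \<Rightarrow> {0} | Suc j \<Rightarrow> Q j) (sub_ring toric)"
      using Q zero_prime by (cases i) (auto simp: prime_chain_def)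
  next
    fix i assume "i < Suc n"
    then show "(case i of 0 \<Rightarrow> {0} | Suc j \<Rightarrow> Q j) \<subset> (case Suc i of 0 \<Rightarrow> {0} | Suc j \<Rightarrow> Q j)"
      using Q sub by (cases i) (auto simp: prime_chain_def)
  qed
  from toric.prime_chain_length[OF this, of tvars] have "Suc n \<le> card tvars" using toric_PV by auto
  also have "\<dots> \<le> 5" by (simp add: card_insert_if)
  finally show ?thesis by simp
qed

lemma C_CM: "CM_ideal B I"
  unfolding CM_ideal_def
proof
  show "ideal I B" by (rule I_ideal)
  have "noetherian_ring A" unfolding A_def by (rule noetherian_pol_ring[OF vs])
  then have "noetherian_ring (sub_ring toric)" using pi.noetherian_image pi.surj by blast
  then have "noetherian_ring C" using chiC.noetherian_image chiC.surj by blast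
  then show "CM_ring C" using C_cring C_regular_sequence C_dim by (intro CM_ringI[of C 4])
qed

lemma B_zero_prime: "primeideal {\<zero>\<^bsub>B\<^esub>} B"
proof (rule primeidealI[OF B.zeroideal B_cring])
  have z: "\<zero>\<^bsub>B\<^esub> = chi 0" and o: "\<one>\<^bsub>B\<^esub> = chi 1" using chi.hom_zero chi.hom_one by simp_all
  have "chi 1 \<noteq> chi 0" using chi_inj[of 1 0] by simp
  then show "carrier B \<noteq> {\<zero>\<^bsub>B\<^esub>}" using z o B.one_closed by auto
  fix c d assume cd: "c \<in> carrier B" "d \<in> carrier B" "c \<otimes>\<^bsub>B\<^esub> d \<in> {\<zero>\<^bsub>B\<^esub>}"
  obtain f where f: "f \<in> carrier (sub_ring toric)" "c = chi f" using cd(1) by (rule chi.preimage)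
  obtain h where h: "h \<in> carrier (sub_ring toric)" "d = chi h" using cd(2) by (rule chi.preimage)
  have fh: "f \<in> toric" "c = chi f" "h \<in> toric" "d = chi h" using f h by simp_all
  have "chi (f * h) = chi 0" using cd(3) fh chi.hom_mult[of f h] z by simp
  then have "f * h = 0" using chi_inj[of "f * h" 0] fh by auto
  then show "c \<in> {\<zero>\<^bsub>B\<^esub>} \<or> d \<in> {\<zero>\<^bsub>B\<^esub>}" using fh z by auto
qed

lemma B_z_prime: "primeideal (chi ` multiples zz) B"
proof (rule primeidealI)
  have zK: "multiples zz \<subseteq> toric" using toric_gens(3) by (auto simp: multiples_def)
  interpret Z: primeideal "multiples zz" "sub_ring toric" by (rule z_prime)
  have e: "chi ` multiples zz = Idl\<^bsub>B\<^esub> (chi ` {zz})"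
    using chi.Idl_image_eq[of "{zz}"] toric_gens(3) multiples_PIdl by simp
  show "ideal (chi ` multiples zz) B" unfolding e using toric_gens(3) by (intro B.genideal_ideal) auto
  show "cring B" by (rule B_cring)
  have mem: "chi f \<in> chi ` multiples zz \<longleftrightarrow> f \<in> multiples zz" if "f \<in> toric" for f
    using that zK chi_inj by (auto simp: image_iff subset_iff)
  have "1 \<notin> multiples zz" using Z.I_notcarr Z.one_imp_carrier by auto
  then have "chi 1 \<notin> chi ` multiples zz" using mem by simp
  moreover have "chi 1 \<in> carrier B" using chi.hom_closed[of 1] by simp
  ultimately show "carrier B \<noteq> chi ` multiples zz" by metis
  fix c d assume cd: "c \<in> carrier B" "d \<in> carrier B" "c \<otimes>\<^bsub>B\<^esub> d \<in> chi ` multiples zz"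
  obtain f where f: "f \<in> carrier (sub_ring toric)" "c = chi f" using cd(1) by (rule chi.preimage)
  obtain h where h: "h \<in> carrier (sub_ring toric)" "d = chi h" using cd(2) by (rule chi.preimage)
  have fh: "f \<in> toric" "c = chi f" "h \<in> toric" "d = chi h" using f h by simp_all
  have "chi (f * h) \<in> chi ` multiples zz" using cd(3) fh chi.hom_mult[of f h] by simp
  then have "f * h \<in> multiples zz" using mem[of "f * h"] fh by auto
  then have "f \<in> multiples zz \<or> h \<in> multiples zz" using Z.I_prime[of f h] fh by simp
  then show "c \<in> chi ` multiples zz \<or> d \<in> chi ` multiples zz" using fh by auto
qed

lemma height_z_le: "prime_height B (chi ` multiples zz) \<le> 1"
  unfolding prime_height_def
proof (rule Sup_least, clarify)
  fix n P assume P: "prime_chain B n P" "P n = chi ` multiples zz"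
  define Q where "Q i = {f \<in> toric. chi f \<in> P i}" for i
  have Q: "prime_chain (sub_ring toric) n Q" using chi.prime_chain_vimage[OF P(1)] by (simp add: Q_def[abs_def])
  have zK: "multiples zz \<subseteq> toric" using toric_gens(3) by (auto simp: multiples_def)
  have Qn: "Q n = multiples zz" unfolding Q_def P(2) using zK chi_inj by (auto simp: image_iff subset_iff)
  have "n \<le> 1"
  proof (rule ccontr)
    assume "\<not> n \<le> 1"
    then obtain k where k: "n = Suc (Suc k)" by (metis One_nat_def le_zero_eq not0_implies_Suc not_less_eq_eq order_refl)
    have "primeideal (Q (Suc k)) (sub_ring toric)" "Q (Suc k) \<subset> multiples zz" "Q k \<subset> Q (Suc k)" "primeideal (Q k) (sub_ring toric)"
      using Q k Qn by (auto simp: prime_chain_def)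
    then have "Q k \<subset> {0}" using prime_below_z by metis
    moreover have "0 \<in> Q k"
    proof -
      interpret Qk: primeideal "Q k" "sub_ring toric" by fact
      show ?thesis using Qk.zero_closed by simp
    qed
    ultimately show False by auto
  qed
  then show "enat n \<le> 1" by (simp add: one_enat_def)
qed

text \<open>The prime \<open>(z)\<close> bounds the height from above; from below, every prime containing \<open>g\<close> properly contains the
  zero ideal.\<close>

lemma height_I: "ideal_height B I = 1"
proof (rule antisym)
  have "I \<subseteq> chi ` multiples zz"
    unfolding I_eq
  proof (rule image_mono, rule subsetI)
    fix f assume "f \<in> multiples g"
    then obtain f' where "f' \<in> toric" "f = zz * (zz * w * f')" by (auto simp: multiples_def g power2_eq_square mult.assoc)
    then show "f \<in> multiples zz" using w(1) toric_gens(3) by (auto simp: multiples_def)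
  qed
  then have "ideal_height B I \<le> prime_height B (chi ` multiples zz)"
    unfolding ideal_height_def using B_z_prime by (intro Inf_lower) auto
  then show "ideal_height B I \<le> 1" using height_z_le by (rule order_trans)
  show "1 \<le> ideal_height B I"
    unfolding ideal_height_def
  proof (rule Inf_greatest, clarify)
    fix Q assume Q: "primeideal Q B" "I \<subseteq> Q"
    interpret Q: primeideal Q B by fact
    have "chi g \<in> Q" using I_iff[of g] g_toric multiplesI[of 1 g] Q(2) by auto
    moreover have "chi g \<noteq> chi 0" using chi_inj[of g 0] g_toric by simp
    moreover have "chi 0 = \<zero>\<^bsub>B\<^esub>" using chi.hom_zero by simp
    ultimately have "chi g \<in> Q - {\<zero>\<^bsub>B\<^esub>}" by simp
    then have lt: "{\<zero>\<^bsub>B\<^esub>} \<subset> Q" using Q.zero_closed by blast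
    have "prime_chain B 1 (\<lambda>i. if i = 0 then {\<zero>\<^bsub>B\<^esub>} else Q)"
      unfolding prime_chain_def using B_zero_prime Q(1) lt by simp
    then show "1 \<le> prime_height B Q"
      unfolding prime_height_def one_enat_def
      by (intro Sup_upper CollectI exI[of _ 1] exI[of _ "\<lambda>i. if i = 0 then {\<zero>\<^bsub>B\<^esub>} else Q"] conjI) simp_all
  qed
qed

theorem toric_quotient:
  "colon (A Quot J) (Idl\<^bsub>A Quot J\<^esub> {br g0}) (Idl\<^bsub>A Quot J\<^esub> {br x, br y, br g0}) = Idl\<^bsub>A Quot J\<^esub> {br g0} \<and>
   CM_ideal (A Quot J) (Idl\<^bsub>A Quot J\<^esub> {br g0}) \<and> ideal_height (A Quot J) (Idl\<^bsub>A Quot J\<^esub> {br g0}) = 1"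
  using colon_eq C_CM height_I unfolding I_def by blast

end

end

section \<open>The pencil of linear forms\<close>

lemma linear_form_xy:
  assumes p: "p \<in> PV {Vx, Vy}" "homogeneous 1 p"
  shows "p = Cst (Poly_Mapping.lookup p (Poly_Mapping.single Vx 1)) * Var Vx +
     Cst (Poly_Mapping.lookup p (Poly_Mapping.single Vy 1)) * Var Vy"
proof (rule poly_mapping_eqI)
  fix m
  let ?x = "Poly_Mapping.single Vx (1::nat)" and ?y = "Poly_Mapping.single Vy (1::nat)"
  have "Poly_Mapping.lookup ?x Vx \<noteq> Poly_Mapping.lookup ?y Vx" by (simp add: lookup_single)
  then have xy: "?x \<noteq> ?y" by metis
  have "Poly_Mapping.lookup p m = 0" if "m \<noteq> ?x" "m \<noteq> ?y"
  proof (rule ccontr)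
    assume "\<not> ?thesis"
    then have m: "m \<in> Poly_Mapping.keys p" by (simp add: in_keys_iff)
    then have k: "Poly_Mapping.keys m \<subseteq> {Vx, Vy}" and d: "mon_degree m = 1"
      using p by (auto simp: PV_iff homogeneous_def)
    have "mon_degree m = (\<Sum>v\<in>{Vx, Vy}. Poly_Mapping.lookup m v)"
      unfolding mon_degree_def using k by (intro sum.mono_neutral_left) (auto simp: in_keys_iff)
    then have "Poly_Mapping.lookup m Vx + Poly_Mapping.lookup m Vy = 1" using d by simp
    then have "Poly_Mapping.lookup m Vx = 1 \<and> Poly_Mapping.lookup m Vy = 0 \<or> Poly_Mapping.lookup m Vx = 0 \<and> Poly_Mapping.lookup m Vy = 1"
      by arith
    moreover have "Poly_Mapping.lookup m v = 0" if "v \<noteq> Vx" "v \<noteq> Vy" for v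
      using that k by (auto simp: in_keys_iff)
    ultimately have "m = ?x \<or> m = ?y"
    proof (elim disjE conjE)
      assume "Poly_Mapping.lookup m Vx = 1" "Poly_Mapping.lookup m Vy = 0"
      then have "m = ?x" using \<open>\<And>v. v \<noteq> Vx \<Longrightarrow> v \<noteq> Vy \<Longrightarrow> Poly_Mapping.lookup m v = 0\<close>
        by (intro poly_mapping_eqI) (metis lookup_single_eq lookup_single_not_eq)
      then show ?thesis ..
    next
      assume "Poly_Mapping.lookup m Vx = 0" "Poly_Mapping.lookup m Vy = 1"
      then have "m = ?y" using \<open>\<And>v. v \<noteq> Vx \<Longrightarrow> v \<noteq> Vy \<Longrightarrow> Poly_Mapping.lookup m v = 0\<close>
        by (intro poly_mapping_eqI) (metis lookup_single_eq lookup_single_not_eq)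
      then show ?thesis ..
    qed
    then show False using that by blast
  qed
  then show "Poly_Mapping.lookup p m = Poly_Mapping.lookup (Cst (Poly_Mapping.lookup p ?x) * Var Vx + Cst (Poly_Mapping.lookup p ?y) * Var Vy) m"
    using xy by (cases "m = ?x"; cases "m = ?y") (simp_all add: lookup_add lookup_Cst_mult Var_eq_Mon lookup_Mon)
qed

lemma homogeneous_at_0:
  fixes p :: "'k::comm_ring_1 pol"
  assumes "homogeneous d p" "0 < d"
  shows "pev (\<lambda>_. 0) p = 0"
  unfolding ev_def
proof (rule sum.neutral, rule ballI)
  fix m assume m: "m \<in> Poly_Mapping.keys p"
  then have "mon_degree m \<noteq> 0" using assms by (auto simp: homogeneous_def)
  then obtain v where v: "v \<in> Poly_Mapping.keys m" unfolding mon_degree_def by (meson sum.neutral)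
  then have "(0::'k) ^ Poly_Mapping.lookup m v = 0" by (simp add: in_keys_iff zero_power)
  then have "(\<Prod>v\<in>Poly_Mapping.keys m. (0::'k) ^ Poly_Mapping.lookup m v) = 0"
    using v by (intro prod_zero) auto
  then show "Poly_Mapping.lookup p m * (\<Prod>v\<in>Poly_Mapping.keys m. 0 ^ Poly_Mapping.lookup m v) = 0" by simp
qed

text \<open>The generator \<open>f\<^sub>0\<close> is nonzero because no generator of a minimal system can be left out.\<close>

locale presented_ideal =
  fixes n :: nat and \<phi> :: "'k::alg_closed_field pol mat" and f :: "'k pol vec"
  assumes n: "4 < n" and f_dim: "f \<in> carrier_vec n" and f_R: "set\<^sub>v f \<subseteq> carrier R_ring"
    and pres: "presentation_matrix R_ring \<phi> f" and alin: "almost_linear n \<phi>" and f0: "f $ 0 \<noteq> 0"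
begin

abbreviation "RR \<equiv> PV {Vx, Vy, Vz}"

lemma phi_dim: "\<phi> \<in> carrier_mat n (n - 1)"
  using alin by (simp add: almost_linear_def)

lemma f_RR: "i < n \<Longrightarrow> f $ i \<in> RR"
  using f_R f_dim by (auto simp: vec_set_def)

lemma phi_RR: "i < n \<Longrightarrow> j < n - 1 \<Longrightarrow> \<phi> $$ (i, j) \<in> RR"
proof -
  assume "i < n" "j < n - 1"
  then have "\<phi> $$ (i, j) \<in> elements_mat \<phi>" using phi_dim by (intro elements_matI) auto
  then show ?thesis using pres by (auto simp: presentation_matrix_def)
qed

text \<open>Exactness of the presentation, with vectors written as functions.\<close>

lemma syzygy_iff:
  assumes v: "\<And>i. i < n \<Longrightarrow> v i \<in> RR"
  shows "(\<Sum>i<n. f $ i * v i) = 0 \<longleftrightarrow>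
    (\<exists>u. (\<forall>j<n-1. u j \<in> RR) \<and> (\<forall>i<n. v i = (\<Sum>j<n-1. \<phi> $$ (i, j) * u j)))"
proof -
  have d: "dim_row \<phi> = n" "dim_col \<phi> = n - 1" using phi_dim by auto
  have vv: "vec n v \<in> carrier_vec n" "set\<^sub>v (vec n v) \<subseteq> RR" using v by (auto simp: vec_set_def)
  have fv: "f \<bullet> vec n v = (\<Sum>i<n. f $ i * v i)" by (simp add: scalar_prod_def lessThan_atLeast0)
  have eq: "vec n v = \<phi> *\<^sub>v u \<longleftrightarrow> (\<forall>i<n. v i = (\<Sum>j<n-1. \<phi> $$ (i, j) * u $ j))" if "u \<in> carrier_vec (n - 1)" for u
    using that d by (auto simp: vec_eq_iff scalar_prod_def lessThan_atLeast0)
  have "f \<bullet> vec n v = 0 \<longleftrightarrow> (\<exists>u. vec n v = \<phi> *\<^sub>v u \<and> u \<in> carrier_vec (n - 1) \<and> set\<^sub>v u \<subseteq> RR)"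
    using pres vv unfolding presentation_matrix_def d by blast
  also have "\<dots> \<longleftrightarrow> (\<exists>u. (\<forall>j<n-1. u j \<in> RR) \<and> (\<forall>i<n. v i = (\<Sum>j<n-1. \<phi> $$ (i, j) * u j)))"
  proof
    assume "\<exists>u. vec n v = \<phi> *\<^sub>v u \<and> u \<in> carrier_vec (n - 1) \<and> set\<^sub>v u \<subseteq> RR"
    then obtain u where u: "vec n v = \<phi> *\<^sub>v u" "u \<in> carrier_vec (n - 1)" "set\<^sub>v u \<subseteq> RR" by blast
    then show "\<exists>u. (\<forall>j<n-1. u j \<in> RR) \<and> (\<forall>i<n. v i = (\<Sum>j<n-1. \<phi> $$ (i, j) * u j))"
      using eq[OF u(2)] by (intro exI[of _ "\<lambda>j. u $ j"]) (auto simp: vec_set_def)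
  next
    assume "\<exists>u. (\<forall>j<n-1. u j \<in> RR) \<and> (\<forall>i<n. v i = (\<Sum>j<n-1. \<phi> $$ (i, j) * u j))"
    then obtain u where u: "\<forall>j<n-1. u j \<in> RR" "\<forall>i<n. v i = (\<Sum>j<n-1. \<phi> $$ (i, j) * u j)" by blast
    have "vec n v = \<phi> *\<^sub>v vec (n - 1) u" using u(2) by (subst eq) auto
    then show "\<exists>u. vec n v = \<phi> *\<^sub>v u \<and> u \<in> carrier_vec (n - 1) \<and> set\<^sub>v u \<subseteq> RR"
      using u(1) by (intro exI[of _ "vec (n - 1) u"]) (auto simp: vec_set_def)
  qed
  finally show ?thesis unfolding fv .
qed

text \<open>The entries of \<open>\<phi>\<close> vanish at the origin, so a syzygy has no constant coordinates other than \<open>0\<close>.\<close>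

lemma constant_syzygy:
  assumes "(\<Sum>i<n. f $ i * Cst (c i)) = 0" "i < n"
  shows "c i = 0"
proof -
  obtain u where u: "\<And>i. i < n \<Longrightarrow> Cst (c i) = (\<Sum>j<n-1. \<phi> $$ (i, j) * u j)"
    using syzygy_iff[of "\<lambda>i. Cst (c i)"] assms(1) by auto
  have z: "pev (\<lambda>_. 0) (\<phi> $$ (i, j)) = 0" if j: "j < n - 1" for j
  proof (cases "j < n - 2")
    case True
    then show ?thesis using alin assms(2) by (auto simp: almost_linear_def intro: homogeneous_at_0[of 1])
  next
    case False
    then have "j = n - 2" using j by simp
    then show ?thesis using alin assms(2) by (auto simp: almost_linear_def intro: homogeneous_at_0[of 2])
  qed
  have "c i = pev (\<lambda>_. 0) (Cst (c i))" by simp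
  also have "\<dots> = 0" unfolding u[OF assms(2)] using z by (simp add: hom_distribs)
  finally show ?thesis .
qed

text \<open>The syzygies \<open>f\<^sub>0 e\<^sub>k - f\<^sub>k e\<^sub>0\<close> are combinations of the columns, so the matrix without its first row
  divides \<open>f\<^sub>0\<close> times the unit matrix; its determinant cannot vanish.\<close>

lemma columns_independent:
  assumes u: "\<And>i. i < n \<Longrightarrow> (\<Sum>j<n-1. \<phi> $$ (i, j) * u j) = 0" and j: "j < n - 1"
  shows "u j = 0"
proof -
  define m where "m = n - 1"
  define M where "M = mat m m (\<lambda>(i, j). \<phi> $$ (Suc i, j))"
  have M: "M \<in> carrier_mat m m" by (simp add: M_def)
  have "\<exists>w. \<forall>i<m. (\<Sum>j<m. \<phi> $$ (Suc i, j) * w j) = (if i = k then f $ 0 else 0)" if k: "k < m" for k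
  proof -
    define v where "v i = (if i = 0 then - f $ Suc k else if i = Suc k then f $ 0 else 0)" for i
    have kn: "Suc k < n" "0 < n" using k n by (auto simp: m_def)
    have "(\<Sum>i<n. f $ i * v i) = (\<Sum>i\<in>{0, Suc k}. f $ i * v i)"
      using kn by (intro sum.mono_neutral_right) (auto simp: v_def)
    then have "(\<Sum>i<n. f $ i * v i) = 0" by (simp add: v_def)
    moreover have "v i \<in> RR" if "i < n" for i using kn f_RR by (auto simp: v_def intro: PV_uminus)
    ultimately obtain w where w: "\<forall>i<n. v i = (\<Sum>j<n-1. \<phi> $$ (i, j) * w j)"
      using syzygy_iff[of v] by blast
    have "(\<Sum>j<m. \<phi> $$ (Suc i, j) * w j) = (if i = k then f $ 0 else 0)" if "i < m" for i
      using w[rule_format, of "Suc i"] that by (auto simp: m_def v_def)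
    then show ?thesis by blast
  qed
  then obtain w where w: "\<And>k i. k < m \<Longrightarrow> i < m \<Longrightarrow> (\<Sum>j<m. \<phi> $$ (Suc i, j) * w k j) = (if i = k then f $ 0 else 0)"
    by metis
  define U where "U = mat m m (\<lambda>(j, k). w k j)"
  have U: "U \<in> carrier_mat m m" by (simp add: U_def)
  have "M * U = f $ 0 \<cdot>\<^sub>m 1\<^sub>m m"
  proof (rule eq_matI)
    fix i k assume ik: "i < dim_row (f $ 0 \<cdot>\<^sub>m 1\<^sub>m m)" "k < dim_col (f $ 0 \<cdot>\<^sub>m 1\<^sub>m m)"
    then have "(M * U) $$ (i, k) = (\<Sum>j<m. \<phi> $$ (Suc i, j) * w k j)"
      by (simp add: M_def U_def scalar_prod_def lessThan_atLeast0)
    then show "(M * U) $$ (i, k) = (f $ 0 \<cdot>\<^sub>m 1\<^sub>m m) $$ (i, k)" using w[of k i] ik by simp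
  qed (simp_all add: M_def U_def)
  then have "det M * det U = (f $ 0) ^ m" using det_mult[OF M U] by simp
  then have "det M \<noteq> 0" using f0 by auto
  then have nz: "\<And>v. v \<in> carrier_vec m \<Longrightarrow> M *\<^sub>v v = 0\<^sub>v m \<Longrightarrow> v = 0\<^sub>v m"
    using det_0_iff_vec_prod_zero[OF M] by blast
  have "M *\<^sub>v vec m u = 0\<^sub>v m"
    using u by (intro eq_vecI) (auto simp: M_def scalar_prod_def lessThan_atLeast0 m_def)
  from nz[OF _ this] have "vec m u = 0\<^sub>v m" by simp
  then have "vec m u $ j = 0\<^sub>v m $ j" by simp
  then show ?thesis using j by (simp add: m_def)
qed

text \<open>If the coefficient matrices satisfy a relation \<open>s A c + t B c = 0\<close>, then the column \<open>(x A + y B) c\<close>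
  is a linear form times a constant vector, which is again a syzygy.\<close>

theorem pencil_no_relation:
  assumes \<phi>: "\<And>i j. i < n \<Longrightarrow> j < n - 2 \<Longrightarrow> \<phi> $$ (i, j) = Cst (\<alpha> i j) * Var Vx + Cst (\<beta> i j) * Var Vy"
    and st: "s \<noteq> 0 \<or> t \<noteq> 0" and rel: "\<And>i. i < n \<Longrightarrow> (\<Sum>j<n-2. (s * \<alpha> i j + t * \<beta> i j) * c j) = 0"
    and j: "j < n - 2"
  shows "c j = 0"
proof -
  define u where "u j = (if j < n - 2 then Cst (c j) else 0)" for j
  define a where "a i = (\<Sum>j<n-2. \<alpha> i j * c j)" for i
  define b where "b i = (\<Sum>j<n-2. \<beta> i j * c j)" for i
  have ab: "s * a i + t * b i = 0" if "i < n" for i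
    using rel[OF that] by (simp add: a_def b_def sum_distrib_left distrib_right sum.distrib mult.assoc)
  have "\<exists>v. a i = t * v \<and> b i = - s * v" if "i < n" for i
  proof (cases "t = 0")
    case False
    have "t * b i = - (s * a i)" using ab[OF that] by (simp add: eq_neg_iff_add_eq_0 add.commute)
    then have "b i = - s * (a i / t)" using False by (simp add: field_simps)
    then show ?thesis using False by (intro exI[of _ "a i / t"]) simp
  next
    case True
    then show ?thesis using st ab[OF that] by (intro exI[of _ "- b i / s"]) auto
  qed
  then obtain v where v: "\<And>i. i < n \<Longrightarrow> a i = t * v i \<and> b i = - s * v i" by metis
  have n2: "{..<n-2} \<subseteq> {..<n-1}" by auto
  have col: "(\<Sum>j<n-1. \<phi> $$ (i, j) * u j) = (Cst t * Var Vx - Cst s * Var Vy) * Cst (v i)" if i: "i < n" for i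
  proof -
    have "(\<Sum>j<n-1. \<phi> $$ (i, j) * u j) = (\<Sum>j<n-2. \<phi> $$ (i, j) * Cst (c j))"
      using n2 by (intro sum.mono_neutral_cong_right) (auto simp: u_def)
    also have "\<dots> = (\<Sum>j<n-2. Cst (\<alpha> i j * c j) * Var Vx + Cst (\<beta> i j * c j) * Var Vy)"
      using \<phi>[OF i] by (intro sum.cong) (auto simp: hom_distribs algebra_simps)
    also have "\<dots> = Cst (a i) * Var Vx + Cst (b i) * Var Vy"
      by (simp add: sum.distrib a_def b_def hom_distribs sum_distrib_right)
    also have "\<dots> = (Cst t * Var Vx - Cst s * Var Vy) * Cst (v i)"
      using v[OF i] by (simp add: hom_distribs algebra_simps)
    finally show ?thesis .
  qed
  have "(\<Sum>i<n. f $ i * (\<Sum>j<n-1. \<phi> $$ (i, j) * u j)) = 0"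
  proof (subst syzygy_iff)
    show "(\<Sum>j<n-1. \<phi> $$ (i, j) * u j) \<in> RR" if "i < n" for i
      using phi_RR that by (intro PV_sum PV_mult) (auto simp: u_def)
    show "\<exists>u'. (\<forall>j<n-1. u' j \<in> RR) \<and> (\<forall>i<n. (\<Sum>j<n-1. \<phi> $$ (i, j) * u j) = (\<Sum>j<n-1. \<phi> $$ (i, j) * u' j))"
      by (intro exI[of _ u]) (auto simp: u_def)
  qed
  moreover have "(\<Sum>i<n. f $ i * (\<Sum>j<n-1. \<phi> $$ (i, j) * u j)) = (\<Sum>i<n. (Cst t * Var Vx - Cst s * Var Vy) * (f $ i * Cst (v i)))"
    by (intro sum.cong refl) (simp only: col lessThan_iff mult.left_commute)
  ultimately have "(Cst t * Var Vx - Cst s * Var Vy) * (\<Sum>i<n. f $ i * Cst (v i)) = 0"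
    by (simp only: sum_distrib_left)
  moreover have "Cst t * Var Vx - Cst s * Var Vy \<noteq> 0"
  proof
    assume 0: "Cst t * Var Vx - Cst s * Var Vy = 0"
    have "pev (\<lambda>w. if w = Vx then 1 else 0) (Cst t * Var Vx - Cst s * Var Vy) = t"
      "pev (\<lambda>w. if w = Vy then 1 else 0) (Cst t * Var Vx - Cst s * Var Vy) = - s"
      by (simp_all add: hom_distribs)
    then show False using st unfolding 0 by simp
  qed
  ultimately have "(\<Sum>i<n. f $ i * Cst (v i)) = 0" by simp
  then have "v i = 0" if "i < n" for i using constant_syzygy that by blast
  then have "(\<Sum>j<n-1. \<phi> $$ (i, j) * u j) = 0" if "i < n" for i using col that by simp
  then have "u j = 0" using columns_independent[of u j] j by simp
  then show ?thesis using j by (simp add: u_def)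
qed

end

section \<open>From the pencil to the toric ring\<close>

interpretation PolVP: vector_space_pair "\<lambda>(c::'k::field) (p :: 'k pol). Cst c * p" "\<lambda>(c::'k) (p :: 'k pol). Cst c * p"
  by unfold_locales

lemma independent_family:
  fixes E :: "'i \<Rightarrow> 'k::field pol"
  assumes fin: "finite J" and ind: "\<And>c. (\<Sum>j\<in>J. Cst (c j) * E j) = 0 \<Longrightarrow> \<forall>j\<in>J. c j = 0"
  shows "inj_on E J" "PolV.independent (E ` J)"
proof -
  show inj: "inj_on E J"
  proof (rule inj_onI, rule ccontr)
    fix i j assume ij: "i \<in> J" "j \<in> J" "E i = E j" "i \<noteq> j"
    let ?c = "\<lambda>k. if k = i then 1 else if k = j then - 1 else (0 :: 'k)"
    have "(\<Sum>k\<in>J. Cst (?c k) * E k) = (\<Sum>k\<in>{i, j}. Cst (?c k) * E k)"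
      using ij fin by (intro sum.mono_neutral_right) auto
    also have "\<dots> = 0" using ij by (simp add: hom_distribs)
    finally show False using ind[of ?c] ij(1) by auto
  qed
  show "PolV.independent (E ` J)"
  proof
    assume "PolV.dependent (E ` J)"
    then obtain e where e: "(\<Sum>p\<in>E ` J. Cst (e p) * p) = 0" "\<exists>p\<in>E ` J. e p \<noteq> 0"
      using PolV.dependent_finite[of "E ` J"] fin by auto
    then have "(\<Sum>j\<in>J. Cst (e (E j)) * E j) = 0" using inj by (simp add: sum.reindex)
    then show False using ind[of "\<lambda>j. e (E j)"] e(2) by auto
  qed
qed

lemma span_family:
  fixes E :: "'i \<Rightarrow> 'k::field pol"
  assumes fin: "finite J" and x: "x \<in> PolV.span (E ` J)"
  shows "\<exists>c. x = (\<Sum>j\<in>J. Cst (c j) * E j)"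
proof -
  let ?S = "{x. \<exists>c. x = (\<Sum>j\<in>J. Cst (c j) * E j)}"
  have "PolV.subspace ?S"
  proof (rule PolV.subspaceI)
    show "0 \<in> ?S" by (intro CollectI exI[of _ "\<lambda>_. 0"]) simp
    fix x y assume "x \<in> ?S" "y \<in> ?S"
    then obtain c d where "x = (\<Sum>j\<in>J. Cst (c j) * E j)" "y = (\<Sum>j\<in>J. Cst (d j) * E j)" by blast
    then show "x + y \<in> ?S"
      by (intro CollectI exI[of _ "\<lambda>j. c j + d j"]) (simp add: hom_distribs distrib_right sum.distrib)
  next
    fix k x assume "x \<in> ?S"
    then obtain c where "x = (\<Sum>j\<in>J. Cst (c j) * E j)" by blast
    then show "Cst k * x \<in> ?S"
      by (intro CollectI exI[of _ "\<lambda>j. k * c j"]) (simp only: Cst.hom_mult sum_distrib_left mult.assoc)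
  qed
  moreover have "E ` J \<subseteq> ?S"
  proof
    fix x assume "x \<in> E ` J"
    then obtain i where i: "i \<in> J" "x = E i" by blast
    have "(\<Sum>j\<in>J. Cst (if j = i then 1 else 0) * E j) = (\<Sum>j\<in>J. if j = i then E i else 0)"
      by (intro sum.cong) auto
    then show "x \<in> ?S" using i fin by (intro CollectI exI[of _ "\<lambda>j. if j = i then 1 else 0"]) simp
  qed
  ultimately have "PolV.span (E ` J) \<subseteq> ?S" by (rule PolV.span_minimal[rotated])
  then show ?thesis using x by blast
qed

text \<open>A linear map is determined by arbitrary values on an independent family; the extension beyond the span of
  the family is arbitrary, which avoids side conditions.\<close>

lemma ex_linear_map:
  fixes E G :: "'i \<Rightarrow> 'k::field pol"
  assumes fin: "finite J" and ind: "\<And>c. (\<Sum>j\<in>J. Cst (c j) * E j) = 0 \<Longrightarrow> \<forall>j\<in>J. c j = 0"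
  shows "\<exists>T. (\<forall>x y. T (x + y) = T x + T y) \<and> (\<forall>c x. T (Cst c * x) = Cst c * T x) \<and> (\<forall>j\<in>J. T (E j) = G j)"
proof -
  note i = independent_family[of J E, OF fin ind]
  obtain T where T: "Vector_Spaces.linear (\<lambda>c p. Cst c * p) (\<lambda>c p. Cst c * p) T"
    and E: "\<forall>x\<in>E ` J. T x = G (inv_into J E x)"
    using PolVP.linear_independent_extend[OF i(2), of "\<lambda>x. G (inv_into J E x)"] by blast
  interpret T: Vector_Spaces.linear "\<lambda>c p. Cst c * p" "\<lambda>c p. Cst c * p" T by (rule T)
  show ?thesis
    by (intro exI[of _ T] conjI allI ballI T.add T.scale) (use E i(1) in auto)
qed

lemma linear_map_sum:
  fixes T :: "'k::field pol \<Rightarrow> 'k pol"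
  assumes "\<And>x y. T (x + y) = T x + T y" "\<And>c x. T (Cst c * x) = Cst c * T x"
  shows "T (\<Sum>i\<in>A. Cst (c i) * f i) = (\<Sum>i\<in>A. Cst (c i) * T (f i))"
proof (induction A rule: infinite_finite_induct)
  have "T 0 = 0" using assms(2)[of 0 0] by simp
  { case (infinite A) with \<open>T 0 = 0\<close> show ?case by simp next case empty with \<open>T 0 = 0\<close> show ?case by simp }
qed (simp add: assms)

lemma (in scroll) tmon_eq_iff:
  "tmon i j k c e = tmon i' j' k' c' e' \<longleftrightarrow> i = i' \<and> j = j' \<and> k = k' \<and> c = c' \<and> e = e'"
  by (metis lookup_tmon)

lemma (in scroll) rows_independent:
  assumes "(\<Sum>i\<le>a. Cst (c i) * (lam ^ i * qq)) + (\<Sum>j\<le>b. Cst (d j) * (lam ^ j * rr)) = 0" (is "?s + ?t = 0")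
  shows "i \<le> a \<Longrightarrow> c i = 0" "j \<le> b \<Longrightarrow> d j = 0"
proof -
  have m: "lam ^ i * qq = Mon (tmon 0 1 0 i 0)" "lam ^ j * rr = Mon (tmon 0 0 1 j 0)" for i j
    by (simp_all add: Mon_tmon mult.commute)
  have l: "Poly_Mapping.lookup (Cst x * Mon m' :: 'k pol) m = (if m' = m then x else 0)" for x m' m
    by (simp add: lookup_Cst_mult lookup_Mon)
  show "c i = 0" if "i \<le> a"
  proof -
    have "Poly_Mapping.lookup (?s + ?t) (tmon 0 1 0 i 0) = c i"
      using that by (simp add: m lookup_add lookup_sum l tmon_eq_iff)
    then show ?thesis using assms by simp
  qed
  show "d j = 0" if "j \<le> b"
  proof -
    have "Poly_Mapping.lookup (?s + ?t) (tmon 0 0 1 j 0) = d j"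
      using that by (simp add: m lookup_add lookup_sum l tmon_eq_iff)
    then show ?thesis using assms by simp
  qed
qed

locale pencil =
  fixes n :: nat and \<alpha> \<beta> :: "nat \<Rightarrow> nat \<Rightarrow> 'k::alg_closed_field"
  assumes n: "4 < n" and no_relation: "\<And>s t c j. s \<noteq> 0 \<or> t \<noteq> 0 \<Longrightarrow>
    (\<And>i. i < n \<Longrightarrow> (\<Sum>j<n-2. (s * \<alpha> i j + t * \<beta> i j) * c j) = 0) \<Longrightarrow> j < n - 2 \<Longrightarrow> c j = 0"
begin

definition LX :: "nat \<Rightarrow> 'k pol" where "LX j = (\<Sum>i<n. Cst (\<alpha> i j) * Var (Vw i))"
definition LY :: "nat \<Rightarrow> 'k pol" where "LY j = (\<Sum>i<n. Cst (\<beta> i j) * Var (Vw i))"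
definition rel :: "nat \<Rightarrow> 'k pol" where "rel j = Var Vx * LX j + Var Vy * LY j"

abbreviation "vs \<equiv> {Vx, Vy, Vz} \<union> Vw ` {..<n}"
abbreviation "ws \<equiv> (\<lambda>i. Var (Vw i) :: 'k pol) ` {..<n}"

definition RI :: "'k pol set" where "RI = Idl\<^bsub>pol_ring vs\<^esub> (rel ` {..<n-2})"

lemma W_independent:
  assumes "(\<Sum>i<n. Cst (c i) * Var (Vw i)) = (0 :: 'k pol)"
  shows "\<forall>i\<in>{..<n}. c i = 0"
proof
  fix i assume i: "i \<in> {..<n}"
  let ?e = "\<lambda>v. if v = Vw i then 1 else (0 :: 'k)"
  have "pev ?e (\<Sum>k<n. Cst (c k) * Var (Vw k)) = (\<Sum>k<n. c k * (if k = i then 1 else 0))"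
    by (simp add: hom_distribs)
  also have "\<dots> = (\<Sum>k<n. if k = i then c k else 0)" by (intro sum.cong) auto
  finally show "c i = 0" using assms i by simp
qed

lemma pencil_independent:
  assumes st: "s \<noteq> 0 \<or> t \<noteq> 0" and 0: "(\<Sum>j<n-2. Cst (c j) * (Cst s * LX j + Cst t * LY j)) = 0"
  shows "\<forall>j\<in>{..<n-2}. c j = 0"
proof -
  have summand: "Cst (c j) * (Cst s * (Cst (\<alpha> i j) * w) + Cst t * (Cst (\<beta> i j) * w)) = Cst ((s * \<alpha> i j + t * \<beta> i j) * c j) * w"
    for i j and w :: "'k pol"
    by (simp only: Cst.hom_add Cst.hom_mult distrib_left distrib_right mult_ac)
  have "Cst (c j) * (Cst s * LX j + Cst t * LY j) = (\<Sum>i<n. Cst ((s * \<alpha> i j + t * \<beta> i j) * c j) * Var (Vw i))" for j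
    unfolding LX_def LY_def sum_distrib_left sum.distrib[symmetric] by (rule sum.cong[OF refl]) (rule summand)
  then have "(\<Sum>j<n-2. Cst (c j) * (Cst s * LX j + Cst t * LY j))
     = (\<Sum>j<n-2. \<Sum>i<n. Cst ((s * \<alpha> i j + t * \<beta> i j) * c j) * Var (Vw i))"
    by (simp only:)
  also have "\<dots> = (\<Sum>i<n. Cst (\<Sum>j<n-2. (s * \<alpha> i j + t * \<beta> i j) * c j) * Var (Vw i))"
    by (subst sum.swap) (simp only: Cst.hom_sum sum_distrib_right)
  finally have "\<forall>i\<in>{..<n}. (\<Sum>j<n-2. (s * \<alpha> i j + t * \<beta> i j) * c j) = 0"
    using 0 by (intro W_independent) simp
  then show ?thesis using no_relation[OF st, of c] by auto
qed

lemma LY_independent: "(\<Sum>j<n-2. Cst (c j) * LY j) = 0 \<Longrightarrow> \<forall>j\<in>{..<n-2}. c j = 0"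
  using pencil_independent[of 0 1 c] by simp

lemma W_family: "inj_on (\<lambda>i. Var (Vw i) :: 'k pol) {..<n}" "PolV.independent ws"
  using independent_family[of "{..<n}" "\<lambda>i. Var (Vw i) :: 'k pol"] W_independent by simp_all

lemma LY_family: "inj_on LY {..<n-2}" "PolV.independent (LY ` {..<n-2})"
  using independent_family[of "{..<n-2}" LY] LY_independent by simp_all

lemma LX_span: "LX j \<in> PolV.span ws" and LY_span: "LY j \<in> PolV.span ws"
  unfolding LX_def LY_def by (rule PolV.span_sum, rule PolV.span_scale, rule PolV.span_base, simp)+

interpretation S: subalgebra "PV vs :: 'k pol set"
  by unfold_locales (auto intro: PV_closed)

lemma span_PV: "h \<in> PolV.span ws \<Longrightarrow> h \<in> PV vs"
proof -
  have "PolV.span ws \<subseteq> PV vs"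
    by (rule PolV.span_minimal) (auto simp: PolV.subspace_def intro: PV_closed)
  then show "h \<in> PolV.span ws \<Longrightarrow> h \<in> PV vs" by blast
qed

lemma rel_PV: "rel j \<in> PV vs"
  unfolding rel_def using LX_span LY_span by (intro PV_add PV_mult PV_Var span_PV) auto

lemma S_eq: "sub_ring (PV vs) = (pol_ring vs :: 'k pol ring)"
  by (rule pol_ring_eq_sub_ring[symmetric])

lemma RI_sub_ring: "RI = Idl\<^bsub>sub_ring (PV vs)\<^esub> (rel ` {..<n-2})"
  by (simp only: RI_def S_eq)

lemma RI_ideal: "ideal RI (sub_ring (PV vs))"
  unfolding RI_sub_ring by (rule S.genideal_ideal) (use rel_PV in auto)

lemma RI_eq: "RI = {\<Sum>i\<in>B. r i * rel i | r B. finite B \<and> B \<subseteq> {..<n-2} \<and> (\<forall>i\<in>B. r i \<in> PV vs)}"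
  unfolding RI_sub_ring by (rule S.Idl_finite_family) (rule rel_PV)

lemma rel_RI: "j < n - 2 \<Longrightarrow> rel j \<in> RI"
  unfolding RI_sub_ring using S.genideal_self[of "rel ` {..<n-2}"] rel_PV by auto

text \<open>Modulo the relations \<open>x LX\<^sub>j + y LY\<^sub>j\<close> the map \<open>T\<close> plays the part of \<open>y/x\<close> on the span of the \<open>LY\<^sub>j\<close>. An
  eigenvector of \<open>T\<close> would be a dependency between the columns of a member of the pencil.\<close>

lemma ex_shift:
  obtains T where "\<And>x y. T (x + y) = T x + T y" "\<And>c x. T (Cst c * x) = Cst c * T x"
    "\<And>j. j < n - 2 \<Longrightarrow> T (LY j) = - LX j" "partial_shift T ws (LY ` {..<n-2})"
proof -
  obtain T where T0: "(\<forall>x y. T (x + y) = T x + T y) \<and> (\<forall>c x. T (Cst c * x) = Cst c * T x) \<and> (\<forall>j\<in>{..<n-2}. T (LY j) = - LX j)"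
    using ex_linear_map[of "{..<n-2}" LY "\<lambda>j. - LX j", OF finite_lessThan LY_independent] by blast
  then have T: "\<And>x y. T (x + y) = T x + T y" "\<And>c x. T (Cst c * x) = Cst c * T x"
    "\<And>j. j < n - 2 \<Longrightarrow> T (LY j) = - LX j" by simp_all
  have TB: "T (\<Sum>j<n-2. Cst (c j) * LY j) = (\<Sum>j<n-2. Cst (c j) * - LX j)" for c
    by (subst linear_map_sum[of T, OF T(1,2)]) (auto intro: sum.cong simp: T(3))
  have "partial_shift T ws (LY ` {..<n-2})"
  proof
    show "finite ws" "finite (LY ` {..<n-2})" by auto
    show "PolV.independent ws" "PolV.independent (LY ` {..<n-2})"
      by (rule W_family(2)) (rule LY_family(2))
    have "card ws = n" "card (LY ` {..<n-2}) = n - 2"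
      using card_image[OF W_family(1)] card_image[OF LY_family(1)] by simp_all
    then show "card (LY ` {..<n-2}) + 2 = card ws" using n by simp
    show "PolV.span (LY ` {..<n-2}) \<subseteq> PolV.span ws"
      by (rule PolV.span_minimal) (auto intro: LY_span)
    show "T x \<in> PolV.span ws" if "x \<in> PolV.span (LY ` {..<n-2})" for x
    proof -
      obtain c where "x = (\<Sum>j<n-2. Cst (c j) * LY j)" using span_family[OF finite_lessThan \<open>x \<in> _\<close>] by blast
      then show ?thesis by (auto simp: TB intro!: PolV.span_sum PolV.span_scale PolV.span_neg LX_span simp del: mult_minus_right)
    qed
    show "x = 0" if x: "x \<in> PolV.span (LY ` {..<n-2})" "T x = Cst k * x" for k x
    proof -
      obtain c where c: "x = (\<Sum>j<n-2. Cst (c j) * LY j)" using span_family[OF finite_lessThan x(1)] by blast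
      have "(\<Sum>j<n-2. Cst (c j) * (Cst 1 * LX j + Cst k * LY j)) = Cst k * x - T x"
        unfolding c TB by (simp add: sum_distrib_left sum_subtractf[symmetric] algebra_simps flip: sum_negf)
      also have "\<dots> = 0" using x by simp
      finally have "\<forall>j\<in>{..<n-2}. c j = 0" by (intro pencil_independent[of 1 k]) auto
      then show ?thesis by (simp add: c)
    qed
  qed (simp_all add: T)
  with T that show ?thesis by blast
qed

text \<open>The two chains of \<open>T\<close> satisfy the relations of the scroll, so sending them to the rows \<open>\<lambda>\<^sup>i q\<close> and \<open>\<lambda>\<^sup>j r\<close> of
  the toric ring defines a substitution \<open>\<pi>\<close>. The colon ideal \<open>J\<close> is its kernel: elements of the kernel are
  multiplied into the ideal of relations by \<open>x\<close> and \<open>y\<close> through straightening, and conversely \<open>\<pi>\<close> kills the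
  relations and sends \<open>x\<close> to \<open>p \<noteq> 0\<close>.\<close>

theorem colon_ideal_properties:
  defines "J \<equiv> colon (pol_ring vs) RI (Idl\<^bsub>pol_ring vs\<^esub> {Var Vx, Var Vy})"
  defines "B \<equiv> pol_ring vs Quot J"
  defines "br \<equiv> \<lambda>p. J +>\<^bsub>pol_ring vs\<^esub> p"
  defines "K \<equiv> Idl\<^bsub>B\<^esub> {br (Var Vz ^ 2 * Var (Vw 0))}"
  shows "colon B K (Idl\<^bsub>B\<^esub> {br (Var Vx), br (Var Vy), br (Var Vz ^ 2 * Var (Vw 0))}) = K \<and>
    CM_ideal B K \<and> ideal_height B K = 1"
proof -
  obtain T where T: "\<And>x y. T (x + y) = T x + T y" "\<And>c x. T (Cst c * x) = Cst c * T x"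
    "\<And>j. j < n - 2 \<Longrightarrow> T (LY j) = - LX j" and ps: "partial_shift T ws (LY ` {..<n-2})"
    by (rule ex_shift) (assumption | blast)+
  let ?V = "PolV.span ws" and ?H = "PolV.span (LY ` {..<n-2})"
  have cardW: "card ws = n" using card_image[OF W_family(1)] by simp
  have HV: "?H \<subseteq> ?V" by (rule PolV.span_minimal) (auto intro: LY_span)
  obtain u v a b where ab: "a \<le> b" "a + b + 2 = n"
    and uvH0: "\<forall>i<a. (T ^^ i) u \<in> ?H" "\<forall>j<b. (T ^^ j) v \<in> ?H"
    and ind: "\<forall>c d. (\<Sum>i\<le>a. Cst (c i) * (T ^^ i) u) + (\<Sum>j\<le>b. Cst (d j) * (T ^^ j) v) = 0 \<longrightarrow>
       (\<forall>i\<le>a. c i = 0) \<and> (\<forall>j\<le>b. d j = 0)"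
    and spV: "\<forall>x\<in>?V. \<exists>c d. x = (\<Sum>i\<le>a. Cst (c i) * (T ^^ i) u) + (\<Sum>j\<le>b. Cst (d j) * (T ^^ j) v)"
    and spH: "\<forall>x\<in>?H. \<exists>c d. x = (\<Sum>i<a. Cst (c i) * (T ^^ i) u) + (\<Sum>j<b. Cst (d j) * (T ^^ j) v)"
    and uvV: "(T ^^ a) u \<in> ?V" "(T ^^ b) v \<in> ?V"
    using partial_shift.chain_basis[OF ps] unfolding cardW by (elim exE conjE) (rule that)
  have uvH: "\<And>i. i < a \<Longrightarrow> (T ^^ i) u \<in> ?H" "\<And>j. j < b \<Longrightarrow> (T ^^ j) v \<in> ?H" using uvH0 by blast+
  define uu where "uu i = (T ^^ i) u" for i
  define vv where "vv j = (T ^^ j) v" for j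
  have uuV: "uu i \<in> ?V" if "i \<le> a" for i
    using uvH(1)[of i] uvV(1) HV that by (cases "i = a") (auto simp: uu_def)
  have vvV: "vv j \<in> ?V" if "j \<le> b" for j
    using uvH(2)[of j] uvV(2) HV that by (cases "j = b") (auto simp: vv_def)
  have b0: "0 < b" using ab n by simp
  interpret st: straightening "PV vs :: 'k pol set" RI "Var Vx" "Var Vy"
    by (intro straightening.intro S.subalgebra_axioms RI_ideal) (auto intro: PV_Var)
  have shift_RI: "Var Vy * h - Var Vx * T h \<in> RI" if "h \<in> ?H" for h
  proof -
    have T0: "T 0 = 0" using T(2)[of 0 0] by simp
    have "PolV.subspace {h. Var Vy * h - Var Vx * T h \<in> RI}"
    proof (rule PolV.subspaceI)
      show "0 \<in> {h. Var Vy * h - Var Vx * T h \<in> RI}" using T0 st.L_0 by simp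
      fix g h assume "g \<in> {h. Var Vy * h - Var Vx * T h \<in> RI}" "h \<in> {h. Var Vy * h - Var Vx * T h \<in> RI}"
      then show "g + h \<in> {h. Var Vy * h - Var Vx * T h \<in> RI}"
        using st.L_add[of "Var Vy * g - Var Vx * T g" "Var Vy * h - Var Vx * T h"] by (simp add: T algebra_simps)
    next
      fix c h assume "h \<in> {h. Var Vy * h - Var Vx * T h \<in> RI}"
      then have "Cst c * (Var Vy * h - Var Vx * T h) \<in> RI" by (intro st.L_mult) auto
      moreover have "Cst c * (Var Vy * h - Var Vx * T h) = Var Vy * (Cst c * h) - Var Vx * T (Cst c * h)"
        by (simp add: T right_diff_distrib mult.left_commute)
      ultimately show "Cst c * h \<in> {h. Var Vy * h - Var Vx * T h \<in> RI}" by simp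
    qed
    moreover have "LY ` {..<n-2} \<subseteq> {h. Var Vy * h - Var Vx * T h \<in> RI}"
      using rel_RI by (auto simp: T rel_def add.commute)
    ultimately have "?H \<subseteq> {h. Var Vy * h - Var Vx * T h \<in> RI}" by (rule PolV.span_minimal[rotated])
    then show ?thesis using that by blast
  qed
  have chu: "st.chain a uu" and chv: "st.chain b vv"
    unfolding st.chain_def st.cg_def using uuV vvV span_PV shift_RI[OF uvH(1)] shift_RI[OF uvH(2)]
    by (auto simp: uu_def vv_def)
  interpret straightening_scroll "PV vs :: 'k pol set" RI "Var Vx" "Var Vy" a b uu vv "Var Vz"
    by unfold_locales (use ab b0 chu chv in \<open>auto intro: PV_Var\<close>)
  let ?J = "{..a} <+> {..b}"
  let ?E = "case_sum uu vv" and ?G = "case_sum (\<lambda>i. lam ^ i * qq) (\<lambda>j. lam ^ j * rr)"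
  have E: "(\<Sum>i\<in>?J. Cst (c i) * ?E i) = (\<Sum>i\<le>a. Cst (c (Inl i)) * uu i) + (\<Sum>j\<le>b. Cst (c (Inr j)) * vv j)" for c
    by (simp add: sum.Plus comp_def)
  have Eind: "\<forall>i\<in>?J. c i = 0" if "(\<Sum>i\<in>?J. Cst (c i) * ?E i) = 0" for c
  proof -
    have "(\<Sum>i\<le>a. Cst (c (Inl i)) * (T ^^ i) u) + (\<Sum>j\<le>b. Cst (c (Inr j)) * (T ^^ j) v) = 0"
      using that unfolding E[of c] uu_def vv_def .
    from mp[OF spec[OF spec[OF ind, of "\<lambda>i. c (Inl i)"], of "\<lambda>j. c (Inr j)"] this]
    show ?thesis by (auto elim!: PlusE)
  qed
  obtain \<Lambda> where \<Lambda>: "\<And>x y. \<Lambda> (x + y) = \<Lambda> x + \<Lambda> y" "\<And>c x. \<Lambda> (Cst c * x) = Cst c * \<Lambda> x"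
    and \<Lambda>E: "\<forall>i\<in>?J. \<Lambda> (?E i) = ?G i"
  proof -
    have "finite ?J" by simp
    from ex_linear_map[of ?J ?E ?G, OF this Eind] obtain \<Lambda> where
      "(\<forall>x y. \<Lambda> (x + y) = \<Lambda> x + \<Lambda> y) \<and> (\<forall>c x. \<Lambda> (Cst c * x) = Cst c * \<Lambda> x) \<and> (\<forall>i\<in>?J. \<Lambda> (?E i) = ?G i)" by blast
    then show ?thesis using that[of \<Lambda>] by simp
  qed
  have \<Lambda>u: "\<Lambda> (uu i) = lam ^ i * qq" if "i \<le> a" for i using \<Lambda>E[rule_format, of "Inl i"] that by auto
  have \<Lambda>v: "\<Lambda> (vv j) = lam ^ j * rr" if "j \<le> b" for j using \<Lambda>E[rule_format, of "Inr j"] that by auto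
  have \<Lambda>_sum: "\<Lambda> ((\<Sum>i\<in>I. Cst (c i) * f i) + (\<Sum>j\<in>K. Cst (d j) * h j)) = (\<Sum>i\<in>I. Cst (c i) * \<Lambda> (f i)) + (\<Sum>j\<in>K. Cst (d j) * \<Lambda> (h j))"
    for I K :: "nat set" and c d f h
    unfolding \<Lambda>(1) linear_map_sum[of \<Lambda>, OF \<Lambda>] ..
  define \<pi> where "\<pi> v = (case v of Vx \<Rightarrow> pp | Vy \<Rightarrow> lam * pp | Vz \<Rightarrow> zz | Vw i \<Rightarrow> \<Lambda> (Var (Vw i)))" for v
  have \<pi>_simps [simp]: "\<pi> Vx = pp" "\<pi> Vy = lam * pp" "\<pi> Vz = zz" "\<pi> (Vw i) = \<Lambda> (Var (Vw i))" for i
    by (simp_all add: \<pi>_def)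
  have \<pi>V: "psub \<pi> h = \<Lambda> h" if h: "h \<in> ?V" for h
  proof -
    obtain c where "h = (\<Sum>i<n. Cst (c i) * Var (Vw i))" using span_family[OF finite_lessThan h] by blast
    then show ?thesis by (simp add: linear_map_sum[of \<Lambda>, OF \<Lambda>] hom_distribs)
  qed
  \<comment> \<open>\<open>T\<close> becomes multiplication by \<open>lam\<close>.\<close>
  have \<pi>T: "psub \<pi> (T h) = lam * psub \<pi> h" if h: "h \<in> ?H" for h
  proof -
    obtain c d where h': "h = (\<Sum>i<a. Cst (c i) * uu i) + (\<Sum>j<b. Cst (d j) * vv j)"
      using spH[rule_format, OF h] by (auto simp: uu_def vv_def)
    have "T h = (\<Sum>i<a. Cst (c i) * uu (Suc i)) + (\<Sum>j<b. Cst (d j) * vv (Suc j))"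
      unfolding h' T(1) linear_map_sum[of T, OF T(1,2)] by (simp add: uu_def vv_def)
    then have 1: "\<Lambda> (T h) = (\<Sum>i<a. Cst (c i) * (lam ^ Suc i * qq)) + (\<Sum>j<b. Cst (d j) * (lam ^ Suc j * rr))"
      using \<Lambda>u \<Lambda>v by (simp add: \<Lambda>_sum)
    have "\<Lambda> h = (\<Sum>i<a. Cst (c i) * (lam ^ i * qq)) + (\<Sum>j<b. Cst (d j) * (lam ^ j * rr))"
      unfolding h' \<Lambda>_sum using \<Lambda>u \<Lambda>v by simp
    with 1 have "\<Lambda> (T h) = lam * \<Lambda> h" by (simp add: distrib_left sum_distrib_left mult_ac)
    moreover have "T h \<in> ?V" using partial_shift.T_V[OF ps] h by blast
    ultimately show ?thesis using \<pi>V h HV by auto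
  qed
  have \<pi>rel: "psub \<pi> (rel j) = 0" if "j < n - 2" for j
  proof -
    have "LY j \<in> ?H" using that by (intro PolV.span_base) auto
    then have "psub \<pi> (- LX j) = lam * psub \<pi> (LY j)" using \<pi>T T(3)[OF that] by metis
    then have "- psub \<pi> (LX j) = lam * psub \<pi> (LY j)" by (simp add: hom_distribs)
    then have "psub \<pi> (LX j) = - (lam * psub \<pi> (LY j))" by (metis add.inverse_inverse)
    then show ?thesis by (simp add: rel_def hom_distribs mult_ac)
  qed
  have spV': "\<exists>c d. x = (\<Sum>i\<le>a. Cst (c i) * uu i) + (\<Sum>j\<le>b. Cst (d j) * vv j)" if "x \<in> ?V" for x
    unfolding uu_def vv_def using spV that by blast
  have w: "\<exists>c d. Var (Vw i) = (\<Sum>i\<le>a. Cst (c i) * uu i) + (\<Sum>j\<le>b. Cst (d j) * vv j) \<and>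
      \<Lambda> (Var (Vw i)) = (\<Sum>i\<le>a. Cst (c i) * (lam ^ i * qq)) + (\<Sum>j\<le>b. Cst (d j) * (lam ^ j * rr))"
    if i: "i < n" for i
  proof -
    have "Var (Vw i) \<in> ?V" using i by (intro PolV.span_base) auto
    then obtain c d where cd: "Var (Vw i) = (\<Sum>i\<le>a. Cst (c i) * uu i) + (\<Sum>j\<le>b. Cst (d j) * vv j)"
      using spV' by blast
    have "\<Lambda> (Var (Vw i)) = (\<Sum>i\<le>a. Cst (c i) * (lam ^ i * qq)) + (\<Sum>j\<le>b. Cst (d j) * (lam ^ j * rr))"
      unfolding cd \<Lambda>_sum using \<Lambda>u \<Lambda>v by simp
    with cd show ?thesis by blast
  qed
  have acts_var: "acts (Var v) (\<pi> v)" if v: "v \<in> vs" for v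
  proof -
    consider "v \<in> {Vx, Vy, Vz}" | i where "i < n" "v = Vw i" using v by blast
    then show ?thesis
    proof cases
      case 1
      then show ?thesis using acts_gens(1-3) by auto
    next
      case 2
      obtain c d where cd: "Var (Vw i) = (\<Sum>i\<le>a. Cst (c i) * uu i) + (\<Sum>j\<le>b. Cst (d j) * vv j)"
        "\<Lambda> (Var (Vw i)) = (\<Sum>i\<le>a. Cst (c i) * (lam ^ i * qq)) + (\<Sum>j\<le>b. Cst (d j) * (lam ^ j * rr))"
        using w[OF 2(1)] by blast
      have "acts (\<Sum>i\<le>a. Cst (c i) * uu i) (\<Sum>i\<le>a. Cst (c i) * (lam ^ i * qq))"
        "acts (\<Sum>j\<le>b. Cst (d j) * vv j) (\<Sum>j\<le>b. Cst (d j) * (lam ^ j * rr))"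
        by (intro acts_sum acts_mult acts_Cst acts_gens; simp)+
      then show ?thesis using acts_add unfolding 2(2) \<pi>_simps cd(2) by (subst cd(1))
    qed
  qed
  have acts: "acts h (psub \<pi> h)" if "h \<in> PV vs" for h
    using that
  proof (induction h rule: pol_induct)
    case (Cst c)
    show ?case unfolding psub_Cst by (rule acts_Cst)
  next
    case (add p q)
    show ?case unfolding hom_distribs by (rule acts_add[OF add.IH])
  next
    case (Var v p)
    show ?case unfolding hom_distribs psub_Var by (rule acts_mult[OF acts_var[OF Var.hyps(1)] Var.IH])
  qed
  have RI_kernel: "psub \<pi> p = 0" if p: "p \<in> RI" for p
  proof -
    obtain r B where "p = (\<Sum>i\<in>B. r i * rel i)" "B \<subseteq> {..<n-2}" using p unfolding RI_eq by blast
    moreover have "(\<Sum>i\<in>B. psub \<pi> (r i) * psub \<pi> (rel i)) = 0"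
      using \<open>B \<subseteq> _\<close> \<pi>rel by (intro sum.neutral) auto
    ultimately show ?thesis by (simp add: hom_distribs)
  qed
  have xyPV: "(Var Vx :: 'k pol) \<in> PV vs" "(Var Vy :: 'k pol) \<in> PV vs" by (auto intro: PV_Var)
  have xyI: "{Var Vx, Var Vy} \<subseteq> carrier (sub_ring (PV vs :: 'k pol set))" using xyPV by simp
  have J_iff: "p \<in> J \<longleftrightarrow> p \<in> PV vs \<and> (\<forall>q\<in>Idl\<^bsub>sub_ring (PV vs)\<^esub> {Var Vx, Var Vy}. p * q \<in> RI)" for p
  proof -
    have "J = colon (sub_ring (PV vs)) RI (Idl\<^bsub>sub_ring (PV vs)\<^esub> {Var Vx, Var Vy})"
      by (simp only: J_def S_eq)
    then show ?thesis by (simp only: colon_def sub_ring_simps mem_Collect_eq)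
  qed
  have J: "J = {p \<in> PV vs. psub \<pi> p = 0}"
  proof (intro Set.set_eqI iffI)
    fix p assume pJ: "p \<in> J"
    have p: "p \<in> PV vs" by (rule conjunct1[OF iffD1[OF J_iff pJ]])
    have pq: "\<forall>q\<in>Idl\<^bsub>sub_ring (PV vs)\<^esub> {Var Vx, Var Vy}. p * q \<in> RI" by (rule conjunct2[OF iffD1[OF J_iff pJ]])
    have "(Var Vx :: 'k pol) \<in> Idl\<^bsub>sub_ring (PV vs)\<^esub> {Var Vx, Var Vy}" by (rule subsetD[OF S.genideal_self[OF xyI]]) simp
    then have "p * Var Vx \<in> RI" by (rule bspec[OF pq])
    then have "psub \<pi> p * pp = 0" using RI_kernel[of "p * Var Vx"] by (simp add: hom_distribs)
    then show "p \<in> {p \<in> PV vs. psub \<pi> p = 0}" using p Var_neq_0[of Vx] by simp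
  next
    fix p assume "p \<in> {p \<in> PV vs. psub \<pi> p = 0}"
    then have p: "p \<in> PV vs" "acts p 0" using acts[of p] by auto
    have "p * q \<in> RI" if q: "q \<in> Idl\<^bsub>sub_ring (PV vs)\<^esub> {Var Vx, Var Vy}" for q
    proof -
      have "Idl\<^bsub>sub_ring (PV vs)\<^esub> ((\<lambda>f. f) ` {Var Vx, Var Vy :: 'k pol}) = {\<Sum>i\<in>B. r i * i | r B.
          finite B \<and> B \<subseteq> {Var Vx, Var Vy} \<and> (\<forall>i\<in>B. r i \<in> PV vs)}"
        by (rule S.Idl_finite_family) (use xyPV in auto)
      then have "q \<in> {\<Sum>i\<in>B. r i * i | r B. finite B \<and> B \<subseteq> {Var Vx, Var Vy} \<and> (\<forall>i\<in>B. r i \<in> PV vs)}"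
        using q by (simp only: image_ident)
      then obtain r B where B: "q = (\<Sum>i\<in>B. r i * i)" "finite B" "B \<subseteq> {Var Vx, Var Vy}" "\<forall>i\<in>B. r i \<in> PV vs"
        by blast
      have "(\<Sum>i\<in>B. r i * (i * p)) \<in> RI"
        using B(2-4)
      proof (induction B rule: finite_induct)
        case (insert i B)
        then have "i * p \<in> RI" using acts_zero[OF p(2)] by auto
        then show ?case using insert st.L_add st.L_mult by simp
      qed (simp add: st.L_0)
      moreover have "p * q = (\<Sum>i\<in>B. r i * (i * p))" unfolding B(1) by (simp add: sum_distrib_left mult_ac)
      ultimately show ?thesis by simp
    qed
    then show "p \<in> J" unfolding J_iff using p(1) by blast
  qed
  have img: "psub \<pi> ` PV vs = toric"
  proof
    have "psub \<pi> h \<in> toric" if "h \<in> PV vs" for h using acts[OF that] unfolding acts_def by blast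
    then show "psub \<pi> ` PV vs \<subseteq> toric" by (rule image_subsetI)
    show "toric \<subseteq> psub \<pi> ` PV vs"
    proof
      fix g assume g: "g \<in> toric"
      have pu: "psub \<pi> (uu i) = lam ^ i * qq" if "i \<le> a" for i using \<pi>V[OF uuV[OF that]] \<Lambda>u[OF that] by simp
      have pv: "psub \<pi> (vv j) = lam ^ j * rr" if "j \<le> b" for j using \<pi>V[OF vvV[OF that]] \<Lambda>v[OF that] by simp
      have sm: "psub \<pi> (stdm m) = Mon m" if m: "m \<in> cone" for m
      proof -
        obtain i j k c e where t: "m = tmon i j k c e" "c \<le> i + a * j + b * k" using m by (rule cone_E)
        have "psub \<pi> (std j k i c) = pp ^ i * qq ^ j * rr ^ k * lam ^ c"
          by (rule psub_std) (use t pu pv in simp_all)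
        then show ?thesis unfolding t(1) by (simp add: Mon_tmon hom_distribs mult_ac)
      qed
      have k: "Poly_Mapping.keys g \<subseteq> cone" using g by (simp add: toric_def)
      have "Sec g \<in> PV vs" unfolding Sec_def using k by (intro PV_sum PV_mult PV_Cst stdm_S) auto
      moreover have "psub \<pi> (Sec g) = (\<Sum>m\<in>Poly_Mapping.keys g. Cst (Poly_Mapping.lookup g m) * Mon m)"
        unfolding Sec_def hom_distribs using k sm by (intro sum.cong) auto
      then have "psub \<pi> (Sec g) = g" using pol_eq_sum[of g] by simp
      ultimately show "g \<in> psub \<pi> ` PV vs" by (metis image_eqI)
    qed
  qed
  obtain c d where w0: "Var (Vw 0) = (\<Sum>i\<le>a. Cst (c i) * uu i) + (\<Sum>j\<le>b. Cst (d j) * vv j)"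
      "\<Lambda> (Var (Vw 0)) = (\<Sum>i\<le>a. Cst (c i) * (lam ^ i * qq)) + (\<Sum>j\<le>b. Cst (d j) * (lam ^ j * rr))"
    using w[of 0] n by auto
  have w1: "\<pi> (Vw 0) \<in> toric"
  proof -
    have "acts (Var (Vw 0)) (\<pi> (Vw 0))" by (rule acts_var) (use n in simp)
    then show ?thesis unfolding acts_def by blast
  qed
  have w2: "\<pi> (Vw 0) \<noteq> 0"
  proof
    assume "\<pi> (Vw 0) = 0"
    then have "(\<Sum>i\<le>a. Cst (c i) * (lam ^ i * qq)) + (\<Sum>j\<le>b. Cst (d j) * (lam ^ j * rr)) = 0" using w0(2) by simp
    from rows_independent[OF this] have "Var (Vw 0) = (0 :: 'k pol)" unfolding w0(1) by simp
    then show False using Var_neq_0 by blast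
  qed
  have w3: "\<pi> (Vw 0) \<in> PV {Vy, Vw 0, Vw (Suc 0)}"
    unfolding \<pi>_simps w0(2) by (intro PV_add PV_sum PV_mult PV_Cst PV_power PV_Var) auto
  have g0: "Var Vz ^ 2 * Var (Vw 0) \<in> (PV vs :: 'k pol set)" using n by (intro PV_mult PV_power PV_Var) auto
  show ?thesis
    unfolding K_def B_def br_def
    by (rule toric_quotient[OF _ img xyPV g0 _ _ _ _ w1 w2 w3 _ refl J])
      (simp_all add: hom_distribs)
qed

end

section \<open>The ideal \<open>K''\<close>\<close>

theorem theorem6p4:
  fixes n d :: nat
    and \<phi> :: "'k::alg_closed_field pol mat"
    and f :: "'k pol vec"
    and I :: "'k pol set"
  assumes n: "n > 4"
    and f_dim: "f \<in> carrier_vec n"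
    and f_R: "set\<^sub>v f \<subseteq> carrier R_ring"
    and f_hom: "\<forall>i<n. homogeneous d (f $ i)"
    and I_gen: "I = Idl\<^bsub>R_ring\<^esub> (set\<^sub>v f)"
    and I_min: "min_gens R_ring I = enat n"
    and I_ht: "ideal_height R_ring I = 2"
    and I_perfect: "perfect_ideal R_ring I"
    and pres: "presentation_matrix R_ring \<phi> f"
    and alin: "almost_linear n \<phi>"
    and I1: "radical R_ring (minors_ideal R_ring 1 \<phi>) = Idl\<^bsub>R_ring\<^esub> {Var Vx, Var Vy, Var Vz}"
    and rank1: "minors_ideal R_ring 2 \<phi> \<subseteq> Idl\<^bsub>R_ring\<^esub> {Var Vx, Var Vy}"
    and G2: "G_condition 2 R_ring I"
    and not_G3: "\<not> G_condition 3 R_ring I"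
    and III: "case_III n \<phi>"
  shows "K'' n \<phi> = Idl\<^bsub>B_ring n \<phi>\<^esub> {bar n \<phi> (Var Vz ^ 2 * Var (Vw 0))} \<and>
         CM_ideal (B_ring n \<phi>) (K'' n \<phi>) \<and>
         ideal_height (B_ring n \<phi>) (K'' n \<phi>) = 1"
proof -
  \<comment> \<open>Otherwise the remaining \<open>n - 1\<close> entries of \<open>f\<close> generate \<open>I\<close>.\<close>
  have f0: "f $ 0 \<noteq> 0"
  proof
    assume 0: "f $ 0 = 0"
    interpret R: cring "R_ring :: 'k pol ring" by (rule cring_pol_ring)
    let ?F = "(\<lambda>i. f $ i) ` {1..<n}"
    have F: "?F \<subseteq> set\<^sub>v f" using f_dim by (auto simp: vec_set_def)
    have FR: "?F \<subseteq> carrier R_ring" using F f_R by blast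
    interpret FI: ideal "Idl\<^bsub>R_ring\<^esub> ?F" "R_ring :: 'k pol ring" by (rule R.genideal_ideal[OF FR])
    have "set\<^sub>v f \<subseteq> Idl\<^bsub>R_ring\<^esub> ?F"
    proof
      fix p assume "p \<in> set\<^sub>v f"
      then obtain i where i: "i < n" "p = f $ i" using f_dim by (auto simp: vec_set_def)
      show "p \<in> Idl\<^bsub>R_ring\<^esub> ?F"
      proof (cases "i = 0")
        case True
        then show ?thesis using 0 i FI.zero_closed by simp
      next
        case False
        then have "p \<in> ?F" using i by auto
        then show ?thesis using R.genideal_self[OF FR] by blast
      qed
    qed
    then have "I \<subseteq> Idl\<^bsub>R_ring\<^esub> ?F" unfolding I_gen by (intro R.genideal_minimal FI.is_ideal)
    moreover have "Idl\<^bsub>R_ring\<^esub> ?F \<subseteq> I"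
      unfolding I_gen using F R.genideal_self[OF f_R] by (intro R.genideal_minimal R.genideal_ideal f_R) blast
    ultimately have "I = Idl\<^bsub>R_ring\<^esub> ?F" by blast
    then have "min_gens R_ring I \<le> enat (card ?F)"
      unfolding min_gens_def using FR by (intro Inf_lower) auto
    moreover have "card ?F \<le> n - 1" using card_image_le[of "{1..<n}" "\<lambda>i. f $ i"] by simp
    ultimately show False using I_min n by simp
  qed
  interpret presented_ideal n \<phi> f
    by unfold_locales (use n f_dim f_R pres alin f0 in auto)
  define \<alpha> where "\<alpha> i j = Poly_Mapping.lookup (\<phi> $$ (i, j)) (Poly_Mapping.single Vx 1)" for i j
  define \<beta> where "\<beta> i j = Poly_Mapping.lookup (\<phi> $$ (i, j)) (Poly_Mapping.single Vy 1)" for i j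
  have \<phi>: "\<phi> $$ (i, j) = Cst (\<alpha> i j) * Var Vx + Cst (\<beta> i j) * Var Vy" if "i < n" "j < n - 2" for i j
    unfolding \<alpha>_def \<beta>_def using III that by (intro linear_form_xy) (auto simp: case_III_def)
  interpret pencil n \<alpha> \<beta>
    by unfold_locales (use n pencil_no_relation[OF \<phi>] in blast)+
  have "lform \<phi> j = rel j" if "j < n - 2" for j
  proof -
    have "dim_row \<phi> = n" using phi_dim by auto
    then show ?thesis
      using \<phi> that by (simp add: lform_def rel_def LX_def LY_def sum_distrib_left algebra_simps flip: sum.distrib)
  qed
  then have "lform \<phi> ` {..<n-2} = rel ` {..<n-2}" by auto
  then have "J_ideal n \<phi> = colon (S_ring n) RI (Idl\<^bsub>S_ring n\<^esub> {Var Vx, Var Vy})"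
    by (simp add: J_ideal_def RI_def)
  then show ?thesis
    using colon_ideal_properties unfolding K''_def B_ring_def bar_def by simp
qed

end
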